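(* Let $A$ be a C*-algebra, let $I$ be a $\sigma$-unital closed two-sided ideal of $A$, and let $\pi\colon A\to A/I$ be the quotient map. Let $M$ and $N$ be countably generated right Hilbert C*-modules over $A$. Then $Cu_s(\pi)([M])\le Cu_s(\pi)([N])$ in $Cu_s(A/I)$ if and only if \[ [M]+[N]I\le [N]+[M]I \quad\text{in } Cu_s(A). \]
   Context: All Hilbert C*-modules are right Hilbert modules. For a Hilbert $A$-module $M$, $K(M)$ denotes the norm-closed span of the operators $\theta_{u,v}(x)=v\langle u,x\rangle$ ($u,v\in M$). A submodule $F\subseteq M$ is compactly contained in $M$ if there is a positive $T\in K(M)$ whose restriction to $F$ is the identity of $F$. For Hilbert $A$-modules $M,N$, write $M\preceq N$ if every submodule $F$ compactly contained in $M$ is isomorphic (as a Hilbert module) to some submodule $F'$ compactly contained in $N$. $M,N$ are Cuntz equivalent if $M\preceq N$ and $N\preceq M$, and $[M]$ denotes the Cuntz equivalence class of $M$. $Cu_s(A)$ is the set of Cuntz classes of countably generated Hilbert $A$-modules, ordered by $[M]\le[N]$ iff $M\preceq N$, with addition $[M]+[N]=[M\oplus N]$. For a closed two-sided ideal $I$ of $A$, $MI$ denotes the closed submodule of $M$ spanned by $\{mi: m\in M, i\in I\}$ (equivalently, $\{z\in M:\langle z,z\rangle\in I\}$); $M/MI$ is a Hilbert $A/I$-module with inner product $\langle x+MI,y+MI\rangle=\langle x,y\rangle+I$. When $I$ is $\sigma$-unital and $M$ is countably generated, $MI$ is countably generated and one writes $[M]I:=[MI]\in Cu_s(A)$ (this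 depends only on $[M]$). For the quotient map $\pi\colon A\to A/I$, $Cu_s(\pi)\colon Cu_s(A)\to Cu_s(A/I)$ is given by $Cu_s(\pi)([M])=[M/MI]$. *)

theory Defs
  imports Complex_Main "HOL-Library.Countable_Set"
begin

record 'a cs_alg =
  cs_carrier :: "'a set"
  cs_zero :: 'a
  cs_add :: "'a \<Rightarrow> 'a \<Rightarrow> 'a"
  cs_neg :: "'a \<Rightarrow> 'a"
  cs_smul :: "complex \<Rightarrow> 'a \<Rightarrow> 'a"
  cs_mult :: "'a \<Rightarrow> 'a \<Rightarrow> 'a"
  cs_star :: "'a \<Rightarrow> 'a"
  cs_norm :: "'a \<Rightarrow> real"

definition cvs :: "'v set \<Rightarrow> 'v \<Rightarrow> ('v \<Rightarrow> 'v \<Rightarrow> 'v) \<Rightarrow> ('v \<Rightarrow> 'v) \<Rightarrow> (complex \<Rightarrow> 'v \<Rightarrow> 'v) \<Rightarrow> bool" where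
  "cvs V z ad ng sm \<longleftrightarrow>
     z \<in> V \<and> (\<forall>x\<in>V. \<forall>y\<in>V. ad x y \<in> V) \<and> (\<forall>x\<in>V. ng x \<in> V) \<and> (\<forall>c. \<forall>x\<in>V. sm c x \<in> V) \<and>
     (\<forall>x\<in>V. \<forall>y\<in>V. \<forall>w\<in>V. ad (ad x y) w = ad x (ad y w)) \<and>
     (\<forall>x\<in>V. \<forall>y\<in>V. ad x y = ad y x) \<and> (\<forall>x\<in>V. ad z x = x) \<and> (\<forall>x\<in>V. ad (ng x) x = z) \<and>
     (\<forall>c. \<forall>x\<in>V. \<forall>y\<in>V. sm c (ad x y) = ad (sm c x) (sm c y)) \<and>
     (\<forall>c d. \<forall>x\<in>V. sm (c + d) x = ad (sm c x) (sm d x)) \<and>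
     (\<forall>c d. \<forall>x\<in>V. sm c (sm d x) = sm (c * d) x) \<and> (\<forall>x\<in>V. sm 1 x = x)"

definition complete_wrt :: "'v set \<Rightarrow> ('v \<Rightarrow> 'v \<Rightarrow> real) \<Rightarrow> bool" where
  "complete_wrt V d \<longleftrightarrow>
     (\<forall>s. (\<forall>n. s n \<in> V) \<longrightarrow> (\<forall>e>0. \<exists>K. \<forall>m\<ge>K. \<forall>n\<ge>K. d (s m) (s n) < e) \<longrightarrow>
          (\<exists>l\<in>V. (\<lambda>n. d (s n) l) \<longlonglongrightarrow> 0))"

definition cs_dist :: "'a cs_alg \<Rightarrow> 'a \<Rightarrow> 'a \<Rightarrow> real" where
  "cs_dist A x y = cs_norm A (cs_add A x (cs_neg A y))"

definition cstar_algebra :: "'a cs_alg \<Rightarrow> bool" where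
  "cstar_algebra A \<longleftrightarrow>
     (let C = cs_carrier A; ad = cs_add A; mu = cs_mult A; sm = cs_smul A; st = cs_star A; nm = cs_norm A in
     cvs C (cs_zero A) ad (cs_neg A) sm \<and>
     (\<forall>a\<in>C. \<forall>b\<in>C. mu a b \<in> C) \<and> (\<forall>a\<in>C. st a \<in> C) \<and>
     (\<forall>a\<in>C. \<forall>b\<in>C. \<forall>c\<in>C. mu (mu a b) c = mu a (mu b c)) \<and>
     (\<forall>a\<in>C. \<forall>b\<in>C. \<forall>c\<in>C. mu a (ad b c) = ad (mu a b) (mu a c)) \<and>
     (\<forall>a\<in>C. \<forall>b\<in>C. \<forall>c\<in>C. mu (ad a b) c = ad (mu a c) (mu b c)) \<and>
     (\<forall>z. \<forall>a\<in>C. \<forall>b\<in>C. sm z (mu a b) = mu (sm z a) b \<and> sm z (mu a b) = mu a (sm z b)) \<and>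
     (\<forall>a\<in>C. st (st a) = a) \<and> (\<forall>a\<in>C. \<forall>b\<in>C. st (ad a b) = ad (st a) (st b)) \<and>
     (\<forall>z. \<forall>a\<in>C. st (sm z a) = sm (cnj z) (st a)) \<and>
     (\<forall>a\<in>C. \<forall>b\<in>C. st (mu a b) = mu (st b) (st a)) \<and>
     (\<forall>a\<in>C. nm a \<ge> 0) \<and> (\<forall>a\<in>C. nm a = 0 \<longleftrightarrow> a = cs_zero A) \<and>
     (\<forall>a\<in>C. \<forall>b\<in>C. nm (ad a b) \<le> nm a + nm b) \<and>
     (\<forall>z. \<forall>a\<in>C. nm (sm z a) = cmod z * nm a) \<and>
     (\<forall>a\<in>C. \<forall>b\<in>C. nm (mu a b) \<le> nm a * nm b) \<and>
     (\<forall>a\<in>C. nm (mu (st a) a) = (nm a)\<^sup>2) \<and>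
     complete_wrt C (cs_dist A))"

definition cs_pos :: "'a cs_alg \<Rightarrow> 'a \<Rightarrow> bool" where
  "cs_pos A a \<longleftrightarrow> a \<in> cs_carrier A \<and> (\<exists>b\<in>cs_carrier A. a = cs_mult A (cs_star A b) b)"

definition cs_le :: "'a cs_alg \<Rightarrow> 'a \<Rightarrow> 'a \<Rightarrow> bool" where
  "cs_le A a b \<longleftrightarrow> cs_pos A (cs_add A b (cs_neg A a))"

definition closed_ideal :: "'a cs_alg \<Rightarrow> 'a set \<Rightarrow> bool" where
  "closed_ideal A I \<longleftrightarrow>
     I \<subseteq> cs_carrier A \<and> cs_zero A \<in> I \<and>
     (\<forall>x\<in>I. \<forall>y\<in>I. cs_add A x y \<in> I) \<and> (\<forall>x\<in>I. cs_neg A x \<in> I) \<and>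
     (\<forall>z. \<forall>x\<in>I. cs_smul A z x \<in> I) \<and>
     (\<forall>a\<in>cs_carrier A. \<forall>x\<in>I. cs_mult A a x \<in> I \<and> cs_mult A x a \<in> I) \<and>
     (\<forall>s l. (\<forall>n. s n \<in> I) \<longrightarrow> l \<in> cs_carrier A \<longrightarrow>
        (\<lambda>n. cs_dist A (s n) l) \<longlonglongrightarrow> 0 \<longrightarrow> l \<in> I)"

definition sigma_unital :: "'a cs_alg \<Rightarrow> 'a set \<Rightarrow> bool" where
  "sigma_unital A I \<longleftrightarrow>
     (\<exists>e. (\<forall>n. e n \<in> I \<and> cs_pos A (e n) \<and> cs_norm A (e n) \<le> 1 \<and> cs_le A (e n) (e (Suc n))) \<and>
          (\<forall>x\<in>I. (\<lambda>n. cs_dist A (cs_mult A (e n) x) x) \<longlonglongrightarrow> 0 \<and>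
                  (\<lambda>n. cs_dist A (cs_mult A x (e n)) x) \<longlonglongrightarrow> 0))"

definition rep :: "'x set \<Rightarrow> 'x" where
  "rep X = (SOME x. x \<in> X)"

definition coset :: "'a cs_alg \<Rightarrow> 'a set \<Rightarrow> 'a \<Rightarrow> 'a set" where
  "coset A I a = {cs_add A a i | i. i \<in> I}"

definition quot_alg :: "'a cs_alg \<Rightarrow> 'a set \<Rightarrow> 'a set cs_alg" where
  "quot_alg A I =
     \<lparr> cs_carrier = coset A I ` cs_carrier A,
       cs_zero = coset A I (cs_zero A),
       cs_add = (\<lambda>X Y. coset A I (cs_add A (rep X) (rep Y))),
       cs_neg = (\<lambda>X. coset A I (cs_neg A (rep X))),
       cs_smul = (\<lambda>z X. coset A I (cs_smul A z (rep X))),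
       cs_mult = (\<lambda>X Y. coset A I (cs_mult A (rep X) (rep Y))),
       cs_star = (\<lambda>X. coset A I (cs_star A (rep X))),
       cs_norm = (\<lambda>X. INF x\<in>X. cs_norm A x) \<rparr>"

record ('m, 'a) hmod =
  hm_carrier :: "'m set"
  hm_zero :: 'm
  hm_add :: "'m \<Rightarrow> 'm \<Rightarrow> 'm"
  hm_neg :: "'m \<Rightarrow> 'm"
  hm_smul :: "complex \<Rightarrow> 'm \<Rightarrow> 'm"
  hm_act :: "'m \<Rightarrow> 'a \<Rightarrow> 'm"
  hm_inner :: "'m \<Rightarrow> 'm \<Rightarrow> 'a"

definition hm_norm :: "'a cs_alg \<Rightarrow> ('m, 'a) hmod \<Rightarrow> 'm \<Rightarrow> real" where
  "hm_norm A M x = sqrt (cs_norm A (hm_inner M x x))"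

definition hm_dist :: "'a cs_alg \<Rightarrow> ('m, 'a) hmod \<Rightarrow> 'm \<Rightarrow> 'm \<Rightarrow> real" where
  "hm_dist A M x y = hm_norm A M (hm_add M x (hm_neg M y))"

text \<open>Inner product A-linear in the second variable (consistent with theta).\<close>
definition hilbert_module :: "'a cs_alg \<Rightarrow> ('m, 'a) hmod \<Rightarrow> bool" where
  "hilbert_module A M \<longleftrightarrow>
    (let V = hm_carrier M; C = cs_carrier A; ad = hm_add M; sm = hm_smul M; act = hm_act M; ip = hm_inner M in
     cvs V (hm_zero M) ad (hm_neg M) sm \<and>
     (\<forall>x\<in>V. \<forall>a\<in>C. act x a \<in> V) \<and>
     (\<forall>x\<in>V. \<forall>a\<in>C. \<forall>b\<in>C. act (act x a) b = act x (cs_mult A a b)) \<and>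
     (\<forall>x\<in>V. \<forall>y\<in>V. \<forall>a\<in>C. act (ad x y) a = ad (act x a) (act y a)) \<and>
     (\<forall>x\<in>V. \<forall>a\<in>C. \<forall>b\<in>C. act x (cs_add A a b) = ad (act x a) (act x b)) \<and>
     (\<forall>z. \<forall>x\<in>V. \<forall>a\<in>C. act (sm z x) a = sm z (act x a) \<and> act x (cs_smul A z a) = sm z (act x a)) \<and>
     (\<forall>x\<in>V. \<forall>y\<in>V. ip x y \<in> C) \<and>
     (\<forall>x\<in>V. \<forall>y\<in>V. \<forall>w\<in>V. ip x (ad y w) = cs_add A (ip x y) (ip x w)) \<and>
     (\<forall>z. \<forall>x\<in>V. \<forall>y\<in>V. ip x (sm z y) = cs_smul A z (ip x y)) \<and>
     (\<forall>x\<in>V. \<forall>y\<in>V. \<forall>a\<in>C. ip x (act y a) = cs_mult A (ip x y) a) \<and>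
     (\<forall>x\<in>V. \<forall>y\<in>V. ip y x = cs_star A (ip x y)) \<and>
     (\<forall>x\<in>V. cs_pos A (ip x x)) \<and>
     (\<forall>x\<in>V. ip x x = cs_zero A \<longrightarrow> x = hm_zero M) \<and>
     complete_wrt V (hm_dist A M))"

definition hm_submodule :: "'a cs_alg \<Rightarrow> ('m, 'a) hmod \<Rightarrow> 'm set \<Rightarrow> bool" where
  "hm_submodule A M F \<longleftrightarrow>
     F \<subseteq> hm_carrier M \<and> hm_zero M \<in> F \<and>
     (\<forall>x\<in>F. \<forall>y\<in>F. hm_add M x y \<in> F) \<and> (\<forall>x\<in>F. hm_neg M x \<in> F) \<and>
     (\<forall>z. \<forall>x\<in>F. hm_smul M z x \<in> F) \<and>
     (\<forall>x\<in>F. \<forall>a\<in>cs_carrier A. hm_act M x a \<in> F) \<and>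
     (\<forall>s l. (\<forall>n. s n \<in> F) \<longrightarrow> l \<in> hm_carrier M \<longrightarrow>
        (\<lambda>n. hm_dist A M (s n) l) \<longlonglongrightarrow> 0 \<longrightarrow> l \<in> F)"

definition gen_submodule :: "'a cs_alg \<Rightarrow> ('m, 'a) hmod \<Rightarrow> 'm set \<Rightarrow> 'm set" where
  "gen_submodule A M S = \<Inter>{F. hm_submodule A M F \<and> S \<subseteq> F}"

definition countably_generated :: "'a cs_alg \<Rightarrow> ('m, 'a) hmod \<Rightarrow> bool" where
  "countably_generated A M \<longleftrightarrow>
     (\<exists>S. countable S \<and> S \<subseteq> hm_carrier M \<and> gen_submodule A M S = hm_carrier M)"

definition restrict_mod :: "('m, 'a) hmod \<Rightarrow> 'm set \<Rightarrow> ('m, 'a) hmod" where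
  "restrict_mod M F = M\<lparr>hm_carrier := F\<rparr>"

definition module_ideal :: "'a cs_alg \<Rightarrow> 'a set \<Rightarrow> ('m, 'a) hmod \<Rightarrow> 'm set" where
  "module_ideal A I M =
     gen_submodule A M {hm_act M m i | m i. m \<in> hm_carrier M \<and> i \<in> I}"

definition MI_mod :: "'a cs_alg \<Rightarrow> 'a set \<Rightarrow> ('m, 'a) hmod \<Rightarrow> ('m, 'a) hmod" where
  "MI_mod A I M = restrict_mod M (module_ideal A I M)"

definition hm_dsum :: "'a cs_alg \<Rightarrow> ('m, 'a) hmod \<Rightarrow> ('n, 'a) hmod \<Rightarrow> ('m \<times> 'n, 'a) hmod" where
  "hm_dsum A M N =
     \<lparr> hm_carrier = hm_carrier M \<times> hm_carrier N,
       hm_zero = (hm_zero M, hm_zero N),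
       hm_add = (\<lambda>p q. (hm_add M (fst p) (fst q), hm_add N (snd p) (snd q))),
       hm_neg = (\<lambda>p. (hm_neg M (fst p), hm_neg N (snd p))),
       hm_smul = (\<lambda>z p. (hm_smul M z (fst p), hm_smul N z (snd p))),
       hm_act = (\<lambda>p a. (hm_act M (fst p) a, hm_act N (snd p) a)),
       hm_inner = (\<lambda>p q. cs_add A (hm_inner M (fst p) (fst q)) (hm_inner N (snd p) (snd q))) \<rparr>"

definition mcoset :: "('m, 'a) hmod \<Rightarrow> 'm set \<Rightarrow> 'm \<Rightarrow> 'm set" where
  "mcoset M K x = {hm_add M x z | z. z \<in> K}"

definition quot_mod :: "'a cs_alg \<Rightarrow> 'a set \<Rightarrow> ('m, 'a) hmod \<Rightarrow> ('m set, 'a set) hmod" where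
  "quot_mod A I M =
    (let K = module_ideal A I M in
     \<lparr> hm_carrier = mcoset M K ` hm_carrier M,
       hm_zero = mcoset M K (hm_zero M),
       hm_add = (\<lambda>X Y. mcoset M K (hm_add M (rep X) (rep Y))),
       hm_neg = (\<lambda>X. mcoset M K (hm_neg M (rep X))),
       hm_smul = (\<lambda>z X. mcoset M K (hm_smul M z (rep X))),
       hm_act = (\<lambda>X a. mcoset M K (hm_act M (rep X) (rep a))),
       hm_inner = (\<lambda>X Y. coset A I (hm_inner M (rep X) (rep Y))) \<rparr>)"

definition theta :: "('m, 'a) hmod \<Rightarrow> 'm \<Rightarrow> 'm \<Rightarrow> 'm \<Rightarrow> 'm" where
  "theta M u v x = hm_act M v (hm_inner M u x)"

definition fr_apply :: "('m, 'a) hmod \<Rightarrow> ('m \<times> 'm) list \<Rightarrow> 'm \<Rightarrow> 'm" where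
  "fr_apply M ps x = foldr (\<lambda>p acc. hm_add M (theta M (fst p) (snd p) x) acc) ps (hm_zero M)"

definition hm_compact :: "'a cs_alg \<Rightarrow> ('m, 'a) hmod \<Rightarrow> ('m \<Rightarrow> 'm) \<Rightarrow> bool" where
  "hm_compact A M T \<longleftrightarrow>
     (\<forall>x\<in>hm_carrier M. T x \<in> hm_carrier M) \<and>
     (\<forall>e>0. \<exists>ps. set ps \<subseteq> hm_carrier M \<times> hm_carrier M \<and>
        (\<forall>x\<in>hm_carrier M. hm_dist A M (T x) (fr_apply M ps x) \<le> e * hm_norm A M x))"

definition hm_adjoint :: "('m, 'a) hmod \<Rightarrow> ('m \<Rightarrow> 'm) \<Rightarrow> ('m \<Rightarrow> 'm) \<Rightarrow> bool" where
  "hm_adjoint M S S' \<longleftrightarrow>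
     (\<forall>x\<in>hm_carrier M. \<forall>y\<in>hm_carrier M. hm_inner M (S x) y = hm_inner M x (S' y))"

definition hm_pos_compact :: "'a cs_alg \<Rightarrow> ('m, 'a) hmod \<Rightarrow> ('m \<Rightarrow> 'm) \<Rightarrow> bool" where
  "hm_pos_compact A M T \<longleftrightarrow>
     hm_compact A M T \<and>
     (\<exists>S S'. hm_compact A M S \<and> (\<forall>x\<in>hm_carrier M. S' x \<in> hm_carrier M) \<and>
            hm_adjoint M S S' \<and> (\<forall>x\<in>hm_carrier M. T x = S' (S x)))"

definition compactly_contained :: "'a cs_alg \<Rightarrow> ('m, 'a) hmod \<Rightarrow> 'm set \<Rightarrow> bool" where
  "compactly_contained A M F \<longleftrightarrow>
     hm_submodule A M F \<and> (\<exists>T. hm_pos_compact A M T \<and> (\<forall>x\<in>F. T x = x))"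

definition hm_iso :: "'a cs_alg \<Rightarrow> ('m, 'a) hmod \<Rightarrow> ('n, 'a) hmod \<Rightarrow> ('m \<Rightarrow> 'n) \<Rightarrow> bool" where
  "hm_iso A M N U \<longleftrightarrow>
     bij_betw U (hm_carrier M) (hm_carrier N) \<and>
     (\<forall>x\<in>hm_carrier M. \<forall>y\<in>hm_carrier M.
        U (hm_add M x y) = hm_add N (U x) (U y) \<and> hm_inner N (U x) (U y) = hm_inner M x y) \<and>
     (\<forall>z. \<forall>x\<in>hm_carrier M. U (hm_smul M z x) = hm_smul N z (U x)) \<and>
     (\<forall>x\<in>hm_carrier M. \<forall>a\<in>cs_carrier A. U (hm_act M x a) = hm_act N (U x) a)"

definition cu_le :: "'a cs_alg \<Rightarrow> ('m, 'a) hmod \<Rightarrow> ('n, 'a) hmod \<Rightarrow> bool" where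
  "cu_le A M N \<longleftrightarrow>
     (\<forall>F. compactly_contained A M F \<longrightarrow>
        (\<exists>F'. compactly_contained A N F' \<and>
              (\<exists>U. hm_iso A (restrict_mod M F) (restrict_mod N F') U)))"

end

theory Submission
  imports Defs "HOL-Analysis.Analysis"
begin

text \<open>
  If \<open>\<phi>\<close> embeds a compactly contained submodule of \<open>M/MI\<close> into \<open>N/NI\<close>, then \<open>\<phi>\<close>, cut down by functions of a compact
  operator, is a compact operator modulo \<open>I\<close> and lifts to \<open>X : M \<rightarrow> N\<close>. The Cayley transform of the skew-adjoint
  operator \<open>X - X\<^sup>*\<close> on \<open>M \<oplus> N\<close> is a unitary which agrees with \<open>X\<close> modulo \<open>I\<close> wherever \<open>X\<close> is isometric modulo \<open>I\<close>
  (a smooth form of Halmos' dilation), so it moves a submodule compactly contained in \<open>M \<oplus> NI\<close> into \<open>N \<oplus> MI\<close>.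
  Conversely, a compact operator fixing a submodule of \<open>M/MI\<close> lifts to a self-adjoint compact operator \<open>T\<close> on \<open>M\<close>;
  functions \<open>g k = k\<close> of \<open>T\<close> give a submodule \<open>{x. g x = x}\<close> compactly contained in \<open>M \<oplus> NI\<close> which covers the given one,
  and its image in \<open>N \<oplus> MI\<close> reduces to a submodule of \<open>N/NI\<close>.
\<close>

text \<open>The lift \<open>X\<close> of an isometry between quotient submodules comes without a
  norm bound, while a dilation through the root of one minus \<open>X' * X\<close> would need a
  contraction. The Cayley transform needs no bound. With \<open>K = X - X'\<close>, wherever
  \<open>X\<close> is isometric modulo \<open>I\<close> one has K^2 z = -z modulo \<open>I\<close>;
  hence (1 + K)^2 z = 2 K z and (1 - K^2) z = 2 z, and the unitary (1 + K)^2 (1 - K^2)^(-1) sends z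
  to K z = X z modulo \<open>I\<close>. A vector fixed modulo \<open>I\<close> by the lifted compact
  operator need not be fixed by that operator. This is why functions come in pairs with
  \<open>g * k = k\<close>: \<open>k\<close> changes such a vector only by an element of
  \<open>MI\<close>, and the result is fixed by \<open>g\<close> exactly. Spectral theory is
  replaced by a single iteration for square roots, from which positivity of \<open>b' * b\<close>,
  absolute values and the pair \<open>g\<close>, \<open>k\<close> are all derived. Quotient modules
  are never turned into types: equality in \<open>M/MI\<close> is congruence modulo a closed
  submodule \<open>Z\<close>, and the quotient norm is the distance to \<open>Z\<close>.\<close>

text \<open>Real scalars make the type classes of analysis applicable; \<open>mulI\<close> is multiplication by \<open>\<i>\<close>.\<close>

class cstar = real_normed_algebra + banach +
  fixes star :: "'a \<Rightarrow> 'a" and mulI :: "'a \<Rightarrow> 'a"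
  assumes star_star [simp]: "star (star a) = a"
    and star_add: "star (a + b) = star a + star b"
    and star_scaleR: "star (r *\<^sub>R a) = r *\<^sub>R star a"
    and star_mult: "star (a * b) = star b * star a"
    and norm_star_mult: "norm (star a * a) = (norm a)\<^sup>2"
    and mulI_add: "mulI (a + b) = mulI a + mulI b"
    and mulI_mulI: "mulI (mulI a) = - a"
    and mulI_star: "star (mulI a) = - mulI (star a)"
    and mulI_right: "a * mulI b = mulI (a * b)"
    and mulI_left: "mulI a * b = mulI (a * b)"
    and norm_mulI: "norm (mulI a) = norm a"

section \<open>Involution and norm in a C*-algebra\<close>

lemma star_0 [simp]: "star (0::'a::cstar) = 0"
  using star_scaleR[of 0 "0::'a"] by simp

lemma star_minus: "star (- a) = - star (a::'a::cstar)"
  using star_scaleR[of "-1" a] by simp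

lemma star_diff: "star (a - b) = star a - star (b::'a::cstar)"
  using star_add[of a "- b"] star_minus by simp

lemma mulI_0 [simp]: "mulI (0::'a::cstar) = 0"
  using mulI_add[of 0 "0::'a"] by simp

lemma mulI_minus: "mulI (- a) = - mulI (a::'a::cstar)"
  using mulI_add[of a "- a"] by (simp add: eq_neg_iff_add_eq_0 add.commute)

lemma norm_star [simp]: "norm (star a) = norm (a::'a::cstar)"
proof -
  have le: "norm b \<le> norm (star b)" for b :: 'a
  proof -
    have "(norm b)\<^sup>2 \<le> norm (star b) * norm b"
      using norm_star_mult[of b] norm_mult_ineq[of "star b" b] by simp
    then show ?thesis by (cases "norm b = 0") (auto simp: power2_eq_square)
  qed
  show ?thesis using le[of a] le[of "star a"] by simp
qed

lemma norm_mult_star: "norm (a * star a) = (norm (a::'a::cstar))\<^sup>2"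
  using norm_star_mult[of "star a"] by simp

lemma bounded_linear_star: "bounded_linear (star :: 'a::cstar \<Rightarrow> 'a)"
  by (rule bounded_linear_intro[where K=1]) (auto simp: star_add star_scaleR)

lemma tendsto_star: "(f \<longlongrightarrow> l) F \<Longrightarrow> ((\<lambda>x. star (f x)) \<longlongrightarrow> star (l::'a::cstar)) F"
  by (rule bounded_linear.tendsto[OF bounded_linear_star])

section \<open>Bounded operators as a unital Banach algebra\<close>

text \<open>Wrapping the bounded operators in a type of their own lets composition be the multiplication of a ring.\<close>

typedef (overloaded) 'h endo = "UNIV :: ('h::real_normed_vector \<Rightarrow>\<^sub>L 'h) set"
  morphisms blin_of Endo by simp

setup_lifting type_definition_endo

instantiation endo :: (real_normed_vector) real_vector
begin
lift_definition zero_endo :: "'a endo" is 0 .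
lift_definition plus_endo :: "'a endo \<Rightarrow> 'a endo \<Rightarrow> 'a endo" is "(+)" .
lift_definition minus_endo :: "'a endo \<Rightarrow> 'a endo \<Rightarrow> 'a endo" is "(-)" .
lift_definition uminus_endo :: "'a endo \<Rightarrow> 'a endo" is "uminus" .
lift_definition scaleR_endo :: "real \<Rightarrow> 'a endo \<Rightarrow> 'a endo" is "scaleR" .
instance
  by standard (transfer, simp add: algebra_simps)+
end

instantiation endo :: (real_normed_vector) real_normed_vector
begin
lift_definition norm_endo :: "'a endo \<Rightarrow> real" is "norm" .
definition dist_endo :: "'a endo \<Rightarrow> 'a endo \<Rightarrow> real" where "dist_endo x y = norm (x - y)"
definition sgn_endo :: "'a endo \<Rightarrow> 'a endo" where "sgn_endo x = x /\<^sub>R norm x"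
definition uniformity_endo :: "('a endo \<times> 'a endo) filter"
  where "uniformity_endo = (INF e\<in>{0<..}. principal {(x, y). dist x y < e})"
definition open_endo :: "'a endo set \<Rightarrow> bool"
  where "open_endo U = (\<forall>x\<in>U. eventually (\<lambda>(x', y). x' = x \<longrightarrow> y \<in> U) uniformity)"
instance
  apply standard
  unfolding dist_endo_def sgn_endo_def uniformity_endo_def open_endo_def
  by (rule refl ballI TrueI | transfer, simp add: norm_triangle_ineq)+
end

instantiation endo :: (real_normed_vector) "{monoid_mult, real_normed_algebra}"
begin
lift_definition one_endo :: "'a endo" is id_blinfun .
lift_definition times_endo :: "'a endo \<Rightarrow> 'a endo \<Rightarrow> 'a endo" is "blinfun_compose" .
instance
  by standard (transfer, auto intro!: blinfun_eqI simp: blinfun.bilinear_simps norm_blinfun_compose)+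
end

lift_definition app :: "'a::real_normed_vector endo \<Rightarrow> 'a \<Rightarrow> 'a" is blinfun_apply .

lemma app_bilinear: "bounded_bilinear (app :: 'a::real_normed_vector endo \<Rightarrow> 'a \<Rightarrow> 'a)"
proof -
  have "bounded_linear (blin_of :: 'a endo \<Rightarrow> _)"
    by (rule bounded_linear_intro[where K=1]) (transfer; simp)+
  note * = bounded_bilinear.comp1[OF bounded_bilinear_blinfun_apply this]
  have "(app :: 'a endo \<Rightarrow> _) = (\<lambda>x. blinfun_apply (blin_of x))"
    by (rule ext) (rule app.rep_eq)
  with * show ?thesis by simp
qed

interpretation app: bounded_bilinear app
  by (rule app_bilinear)

lemma app_simps [simp]:
  "app 1 x = x" "app (S * T) x = app S (app T x)"
  by (transfer; simp)+

lemmas app_lin = app.add_left app.add_right app.diff_left app.diff_right app.minus_left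
  app.minus_right app.zero_left app.zero_right app.scaleR_left app.scaleR_right

lemma endo_eqI: "(\<And>x. app S x = app T x) \<Longrightarrow> S = T"
  by transfer (rule blinfun_eqI)

lemma norm_app: "norm (app S x) \<le> norm S * norm x"
  by transfer (rule norm_blinfun)

lemma norm_endo_bound: "0 \<le> b \<Longrightarrow> (\<And>x. norm (app S x) \<le> b * norm x) \<Longrightarrow> norm S \<le> b"
  by transfer (rule norm_blinfun_bound)

text \<open>On the zero space the identity operator is 0, so in general only the inequality is true.
  \<open>norm_power_le\<close> accordingly asks for this bound on the unit and not for a unit of
  norm one.\<close>

lemma norm_one_endo: "norm (1 :: 'a::real_normed_vector endo) \<le> 1"
  by (rule norm_endo_bound) auto

definition endo_of :: "('a::real_normed_vector \<Rightarrow> 'a) \<Rightarrow> 'a endo" where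
  "endo_of f = Endo (Blinfun f)"

lemma app_endo_of: "bounded_linear f \<Longrightarrow> app (endo_of f) x = f x"
  by (simp add: endo_of_def app.rep_eq Endo_inverse bounded_linear_Blinfun_apply)

instance endo :: (banach) banach
proof
  fix X :: "nat \<Rightarrow> 'a endo"
  assume "Cauchy X"
  then have "Cauchy (\<lambda>n. blin_of (X n))"
    by (simp add: Cauchy_def dist_norm dist_endo_def norm_endo.rep_eq minus_endo.rep_eq)
  then obtain L where "(\<lambda>n. blin_of (X n)) \<longlonglongrightarrow> L"
    using convergent_eq_Cauchy by blast
  then have "X \<longlonglongrightarrow> Endo L"
    by (simp add: tendsto_iff dist_norm dist_endo_def norm_endo.rep_eq minus_endo.rep_eq Endo_inverse)
  then show "convergent X" by (auto simp: convergent_def)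
qed

lemma norm_power_le:
  fixes x :: "'a::{real_normed_algebra,monoid_mult}"
  assumes "norm (1::'a) \<le> 1"
  shows "norm (x ^ n) \<le> norm x ^ n"
proof (induction n)
  case (Suc n)
  then show ?case using norm_mult_ineq[of x "x ^ n"]
    by (simp add: order.trans[OF _ mult_left_mono])
qed (use assms in simp)

lemma neumann:
  fixes y :: "'h::banach endo"
  assumes "norm y < 1"
  obtains z where "z * (1 - y) = 1" "(1 - y) * z = 1"
proof -
  have sm: "summable (\<lambda>n. y ^ n)"
  proof (rule summable_comparison_test')
    show "summable (\<lambda>n. norm y ^ n)" using assms by (simp add: summable_geometric)
    show "norm (y ^ n) \<le> norm y ^ n" for n using norm_power_le[OF norm_one_endo] .
  qed
  let ?z = "\<Sum>n. y ^ n"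
  have 1: "y * ?z = ?z - 1"
    using suminf_mult[OF sm, of y] suminf_split_head[OF sm] by simp
  have 2: "?z * y = ?z - 1"
    using suminf_mult2[OF sm, of y] suminf_split_head[OF sm] by (simp add: power_commutes)
  show ?thesis
    by (rule that[of ?z]) (simp_all add: algebra_simps 1 2)
qed

subsection \<open>Square roots\<close>

text \<open>A fixed point s of s = (y + s^2)/2 satisfies (1 - s)^2 = 1 - y. The iterates are
  polynomials in \<open>y\<close> with nonnegative coefficients and without constant term. The
  definition is generic so that the same recursion on real numbers can serve as a majorant and as
  the scalar value of an operator function.\<close>

primrec sqi :: "'a::{real_normed_algebra,monoid_mult} \<Rightarrow> nat \<Rightarrow> 'a" where
  "sqi y 0 = 0"
| "sqi y (Suc n) = (1/2) *\<^sub>R (y + sqi y n * sqi y n)"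

lemma sqi_commute:
  assumes "z * y = y * z" shows "z * sqi y n = sqi y n * z"
proof (induction n)
  case (Suc n)
  have "z * (sqi y n * sqi y n) = sqi y n * sqi y n * z"
    by (metis Suc.IH mult.assoc)
  then show ?case using assms by (simp add: algebra_simps)
qed simp

lemma sqi_real: "0 \<le> sqi (1::real) n \<and> sqi (1::real) n \<le> 1 \<and> sqi 1 n \<le> sqi (1::real) (Suc n)"
proof (induction n)
  case (Suc n)
  let ?s = "sqi (1::real) n" and ?t = "sqi (1::real) (Suc n)"
  have t: "0 \<le> ?t" "?t \<le> 1"
    using Suc mult_le_one[of ?s ?s] by auto
  moreover have "?s * ?s \<le> ?t * ?t" using Suc t by (intro mult_mono) auto
  ultimately show ?case by simp
qed simp

text \<open>The scalar iteration at 1 majorizes both the iterates and their increments. For the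
  increments the two consecutive iterates commute, so the difference of their squares factors as
  difference times sum, exactly as for the majorant. Convergence in \<open>sqo_lim\<close> then
  follows from that of a bounded increasing real sequence.\<close>

lemma sqi_bound:
  fixes y :: "'a::{real_normed_algebra,monoid_mult}"
  assumes "norm y \<le> 1"
  shows "norm (sqi y n) \<le> sqi 1 n \<and> norm (sqi y (Suc n) - sqi y n) \<le> sqi 1 (Suc n) - sqi 1 n"
proof (induction n)
  case 0
  show ?case using assms by simp
next
  case (Suc n)
  let ?a = "sqi y (Suc n)" and ?b = "sqi y n" and ?s = "sqi (1::real) (Suc n)" and ?t = "sqi (1::real) n"
  have na: "norm ?a \<le> ?s"
  proof -
    have "norm (?b * ?b) \<le> ?t * ?t"
      using norm_mult_ineq[of ?b ?b] Suc mult_mono[of "norm ?b" ?t "norm ?b" ?t] sqi_real[of n] by auto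
    then show ?thesis using norm_triangle_ineq[of y "?b * ?b"] assms by simp
  qed
  have comm: "?a * ?b = ?b * ?a"
    using sqi_commute[of "?b" y "Suc n"] sqi_commute[of y y n] by simp
  have "sqi y (Suc (Suc n)) - ?a = (1/2) *\<^sub>R (?a * ?a - ?b * ?b)"
    by (simp add: scaleR_diff_right[symmetric] del: scaleR_diff_right)
  also have "?a * ?a - ?b * ?b = (?a - ?b) * (?a + ?b)"
    using comm by (simp add: algebra_simps)
  also have "norm ((1/2) *\<^sub>R ((?a - ?b) * (?a + ?b))) \<le> (1/2) * ((?s - ?t) * (?s + ?t))"
  proof -
    have "norm ((?a - ?b) * (?a + ?b)) \<le> norm (?a - ?b) * norm (?a + ?b)"
      by (rule norm_mult_ineq)
    also have "\<dots> \<le> (?s - ?t) * (?s + ?t)"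
      using Suc na norm_triangle_ineq[of ?a ?b] sqi_real[of n] by (intro mult_mono) (auto simp del: sqi.simps)
    finally show ?thesis by simp
  qed
  also have "\<dots> = sqi 1 (Suc (Suc n)) - ?s" by (simp add: algebra_simps)
  finally show ?case using na by simp
qed

text \<open>\<open>1 - sqo y\<close> is the square root of \<open>1 - y\<close>; the name stands for
  the part of the root that the iteration computes.\<close>

definition sqo :: "'a::{real_normed_algebra,monoid_mult,banach} \<Rightarrow> 'a" where
  "sqo y = lim (sqi y)"

lemma sqo_lim:
  fixes y :: "'a::{real_normed_algebra,monoid_mult,banach}"
  assumes "norm y \<le> 1"
  shows "sqi y \<longlonglongrightarrow> sqo y"
proof -
  have inc: "sqi (1::real) m \<le> sqi 1 n" if "m \<le> n" for m n
    using lift_Suc_mono_le[of "sqi (1::real)"] that sqi_real by blast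
  have "convergent (sqi (1::real))"
    using inc sqi_real by (intro Bseq_mono_convergent BseqI'[of _ 1]) (auto simp: mono_def)
  then have "Cauchy (sqi (1::real))" by (rule convergent_Cauchy)
  moreover have "norm (sqi y n - sqi y m) \<le> norm (sqi 1 n - sqi (1::real) m)" if "m \<le> n" for m n
  proof -
    have "norm (sqi y (m + k) - sqi y m) \<le> sqi 1 (m + k) - sqi (1::real) m" for k
    proof (induction k)
      case (Suc k)
      have "norm (sqi y (m + Suc k) - sqi y m)
          \<le> norm (sqi y (Suc (m + k)) - sqi y (m + k)) + norm (sqi y (m + k) - sqi y m)"
        using norm_triangle_ineq[of "sqi y (Suc (m + k)) - sqi y (m + k)" "sqi y (m + k) - sqi y m"]
        by simp
      then show ?case using Suc sqi_bound[OF assms, of "m + k"] by simp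
    qed simp
    from this[of "n - m"] show ?thesis using that inc[OF that] by simp
  qed
  then have *: "norm (sqi y m - sqi y n) \<le> norm (sqi 1 m - sqi (1::real) n)" for m n
    by (metis linear norm_minus_commute)
  ultimately have "Cauchy (sqi y)"
    unfolding Cauchy_def dist_norm by (meson le_less_trans)
  then show ?thesis
    unfolding sqo_def by (simp add: Cauchy_convergent_iff convergent_LIMSEQ_iff)
qed

lemma sqo_norm:
  fixes y :: "'a::{real_normed_algebra,monoid_mult,banach}"
  assumes "norm y \<le> 1" shows "norm (sqo y) \<le> 1"
proof (rule Lim_norm_ubound[OF _ sqo_lim[OF assms]])
  show "eventually (\<lambda>n. norm (sqi y n) \<le> 1) sequentially"
    using sqi_bound[OF assms] sqi_real by (meson always_eventually order.trans)
qed simp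

lemma sqo_square:
  fixes y :: "'a::{real_normed_algebra,monoid_mult,banach}"
  assumes "norm y \<le> 1" shows "(1 - sqo y) * (1 - sqo y) = 1 - y"
proof -
  have "(\<lambda>n. sqi y (Suc n)) \<longlonglongrightarrow> (1/2) *\<^sub>R (y + sqo y * sqo y)"
    unfolding sqi.simps by (intro tendsto_intros sqo_lim[OF assms])
  moreover have "(\<lambda>n. sqi y (Suc n)) \<longlonglongrightarrow> sqo y"
    using sqo_lim[OF assms] by (rule LIMSEQ_Suc)
  ultimately have "sqo y = (1/2) *\<^sub>R (y + sqo y * sqo y)"
    using LIMSEQ_unique by blast
  then have "sqo y + sqo y = y + sqo y * sqo y"
    by (metis scaleR_2 scaleR_half_double scaleR_scaleR mult.commute)
  then show ?thesis by (simp add: algebra_simps)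
qed

text \<open>In \<open>bump\<close> this evaluates the scalar that has to be subtracted from an
  operator root to get rid of its constant term.\<close>

lemma sqo_real:
  assumes "0 \<le> \<eta>" "\<eta> \<le> 1" shows "sqo (\<eta>::real) = 1 - sqrt (1 - \<eta>)"
proof -
  have n: "norm \<eta> \<le> 1" using assms by simp
  have "0 \<le> 1 - sqo \<eta>" using sqo_norm[OF n] by auto
  moreover have "(1 - sqo \<eta>)\<^sup>2 = 1 - \<eta>" using sqo_square[OF n] by (simp add: power2_eq_square)
  ultimately have "1 - sqo \<eta> = sqrt (1 - \<eta>)" by (metis real_sqrt_unique)
  then show ?thesis by simp
qed

lemma sqo_commute:
  fixes y :: "'a::{real_normed_algebra,monoid_mult,banach}"
  assumes "norm y \<le> 1" "z * y = y * z" shows "z * sqo y = sqo y * z"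
proof -
  have "(\<lambda>n. z * sqi y n) \<longlonglongrightarrow> z * sqo y" "(\<lambda>n. sqi y n * z) \<longlonglongrightarrow> sqo y * z"
    by (intro tendsto_intros sqo_lim[OF assms(1)])+
  then show ?thesis using sqi_commute[OF assms(2)] LIMSEQ_unique by (metis (no_types, lifting) ext)
qed

section \<open>Adjointable operators for an algebra-valued inner product\<close>

lemma le_of_square_le_mult:
  fixes a b :: real
  assumes "a\<^sup>2 \<le> b * a" "0 \<le> a" "0 \<le> b"
  shows "a \<le> b"
  using assms by (cases "a = 0") (simp_all add: power2_eq_square)

text \<open>Two kinds of instances are intended: a C*-algebra with the form
  \<open>star a * b\<close>, and Hilbert modules. The axioms say nothing about positivity of
  \<open>ip x x\<close>. Positive operators are developed from the norm alone, then applied to left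
  multiplications on the algebra, and only this gives positive elements and the Cauchy-Schwarz
  inequality for modules. \<open>J\<close> is multiplication by the imaginary unit.\<close>

locale ipm =
  fixes ip :: "'h::banach \<Rightarrow> 'h \<Rightarrow> 'e::cstar" and J :: "'h endo"
  assumes ip_add_right: "ip x (y + z) = ip x y + ip x z"
    and ip_scaleR_right: "ip x (r *\<^sub>R y) = r *\<^sub>R ip x y"
    and ip_star: "star (ip x y) = ip y x"
    and ip_norm: "norm (ip x x) = (norm x)\<^sup>2"
    and ip_CS: "norm (ip x y) \<le> norm x * norm y"
    and ip_J: "ip x (app J y) = mulI (ip x y)"
begin

lemma ip_add_left: "ip (x + y) z = ip x z + ip y z"
  using ip_star[of z "x + y"] by (simp add: ip_add_right star_add ip_star)

lemma ip_scaleR_left: "ip (r *\<^sub>R x) y = r *\<^sub>R ip x y"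
  using ip_star[of y "r *\<^sub>R x"] by (simp add: ip_scaleR_right star_scaleR ip_star)

lemma bounded_bilinear_ip: "bounded_bilinear ip"
proof
  show "\<exists>K. \<forall>a b. norm (ip a b) \<le> norm a * norm b * K"
    using ip_CS by (intro exI[of _ 1]) simp
qed (simp_all add: ip_add_left ip_add_right ip_scaleR_left ip_scaleR_right)

sublocale ip: bounded_bilinear ip
  by (rule bounded_bilinear_ip)

lemma ip_eq_0D: "ip x x = 0 \<Longrightarrow> x = 0"
  using ip_norm[of x] by simp

lemma ip_eqI:
  assumes "\<And>x. ip x y = ip x z" shows "y = z"
proof -
  have "ip (y - z) (y - z) = 0" using assms by (simp add: ip.diff_right)
  then show ?thesis using ip_eq_0D[of "y - z"] by simp
qed

text \<open>A relation and not a function, because a bounded operator on a Hilbert module may fail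
  to have an adjoint.\<close>

definition adj :: "'h endo \<Rightarrow> 'h endo \<Rightarrow> bool" where
  "adj S T \<longleftrightarrow> (\<forall>x y. ip (app S x) y = ip x (app T y))"

lemma adjD: "adj S T \<Longrightarrow> ip (app S x) y = ip x (app T y)"
  by (simp add: adj_def)

lemma adj_sym:
  assumes "adj S T" shows "adj T S"
proof -
  have "ip (app T x) y = ip x (app S y)" for x y
    using adjD[OF assms, of y x] ip_star[of y "app T x"] ip_star[of "app S y" x] by simp
  then show ?thesis by (simp add: adj_def)
qed

lemma adj_unique: "adj S T \<Longrightarrow> adj S T' \<Longrightarrow> T = T'"
proof (rule endo_eqI, rule ip_eqI)
  show "ip z (app T x) = ip z (app T' x)" if "adj S T" "adj S T'" for x z
    using adjD[OF that(1), of z x] adjD[OF that(2), of z x] by simp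
qed

lemma adj_0 [simp]: "adj 0 0" and adj_1 [simp]: "adj 1 1"
  by (simp_all add: adj_def app.zero_left ip.zero_left ip.zero_right)

lemma adj_J: "adj J (- J)"
proof -
  have "ip (app J x) y = - mulI (ip x y)" for x y
    by (simp add: ip_star[of y "app J x", symmetric] ip_J mulI_star ip_star)
  then show ?thesis by (simp add: adj_def app.minus_left ip.minus_right ip_J)
qed

lemma adj_add: "adj S S' \<Longrightarrow> adj T T' \<Longrightarrow> adj (S + T) (S' + T')"
  and adj_diff: "adj S S' \<Longrightarrow> adj T T' \<Longrightarrow> adj (S - T) (S' - T')"
  and adj_scaleR: "adj S S' \<Longrightarrow> adj (r *\<^sub>R S) (r *\<^sub>R S')"
  and adj_minus: "adj S S' \<Longrightarrow> adj (- S) (- S')"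
  and adj_mult: "adj S S' \<Longrightarrow> adj T T' \<Longrightarrow> adj (S * T) (T' * S')"
  by (simp_all add: adj_def app_lin ip.add_left ip.add_right ip.diff_left ip.diff_right
      ip.scaleR_left ip.scaleR_right ip.minus_left ip.minus_right)

lemma adj_power: "adj S S' \<Longrightarrow> adj (S ^ n) (S' ^ n)"
proof (induction n)
  case (Suc n)
  then show ?case using adj_mult[of S S' "S ^ n" "S' ^ n"] by (simp add: power_commutes)
qed simp

lemma adj_lim:
  assumes "S \<longlonglongrightarrow> L" "T \<longlonglongrightarrow> L'" "\<And>n. adj (S n) (T n)"
  shows "adj L L'"
  unfolding adj_def
proof (intro allI)
  fix x y
  have "(\<lambda>n. ip (app (S n) x) y) \<longlonglongrightarrow> ip (app L x) y"
    "(\<lambda>n. ip x (app (T n) y)) \<longlonglongrightarrow> ip x (app L' y)"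
    by (intro ip.tendsto app.tendsto tendsto_const assms)+
  moreover have "ip (app (S n) x) y = ip x (app (T n) y)" for n
    by (rule adjD[OF assms(3)])
  ultimately show "ip (app L x) y = ip x (app L' y)"
    by (simp add: LIMSEQ_unique)
qed

lemma adj_norm_le:
  assumes "adj S T" shows "norm S \<le> norm T"
proof (rule norm_endo_bound)
  fix x
  have "(norm (app S x))\<^sup>2 = norm (ip x (app T (app S x)))"
    by (simp only: adjD[OF assms, symmetric] ip_norm)
  also have "\<dots> \<le> norm x * norm (app T (app S x))" by (rule ip_CS)
  also have "\<dots> \<le> norm x * (norm T * norm (app S x))"
    by (intro mult_left_mono norm_app norm_ge_zero)
  finally show "norm (app S x) \<le> norm T * norm x"
    using le_of_square_le_mult[of "norm (app S x)" "norm T * norm x"] by (simp add: mult_ac)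
qed simp

lemma adj_norm: "adj S T \<Longrightarrow> norm S = norm T"
  by (rule order_antisym[OF adj_norm_le adj_norm_le[OF adj_sym]])

lemma norm_adj_mult:
  assumes "adj S T" shows "norm (T * S) = (norm S)\<^sup>2"
proof (rule antisym)
  show "norm (T * S) \<le> (norm S)\<^sup>2"
    using norm_mult_ineq[of T S] adj_norm[OF assms] by (simp add: power2_eq_square)
  have "norm S \<le> sqrt (norm (T * S))"
  proof (rule norm_endo_bound)
    fix x
    have "(norm (app S x))\<^sup>2 = norm (ip x (app (T * S) x))"
      by (simp only: adjD[OF assms, symmetric] ip_norm app_simps)
    also have "\<dots> \<le> norm x * norm (app (T * S) x)" by (rule ip_CS)
    also have "\<dots> \<le> norm x * (norm (T * S) * norm x)"
      by (intro mult_left_mono norm_app norm_ge_zero)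
    finally have "(norm (app S x))\<^sup>2 \<le> norm (T * S) * (norm x)\<^sup>2"
      by (simp only: power2_eq_square mult_ac)
    from real_sqrt_le_mono[OF this] show "norm (app S x) \<le> sqrt (norm (T * S)) * norm x"
      by (simp only: real_sqrt_mult real_sqrt_abs abs_norm_cancel)
  next
    show "0 \<le> sqrt (norm (T * S))" by (rule real_sqrt_ge_zero) (rule norm_ge_zero)
  qed
  from power_mono[OF this norm_ge_zero, of 2] show "(norm S)\<^sup>2 \<le> norm (T * S)"
    by simp
qed

lemma adj_mult_eq_0D: "adj S T \<Longrightarrow> T * S = 0 \<Longrightarrow> S = 0"
  using norm_adj_mult[of S T] by simp

lemma J_J: "J * J = - 1"
proof (rule endo_eqI, rule ip_eqI)
  show "ip z (app (J * J) x) = ip z (app (- 1) x)" for x z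
    by (simp add: ip_J mulI_mulI app_lin ip.minus_right)
qed

lemma adj_J_commute:
  assumes "adj S T" shows "S * J = J * S"
proof (rule endo_eqI, rule ip_eqI)
  have "ip z (app S y) = ip (app T z) y" for y z
    using adjD[OF adj_sym[OF assms]] by metis
  then show "ip z (app (S * J) x) = ip z (app (J * S) x)" for x z
    by (simp add: ip_J)
qed

lemma adj_sqi: "adj y y \<Longrightarrow> adj (sqi y n) (sqi y n)"
  by (induction n) (auto intro!: adj_scaleR adj_add adj_mult simp del: scaleR_add_right)

lemma adj_sqo: "adj y y \<Longrightarrow> norm y \<le> 1 \<Longrightarrow> adj (sqo y) (sqo y)"
  by (rule adj_lim[OF sqo_lim sqo_lim adj_sqi])

text \<open>If \<open>w\<close>, \<open>v\<close> are commuting and self-adjoint with \<open>w\<^sup>2 + v\<^sup>2 = s\<close>, then \<open>w \<plusminus> iv\<close> is \<open>sqrt s\<close> times an isometry.\<close>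

lemma norm_le_of_square_sum:
  assumes w: "adj w w" and v: "adj v v" and comm: "w * v = v * w"
    and sum: "w * w + v * v = s *\<^sub>R 1" and "0 \<le> s"
  shows "norm w \<le> sqrt s"
proof (rule norm_endo_bound)
  let ?u = "w + J * v" and ?u' = "w - J * v"
  have cw: "w * (J * v) = J * (v * w)"
  proof -
    have "w * (J * v) = (w * J) * v" by (simp only: mult.assoc)
    also have "\<dots> = J * (w * v)" by (simp only: adj_J_commute[OF w] mult.assoc)
    finally show ?thesis by (simp only: comm)
  qed
  have cv: "J * (v * (J * v)) = - (v * v)"
  proof -
    have "J * (v * (J * v)) = J * (v * J) * v" by (simp only: mult.assoc)
    also have "\<dots> = (J * J) * (v * v)" by (simp only: adj_J_commute[OF v] mult.assoc)
    finally show ?thesis by (simp add: J_J)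
  qed
  have a: "adj ?u ?u'"
  proof -
    have "adj (J * v) (v * (- J))" by (rule adj_mult[OF adj_J v])
    moreover have "v * (- J) = - (J * v)" using adj_J_commute[OF v] by simp
    ultimately have "adj (J * v) (- (J * v))" by simp
    from adj_add[OF w this] show ?thesis by simp
  qed
  have "?u' * ?u = w * w + v * v" "?u * ?u' = w * w + v * v"
    by (simp_all add: algebra_simps cw cv)
  then have uu: "?u' * ?u = s *\<^sub>R 1" "?u * ?u' = s *\<^sub>R 1"
    using sum by simp_all
  have iso: "norm (app S x) = sqrt s * norm x" if "adj S T" "T * S = s *\<^sub>R 1" for S T x
  proof -
    have "ip (app S x) (app S x) = s *\<^sub>R ip x x"
      unfolding adjD[OF that(1)] app_simps(2)[symmetric] that(2)
      by (simp add: app.scaleR_left ip_scaleR_right)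
    then have "norm (ip (app S x) (app S x)) = s * norm (ip x x)"
      using assms(5) by simp
    then have "(norm (app S x))\<^sup>2 = s * (norm x)\<^sup>2"
      by (simp only: ip_norm)
    then have "sqrt ((norm (app S x))\<^sup>2) = sqrt (s * (norm x)\<^sup>2)" by (rule arg_cong)
    then show ?thesis by (simp only: real_sqrt_mult real_sqrt_abs abs_norm_cancel)
  qed
  fix x
  have "2 *\<^sub>R app w x = app ?u x + app ?u' x" by (simp add: app_lin scaleR_2)
  then have "norm (2 *\<^sub>R app w x) \<le> norm (app ?u x) + norm (app ?u' x)"
    by (simp only: norm_triangle_ineq)
  then have "2 * norm (app w x) \<le> norm (app ?u x) + norm (app ?u' x)"
    by simp
  then show "norm (app w x) \<le> sqrt s * norm x"
    using iso[OF a uu(1)] iso[OF adj_sym[OF a] uu(2)] by simp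
qed (use assms in simp)

text \<open>The iteration itself only bounds the root r of 1 - b^2 by 2. But r commutes with
  \<open>b\<close> and r^2 + b^2 = 1, so \<open>norm_le_of_square_sum\<close> with s = 1 improves
  this to norm at most 1.\<close>

lemma norm_one_minus_square:
  assumes "adj b b" "norm b \<le> 1"
  shows "norm (1 - b * b) \<le> 1"
proof -
  let ?r = "1 - sqo (b * b)"
  have n: "norm (b * b) \<le> 1"
    using norm_mult_ineq[of b b] mult_le_one[of "norm b" "norm b"] assms by simp
  have rr: "?r * ?r = 1 - b * b" by (rule sqo_square[OF n])
  have a: "adj ?r ?r" using assms n by (auto intro!: adj_diff adj_sqo adj_mult)
  have "b * sqo (b * b) = sqo (b * b) * b"
    by (rule sqo_commute[OF n]) (simp add: mult.assoc)
  then have "?r * b = b * ?r" by (simp add: algebra_simps)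
  moreover have "?r * ?r + b * b = 1 *\<^sub>R 1" unfolding rr by simp
  ultimately have "norm ?r \<le> sqrt 1"
    by (rule norm_le_of_square_sum[OF a assms(1)]) simp
  then have "norm (?r * ?r) \<le> 1"
    using norm_mult_ineq[of ?r ?r] mult_le_one[of "norm ?r" "norm ?r"] by simp
  then show ?thesis by (simp add: rr)
qed

subsection \<open>Positive operators\<close>

text \<open>The second clause places the spectrum in the interval from 0 to 2t without mentioning
  spectra. In this form sums are handled by the triangle inequality, and dividing by
  \<open>t\<close> gives precisely the input that the square root iteration accepts.\<close>

definition psd :: "'h endo \<Rightarrow> bool" where
  "psd S \<longleftrightarrow> adj S S \<and> (\<exists>t\<ge>0. norm (t *\<^sub>R 1 - S) \<le> t)"

lemma psd_adj: "psd S \<Longrightarrow> adj S S"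
  by (simp add: psd_def)

lemma psd_0 [simp]: "psd 0"
  by (auto simp: psd_def)

lemma psd_add:
  assumes "psd S" "psd T" shows "psd (S + T)"
proof -
  obtain s t where *: "s \<ge> 0" "t \<ge> 0" "norm (s *\<^sub>R 1 - S) \<le> s" "norm (t *\<^sub>R 1 - T) \<le> t"
    using assms by (auto simp: psd_def)
  have "norm ((s + t) *\<^sub>R 1 - (S + T)) \<le> s + t"
    using * norm_triangle_ineq[of "s *\<^sub>R 1 - S" "t *\<^sub>R 1 - T"] by (simp add: algebra_simps)
  then show ?thesis using * assms psd_def adj_add by (metis add_nonneg_nonneg)
qed

lemma psd_scaleR:
  assumes "psd S" "r \<ge> 0" shows "psd (r *\<^sub>R S)"
proof -
  obtain s where *: "s \<ge> 0" "norm (s *\<^sub>R 1 - S) \<le> s"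
    using assms by (auto simp: psd_def)
  have "norm ((r * s) *\<^sub>R 1 - r *\<^sub>R S) = r * norm (s *\<^sub>R 1 - S)"
    using assms(2) by (metis abs_of_nonneg norm_scaleR scaleR_right_diff_distrib scaleR_scaleR)
  also have "\<dots> \<le> r * s" using * assms by (simp add: mult_left_mono)
  finally show ?thesis using * assms unfolding psd_def
    by (auto intro!: exI[of _ "r * s"] adj_scaleR)
qed

lemma psd_shift:
  assumes "adj S S" "norm S \<le> s" shows "psd (s *\<^sub>R 1 - S)"
  using assms unfolding psd_def
  by (auto intro!: adj_diff adj_scaleR exI[of _ s] order_trans[OF norm_ge_zero assms(2)])

text \<open>After division by \<open>t\<close> the operator is 1 - y with
  \<open>norm y \<le> 1\<close>, and the root is the limit of polynomials in \<open>y\<close>.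
  Commutation with everything that commutes with \<open>S\<close> is stated because two roots must
  commute before \<open>norm_le_of_square_sum\<close> applies to them.\<close>

lemma psd_sqrt:
  assumes "psd S"
  obtains w where "adj w w" "w * w = S" "\<And>z. z * S = S * z \<Longrightarrow> z * w = w * z"
proof -
  obtain t where t: "t \<ge> 0" "norm (t *\<^sub>R 1 - S) \<le> t" and S: "adj S S"
    using assms by (auto simp: psd_def)
  show ?thesis
  proof (cases "t = 0")
    case True
    then have "S = 0" using t by simp
    then show ?thesis using that[of 0] by simp
  next
    case False
    define y where "y = 1 - (1/t) *\<^sub>R S"
    define w where "w = sqrt t *\<^sub>R (1 - sqo y)"
    have "y = (1/t) *\<^sub>R (t *\<^sub>R 1 - S)" using False by (simp add: y_def algebra_simps)
    then have n: "norm y \<le> 1" using t False by (simp add: divide_le_eq_1)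
    show ?thesis
    proof (rule that[of w])
      show "adj w w" unfolding w_def y_def
        using S n by (auto intro!: adj_scaleR adj_diff adj_sqo simp: y_def)
      show "w * w = S"
        using sqo_square[OF n] t False by (simp add: w_def y_def)
      show "z * w = w * z" if "z * S = S * z" for z
      proof -
        have "z * sqo y = sqo y * z"
          by (rule sqo_commute[OF n]) (simp add: y_def algebra_simps that)
        then show ?thesis by (simp add: w_def algebra_simps)
      qed
    qed
  qed
qed

lemma psd_square:
  assumes "adj b b" shows "psd (b * b)"
proof -
  \<comment> \<open>The summand 1 keeps the scaling factor strictly positive when
    \<open>b = 0\<close>.\<close>
  define \<beta> where "\<beta> = norm b + 1"
  have \<beta>: "\<beta> > 0" by (simp add: \<beta>_def add_nonneg_pos)
  let ?b = "(1/\<beta>) *\<^sub>R b"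
  have "norm (1 - ?b * ?b) \<le> 1"
    using assms \<beta> by (intro norm_one_minus_square adj_scaleR) (auto simp: \<beta>_def)
  moreover have "\<beta>\<^sup>2 *\<^sub>R 1 - b * b = \<beta>\<^sup>2 *\<^sub>R (1 - ?b * ?b)"
    using \<beta> by (simp add: algebra_simps power2_eq_square)
  ultimately have "norm (\<beta>\<^sup>2 *\<^sub>R 1 - b * b) \<le> \<beta>\<^sup>2"
    by (simp add: mult_left_le)
  then show ?thesis unfolding psd_def using assms by (auto intro!: adj_mult exI[of _ "\<beta>\<^sup>2"])
qed

text \<open>Roots w of S and v of -S commute and w^2 + v^2 = 0, so
  \<open>norm_le_of_square_sum\<close> with s = 0 kills w.\<close>

lemma psd_antisym:
  assumes "psd S" "psd (- S)" shows "S = 0"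
proof -
  obtain w where w: "adj w w" "w * w = S" "\<And>z. z * S = S * z \<Longrightarrow> z * w = w * z"
    using psd_sqrt[OF assms(1)] by metis
  obtain v where v: "adj v v" "v * v = - S" "\<And>z. z * (- S) = (- S) * z \<Longrightarrow> z * v = v * z"
    using psd_sqrt[OF assms(2)] by metis
  have "S * v = v * S" by (rule v(3)) simp
  then have "w * v = v * w" using w(3)[of v] by simp
  then have "norm w \<le> sqrt 0"
    using w(1,2) v(1,2) by (intro norm_le_of_square_sum[of w v]) auto
  then show ?thesis using w(2) by simp
qed

text \<open>With s the norm of p + q, both p and s - p are positive: the latter is the sum of s - (p
  + q) and q. Their roots commute and their squares add up to s, which bounds the root of p by the
  root of s.\<close>

lemma psd_norm_mono:
  assumes "psd p" "psd q" shows "norm p \<le> norm (p + q)"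
proof -
  let ?s = "norm (p + q)"
  have pq: "adj (p + q) (p + q)" using assms by (auto intro: adj_add psd_adj)
  have "psd (?s *\<^sub>R 1 - (p + q) + q)"
    by (intro psd_add psd_shift pq assms order_refl)
  then have 1: "psd (?s *\<^sub>R 1 - p)" by simp
  obtain w where w: "adj w w" "w * w = p" "\<And>z. z * p = p * z \<Longrightarrow> z * w = w * z"
    using psd_sqrt[OF assms(1)] by metis
  obtain v where v: "adj v v" "v * v = ?s *\<^sub>R 1 - p"
      "\<And>z. z * (?s *\<^sub>R 1 - p) = (?s *\<^sub>R 1 - p) * z \<Longrightarrow> z * v = v * z"
    using psd_sqrt[OF 1] by metis
  have "p * v = v * p" by (rule v(3)) (simp add: algebra_simps)
  then have "w * v = v * w" using w(3)[of v] by simp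
  then have "norm w \<le> sqrt ?s"
    using w(1,2) v(1,2) by (intro norm_le_of_square_sum[of w v]) auto
  then have "norm w * norm w \<le> sqrt ?s * sqrt ?s" by (intro mult_mono) auto
  then show ?thesis using norm_mult_ineq[of w w] w(2) by simp
qed

text \<open>The norms of the powers \<open>u\<^sup>n\<close> grow at most linearly, whereas those of \<open>u ^ (2 ^ k)\<close> are \<open>norm u ^ (2 ^ k)\<close>.\<close>

lemma norm_le_1_of_power_bound:
  assumes u: "adj u u" and K: "\<And>n. norm (u ^ n * (1 - u)) \<le> K"
  shows "norm u \<le> 1"
proof (rule ccontr)
  assume "\<not> norm u \<le> 1"
  define \<delta> where "\<delta> = norm u - 1"
  have \<delta>: "\<delta> > 0" using \<open>\<not> norm u \<le> 1\<close> by (simp add: \<delta>_def)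
  have K0: "0 \<le> K" using K[of 0] norm_ge_zero order_trans by blast
  have lin: "norm (u ^ n) \<le> 1 + n * K" for n
  proof (induction n)
    case 0 show ?case using norm_one_endo by simp
  next
    case (Suc n)
    have "u ^ Suc n = u ^ n - u ^ n * (1 - u)" by (simp add: algebra_simps power_commutes)
    then have "norm (u ^ Suc n) \<le> norm (u ^ n) + norm (u ^ n * (1 - u))"
      by (metis norm_triangle_ineq4)
    then show ?case using Suc K[of n] by (simp add: algebra_simps)
  qed
  have pow: "norm (u ^ (2 ^ k)) = norm u ^ (2 ^ k)" for k
  proof (induction k)
    case (Suc k)
    have "norm (u ^ (2 ^ k) * u ^ (2 ^ k)) = (norm (u ^ (2 ^ k)))\<^sup>2"
      by (rule norm_adj_mult) (rule adj_power[OF u])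
    then show ?case using Suc
      by (simp add: power_add[symmetric] mult_2 power_mult[symmetric] mult.commute)
  qed simp
  \<comment> \<open>At exponent 2m with m = 2^j, Bernoulli's inequality bounds the norm of the power
    from below by (m \<delta>)^2, against a linear bound from above. This \<open>j\<close> makes m
    \<delta>^2 larger than 1 + 2K, which contradicts the comparison.\<close>
  obtain j where j: "(1 + 2 * K) / \<delta>\<^sup>2 < 2 ^ j"
    using real_arch_pow[of 2] by auto
  define m where "m = (2::nat) ^ j"
  have m: "real m \<ge> 1" by (simp add: m_def)
  have "(real m * \<delta>)\<^sup>2 \<le> (1 + real m * \<delta>)\<^sup>2"
    using \<delta> m by (intro power_mono) auto
  also have "\<dots> \<le> ((1 + \<delta>) ^ m)\<^sup>2"
    using \<delta> Bernoulli_inequality[of \<delta> m] by (intro power_mono) auto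
  also have "\<dots> = norm (u ^ (2 ^ Suc j))"
    unfolding pow by (simp add: \<delta>_def m_def power_mult[symmetric] mult.commute)
  also have "\<dots> \<le> 1 + real (2 * m) * K" using lin[of "2 ^ Suc j"] by (simp add: m_def)
  also have "\<dots> \<le> real m * (1 + 2 * K)" using m by (simp add: algebra_simps)
  finally have "real m * (real m * \<delta>\<^sup>2) \<le> real m * (1 + 2 * K)"
    by (simp add: power2_eq_square mult_ac)
  then have "real m * \<delta>\<^sup>2 \<le> 1 + 2 * K" using m by (subst (asm) mult_le_cancel_left_pos) auto
  then show False using j \<delta> by (simp add: m_def divide_less_eq)
qed

text \<open>Replaces the fact that both products have the same spectrum up to 0. With u = 1 - c'c/t
  and v = 1 - cc'/t one has u^n c' = c' v^n, hence u^n (1 - u) = c' v^n c / t. As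
  \<open>norm v \<le> 1\<close>, these stay bounded in n, and
  \<open>norm_le_1_of_power_bound\<close> gives \<open>norm u \<le> 1\<close>.\<close>

lemma psd_swap:
  assumes c: "adj c c'" and p: "psd (c * c')" shows "psd (c' * c)"
proof -
  obtain t where t: "t \<ge> 0" "norm (t *\<^sub>R 1 - c * c') \<le> t"
    using p by (auto simp: psd_def)
  have a: "adj (c' * c) (c' * c)" using adj_mult[OF adj_sym[OF c] c] .
  show ?thesis
  proof (cases "t = 0")
    case True
    then have "c * c' = 0" using t by simp
    then have "c' = 0" using adj_mult_eq_0D[OF adj_sym[OF c]] by simp
    then show ?thesis by simp
  next
    case False
    let ?u = "1 - (1/t) *\<^sub>R (c' * c)" and ?v = "1 - (1/t) *\<^sub>R (c * c')"
    have "?v = (1/t) *\<^sub>R (t *\<^sub>R 1 - c * c')" using False by (simp add: algebra_simps)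
    then have n: "norm ?v \<le> 1" using t False by (simp add: divide_le_eq_1)
    have uv: "?u ^ n * c' = c' * ?v ^ n" for n
    proof (induction n)
      case (Suc n)
      have "?u ^ Suc n * c' = ?u * (?u ^ n * c')" by (simp add: mult.assoc)
      also have "\<dots> = ?u * c' * ?v ^ n" by (simp add: Suc mult.assoc)
      also have "?u * c' = c' * ?v" by (simp add: algebra_simps)
      finally show ?case by (simp add: mult.assoc)
    qed simp
    have "norm ?u \<le> 1"
    proof (rule norm_le_1_of_power_bound)
      show "adj ?u ?u" by (intro adj_diff adj_1 adj_scaleR a)
      show "norm (?u ^ n * (1 - ?u)) \<le> (1/t) * (norm c' * norm c)" for n
      proof -
        have "?u ^ n * (1 - ?u) = (1/t) *\<^sub>R (?u ^ n * c' * c)"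
          by (simp add: mult.assoc)
        then have "norm (?u ^ n * (1 - ?u)) = (1/t) * norm (c' * ?v ^ n * c)"
          using t(1) by (simp only: uv norm_scaleR) simp
        moreover have "norm (c' * ?v ^ n * c) \<le> norm c' * norm (?v ^ n) * norm c"
          by (rule order_trans[OF norm_mult_ineq mult_right_mono[OF norm_mult_ineq norm_ge_zero]])
        moreover have "norm (?v ^ n) \<le> 1"
          using norm_power_le[OF norm_one_endo] power_le_one[OF norm_ge_zero n] order_trans by blast
        then have "norm c' * norm (?v ^ n) * norm c \<le> norm c' * 1 * norm c"
          by (intro mult_right_mono mult_left_mono norm_ge_zero)
        ultimately have "norm (?u ^ n * (1 - ?u)) = (1/t) * norm (c' * ?v ^ n * c)"
          "norm (c' * ?v ^ n * c) \<le> norm c' * norm c" by auto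
        then show ?thesis using t(1) by (simp only: mult_left_mono zero_le_divide_1_iff)
      qed
    qed
    moreover have "t *\<^sub>R 1 - c' * c = t *\<^sub>R ?u" using False by (simp add: algebra_simps)
    ultimately have "norm (t *\<^sub>R 1 - c' * c) \<le> t" using t by (simp add: mult_left_le)
    then show ?thesis using a t unfolding psd_def by auto
  qed
qed

text \<open>The absolute value of \<open>b\<close>. The root is built from the iteration directly,
  since this shows that it is positive as well: \<beta> - r is \<beta> times \<open>sqo\<close> of a
  contraction and has norm at most \<beta>.\<close>

lemma psd_abs:
  assumes "adj b b"
  obtains r where "adj r r" "r * r = b * b" "psd r" "\<And>z. z * b = b * z \<Longrightarrow> z * r = r * z"
proof -
  define \<beta> where "\<beta> = norm b + 1"
  have \<beta>: "\<beta> > 0" by (simp add: \<beta>_def add_nonneg_pos)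
  define c where "c = (1/\<beta>) *\<^sub>R b"
  have c: "adj c c" "norm c \<le> 1" using assms \<beta> by (auto simp: c_def \<beta>_def intro: adj_scaleR)
  let ?y = "1 - c * c"
  define r where "r = \<beta> *\<^sub>R (1 - sqo ?y)"
  have n: "norm ?y \<le> 1" by (rule norm_one_minus_square[OF c])
  have a: "adj (sqo ?y) (sqo ?y)" using c n by (auto intro!: adj_sqo adj_diff adj_mult)
  show ?thesis
  proof (rule that[of r])
    show r: "adj r r" using a unfolding r_def by (intro adj_scaleR adj_diff adj_1)
    show "r * r = b * b" using sqo_square[OF n] \<beta> by (simp add: r_def c_def)
    have "norm (\<beta> *\<^sub>R 1 - r) = \<beta> * norm (sqo ?y)" using \<beta> by (simp add: r_def algebra_simps)
    then have "norm (\<beta> *\<^sub>R 1 - r) \<le> \<beta>" using sqo_norm[OF n] \<beta> by (simp add: mult_left_le)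
    then show "psd r" using r \<beta> unfolding psd_def by (auto intro!: exI[of _ \<beta>])
    show "z * r = r * z" if "z * b = b * z" for z
    proof -
      have zc: "z * c = c * z" by (simp add: c_def that)
      have "z * (c * c) = c * c * z" by (metis zc mult.assoc)
      then have "z * sqo ?y = sqo ?y * z" by (intro sqo_commute[OF n]) (simp add: algebra_simps)
      then show ?thesis by (simp add: r_def algebra_simps)
    qed
  qed
qed

text \<open>Kaplansky's argument.\<close>

lemma psd_adj_mult:
  assumes b: "adj b b'" shows "psd (b' * b)"
proof -
  define a where "a = b' * b"
  have a: "adj a a" unfolding a_def by (rule adj_mult[OF adj_sym[OF b] b])
  obtain r where r: "adj r r" "r * r = a * a" "psd r" "\<And>z. z * a = a * z \<Longrightarrow> z * r = r * z"
    using psd_abs[OF a] by metis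
  have ar: "a * r = r * a" by (rule r(4)) simp
  \<comment> \<open>Twice the negative part of \<open>a\<close>, with \<open>r\<close> the absolute
    value; the aim is \<open>n = 0\<close>.\<close>
  define n where "n = r - a"
  have n: "adj n n" unfolding n_def by (intro adj_diff a r)
  have nr: "n * r = r * n" by (simp add: n_def algebra_simps ar)
  obtain w where w: "adj w w" "w * w = r" "\<And>z. z * r = r * z \<Longrightarrow> z * w = w * z"
    using psd_sqrt[OF r(3)] by metis
  have nw: "n * w = w * n" by (rule w(3)[OF nr])
  have an: "a * n = - (r * n)" by (simp add: n_def algebra_simps r(2) ar)
  have nn: "n * n = 2 *\<^sub>R (r * n)" by (simp add: n_def algebra_simps r(2) ar scaleR_2)
  \<comment> \<open>Since \<open>a * n = - (r * n)\<close>, the product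
    \<open>c' * c = n * a * n\<close> is minus the square of the self-adjoint operator
    \<open>w * n\<close>.\<close>
  define c where "c = b * n"
  define c' where "c' = n * b'"
  have c: "adj c c'" unfolding c_def c'_def by (rule adj_mult[OF b n])
  let ?q = "w * n"
  have q: "adj ?q ?q" using adj_mult[OF w(1) n] nw by simp
  have qq: "?q * ?q = r * n * n" using nw w(2) by (metis mult.assoc)
  have cc: "c' * c = - (?q * ?q)"
  proof -
    have "c' * c = n * (a * n)" by (simp add: c_def c'_def a_def mult.assoc)
    also have "\<dots> = - (n * r * n)" by (simp add: an mult.assoc)
    finally show ?thesis using nr qq by simp
  qed
  \<comment> \<open>Real and imaginary part of \<open>c\<close> up to scalar factors. The sum
    \<open>c * c' + c' * c\<close> is half the sum of their squares and \<open>c' * c\<close> is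
    negative, so \<open>c * c'\<close> is positive. Then \<open>psd_swap\<close> makes
    \<open>c' * c\<close> positive too, hence zero.\<close>
  let ?X = "c + c'" and ?Y = "J * (c - c')"
  have X: "adj ?X ?X" using adj_add[OF c adj_sym[OF c]] by (simp add: add.commute)
  have Jc: "(c - c') * J = J * (c - c')"
    by (rule adj_J_commute[OF adj_diff[OF c adj_sym[OF c]]])
  have Y: "adj ?Y ?Y"
  proof -
    have "adj ?Y ((c' - c) * (- J))" by (rule adj_mult[OF adj_J adj_diff[OF c adj_sym[OF c]]])
    moreover have "(c' - c) * (- J) = (c - c') * J" by (simp add: algebra_simps)
    ultimately show ?thesis using Jc by simp
  qed
  have "?Y * ?Y = J * ((c - c') * J) * (c - c')" by (simp only: mult.assoc)
  also have "\<dots> = (J * J) * ((c - c') * (c - c'))" by (simp only: Jc mult.assoc)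
  finally have "?Y * ?Y = - ((c - c') * (c - c'))" by (simp add: J_J)
  then have "?X * ?X + ?Y * ?Y = 2 *\<^sub>R (c * c' + c' * c)"
    by (simp add: algebra_simps scaleR_2)
  then have "c * c' = (1/2) *\<^sub>R (?X * ?X + ?Y * ?Y) + ?q * ?q"
    using cc by simp
  moreover have "psd ((1/2) *\<^sub>R (?X * ?X + ?Y * ?Y) + ?q * ?q)"
    by (intro psd_add psd_scaleR psd_square X Y q) simp
  ultimately have "psd (c' * c)" using psd_swap[OF c] by simp
  moreover have "psd (- (c' * c))" using psd_square[OF q] cc by simp
  ultimately have "c' * c = 0" by (rule psd_antisym)
  then have "?q * ?q = 0" using cc by simp
  then have "w * n = 0" using adj_mult_eq_0D[OF q] by simp
  then have "r * n = 0" using w(2) by (metis mult.assoc mult_zero_right)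
  then have "n * n = 0" using nn by simp
  then have "n = 0" using adj_mult_eq_0D[OF n] by simp
  then show ?thesis using r(3) by (simp add: n_def a_def)
qed

end

context ipm
begin

lemma psd_norm_one_minus:
  assumes "psd S" "norm S \<le> 1" shows "norm (1 - S) \<le> 1"
proof -
  obtain w where w: "adj w w" "w * w = S"
    using psd_sqrt[OF assms(1)] by metis
  have "(norm w)\<^sup>2 \<le> 1" using norm_adj_mult[OF w(1)] w(2) assms(2) by simp
  then have "norm w \<le> 1" by (simp add: power_le_one_iff)
  then show ?thesis using norm_one_minus_square[OF w(1)] w(2) by simp
qed

end

subsection \<open>Positive elements\<close>

text \<open>Real homogeneity of \<open>mulI\<close> is derived from the way it moves across
  products: the defect \<open>S\<close> annihilates every element from the left, in particular
  \<open>star S\<close>, and vanishes by the C*-identity.\<close>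

lemma bounded_linear_mulI: "bounded_linear (mulI :: 'a::cstar \<Rightarrow> 'a)"
proof (rule bounded_linear_intro[where K=1])
  fix r :: real and x :: 'a
  define S where "S = mulI (r *\<^sub>R x) - r *\<^sub>R mulI x"
  have "S * y = 0" for y
  proof -
    have "mulI (r *\<^sub>R x) * y = (r *\<^sub>R x) * mulI y" "mulI x * y = x * mulI y"
      by (simp_all only: mulI_left mulI_right)
    then show ?thesis by (simp add: S_def left_diff_distrib)
  qed
  then have "norm (S * star S) = 0" by simp
  then show "mulI (r *\<^sub>R x) = r *\<^sub>R mulI x" by (simp add: norm_mult_star S_def)
qed (simp_all add: mulI_add norm_mulI)

lemma app_mulI [simp]: "app (endo_of mulI) (x::'a::cstar) = mulI x"
  by (rule app_endo_of[OF bounded_linear_mulI])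

text \<open>The algebra as a module over itself. Its left multiplications are adjointable operators,
  and among operators there is a unit even if the algebra has none.\<close>

interpretation self: ipm "\<lambda>(a::'e::cstar) b. star a * b" "endo_of mulI"
proof
  show "norm (star x * y) \<le> norm x * norm y" for x y :: 'e
    using norm_mult_ineq[of "star x" y] by simp
qed (simp_all add: distrib_left star_mult norm_star_mult mulI_right)

definition lmul :: "'e::cstar \<Rightarrow> 'e endo" where
  "lmul a = endo_of (\<lambda>b. a * b)"

lemma app_lmul [simp]: "app (lmul a) b = a * b"
  unfolding lmul_def by (rule app_endo_of[OF bounded_linear_mult_right])

lemma lmul_mult: "lmul (a * b) = lmul a * lmul b"
  and lmul_add: "lmul (a + b) = lmul a + lmul b"
  and lmul_diff: "lmul (a - b) = lmul a - lmul b"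
  and lmul_scaleR: "lmul (r *\<^sub>R a) = r *\<^sub>R lmul a"
  by (rule endo_eqI, simp add: app_lin algebra_simps)+

lemma adj_lmul: "self.adj (lmul a) (lmul (star a))"
  by (simp add: self.adj_def star_mult mult.assoc)

lemma norm_lmul [simp]: "norm (lmul a) = norm a"
proof (rule antisym)
  show "norm (lmul a) \<le> norm a"
    by (rule norm_endo_bound) (simp_all add: norm_mult_ineq)
  have "(norm a)\<^sup>2 \<le> norm (lmul a) * norm a"
    using norm_app[of "lmul a" "star a"] by (simp add: norm_mult_star)
  then show "norm a \<le> norm (lmul a)" by (rule le_of_square_le_mult) auto
qed

text \<open>Defined through left multiplication because the difference of \<open>t\<close> times the
  unit and \<open>a\<close> has a meaning only there.\<close>

definition pos :: "'e::cstar \<Rightarrow> bool" where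
  "pos a \<longleftrightarrow> self.psd (lmul a)"

lemma pos_star_mult: "pos (star b * b)"
  unfolding pos_def lmul_mult by (rule self.psd_adj_mult[OF adj_lmul])

lemma pos_0 [simp]: "pos 0"
  using pos_star_mult[of 0] by simp

lemma pos_add: "pos a \<Longrightarrow> pos b \<Longrightarrow> pos (a + b)"
  unfolding pos_def lmul_add by (rule self.psd_add)

lemma pos_scaleR: "pos a \<Longrightarrow> 0 \<le> r \<Longrightarrow> pos (r *\<^sub>R a)"
  unfolding pos_def lmul_scaleR by (rule self.psd_scaleR)

lemma pos_norm_mono: "pos p \<Longrightarrow> pos q \<Longrightarrow> norm p \<le> norm (p + q)"
  unfolding pos_def using self.psd_norm_mono[of "lmul p" "lmul q"]
  by (simp add: lmul_add[symmetric])

lemma pos_star: "pos a \<Longrightarrow> star a = a"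
proof -
  assume "pos a"
  then have "self.adj (lmul a) (lmul a)" by (simp add: pos_def self.psd_adj)
  then have "lmul (star a) = lmul a" using self.adj_unique adj_lmul by blast
  then have "norm (lmul (star a - a)) = 0" unfolding lmul_diff by simp
  then show ?thesis by simp
qed

lemma pos_one_minus:
  assumes "pos e" "norm e \<le> 1"
  shows "norm (b - e * b) \<le> norm b" "norm (b - b * e) \<le> norm b"
proof -
  have *: "norm (c - e * c) \<le> norm c" for c
  proof -
    have "norm (app (1 - lmul e) c) \<le> 1 * norm c"
      using assms by (intro order_trans[OF norm_app] mult_right_mono self.psd_norm_one_minus)
        (simp_all add: pos_def)
    then show ?thesis by (simp add: app_lin)
  qed
  then show "norm (b - e * b) \<le> norm b" .
  have "norm (b - b * e) = norm (star b - e * star b)"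
    using norm_star[of "b - b * e"] pos_star[OF assms(1)] by (simp add: star_diff star_mult)
  then show "norm (b - b * e) \<le> norm b" using *[of "star b"] by simp
qed

text \<open>A norm inequality free of units and of square roots, hence one that can be checked
  coordinate by coordinate in a product of algebras. \<open>pos_norm_diff\<close> provides it in
  each coordinate, and with one \<open>t\<close> for all coordinates this lemma reassembles
  them.\<close>

lemma pos_criterion:
  assumes "star a = a" "0 \<le> t" "\<And>b. norm (t *\<^sub>R b - a * b) \<le> t * norm b"
  shows "pos a"
proof -
  have "norm (t *\<^sub>R 1 - lmul a) \<le> t"
    using assms(2,3) by (intro norm_endo_bound) (simp_all add: app_lin)
  then show ?thesis
    using adj_lmul[of a] assms(1,2) by (auto simp: pos_def self.psd_def)
qed

lemma pos_norm_diff: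
  assumes "pos a" "norm a \<le> t"
  shows "norm (t *\<^sub>R b - a * b) \<le> t * norm b"
proof (cases "t = 0")
  case False
  then have t: "t > 0" using assms(2) norm_ge_zero[of a] by linarith
  have "norm (b - ((1/t) *\<^sub>R a) * b) \<le> norm b"
    using assms t by (intro pos_one_minus pos_scaleR) (simp_all add: divide_le_eq_1)
  then have "t * norm (b - ((1/t) *\<^sub>R a) * b) \<le> t * norm b"
    using t by (intro mult_left_mono) auto
  moreover have "t *\<^sub>R b - a * b = t *\<^sub>R (b - ((1/t) *\<^sub>R a) * b)"
    using t by (simp add: scaleR_diff_right)
  then have "norm (t *\<^sub>R b - a * b) = t * norm (b - ((1/t) *\<^sub>R a) * b)"
    using t by simp
  ultimately show ?thesis by simp
qed (use assms in simp)

text \<open>The operator \<open>norm p *\<^sub>R 1 - lmul p\<close> is positive and has a root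
  \<open>w\<close>; the claim is positivity of the adjoint of \<open>w * lmul a\<close> times
  \<open>w * lmul a\<close>.\<close>

lemma pos_norm_conj:
  assumes "pos p" shows "pos (norm p *\<^sub>R (star a * a) - star a * p * a)"
proof -
  have p: "self.adj (lmul p) (lmul p)" using assms by (simp add: pos_def self.psd_adj)
  have "self.psd (norm p *\<^sub>R 1 - lmul p)" by (rule self.psd_shift[OF p]) simp
  then obtain w where w: "self.adj w w" "w * w = norm p *\<^sub>R 1 - lmul p"
    by (rule self.psd_sqrt)
  have "self.adj (w * lmul a) (lmul (star a) * w)" by (rule self.adj_mult[OF w(1) adj_lmul])
  then have "self.psd (lmul (star a) * w * (w * lmul a))" by (rule self.psd_adj_mult)
  also have "lmul (star a) * w * (w * lmul a) = lmul (star a) * (w * w) * lmul a"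
    by (simp only: mult.assoc)
  also have "\<dots> = lmul (norm p *\<^sub>R (star a * a) - star a * p * a)"
    unfolding w(2) by (rule endo_eqI) (simp add: app_lin algebra_simps)
  finally show ?thesis by (simp add: pos_def)
qed

text \<open>The Cauchy-Schwarz inequality in the form \<open>p = \<langle>x,x\<rangle>\<close>, \<open>h = \<langle>x,y\<rangle>\<close>, \<open>q = \<langle>y,y\<rangle>\<close>;
  the hypothesis is positivity of \<open>\<langle>xa - y, xa - y\<rangle>\<close> for \<open>a = \<tau>h\<close>.\<close>

lemma cauchy_schwarz_pos:
  assumes p: "pos p" and 0: "p = 0 \<Longrightarrow> h = 0"
    and z: "\<And>\<tau>::real. pos (\<tau>\<^sup>2 *\<^sub>R (star h * p * h) - (2 * \<tau>) *\<^sub>R (star h * h) + q)"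
  shows "(norm h)\<^sup>2 \<le> norm p * norm q"
proof (cases "p = 0")
  case False
  \<comment> \<open>The value which maximizes the coefficient 2 \<tau> - \<tau>^2
    \<open>norm p\<close> left in front of \<open>star h * h\<close> after
    \<open>star h * p * h\<close> has been estimated by \<open>norm p\<close> times
    \<open>star h * h\<close>.\<close>
  define \<tau> where "\<tau> = 1 / norm p"
  have np: "norm p > 0" using False by simp
  have "pos ((\<tau>\<^sup>2 *\<^sub>R (star h * p * h) - (2 * \<tau>) *\<^sub>R (star h * h) + q)
      + \<tau>\<^sup>2 *\<^sub>R (norm p *\<^sub>R (star h * h) - star h * p * h))"
    by (intro pos_add z pos_scaleR pos_norm_conj p) simp
  also have "(\<tau>\<^sup>2 *\<^sub>R (star h * p * h) - (2 * \<tau>) *\<^sub>R (star h * h) + q)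
      + \<tau>\<^sup>2 *\<^sub>R (norm p *\<^sub>R (star h * h) - star h * p * h)
      = q - (2 * \<tau> - \<tau>\<^sup>2 * norm p) *\<^sub>R (star h * h)"
    by (simp add: scaleR_diff_right scaleR_diff_left)
  also have "2 * \<tau> - \<tau>\<^sup>2 * norm p = \<tau>" using np by (simp add: \<tau>_def power2_eq_square)
  finally have q: "pos (q - \<tau> *\<^sub>R (star h * h))" .
  have "norm (\<tau> *\<^sub>R (star h * h)) \<le> norm (\<tau> *\<^sub>R (star h * h) + (q - \<tau> *\<^sub>R (star h * h)))"
    using np by (intro pos_norm_mono q pos_scaleR pos_star_mult) (simp add: \<tau>_def)
  then show ?thesis using np by (simp add: \<tau>_def norm_star_mult field_simps)
qed (use 0 in simp)

subsection \<open>Bounded families of Banach spaces\<close>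

lemma cvs_axioms:
  assumes "cvs V z ad ng sm"
  shows "z \<in> V" "\<forall>x\<in>V. \<forall>y\<in>V. ad x y \<in> V" "\<forall>x\<in>V. ng x \<in> V" "\<forall>c. \<forall>x\<in>V. sm c x \<in> V"
    "\<forall>x\<in>V. \<forall>y\<in>V. \<forall>w\<in>V. ad (ad x y) w = ad x (ad y w)"
    "\<forall>x\<in>V. \<forall>y\<in>V. ad x y = ad y x" "\<forall>x\<in>V. ad z x = x" "\<forall>x\<in>V. ad (ng x) x = z"
    "\<forall>c. \<forall>x\<in>V. \<forall>y\<in>V. sm c (ad x y) = ad (sm c x) (sm c y)"
    "\<forall>c d. \<forall>x\<in>V. sm (c + d) x = ad (sm c x) (sm d x)"
    "\<forall>c d. \<forall>x\<in>V. sm c (sm d x) = sm (c * d) x" "\<forall>x\<in>V. sm 1 x = x"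
  using assms unfolding cvs_def by - (elim conjE, assumption)+

lemmas cvs_facts = cvs_axioms[rule_format]
lemmas cvs_zero = cvs_facts(1)
  and cvs_add = cvs_facts(2)
  and cvs_neg = cvs_facts(3)
  and cvs_smul = cvs_facts(4)
  and cvs_assoc = cvs_facts(5)
  and cvs_commute = cvs_facts(6)
  and cvs_zero_left = cvs_facts(7)
  and cvs_neg_left = cvs_facts(8)
  and cvs_smul_plus = cvs_facts(10)
  and cvs_smul_smul = cvs_facts(11)
  and cvs_smul_one = cvs_facts(12)

lemma cvs_cancel:
  assumes V: "cvs V z ad ng sm" and "x \<in> V" "y \<in> V" "w \<in> V" "ad x y = ad x w"
  shows "y = w"
proof -
  have "ad (ng x) (ad x v) = v" if "v \<in> V" for v
  proof -
    have "ad (ng x) (ad x v) = ad (ad (ng x) x) v"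
      by (rule cvs_assoc[OF V cvs_neg[OF V assms(2)] assms(2) that, symmetric])
    then show ?thesis using cvs_neg_left[OF V assms(2)] cvs_zero_left[OF V that] by simp
  qed
  from this[OF assms(3)] this[OF assms(4)] show ?thesis unfolding assms(5) by (rule trans[OF sym])
qed

lemma cvs_zero_right:
  assumes "cvs V z ad ng sm" "x \<in> V" shows "ad x z = x"
  by (rule trans[OF cvs_commute[OF assms cvs_zero[OF assms(1)]] cvs_zero_left[OF assms]])

lemma cvs_smul_0:
  assumes V: "cvs V z ad ng sm" and x: "x \<in> V" shows "sm 0 x = z"
proof (rule cvs_cancel[OF V])
  show "ad (sm 0 x) (sm 0 x) = ad (sm 0 x) z"
    using cvs_smul_plus[OF V x, of 0 0] cvs_zero_right[OF V cvs_smul[OF V x]] by simp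
qed (use x in \<open>auto intro!: cvs_add[OF V] cvs_neg[OF V] cvs_smul[OF V] cvs_zero[OF V]\<close>)

lemma cvs_neg_smul:
  assumes V: "cvs V z ad ng sm" and x: "x \<in> V" shows "ng x = sm (- 1) x"
proof (rule cvs_cancel[OF V])
  have "ad x (sm (-1) x) = z"
    using cvs_smul_plus[OF V x, of 1 "-1"] cvs_smul_0[OF V x] cvs_smul_one[OF V x] by simp
  then show "ad x (ng x) = ad x (sm (- 1) x)"
    using cvs_commute[OF V x cvs_neg[OF V x]] cvs_neg_left[OF V x] by simp
qed (use x in \<open>auto intro!: cvs_add[OF V] cvs_neg[OF V] cvs_smul[OF V] cvs_zero[OF V]\<close>)

lemma cvs_smul_zero: "cvs V z ad ng sm \<Longrightarrow> sm c z = z"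
  using cvs_smul_smul[of V z ad ng sm z c 0] cvs_smul_0[of V z ad ng sm z] cvs_zero[of V z ad ng sm]
  by simp

lemma cvs_neg_zero: "cvs V z ad ng sm \<Longrightarrow> ng z = z"
  using cvs_neg_smul[of V z ad ng sm z] cvs_smul_zero[of V z ad ng sm] cvs_zero[of V z ad ng sm]
  by simp

locale bfam =
  fixes good :: "'i \<Rightarrow> bool" and V :: "'i \<Rightarrow> 'v set" and z :: "'i \<Rightarrow> 'v"
    and ad :: "'i \<Rightarrow> 'v \<Rightarrow> 'v \<Rightarrow> 'v" and ng :: "'i \<Rightarrow> 'v \<Rightarrow> 'v"
    and sm :: "'i \<Rightarrow> complex \<Rightarrow> 'v \<Rightarrow> 'v" and nm :: "'i \<Rightarrow> 'v \<Rightarrow> real"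
  assumes vs: "good i \<Longrightarrow> cvs (V i) (z i) (ad i) (ng i) (sm i)"
    and nm_nonneg: "good i \<Longrightarrow> x \<in> V i \<Longrightarrow> 0 \<le> nm i x"
    and nm_eq_0: "good i \<Longrightarrow> x \<in> V i \<Longrightarrow> nm i x = 0 \<longleftrightarrow> x = z i"
    and nm_tri: "good i \<Longrightarrow> x \<in> V i \<Longrightarrow> y \<in> V i \<Longrightarrow> nm i (ad i x y) \<le> nm i x + nm i y"
    and nm_smul: "good i \<Longrightarrow> x \<in> V i \<Longrightarrow> nm i (sm i c x) = cmod c * nm i x"
    and compl: "good i \<Longrightarrow> complete_wrt (V i) (\<lambda>x y. nm i (ad i x (ng i y)))"
begin

text \<open>Coordinates that are not \<open>good\<close> carry no space at all. Pinning them to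
  \<open>undefined\<close> makes a family determined by its good coordinates, so that extensional
  equality is the right equality.\<close>

definition Fam :: "('i \<Rightarrow> 'v) set" where
  "Fam = {f. (\<forall>i. good i \<longrightarrow> f i \<in> V i) \<and> (\<forall>i. \<not> good i \<longrightarrow> f i = undefined)
     \<and> (\<exists>B. \<forall>i. good i \<longrightarrow> nm i (f i) \<le> B)}"

definition fam :: "('i \<Rightarrow> 'v) \<Rightarrow> 'i \<Rightarrow> 'v" where
  "fam f = (\<lambda>i. if good i then f i else undefined)"

text \<open>The extra element 0 keeps the supremum meaningful when no index is good, and makes
  \<open>nF_least\<close> ask for a nonnegative bound.\<close>

definition nF :: "('i \<Rightarrow> 'v) \<Rightarrow> real" where
  "nF f = Sup (insert 0 {nm i (f i) |i. good i})"

lemma fam_eq [simp]: "good i \<Longrightarrow> fam f i = f i" "\<not> good i \<Longrightarrow> fam f i = undefined"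
  by (simp_all add: fam_def)

lemma FamI:
  "(\<And>i. good i \<Longrightarrow> f i \<in> V i) \<Longrightarrow> (\<And>i. good i \<Longrightarrow> nm i (f i) \<le> B) \<Longrightarrow> fam f \<in> Fam"
  by (auto simp: Fam_def)

lemma FamD: "f \<in> Fam \<Longrightarrow> good i \<Longrightarrow> f i \<in> V i"
  by (simp add: Fam_def)

lemma Fam_eqI: "f \<in> Fam \<Longrightarrow> g \<in> Fam \<Longrightarrow> (\<And>i. good i \<Longrightarrow> f i = g i) \<Longrightarrow> f = g"
  by (rule ext) (metis (mono_tags, lifting) Fam_def mem_Collect_eq)

lemma bdd:
  assumes "f \<in> Fam" shows "bdd_above (insert 0 {nm i (f i) |i. good i})"
proof -
  obtain B where "\<And>i. good i \<Longrightarrow> nm i (f i) \<le> B" using assms by (auto simp: Fam_def)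
  then show ?thesis by (intro bdd_aboveI[of _ "max 0 B"]) (auto intro: max.coboundedI2)
qed

lemma nF_upper: "f \<in> Fam \<Longrightarrow> good i \<Longrightarrow> nm i (f i) \<le> nF f"
  unfolding nF_def by (rule cSup_upper[OF _ bdd]) auto

lemma nF_nonneg: "f \<in> Fam \<Longrightarrow> 0 \<le> nF f"
  unfolding nF_def by (rule cSup_upper[OF _ bdd]) auto

lemma nF_least: "0 \<le> B \<Longrightarrow> (\<And>i. good i \<Longrightarrow> nm i (f i) \<le> B) \<Longrightarrow> nF f \<le> B"
  unfolding nF_def by (rule cSup_least) auto

lemma nF_cong: "(\<And>i. good i \<Longrightarrow> nm i (f i) = nm i (g i)) \<Longrightarrow> nF f = nF g"
  unfolding nF_def by (rule arg_cong[where f=Sup]) force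

lemma nm_zero: "good i \<Longrightarrow> nm i (z i) = 0"
  using nm_eq_0 cvs_zero[OF vs] by blast

lemma nm_neg: "good i \<Longrightarrow> x \<in> V i \<Longrightarrow> nm i (ng i x) = nm i x"
  by (simp add: cvs_neg_smul[OF vs] nm_smul)

lemma fam_zero: "fam z \<in> Fam"
  by (rule FamI[where B=0]) (auto simp: nm_zero cvs_zero[OF vs])

lemma fam_add: "f \<in> Fam \<Longrightarrow> g \<in> Fam \<Longrightarrow> fam (\<lambda>i. ad i (f i) (g i)) \<in> Fam"
  by (rule FamI[where B="nF f + nF g"])
    (auto intro!: order_trans[OF nm_tri] add_mono nF_upper simp: FamD cvs_add[OF vs])

lemma fam_smul: "f \<in> Fam \<Longrightarrow> fam (\<lambda>i. sm i c (f i)) \<in> Fam"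
  by (rule FamI[where B="cmod c * nF f"])
    (auto intro!: mult_left_mono nF_upper simp: nm_smul FamD cvs_smul[OF vs])

lemma fam_neg: "f \<in> Fam \<Longrightarrow> fam (\<lambda>i. ng i (f i)) \<in> Fam"
  by (rule FamI[where B="nF f"]) (auto intro!: nF_upper simp: nm_neg FamD cvs_neg[OF vs])

lemma nF_add: "f \<in> Fam \<Longrightarrow> g \<in> Fam \<Longrightarrow> nF (fam (\<lambda>i. ad i (f i) (g i))) \<le> nF f + nF g"
  by (rule nF_least)
    (auto intro!: order_trans[OF nm_tri] add_mono nF_upper add_nonneg_nonneg nF_nonneg simp: FamD)

lemma nF_smul:
  assumes "f \<in> Fam" shows "nF (fam (\<lambda>i. sm i c (f i))) = cmod c * nF f"
proof (rule antisym)
  show "nF (fam (\<lambda>i. sm i c (f i))) \<le> cmod c * nF f"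
    using assms by (intro nF_least)
      (auto simp: nm_smul FamD intro!: mult_left_mono nF_upper nF_nonneg mult_nonneg_nonneg)
  show "cmod c * nF f \<le> nF (fam (\<lambda>i. sm i c (f i)))" (is "_ \<le> ?R")
  proof (cases "c = 0")
    case True
    then show ?thesis using nF_nonneg[OF fam_smul[OF assms]] by simp
  next
    case False
    have "nF f \<le> ?R / cmod c"
    proof (rule nF_least)
      show "0 \<le> ?R / cmod c" using nF_nonneg[OF fam_smul[OF assms]] by simp
      fix i assume "good i"
      then show "nm i (f i) \<le> ?R / cmod c"
        using nF_upper[OF fam_smul[OF assms, of c], of i] False assms
        by (simp add: nm_smul FamD field_simps)
    qed
    then show ?thesis using False by (simp add: field_simps)
  qed
qed

lemma nF_eq_0: "f \<in> Fam \<Longrightarrow> nF f = 0 \<longleftrightarrow> f = fam z"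
proof
  assume f: "f \<in> Fam" "nF f = 0"
  show "f = fam z"
  proof (rule Fam_eqI[OF f(1) fam_zero])
    fix i assume i: "good i"
    then have "nm i (f i) = 0" using nF_upper[OF f(1) i] nm_nonneg[OF i FamD[OF f(1) i]] f(2) by simp
    then show "f i = fam z i" using i nm_eq_0 FamD[OF f(1)] by simp
  qed
next
  assume "f \<in> Fam" "f = fam z"
  then have "nF f \<le> 0" by (intro nF_least) (auto simp: nm_zero)
  then show "nF f = 0" using nF_nonneg \<open>f \<in> Fam\<close> by (simp add: order_antisym)
qed

lemma Fam_complete:
  fixes X :: "nat \<Rightarrow> 'i \<Rightarrow> 'v"
  assumes X: "\<And>n. X n \<in> Fam"
    and C: "\<And>e. e > 0 \<Longrightarrow> \<exists>K. \<forall>m\<ge>K. \<forall>n\<ge>K. nF (fam (\<lambda>i. ad i (X m i) (ng i (X n i)))) < e"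
  shows "\<exists>L\<in>Fam. \<forall>e>0. \<exists>K. \<forall>n\<ge>K. nF (fam (\<lambda>i. ad i (X n i) (ng i (L i)))) \<le> e"
proof -
  have mem: "fam (\<lambda>i. ad i (X m i) (ng i (X n i))) \<in> Fam" for m n
  proof -
    have "fam (\<lambda>i. ad i (X m i) (fam (\<lambda>i. ng i (X n i)) i)) \<in> Fam"
      by (rule fam_add[OF X fam_neg[OF X]])
    then show ?thesis by (simp add: fam_def if_distrib cong: if_cong)
  qed
  have pt: "nm i (ad i (X m i) (ng i (X n i))) \<le> nF (fam (\<lambda>i. ad i (X m i) (ng i (X n i))))"
    if "good i" for i m n
    using nF_upper[OF mem that, of m n] that by simp
  have "\<exists>l\<in>V i. (\<lambda>n. nm i (ad i (X n i) (ng i l))) \<longlonglongrightarrow> 0" if i: "good i" for i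
  proof -
    have "\<forall>n. X n i \<in> V i" using FamD[OF X i] by blast
    moreover have "\<forall>e>0. \<exists>K. \<forall>m\<ge>K. \<forall>n\<ge>K. nm i (ad i (X m i) (ng i (X n i))) < e"
      using C pt[OF i] by (meson le_less_trans)
    ultimately show ?thesis
      using compl[OF i, unfolded complete_wrt_def, rule_format, of "\<lambda>n. X n i"] by simp
  qed
  then obtain l where l: "\<And>i. good i \<Longrightarrow> l i \<in> V i"
      "\<And>i. good i \<Longrightarrow> (\<lambda>n. nm i (ad i (X n i) (ng i (l i)))) \<longlonglongrightarrow> 0"
    by metis
  \<comment> \<open>The second argument of the Cauchy estimate is sent to its limit.
    \<open>K\<close> is independent of the coordinate, so the resulting bound is uniform.\<close>
  have close: "nm i (ad i (X n i) (ng i (l i))) \<le> e"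
    if i: "good i" and K: "\<And>m n. m \<ge> K \<Longrightarrow> n \<ge> K \<Longrightarrow> nF (fam (\<lambda>i. ad i (X m i) (ng i (X n i)))) < e"
      and n: "n \<ge> K" for i n K e
  proof (rule LIMSEQ_le_const[where X="\<lambda>m. e + nm i (ad i (X m i) (ng i (l i)))"])
    show "(\<lambda>m. e + nm i (ad i (X m i) (ng i (l i)))) \<longlonglongrightarrow> e"
      using tendsto_add[OF tendsto_const l(2)[OF i], of e] by simp
    show "\<exists>N. \<forall>m\<ge>N. nm i (ad i (X n i) (ng i (l i))) \<le> e + nm i (ad i (X m i) (ng i (l i)))"
    proof (intro exI[of _ K] allI impI)
      fix m assume m: "m \<ge> K"
      note v = FamD[OF X i, of n] FamD[OF X i, of m] l(1)[OF i]
      note c = cvs_facts[OF vs[OF i]]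
      let ?a = "ad i (X n i) (ng i (X m i))" and ?b = "ad i (X m i) (ng i (l i))"
      have "ad i ?a ?b = ad i (X n i) (ad i (ng i (X m i)) (ad i (X m i) (ng i (l i))))"
        using v by (simp add: c(1-5))
      also have "ad i (ng i (X m i)) (ad i (X m i) (ng i (l i))) = ng i (l i)"
        using v by (simp add: c(5)[symmetric] c(1-4) c(8) c(7))
      finally have "nm i (ad i (X n i) (ng i (l i))) \<le> nm i ?a + nm i ?b"
        using nm_tri[OF i, of ?a ?b] v c(1-4) by simp
      also have "nm i ?a \<le> e" using pt[OF i, of n m] K[OF n m] by simp
      finally show "nm i (ad i (X n i) (ng i (l i))) \<le> e + nm i ?b" by simp
    qed
  qed
  have L: "fam l \<in> Fam"
  proof -
    obtain K where K: "\<And>m n. m \<ge> K \<Longrightarrow> n \<ge> K \<Longrightarrow> nF (fam (\<lambda>i. ad i (X m i) (ng i (X n i)))) < 1"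
      using C[of 1] by auto
    show ?thesis
    proof (rule FamI[where B="nF (X K) + 1"])
      fix i assume i: "good i"
      then show "l i \<in> V i" by (rule l)
      note v = FamD[OF X i, of K] l(1)[OF i]
      note c = cvs_facts[OF vs[OF i]]
      let ?b = "ad i (X K i) (ng i (l i))"
      have "ad i (ng i (X K i)) ?b = ng i (l i)"
        using v by (simp add: c(5)[symmetric] c(1-4) c(8) c(7))
      then have "nm i (l i) \<le> nm i (ng i (X K i)) + nm i ?b"
        using nm_tri[OF i, of "ng i (X K i)" ?b] nm_neg[OF i v(2)] v c(1-4) by simp
      also have "nm i ?b \<le> 1" using close[OF i K] by simp
      finally show "nm i (l i) \<le> nF (X K) + 1"
        using nm_neg[OF i v(1)] nF_upper[OF X i, of K] by simp
    qed
  qed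
  show ?thesis
  proof (intro bexI[OF _ L] allI impI)
    fix e :: real assume e: "e > 0"
    then obtain K where K: "\<And>m n. m \<ge> K \<Longrightarrow> n \<ge> K \<Longrightarrow> nF (fam (\<lambda>i. ad i (X m i) (ng i (X n i)))) < e"
      using C by blast
    show "\<exists>K. \<forall>n\<ge>K. nF (fam (\<lambda>i. ad i (X n i) (ng i (fam l i)))) \<le> e"
      using e by (intro exI[of _ K] allI impI nF_least) (auto intro!: close[OF _ K])
  qed
qed

definition single :: "'i \<Rightarrow> 'v \<Rightarrow> 'i \<Rightarrow> 'v" where
  "single p x = fam (\<lambda>i. if i = p then x else z i)"

lemma single_mem: "good p \<Longrightarrow> x \<in> V p \<Longrightarrow> single p x \<in> Fam"
  unfolding single_def
  by (rule FamI[where B="nm p x"]) (auto simp: nm_zero cvs_zero[OF vs] nm_nonneg)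

lemma nF_single: "good p \<Longrightarrow> x \<in> V p \<Longrightarrow> nF (single p x) = nm p x"
proof (rule antisym)
  assume *: "good p" "x \<in> V p"
  show "nF (single p x) \<le> nm p x"
    using * by (intro nF_least) (auto simp: single_def nm_zero nm_nonneg)
  show "nm p x \<le> nF (single p x)"
    using nF_upper[OF single_mem[OF *] *(1)] * by (simp add: single_def)
qed

end

subsection \<open>The type of bounded families over all C*-algebras\<close>

lemma cstar_axioms:
  assumes "cstar_algebra A"
  shows cs_cvs: "cvs (cs_carrier A) (cs_zero A) (cs_add A) (cs_neg A) (cs_smul A)"
    and "\<forall>a\<in>cs_carrier A. \<forall>b\<in>cs_carrier A. cs_mult A a b \<in> cs_carrier A"
    and "\<forall>a\<in>cs_carrier A. cs_star A a \<in> cs_carrier A"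
    and "\<forall>a\<in>cs_carrier A. \<forall>b\<in>cs_carrier A. \<forall>c\<in>cs_carrier A.
      cs_mult A (cs_mult A a b) c = cs_mult A a (cs_mult A b c)"
    and "\<forall>a\<in>cs_carrier A. \<forall>b\<in>cs_carrier A. \<forall>c\<in>cs_carrier A.
      cs_mult A a (cs_add A b c) = cs_add A (cs_mult A a b) (cs_mult A a c)"
    and "\<forall>a\<in>cs_carrier A. \<forall>b\<in>cs_carrier A. \<forall>c\<in>cs_carrier A.
      cs_mult A (cs_add A a b) c = cs_add A (cs_mult A a c) (cs_mult A b c)"
    and "\<forall>z. \<forall>a\<in>cs_carrier A. \<forall>b\<in>cs_carrier A.
      cs_smul A z (cs_mult A a b) = cs_mult A (cs_smul A z a) b \<and>
      cs_smul A z (cs_mult A a b) = cs_mult A a (cs_smul A z b)"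
    and "\<forall>a\<in>cs_carrier A. cs_star A (cs_star A a) = a"
    and "\<forall>a\<in>cs_carrier A. \<forall>b\<in>cs_carrier A. cs_star A (cs_add A a b) = cs_add A (cs_star A a) (cs_star A b)"
    and "\<forall>z. \<forall>a\<in>cs_carrier A. cs_star A (cs_smul A z a) = cs_smul A (cnj z) (cs_star A a)"
    and "\<forall>a\<in>cs_carrier A. \<forall>b\<in>cs_carrier A. cs_star A (cs_mult A a b) = cs_mult A (cs_star A b) (cs_star A a)"
    and "\<forall>a\<in>cs_carrier A. cs_norm A a \<ge> 0"
    and "\<forall>a\<in>cs_carrier A. cs_norm A a = 0 \<longleftrightarrow> a = cs_zero A"
    and "\<forall>a\<in>cs_carrier A. \<forall>b\<in>cs_carrier A. cs_norm A (cs_add A a b) \<le> cs_norm A a + cs_norm A b"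
    and "\<forall>z. \<forall>a\<in>cs_carrier A. cs_norm A (cs_smul A z a) = cmod z * cs_norm A a"
    and "\<forall>a\<in>cs_carrier A. \<forall>b\<in>cs_carrier A. cs_norm A (cs_mult A a b) \<le> cs_norm A a * cs_norm A b"
    and "\<forall>a\<in>cs_carrier A. cs_norm A (cs_mult A (cs_star A a) a) = (cs_norm A a)\<^sup>2"
    and cs_complete: "complete_wrt (cs_carrier A) (cs_dist A)"
  using assms unfolding cstar_algebra_def Let_def by - (elim conjE, assumption)+

lemmas cstar_facts = cstar_axioms[rule_format]
lemmas cs_mult_closed = cstar_facts(2)
  and cs_star_closed = cstar_facts(3)
  and cs_mult_assoc = cstar_facts(4)
  and cs_distrib_left = cstar_facts(5)
  and cs_distrib_right = cstar_facts(6)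
  and cs_smul_mult_left = cstar_facts(7)[THEN conjunct1]
  and cs_smul_mult_right = cstar_facts(7)[THEN conjunct2]
  and cs_star_star = cstar_facts(8)
  and cs_star_add = cstar_facts(9)
  and cs_star_smul = cstar_facts(10)
  and cs_star_mult = cstar_facts(11)
  and cs_norm_nonneg = cstar_facts(12)
  and cs_norm_eq_0 = cstar_facts(13)
  and cs_norm_tri = cstar_facts(14)
  and cs_norm_smul = cstar_facts(15)
  and cs_norm_mult = cstar_facts(16)
  and cs_norm_star_mult = cstar_facts(17)

lemma cs_norm_star_le:
  assumes A: "cstar_algebra A" and a: "a \<in> cs_carrier A"
  shows "cs_norm A (cs_star A a) \<le> cs_norm A a"
proof (rule le_of_square_le_mult)
  note b = cs_star_closed[OF A a]
  show "(cs_norm A (cs_star A a))\<^sup>2 \<le> cs_norm A a * cs_norm A (cs_star A a)"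
    using cs_norm_star_mult[OF A b] cs_norm_mult[OF A a b] cs_star_star[OF A a] by simp
qed (rule cs_norm_nonneg[OF A a] cs_norm_nonneg[OF A cs_star_closed[OF A a]])+

lemmas cs_vs = cvs_facts[OF cs_cvs]
lemmas cs_closed = cs_vs(1-4) cs_mult_closed cs_star_closed

interpretation elF: bfam "\<lambda>p::'a cs_alg \<times> 'h. cstar_algebra (fst p)" "\<lambda>p. cs_carrier (fst p)"
  "\<lambda>p. cs_zero (fst p)" "\<lambda>p. cs_add (fst p)" "\<lambda>p. cs_neg (fst p)" "\<lambda>p. cs_smul (fst p)"
  "\<lambda>p. cs_norm (fst p)"
proof
  fix p :: "'a cs_alg \<times> 'h"
  assume "cstar_algebra (fst p)"
  then show "complete_wrt (cs_carrier (fst p))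
      (\<lambda>x y. cs_norm (fst p) (cs_add (fst p) x (cs_neg (fst p) y)))"
    using cs_complete[of "fst p"] by (simp add: cs_dist_def[abs_def])
qed (simp_all add: cs_cvs cs_norm_nonneg cs_norm_eq_0 cs_norm_tri cs_norm_smul)

text \<open>The carrier of an algebra cannot become a type inside a proof, so all C*-algebras on \<open>'a\<close> are packed
  into one: each of them is a coordinate of their product. The parameter \<open>'h\<close> only enlarges the index set, to
  match that of the Hilbert modules below.\<close>

typedef ('a, 'h) el = "elF.Fam :: ('a cs_alg \<times> 'h \<Rightarrow> 'a) set"
  morphisms el_at Abs_el
  using elF.fam_zero by blast

setup_lifting type_definition_el

lemma el_at_mem: "cstar_algebra (fst p) \<Longrightarrow> el_at x p \<in> cs_carrier (fst p)"
  using el_at[of x] by (rule elF.FamD)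

lemma el_eqI: "(\<And>p. cstar_algebra (fst p) \<Longrightarrow> el_at x p = el_at y p) \<Longrightarrow> x = y"
  using el_at_inject elF.Fam_eqI[OF el_at el_at] by blast

instantiation el :: (type, type) real_vector
begin
lift_definition zero_el :: "('a, 'b) el" is "elF.fam (\<lambda>p. cs_zero (fst p))" by (rule elF.fam_zero)
lift_definition plus_el :: "('a, 'b) el \<Rightarrow> ('a, 'b) el \<Rightarrow> ('a, 'b) el" is
  "\<lambda>f g. elF.fam (\<lambda>p. cs_add (fst p) (f p) (g p))" by (rule elF.fam_add)
lift_definition uminus_el :: "('a, 'b) el \<Rightarrow> ('a, 'b) el" is
  "\<lambda>f. elF.fam (\<lambda>p. cs_neg (fst p) (f p))" by (rule elF.fam_neg)
definition minus_el :: "('a, 'b) el \<Rightarrow> ('a, 'b) el \<Rightarrow> ('a, 'b) el" where "minus_el x y = x + - y"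
lift_definition scaleR_el :: "real \<Rightarrow> ('a, 'b) el \<Rightarrow> ('a, 'b) el" is
  "\<lambda>r f. elF.fam (\<lambda>p. cs_smul (fst p) (of_real r) (f p))" by (rule elF.fam_smul)
instance
proof
  fix a b c :: "('a, 'b) el" and r s :: real
  note [simp] = zero_el.rep_eq plus_el.rep_eq uminus_el.rep_eq scaleR_el.rep_eq
    el_at_mem cs_closed
  show "a + b + c = a + (b + c)" by (rule el_eqI) (simp add: cs_vs(5))
  show "a + b = b + a" by (rule el_eqI) (simp add: cs_vs(6)[OF _ el_at_mem el_at_mem])
  show "0 + a = a" by (rule el_eqI) (simp add: cs_vs(7))
  show "- a + a = 0" by (rule el_eqI) (simp add: cs_vs(8))
  show "a - b = a + - b" by (rule minus_el_def)
  show "r *\<^sub>R (a + b) = r *\<^sub>R a + r *\<^sub>R b" by (rule el_eqI) (simp add: cs_vs(9))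
  show "(r + s) *\<^sub>R a = r *\<^sub>R a + s *\<^sub>R a" by (rule el_eqI) (simp add: cs_vs(10))
  show "r *\<^sub>R s *\<^sub>R a = (r * s) *\<^sub>R a" by (rule el_eqI) (simp add: cs_vs(11))
  show "1 *\<^sub>R a = a" by (rule el_eqI) (simp add: cs_vs(12))
qed
end

instantiation el :: (type, type) real_normed_vector
begin
lift_definition norm_el :: "('a, 'b) el \<Rightarrow> real" is elF.nF .
definition dist_el :: "('a, 'b) el \<Rightarrow> ('a, 'b) el \<Rightarrow> real" where "dist_el x y = norm (x - y)"
definition sgn_el :: "('a, 'b) el \<Rightarrow> ('a, 'b) el" where "sgn_el x = x /\<^sub>R norm x"
definition uniformity_el :: "(('a, 'b) el \<times> ('a, 'b) el) filter"
  where "uniformity_el = (INF e\<in>{0<..}. principal {(x, y). dist x y < e})"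
definition open_el :: "('a, 'b) el set \<Rightarrow> bool"
  where "open_el U = (\<forall>x\<in>U. eventually (\<lambda>(x', y). x' = x \<longrightarrow> y \<in> U) uniformity)"
instance
proof
  fix x y :: "('a, 'b) el" and r :: real
  show "norm x = 0 \<longleftrightarrow> x = 0" by transfer (rule elF.nF_eq_0)
  show "norm (x + y) \<le> norm x + norm y" by transfer (rule elF.nF_add)
  show "norm (r *\<^sub>R x) = \<bar>r\<bar> * norm x" by transfer (simp add: elF.nF_smul)
qed (rule dist_el_def sgn_el_def uniformity_el_def open_el_def[unfolded atomize_eq])+
end

lemma norm_el_at: "cstar_algebra (fst p) \<Longrightarrow> cs_norm (fst p) (el_at x p) \<le> norm x"
  by transfer (rule elF.nF_upper)

lemma norm_el_le:
  "0 \<le> B \<Longrightarrow> (\<And>p. cstar_algebra (fst p) \<Longrightarrow> cs_norm (fst p) (el_at x p) \<le> B) \<Longrightarrow> norm x \<le> B"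
  by transfer (rule elF.nF_least)

instance el :: (type, type) banach
proof
  fix X :: "nat \<Rightarrow> ('a, 'b) el"
  assume C: "Cauchy X"
  have df: "norm (x - y) = elF.nF (elF.fam (\<lambda>p. cs_add (fst p) (el_at x p) (cs_neg (fst p) (el_at y p))))"
    for x y :: "('a, 'b) el"
    unfolding norm_el.rep_eq minus_el_def
    by (rule elF.nF_cong) (simp add: plus_el.rep_eq uminus_el.rep_eq del: add_uminus_conv_diff)
  have "\<exists>L\<in>elF.Fam. \<forall>e>0. \<exists>K. \<forall>n\<ge>K.
      elF.nF (elF.fam (\<lambda>p. cs_add (fst p) (el_at (X n) p) (cs_neg (fst p) (L p)))) \<le> e"
  proof (rule elF.Fam_complete[where X="\<lambda>n. el_at (X n)"])
    show "\<exists>K. \<forall>m\<ge>K. \<forall>n\<ge>K.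
        elF.nF (elF.fam (\<lambda>p. cs_add (fst p) (el_at (X m) p) (cs_neg (fst p) (el_at (X n) p)))) < e"
      if "e > 0" for e
      unfolding df[symmetric] using C that by (simp add: Cauchy_def dist_norm)
  qed (rule el_at)
  then obtain L where L: "L \<in> elF.Fam" "\<forall>e>0. \<exists>K. \<forall>n\<ge>K.
      elF.nF (elF.fam (\<lambda>p. cs_add (fst p) (el_at (X n) p) (cs_neg (fst p) (L p)))) \<le> e"
    by (rule bexE)
  have "X \<longlonglongrightarrow> Abs_el L"
  proof (rule LIMSEQ_I)
    fix e :: real assume "e > 0"
    then obtain K where K: "\<forall>n\<ge>K.
        elF.nF (elF.fam (\<lambda>p. cs_add (fst p) (el_at (X n) p) (cs_neg (fst p) (L p)))) \<le> e / 2"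
      using L(2)[rule_format, of "e / 2"] by auto
    have "norm (X n - Abs_el L) < e" if "n \<ge> K" for n
    proof -
      have "norm (X n - Abs_el L) \<le> e / 2"
        unfolding df Abs_el_inverse[OF L(1)] using K that by blast
      then show ?thesis using \<open>e > 0\<close> by simp
    qed
    then show "\<exists>K. \<forall>n\<ge>K. norm (X n - Abs_el L) < e" by blast
  qed
  then show "convergent X" by (auto simp: convergent_def)
qed

instantiation el :: (type, type) cstar
begin
lift_definition times_el :: "('a, 'b) el \<Rightarrow> ('a, 'b) el \<Rightarrow> ('a, 'b) el" is
  "\<lambda>f g. elF.fam (\<lambda>p. cs_mult (fst p) (f p) (g p))"
  subgoal for f g
    by (rule elF.FamI[where B="elF.nF f * elF.nF g"])
      (simp_all add: cs_closed elF.FamD order_trans[OF cs_norm_mult mult_mono] elF.nF_upper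
        elF.nF_nonneg cs_norm_nonneg)
  done
lift_definition star_el :: "('a, 'b) el \<Rightarrow> ('a, 'b) el" is
  "\<lambda>f. elF.fam (\<lambda>p. cs_star (fst p) (f p))"
  subgoal for f
    by (rule elF.FamI[where B="elF.nF f"])
      (simp_all add: cs_closed elF.FamD order_trans[OF cs_norm_star_le] elF.nF_upper)
  done
lift_definition mulI_el :: "('a, 'b) el \<Rightarrow> ('a, 'b) el" is
  "\<lambda>f. elF.fam (\<lambda>p. cs_smul (fst p) \<i> (f p))" by (rule elF.fam_smul)
instance
proof
  fix a b c :: "('a, 'b) el" and r s :: real
  note [simp] = zero_el.rep_eq plus_el.rep_eq uminus_el.rep_eq scaleR_el.rep_eq times_el.rep_eq
    star_el.rep_eq mulI_el.rep_eq el_at_mem cs_closed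
  show "a * b * c = a * (b * c)" by (rule el_eqI) (simp add: cs_mult_assoc)
  show "(a + b) * c = a * c + b * c" by (rule el_eqI) (simp add: cs_distrib_right)
  show "a * (b + c) = a * b + a * c" by (rule el_eqI) (simp add: cs_distrib_left)
  show "r *\<^sub>R a * b = r *\<^sub>R (a * b)"
    by (rule el_eqI) (simp add: cs_smul_mult_left)
  show "a * r *\<^sub>R b = r *\<^sub>R (a * b)"
    by (rule el_eqI) (simp add: cs_smul_mult_right)
  show "norm (a * b) \<le> norm a * norm b"
    by (rule norm_el_le)
      (simp_all add: order_trans[OF cs_norm_mult mult_mono] norm_el_at cs_norm_nonneg)
  show "star (star a) = a" by (rule el_eqI) (simp add: cs_star_star)
  show "star (a + b) = star a + star b" by (rule el_eqI) (simp add: cs_star_add)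
  show "star (r *\<^sub>R a) = r *\<^sub>R star a" by (rule el_eqI) (simp add: cs_star_smul)
  show "star (a * b) = star b * star a" by (rule el_eqI) (simp add: cs_star_mult)
  show "norm (star a * a) = (norm a)\<^sup>2"
  proof (rule antisym)
    show "norm (star a * a) \<le> (norm a)\<^sup>2"
      by (rule norm_el_le) (simp_all add: cs_norm_star_mult power_mono norm_el_at cs_norm_nonneg)
    have "norm a \<le> sqrt (norm (star a * a))"
    proof (rule norm_el_le)
      fix p :: "'a cs_alg \<times> 'b" assume p: "cstar_algebra (fst p)"
      have "(cs_norm (fst p) (el_at a p))\<^sup>2 \<le> norm (star a * a)"
        using norm_el_at[OF p, of "star a * a"] p by (simp add: cs_norm_star_mult)
      then show "cs_norm (fst p) (el_at a p) \<le> sqrt (norm (star a * a))"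
        by (rule real_le_rsqrt)
    qed simp
    from power_mono[OF this norm_ge_zero, of 2] show "(norm a)\<^sup>2 \<le> norm (star a * a)" by simp
  qed
  show "mulI (a + b) = mulI a + mulI b" by (rule el_eqI) (simp add: cs_vs(9))
  show "mulI (mulI a) = - a"
    by (rule el_eqI) (simp add: cs_vs(11) cvs_neg_smul[OF cs_cvs])
  show "star (mulI a) = - mulI (star a)"
    by (rule el_eqI) (simp add: cs_star_smul cs_vs(11) cvs_neg_smul[OF cs_cvs])
  show "a * mulI b = mulI (a * b)" by (rule el_eqI) (simp add: cs_smul_mult_right)
  show "mulI a * b = mulI (a * b)" by (rule el_eqI) (simp add: cs_smul_mult_left)
  show "norm (mulI a) = norm a"
    unfolding norm_el.rep_eq by (rule elF.nF_cong) (simp add: cs_norm_smul)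
qed
end

text \<open>Placement in the single coordinate \<open>p\<close>. Anything outside the carrier goes
  to the zero family, merely to make the map total.\<close>

lift_definition emb :: "'a cs_alg \<times> 'h \<Rightarrow> 'a \<Rightarrow> ('a, 'h) el" is
  "\<lambda>p a. if cstar_algebra (fst p) \<and> a \<in> cs_carrier (fst p) then elF.single p a
     else elF.fam (\<lambda>p. cs_zero (fst p))"
  by (auto intro: elF.single_mem elF.fam_zero)

lemma el_at_emb:
  assumes "cstar_algebra (fst p)" "a \<in> cs_carrier (fst p)" "cstar_algebra (fst q)"
  shows "el_at (emb p a) q = (if q = p then a else cs_zero (fst q))"
  using assms by (simp add: emb.rep_eq elF.single_def)

lemma emb_at: "cstar_algebra (fst p) \<Longrightarrow> a \<in> cs_carrier (fst p) \<Longrightarrow> el_at (emb p a) p = a"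
  by (simp add: el_at_emb)

lemma norm_emb: "cstar_algebra (fst p) \<Longrightarrow> a \<in> cs_carrier (fst p) \<Longrightarrow> norm (emb p a) = cs_norm (fst p) a"
  by (simp add: norm_el.rep_eq emb.rep_eq elF.nF_single)

lemma cs_star_zero:
  assumes A: "cstar_algebra A" shows "cs_star A (cs_zero A) = cs_zero A"
  using cs_star_smul[OF A cs_closed(1)[OF A], of 0] cvs_smul_0[OF cs_cvs[OF A]]
    cs_closed(1,6)[OF A] by simp

lemma cs_mult_zero:
  assumes "cstar_algebra A" shows "cs_mult A (cs_zero A) (cs_zero A) = cs_zero A"
  using cs_smul_mult_left[OF assms, of "cs_zero A" "cs_zero A" 0] cvs_smul_0[OF cs_cvs[OF assms]]
    cs_closed(1,5)[OF assms] by simp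

context
  fixes p :: "'a cs_alg \<times> 'h" and a :: 'a
  assumes p: "cstar_algebra (fst p)" and a: "a \<in> cs_carrier (fst p)"
begin

lemma emb_add: "b \<in> cs_carrier (fst p) \<Longrightarrow> emb p (cs_add (fst p) a b) = emb p a + emb p b"
  using p a by (intro el_eqI) (simp add: el_at_emb cs_closed plus_el.rep_eq cs_vs(7))

lemma emb_neg: "emb p (cs_neg (fst p) a) = - emb p a"
  using p a by (intro el_eqI) (simp add: el_at_emb cs_closed uminus_el.rep_eq cvs_neg_zero[OF cs_cvs])

lemma emb_mult: "b \<in> cs_carrier (fst p) \<Longrightarrow> emb p (cs_mult (fst p) a b) = emb p a * emb p b"
  using p a by (intro el_eqI) (simp add: el_at_emb cs_closed times_el.rep_eq cs_mult_zero)

lemma emb_star: "emb p (cs_star (fst p) a) = star (emb p a)"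
  using p a by (intro el_eqI) (simp add: el_at_emb cs_closed star_el.rep_eq cs_star_zero)

lemma emb_smul_real: "emb p (cs_smul (fst p) (of_real r) a) = r *\<^sub>R emb p a"
  using p a by (intro el_eqI) (simp add: el_at_emb cs_closed scaleR_el.rep_eq cvs_smul_zero[OF cs_cvs])

lemma emb_inject:
  assumes b: "b \<in> cs_carrier (fst p)" shows "emb p a = emb p b \<longleftrightarrow> a = b"
proof
  assume "emb p a = emb p b"
  then have "el_at (emb p a) p = el_at (emb p b) p" by (rule arg_cong)
  then show "a = b" by (simp only: emb_at[OF p a] emb_at[OF p b])
qed simp

lemma emb_eq_0: "emb p a = 0 \<longleftrightarrow> a = cs_zero (fst p)"
  by (simp only: norm_eq_zero[of "emb p a", symmetric] norm_emb[OF p a] cs_norm_eq_0[OF p a])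

end

subsection \<open>The type of bounded families over all Hilbert modules\<close>

text \<open>Positivity of \<open>\<langle>x,x\<rangle>\<close> is relaxed to a sum of two squares, which is visibly inherited by direct sums.\<close>

definition pre_hilb :: "'a cs_alg \<Rightarrow> ('v, 'a) hmod \<Rightarrow> bool" where
  "pre_hilb A H \<longleftrightarrow>
     cvs (hm_carrier H) (hm_zero H) (hm_add H) (hm_neg H) (hm_smul H) \<and>
     (\<forall>x\<in>hm_carrier H. \<forall>a\<in>cs_carrier A. hm_act H x a \<in> hm_carrier H) \<and>
     (\<forall>x\<in>hm_carrier H. \<forall>y\<in>hm_carrier H. hm_inner H x y \<in> cs_carrier A) \<and>
     (\<forall>x\<in>hm_carrier H. \<forall>y\<in>hm_carrier H. \<forall>w\<in>hm_carrier H.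
        hm_inner H x (hm_add H y w) = cs_add A (hm_inner H x y) (hm_inner H x w)) \<and>
     (\<forall>z. \<forall>x\<in>hm_carrier H. \<forall>y\<in>hm_carrier H.
        hm_inner H x (hm_smul H z y) = cs_smul A z (hm_inner H x y)) \<and>
     (\<forall>x\<in>hm_carrier H. \<forall>y\<in>hm_carrier H. \<forall>a\<in>cs_carrier A.
        hm_inner H x (hm_act H y a) = cs_mult A (hm_inner H x y) a) \<and>
     (\<forall>x\<in>hm_carrier H. \<forall>y\<in>hm_carrier H. hm_inner H y x = cs_star A (hm_inner H x y)) \<and>
     (\<forall>x\<in>hm_carrier H. \<exists>b\<in>cs_carrier A. \<exists>c\<in>cs_carrier A.
        hm_inner H x x = cs_add A (cs_mult A (cs_star A b) b) (cs_mult A (cs_star A c) c)) \<and>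
     (\<forall>x\<in>hm_carrier H. hm_inner H x x = cs_zero A \<longrightarrow> x = hm_zero H) \<and>
     complete_wrt (hm_carrier H) (hm_dist A H)"

lemma pre_hilb_axioms:
  assumes "pre_hilb A H"
  shows hm_cvs: "cvs (hm_carrier H) (hm_zero H) (hm_add H) (hm_neg H) (hm_smul H)"
    and "\<forall>x\<in>hm_carrier H. \<forall>a\<in>cs_carrier A. hm_act H x a \<in> hm_carrier H"
    and "\<forall>x\<in>hm_carrier H. \<forall>y\<in>hm_carrier H. hm_inner H x y \<in> cs_carrier A"
    and "\<forall>x\<in>hm_carrier H. \<forall>y\<in>hm_carrier H. \<forall>w\<in>hm_carrier H.
        hm_inner H x (hm_add H y w) = cs_add A (hm_inner H x y) (hm_inner H x w)"
    and "\<forall>z. \<forall>x\<in>hm_carrier H. \<forall>y\<in>hm_carrier H.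
        hm_inner H x (hm_smul H z y) = cs_smul A z (hm_inner H x y)"
    and "\<forall>x\<in>hm_carrier H. \<forall>y\<in>hm_carrier H. \<forall>a\<in>cs_carrier A.
        hm_inner H x (hm_act H y a) = cs_mult A (hm_inner H x y) a"
    and "\<forall>x\<in>hm_carrier H. \<forall>y\<in>hm_carrier H. hm_inner H y x = cs_star A (hm_inner H x y)"
    and hm_pos: "\<forall>x\<in>hm_carrier H. \<exists>b\<in>cs_carrier A. \<exists>c\<in>cs_carrier A.
        hm_inner H x x = cs_add A (cs_mult A (cs_star A b) b) (cs_mult A (cs_star A c) c)"
    and "\<forall>x\<in>hm_carrier H. hm_inner H x x = cs_zero A \<longrightarrow> x = hm_zero H"
    and hm_complete: "complete_wrt (hm_carrier H) (hm_dist A H)"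
  using assms unfolding pre_hilb_def by - (elim conjE, assumption)+

lemmas hm_vs = cvs_facts[OF hm_cvs]
lemmas hm_act_closed = pre_hilb_axioms(2)[rule_format]
  and hm_inner_closed = pre_hilb_axioms(3)[rule_format]
  and hm_inner_add = pre_hilb_axioms(4)[rule_format]
  and hm_inner_smul = pre_hilb_axioms(5)[rule_format]
  and hm_inner_act = pre_hilb_axioms(6)[rule_format]
  and hm_inner_star = pre_hilb_axioms(7)[rule_format]
  and hm_definite = pre_hilb_axioms(9)[rule_format]

lemma hilbert_axioms:
  assumes "hilbert_module A H"
  shows "cvs (hm_carrier H) (hm_zero H) (hm_add H) (hm_neg H) (hm_smul H)"
    and "\<forall>x\<in>hm_carrier H. \<forall>a\<in>cs_carrier A. hm_act H x a \<in> hm_carrier H"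
    and "\<forall>x\<in>hm_carrier H. \<forall>y\<in>hm_carrier H. hm_inner H x y \<in> cs_carrier A"
    and "\<forall>x\<in>hm_carrier H. \<forall>y\<in>hm_carrier H. \<forall>w\<in>hm_carrier H.
        hm_inner H x (hm_add H y w) = cs_add A (hm_inner H x y) (hm_inner H x w)"
    and "\<forall>z. \<forall>x\<in>hm_carrier H. \<forall>y\<in>hm_carrier H.
        hm_inner H x (hm_smul H z y) = cs_smul A z (hm_inner H x y)"
    and "\<forall>x\<in>hm_carrier H. \<forall>y\<in>hm_carrier H. \<forall>a\<in>cs_carrier A.
        hm_inner H x (hm_act H y a) = cs_mult A (hm_inner H x y) a"
    and "\<forall>x\<in>hm_carrier H. \<forall>y\<in>hm_carrier H. hm_inner H y x = cs_star A (hm_inner H x y)"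
    and "\<forall>x\<in>hm_carrier H. cs_pos A (hm_inner H x x)"
    and "\<forall>x\<in>hm_carrier H. hm_inner H x x = cs_zero A \<longrightarrow> x = hm_zero H"
    and "complete_wrt (hm_carrier H) (hm_dist A H)"
  using assms unfolding hilbert_module_def Let_def by - (elim conjE, assumption)+

lemma hilbert_pre_hilb:
  assumes A: "cstar_algebra A" and H: "hilbert_module A H"
  shows "pre_hilb A H"
proof -
  have "\<exists>b\<in>cs_carrier A. \<exists>c\<in>cs_carrier A.
      a = cs_add A (cs_mult A (cs_star A b) b) (cs_mult A (cs_star A c) c)" if pos: "cs_pos A a" for a
  proof -
    obtain b where b: "b \<in> cs_carrier A" "a = cs_mult A (cs_star A b) b"
      using pos unfolding cs_pos_def by blast
    have "a = cs_add A (cs_mult A (cs_star A b) b) (cs_mult A (cs_star A (cs_zero A)) (cs_zero A))"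
      using b by (simp add: cs_star_zero[OF A] cs_mult_zero[OF A] cvs_zero_right[OF cs_cvs[OF A]]
          cs_closed[OF A])
    then show ?thesis using b(1) cs_closed(1)[OF A] by blast
  qed
  then have "\<forall>x\<in>hm_carrier H. \<exists>b\<in>cs_carrier A. \<exists>c\<in>cs_carrier A.
      hm_inner H x x = cs_add A (cs_mult A (cs_star A b) b) (cs_mult A (cs_star A c) c)"
    using hilbert_axioms(8)[OF H] by simp
  then show ?thesis
    unfolding pre_hilb_def by (intro conjI hilbert_axioms[OF H])
qed

abbreviation hgood :: "'a cs_alg \<times> ('v, 'a) hmod \<Rightarrow> bool" where
  "hgood p \<equiv> cstar_algebra (fst p) \<and> pre_hilb (fst p) (snd p)"

context
  fixes p :: "'a cs_alg \<times> ('v, 'a) hmod" and A H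
  assumes p: "hgood p" and A_def: "A = fst p" and H_def: "H = snd p"
begin

lemma A: "cstar_algebra A" and H: "pre_hilb A H"
  using p by (simp_all add: A_def H_def)

text \<open>The inner product moved into the type \<open>el\<close>, where \<open>pos\<close> and
  \<open>cauchy_schwarz_pos\<close> are available.\<close>

definition inn :: "'v \<Rightarrow> 'v \<Rightarrow> ('a, ('v, 'a) hmod) el" where
  "inn x y = emb p (hm_inner H x y)"

lemmas hcl = hm_vs(1-4)[OF H] hm_act_closed[OF H] hm_inner_closed[OF H] cs_closed[OF A]

lemma ge:
  assumes "a \<in> cs_carrier A"
  shows "b \<in> cs_carrier A \<Longrightarrow> emb p (cs_add A a b) = emb p a + emb p b"
    and "b \<in> cs_carrier A \<Longrightarrow> emb p (cs_mult A a b) = emb p a * emb p b"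
    and "emb p (cs_star A a) = star (emb p a)"
    and "emb p (cs_smul A (of_real r) a) = r *\<^sub>R emb p a"
    and "norm (emb p a) = cs_norm A a"
    and "emb p a = 0 \<longleftrightarrow> a = cs_zero A"
  using A assms unfolding A_def
  by (simp_all add: emb_add emb_mult emb_star emb_smul_real norm_emb emb_eq_0)

lemma inn_add: "x \<in> hm_carrier H \<Longrightarrow> y \<in> hm_carrier H \<Longrightarrow> w \<in> hm_carrier H \<Longrightarrow>
    inn x (hm_add H y w) = inn x y + inn x w"
  by (simp add: inn_def hm_inner_add[OF H] hcl ge)

lemma inn_scale: "x \<in> hm_carrier H \<Longrightarrow> y \<in> hm_carrier H \<Longrightarrow> inn x (hm_smul H (of_real r) y) = r *\<^sub>R inn x y"
  by (simp add: inn_def hm_inner_smul[OF H] hcl ge)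

lemma inn_act: "x \<in> hm_carrier H \<Longrightarrow> y \<in> hm_carrier H \<Longrightarrow> a \<in> cs_carrier A \<Longrightarrow>
    inn x (hm_act H y a) = inn x y * emb p a"
  by (simp add: inn_def hm_inner_act[OF H] hcl ge)

lemma inn_star: "x \<in> hm_carrier H \<Longrightarrow> y \<in> hm_carrier H \<Longrightarrow> star (inn x y) = inn y x"
  using hm_inner_star[OF H, of x y] by (simp add: inn_def hcl ge)

lemma inn_pos: "x \<in> hm_carrier H \<Longrightarrow> pos (inn x x)"
proof -
  assume "x \<in> hm_carrier H"
  then obtain b c where "b \<in> cs_carrier A" "c \<in> cs_carrier A"
    "hm_inner H x x = cs_add A (cs_mult A (cs_star A b) b) (cs_mult A (cs_star A c) c)"
    using hm_pos[OF H] by blast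
  then have "inn x x = star (emb p b) * emb p b + star (emb p c) * emb p c"
    by (simp add: inn_def hcl ge)
  then show ?thesis by (simp add: pos_add pos_star_mult)
qed

lemma inn_eq_0: "x \<in> hm_carrier H \<Longrightarrow> inn x x = 0 \<longleftrightarrow> x = hm_zero H"
proof
  assume x: "x \<in> hm_carrier H"
  { assume "inn x x = 0"
    then show "x = hm_zero H"
      using x by (simp add: inn_def hcl ge hm_definite[OF H]) }
  { assume "x = hm_zero H"
    then show "inn x x = 0"
      using inn_scale[OF x x, of 0] cvs_smul_0[OF hm_cvs[OF H] x] by simp }
qed

lemma hm_norm_sq: "x \<in> hm_carrier H \<Longrightarrow> (hm_norm A H x)\<^sup>2 = norm (inn x x)"
  by (simp add: hm_norm_def inn_def hcl ge cs_norm_nonneg[OF A])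

lemma inn_CS:
  assumes x: "x \<in> hm_carrier H" and y: "y \<in> hm_carrier H"
  shows "norm (inn x y) \<le> hm_norm A H x * hm_norm A H y"
proof -
  let ?h = "hm_inner H x y"
  have h: "?h \<in> cs_carrier A" using x y by (simp add: hcl)
  have gh: "emb p ?h = inn x y" by (simp add: inn_def)
  have "(norm (inn x y))\<^sup>2 \<le> norm (inn x x) * norm (inn y y)"
  proof (rule cauchy_schwarz_pos[OF inn_pos[OF x]])
    assume "inn x x = 0"
    then have "x = hm_zero H" using inn_eq_0[OF x] by simp
    then have "inn y x = 0"
      using inn_scale[OF y x, of 0] cvs_smul_0[OF hm_cvs[OF H] x] by simp
    then show "inn x y = 0" using inn_star[OF y x] by simp
  next
    fix \<tau> :: real
    \<comment> \<open>The vector \<open>x\<close> acted on by \<tau> h, minus \<open>y\<close>. Its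
      inner square is the quadratic expression in \<tau> whose positivity
      \<open>cauchy_schwarz_pos\<close> asks for.\<close>
    let ?z = "hm_add H (hm_smul H (of_real \<tau>) (hm_act H x ?h)) (hm_smul H (of_real (-1)) y)"
    have z: "?z \<in> hm_carrier H" using x y h by (simp add: hcl)
    have gz: "inn w ?z = \<tau> *\<^sub>R (inn w x * inn x y) - inn w y" if w: "w \<in> hm_carrier H" for w
    proof -
      have "inn w ?z = inn w (hm_smul H (of_real \<tau>) (hm_act H x ?h)) + inn w (hm_smul H (of_real (-1)) y)"
        using x y w h by (intro inn_add) (simp_all add: hcl)
      also have "inn w (hm_smul H (of_real \<tau>) (hm_act H x ?h)) = \<tau> *\<^sub>R inn w (hm_act H x ?h)"
        using x w h by (intro inn_scale) (simp_all add: hcl)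
      also have "inn w (hm_act H x ?h) = inn w x * inn x y"
        using inn_act[OF w x h] by (simp add: gh)
      also have "inn w (hm_smul H (of_real (-1)) y) = (- 1) *\<^sub>R inn w y"
        by (rule inn_scale[OF w y])
      finally show ?thesis by simp
    qed
    have gzx: "inn ?z x = \<tau> *\<^sub>R (star (inn x y) * inn x x) - star (inn x y)"
      unfolding inn_star[OF x z, symmetric] gz[OF x]
      by (simp add: star_diff star_scaleR star_mult inn_star x)
    have gzy: "inn ?z y = \<tau> *\<^sub>R (star (inn x y) * inn x y) - inn y y"
      unfolding inn_star[OF y z, symmetric] gz[OF y]
      by (simp add: star_diff star_scaleR star_mult inn_star[OF y x] inn_star[OF y y])
    have "pos (inn ?z ?z)" by (rule inn_pos[OF z])
    also have "inn ?z ?z = \<tau>\<^sup>2 *\<^sub>R (star (inn x y) * inn x x * inn x y) - (2 * \<tau>) *\<^sub>R (star (inn x y) * inn x y) + inn y y"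
      unfolding gz[OF z] gzx gzy
      by (simp add: algebra_simps power2_eq_square scaleR_2[symmetric])
    finally show "pos (\<tau>\<^sup>2 *\<^sub>R (star (inn x y) * inn x x * inn x y) - (2 * \<tau>) *\<^sub>R (star (inn x y) * inn x y) + inn y y)" .
  qed
  also have "\<dots> = (hm_norm A H x * hm_norm A H y)\<^sup>2"
    by (simp add: hm_norm_sq x y power_mult_distrib)
  finally show ?thesis
    by (rule power2_le_imp_le) (simp add: hm_norm_def cs_norm_nonneg[OF A] hcl x y)
qed

lemma hm_norm_nonneg: "x \<in> hm_carrier H \<Longrightarrow> 0 \<le> hm_norm A H x"
  by (simp add: hm_norm_def cs_norm_nonneg[OF A] hcl)

lemma hm_norm_eq_0:
  assumes x: "x \<in> hm_carrier H" shows "hm_norm A H x = 0 \<longleftrightarrow> x = hm_zero H"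
proof -
  have "hm_norm A H x = 0 \<longleftrightarrow> (hm_norm A H x)\<^sup>2 = 0" by simp
  then show ?thesis by (simp only: hm_norm_sq[OF x] norm_eq_zero inn_eq_0[OF x])
qed

lemma hm_norm_tri:
  assumes x: "x \<in> hm_carrier H" and y: "y \<in> hm_carrier H"
  shows "hm_norm A H (hm_add H x y) \<le> hm_norm A H x + hm_norm A H y"
proof (rule power2_le_imp_le)
  let ?z = "hm_add H x y"
  have z: "?z \<in> hm_carrier H" using x y by (simp add: hcl)
  have gz: "inn ?z w = inn x w + inn y w" if "w \<in> hm_carrier H" for w
    unfolding inn_star[OF that z, symmetric] inn_add[OF that x y]
    by (simp add: star_add inn_star x y that)
  have "inn ?z ?z = (inn x x + inn x y) + (inn y x + inn y y)"
    unfolding gz[OF z] by (simp add: inn_add x y)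
  then have "norm (inn ?z ?z) \<le> (norm (inn x x) + norm (inn x y)) + (norm (inn y x) + norm (inn y y))"
    by (simp only: order_trans[OF norm_triangle_ineq add_mono[OF norm_triangle_ineq norm_triangle_ineq]])
  also have "\<dots> \<le> ((hm_norm A H x)\<^sup>2 + hm_norm A H x * hm_norm A H y)
      + (hm_norm A H y * hm_norm A H x + (hm_norm A H y)\<^sup>2)"
    by (intro add_mono inn_CS x y) (simp_all add: hm_norm_sq x y)
  also have "\<dots> = (hm_norm A H x + hm_norm A H y)\<^sup>2" by (simp add: power2_eq_square algebra_simps)
  finally show "(hm_norm A H ?z)\<^sup>2 \<le> (hm_norm A H x + hm_norm A H y)\<^sup>2"
    by (simp add: hm_norm_sq z)
qed (simp add: hm_norm_nonneg x y)

lemma hm_norm_smul: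
  assumes x: "x \<in> hm_carrier H" shows "hm_norm A H (hm_smul H c x) = cmod c * hm_norm A H x"
proof -
  let ?z = "hm_smul H c x"
  have z: "?z \<in> hm_carrier H" using x by (simp add: hcl)
  have "hm_inner H ?z x = cs_star A (hm_inner H x ?z)" by (rule hm_inner_star[OF H x z])
  also have "\<dots> = cs_smul A (cnj c) (hm_inner H x x)"
    using hm_inner_star[OF H x x, symmetric]
    by (simp add: hm_inner_smul[OF H x x] cs_star_smul[OF A] hcl x)
  finally have "hm_inner H ?z ?z = cs_smul A c (cs_smul A (cnj c) (hm_inner H x x))"
    by (simp add: hm_inner_smul[OF H z x])
  then have "cs_norm A (hm_inner H ?z ?z) = (cmod c)\<^sup>2 * cs_norm A (hm_inner H x x)"
    by (simp add: cs_norm_smul[OF A] hcl x power2_eq_square)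
  then show ?thesis by (simp add: hm_norm_def real_sqrt_mult)
qed

lemma hm_norm_act:
  assumes x: "x \<in> hm_carrier H" and a: "a \<in> cs_carrier A"
  shows "hm_norm A H (hm_act H x a) \<le> hm_norm A H x * cs_norm A a"
proof (rule power2_le_imp_le)
  let ?z = "hm_act H x a"
  have z: "?z \<in> hm_carrier H" using x a by (simp add: hcl)
  have "inn ?z x = star (emb p a) * inn x x"
    unfolding inn_star[OF x z, symmetric] inn_act[OF x x a] by (simp add: star_mult inn_star x)
  then have "inn ?z ?z = star (emb p a) * inn x x * emb p a" by (simp add: inn_act[OF z x a])
  then have "norm (inn ?z ?z) \<le> norm (emb p a) * norm (inn x x) * norm (emb p a)"
    using order_trans[OF norm_mult_ineq mult_right_mono[OF norm_mult_ineq norm_ge_zero],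
        of "star (emb p a)" "inn x x" "emb p a"] by simp
  also have "\<dots> = (hm_norm A H x * cs_norm A a)\<^sup>2"
    by (simp add: ge a hm_norm_sq[OF x, symmetric] power2_eq_square mult_ac)
  finally show "(hm_norm A H ?z)\<^sup>2 \<le> (hm_norm A H x * cs_norm A a)\<^sup>2"
    by (simp add: hm_norm_sq z)
qed (simp add: hm_norm_nonneg x cs_norm_nonneg[OF A a])

lemma hm_inner_norm:
  "x \<in> hm_carrier H \<Longrightarrow> y \<in> hm_carrier H \<Longrightarrow> cs_norm A (hm_inner H x y) \<le> hm_norm A H x * hm_norm A H y"
  using inn_CS[of x y] by (simp add: inn_def ge hcl)

end

interpretation vecF: bfam "hgood :: 'a cs_alg \<times> ('v, 'a) hmod \<Rightarrow> bool" "\<lambda>p. hm_carrier (snd p)"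
  "\<lambda>p. hm_zero (snd p)" "\<lambda>p. hm_add (snd p)" "\<lambda>p. hm_neg (snd p)" "\<lambda>p. hm_smul (snd p)"
  "\<lambda>p. hm_norm (fst p) (snd p)"
proof
  fix p :: "'a cs_alg \<times> ('v, 'a) hmod" and x y c
  assume p: "hgood p"
  then show "cvs (hm_carrier (snd p)) (hm_zero (snd p)) (hm_add (snd p)) (hm_neg (snd p)) (hm_smul (snd p))"
    by (intro hm_cvs[of "fst p"]) simp
  show "complete_wrt (hm_carrier (snd p))
      (\<lambda>x y. hm_norm (fst p) (snd p) (hm_add (snd p) x (hm_neg (snd p) y)))"
    using p hm_complete[of "fst p" "snd p"] by (simp add: hm_dist_def[abs_def])
  assume x: "x \<in> hm_carrier (snd p)"
  show "0 \<le> hm_norm (fst p) (snd p) x" by (rule hm_norm_nonneg[OF p refl refl x])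
  show "hm_norm (fst p) (snd p) x = 0 \<longleftrightarrow> x = hm_zero (snd p)" by (rule hm_norm_eq_0[OF p refl refl x])
  show "hm_norm (fst p) (snd p) (hm_smul (snd p) c x) = cmod c * hm_norm (fst p) (snd p) x"
    by (rule hm_norm_smul[OF p refl refl x])
  assume y: "y \<in> hm_carrier (snd p)"
  show "hm_norm (fst p) (snd p) (hm_add (snd p) x y) \<le> hm_norm (fst p) (snd p) x + hm_norm (fst p) (snd p) y"
    by (rule hm_norm_tri[OF p refl refl x y])
qed

typedef ('a, 'v) hvec = "vecF.Fam :: ('a cs_alg \<times> ('v, 'a) hmod \<Rightarrow> 'v) set"
  morphisms vec_at Abs_hvec
  using vecF.fam_zero by blast

setup_lifting type_definition_hvec

lemma vec_at_mem: "hgood p \<Longrightarrow> vec_at x p \<in> hm_carrier (snd p)"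
  using vec_at[of x] by (rule vecF.FamD)

lemma vec_eqI: "(\<And>p. hgood p \<Longrightarrow> vec_at x p = vec_at y p) \<Longrightarrow> x = y"
  using vec_at_inject vecF.Fam_eqI[OF vec_at vec_at] by blast

instantiation hvec :: (type, type) real_vector
begin
lift_definition zero_hvec :: "('a, 'b) hvec" is "vecF.fam (\<lambda>p. hm_zero (snd p))" by (rule vecF.fam_zero)
lift_definition plus_hvec :: "('a, 'b) hvec \<Rightarrow> ('a, 'b) hvec \<Rightarrow> ('a, 'b) hvec" is
  "\<lambda>f g. vecF.fam (\<lambda>p. hm_add (snd p) (f p) (g p))" by (rule vecF.fam_add)
lift_definition uminus_hvec :: "('a, 'b) hvec \<Rightarrow> ('a, 'b) hvec" is
  "\<lambda>f. vecF.fam (\<lambda>p. hm_neg (snd p) (f p))" by (rule vecF.fam_neg)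
definition minus_hvec :: "('a, 'b) hvec \<Rightarrow> ('a, 'b) hvec \<Rightarrow> ('a, 'b) hvec" where "minus_hvec x y = x + - y"
lift_definition scaleR_hvec :: "real \<Rightarrow> ('a, 'b) hvec \<Rightarrow> ('a, 'b) hvec" is
  "\<lambda>r f. vecF.fam (\<lambda>p. hm_smul (snd p) (of_real r) (f p))" by (rule vecF.fam_smul)
instance
proof
  fix a b c :: "('a, 'b) hvec" and r s :: real
  note c = cvs_facts[OF vecF.vs]
  note [simp] = zero_hvec.rep_eq plus_hvec.rep_eq uminus_hvec.rep_eq scaleR_hvec.rep_eq
    vec_at_mem c(1-4)
  show "a + b + c = a + (b + c)" by (rule vec_eqI) (simp add: c(5))
  show "a + b = b + a" by (rule vec_eqI) (simp add: c(6)[OF _ vec_at_mem vec_at_mem])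
  show "0 + a = a" by (rule vec_eqI) (simp add: c(7))
  show "- a + a = 0" by (rule vec_eqI) (simp add: c(8))
  show "a - b = a + - b" by (rule minus_hvec_def)
  show "r *\<^sub>R (a + b) = r *\<^sub>R a + r *\<^sub>R b" by (rule vec_eqI) (simp add: c(9))
  show "(r + s) *\<^sub>R a = r *\<^sub>R a + s *\<^sub>R a" by (rule vec_eqI) (simp add: c(10))
  show "r *\<^sub>R s *\<^sub>R a = (r * s) *\<^sub>R a" by (rule vec_eqI) (simp add: c(11))
  show "1 *\<^sub>R a = a" by (rule vec_eqI) (simp add: c(12))
qed
end

instantiation hvec :: (type, type) real_normed_vector
begin
lift_definition norm_hvec :: "('a, 'b) hvec \<Rightarrow> real" is vecF.nF .
definition dist_hvec :: "('a, 'b) hvec \<Rightarrow> ('a, 'b) hvec \<Rightarrow> real" where "dist_hvec x y = norm (x - y)"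
definition sgn_hvec :: "('a, 'b) hvec \<Rightarrow> ('a, 'b) hvec" where "sgn_hvec x = x /\<^sub>R norm x"
definition uniformity_hvec :: "(('a, 'b) hvec \<times> ('a, 'b) hvec) filter"
  where "uniformity_hvec = (INF e\<in>{0<..}. principal {(x, y). dist x y < e})"
definition open_hvec :: "('a, 'b) hvec set \<Rightarrow> bool"
  where "open_hvec U = (\<forall>x\<in>U. eventually (\<lambda>(x', y). x' = x \<longrightarrow> y \<in> U) uniformity)"
instance
proof
  fix x y :: "('a, 'b) hvec" and r :: real
  show "norm x = 0 \<longleftrightarrow> x = 0" by transfer (rule vecF.nF_eq_0)
  show "norm (x + y) \<le> norm x + norm y" by transfer (rule vecF.nF_add)
  show "norm (r *\<^sub>R x) = \<bar>r\<bar> * norm x" by transfer (simp add: vecF.nF_smul)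
qed (rule dist_hvec_def sgn_hvec_def uniformity_hvec_def open_hvec_def[unfolded atomize_eq])+
end

lemma norm_hvec_at: "hgood p \<Longrightarrow> hm_norm (fst p) (snd p) (vec_at x p) \<le> norm x"
  by transfer (rule vecF.nF_upper)

lemma norm_hvec_le:
  "0 \<le> B \<Longrightarrow> (\<And>p. hgood p \<Longrightarrow> hm_norm (fst p) (snd p) (vec_at x p) \<le> B) \<Longrightarrow> norm x \<le> B"
  by transfer (rule vecF.nF_least)

instance hvec :: (type, type) banach
proof
  fix X :: "nat \<Rightarrow> ('a, 'b) hvec"
  assume C: "Cauchy X"
  have df: "norm (x - y) = vecF.nF (vecF.fam (\<lambda>p. hm_add (snd p) (vec_at x p) (hm_neg (snd p) (vec_at y p))))"
    for x y :: "('a, 'b) hvec"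
    unfolding norm_hvec.rep_eq minus_hvec_def
    by (rule vecF.nF_cong) (simp add: plus_hvec.rep_eq uminus_hvec.rep_eq del: add_uminus_conv_diff)
  have "\<exists>L\<in>vecF.Fam. \<forall>e>0. \<exists>K. \<forall>n\<ge>K.
      vecF.nF (vecF.fam (\<lambda>p. hm_add (snd p) (vec_at (X n) p) (hm_neg (snd p) (L p)))) \<le> e"
  proof (rule vecF.Fam_complete[where X="\<lambda>n. vec_at (X n)"])
    show "\<exists>K. \<forall>m\<ge>K. \<forall>n\<ge>K.
        vecF.nF (vecF.fam (\<lambda>p. hm_add (snd p) (vec_at (X m) p) (hm_neg (snd p) (vec_at (X n) p)))) < e"
      if "e > 0" for e
      unfolding df[symmetric] using C that by (simp add: Cauchy_def dist_norm)
  qed (rule vec_at)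
  then obtain L where L: "L \<in> vecF.Fam" "\<forall>e>0. \<exists>K. \<forall>n\<ge>K.
      vecF.nF (vecF.fam (\<lambda>p. hm_add (snd p) (vec_at (X n) p) (hm_neg (snd p) (L p)))) \<le> e"
    by (rule bexE)
  have "X \<longlonglongrightarrow> Abs_hvec L"
  proof (rule LIMSEQ_I)
    fix e :: real assume "e > 0"
    then obtain K where K: "\<forall>n\<ge>K.
        vecF.nF (vecF.fam (\<lambda>p. hm_add (snd p) (vec_at (X n) p) (hm_neg (snd p) (L p)))) \<le> e / 2"
      using L(2)[rule_format, of "e / 2"] by auto
    have "norm (X n - Abs_hvec L) < e" if "n \<ge> K" for n
    proof -
      have "norm (X n - Abs_hvec L) \<le> e / 2"
        unfolding df Abs_hvec_inverse[OF L(1)] using K that by blast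
      then show ?thesis using \<open>e > 0\<close> by simp
    qed
    then show "\<exists>K. \<forall>n\<ge>K. norm (X n - Abs_hvec L) < e" by blast
  qed
  then show "convergent X" by (auto simp: convergent_def)
qed

text \<open>Bilinearity of the action and its norm bound are derived from \<open>ip_act\<close>,
  because vectors are separated by their inner products.\<close>

locale hilb = ipm ip J
  for ip :: "'h::banach \<Rightarrow> 'h \<Rightarrow> 'e::cstar" and J :: "'h endo" +
  fixes act :: "'h \<Rightarrow> 'e \<Rightarrow> 'h"
  assumes ip_act: "ip x (act y a) = ip x y * a"
    and ip_pos: "pos (ip x x)"

lemma cs_zero_mult:
  assumes A: "cstar_algebra A" and a: "a \<in> cs_carrier A"
  shows "cs_mult A (cs_zero A) a = cs_zero A"
  using cs_smul_mult_left[OF A cs_closed(1)[OF A] a, of 0]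
    cvs_smul_0[OF cs_cvs[OF A] cs_closed(5)[OF A cs_closed(1)[OF A] a]]
    cvs_smul_0[OF cs_cvs[OF A] cs_closed(1)[OF A]] by simp

lemma hm_inner_zero:
  assumes A: "cstar_algebra A" and H: "pre_hilb A H" and x: "x \<in> hm_carrier H"
  shows "hm_inner H x (hm_zero H) = cs_zero A"
  using hm_inner_smul[OF H x x, of 0] cvs_smul_0[OF hm_cvs[OF H] x]
    cvs_smul_0[OF cs_cvs[OF A] hm_inner_closed[OF H x x]] by simp

lemma hm_act_zero:
  assumes A: "cstar_algebra A" and H: "pre_hilb A H" and a: "a \<in> cs_carrier A"
  shows "hm_act H (hm_zero H) a = hm_zero H"
proof -
  note z = hm_vs(1)[OF H]
  note az = hm_act_closed[OF H z a]
  have "hm_inner H (hm_act H (hm_zero H) a) (hm_act H (hm_zero H) a) = cs_zero A"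
    unfolding hm_inner_act[OF H az z a] hm_inner_zero[OF A H az] by (rule cs_zero_mult[OF A a])
  then show ?thesis by (rule hm_definite[OF H az])
qed

text \<open>An index whose algebra is a C*-algebra but whose module is not a Hilbert module is a
  coordinate of \<open>el\<close> and not of \<open>hvec\<close>; there the inner product is set to
  zero.\<close>

lift_definition hip :: "('a, 'v) hvec \<Rightarrow> ('a, 'v) hvec \<Rightarrow> ('a, ('v, 'a) hmod) el" is
  "\<lambda>f g. elF.fam (\<lambda>p. if pre_hilb (fst p) (snd p) then hm_inner (snd p) (f p) (g p) else cs_zero (fst p))"
  subgoal for f g
  proof (rule elF.FamI[where B="vecF.nF f * vecF.nF g"])
    fix p :: "'a cs_alg \<times> ('v, 'a) hmod"
    assume f: "f \<in> vecF.Fam" and g: "g \<in> vecF.Fam" and A: "cstar_algebra (fst p)"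
    let ?h = "if pre_hilb (fst p) (snd p) then hm_inner (snd p) (f p) (g p) else cs_zero (fst p)"
    show "?h \<in> cs_carrier (fst p)"
      using A f g by (simp add: cs_closed hm_inner_closed vecF.FamD)
    show "cs_norm (fst p) ?h \<le> vecF.nF f * vecF.nF g"
    proof (cases "pre_hilb (fst p) (snd p)")
      case True
      then have p: "hgood p" using A by simp
      have "cs_norm (fst p) ?h \<le> hm_norm (fst p) (snd p) (f p) * hm_norm (fst p) (snd p) (g p)"
        using hm_inner_norm[OF p refl refl vecF.FamD[OF f p] vecF.FamD[OF g p]] True by simp
      also have "\<dots> \<le> vecF.nF f * vecF.nF g"
        by (intro mult_mono vecF.nF_upper vecF.nF_nonneg f g p
            hm_norm_nonneg[OF p refl refl] vecF.FamD[OF g p])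
      finally show ?thesis .
    next
      case False
      then show ?thesis
        using A f g cs_norm_eq_0[OF A cs_closed(1)[OF A]]
        by (simp add: vecF.nF_nonneg)
    qed
  qed
  done

lift_definition hact :: "('a, 'v) hvec \<Rightarrow> ('a, ('v, 'a) hmod) el \<Rightarrow> ('a, 'v) hvec" is
  "\<lambda>f a. vecF.fam (\<lambda>p. hm_act (snd p) (f p) (a p))"
  subgoal for f a
  proof (rule vecF.FamI[where B="vecF.nF f * elF.nF a"])
    fix p :: "'a cs_alg \<times> ('v, 'a) hmod"
    assume f: "f \<in> vecF.Fam" and a: "a \<in> elF.Fam" and p: "hgood p"
    then have A: "cstar_algebra (fst p)" by simp
    note fp = vecF.FamD[OF f p] and ap = elF.FamD[OF a A]
    show "hm_act (snd p) (f p) (a p) \<in> hm_carrier (snd p)"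
      using p fp ap by (intro hm_act_closed[of "fst p"]) auto
    show "hm_norm (fst p) (snd p) (hm_act (snd p) (f p) (a p)) \<le> vecF.nF f * elF.nF a"
      by (intro order_trans[OF hm_norm_act[OF p refl refl fp ap]] mult_mono vecF.nF_upper
          elF.nF_upper vecF.nF_nonneg cs_norm_nonneg f a p A ap)
  qed
  done

lift_definition himul :: "('a, 'v) hvec \<Rightarrow> ('a, 'v) hvec" is
  "\<lambda>f. vecF.fam (\<lambda>p. hm_smul (snd p) \<i> (f p))" by (rule vecF.fam_smul)

lemma hip_at:
  "hgood p \<Longrightarrow> el_at (hip x y) p = hm_inner (snd p) (vec_at x p) (vec_at y p)"
  by (simp add: hip.rep_eq)

lemma hip_eqI:
  assumes "\<And>p. hgood p \<Longrightarrow> el_at (hip x y) p = el_at b p"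
    and "\<And>p. cstar_algebra (fst p) \<Longrightarrow> \<not> hgood p \<Longrightarrow> el_at b p = cs_zero (fst p)"
  shows "hip x y = b"
proof (rule el_eqI)
  fix p :: "'a cs_alg \<times> ('b, 'a) hmod" assume A: "cstar_algebra (fst p)"
  show "el_at (hip x y) p = el_at b p"
  proof (cases "hgood p")
    case True then show ?thesis by (rule assms(1))
  next
    case False
    then show ?thesis using assms(2)[OF A False] A by (simp add: hip.rep_eq)
  qed
qed

lemma himul_linear: "bounded_linear himul"
proof (rule bounded_linear_intro[where K=1])
  fix x y :: "('a, 'b) hvec" and r :: real
  note c = cvs_facts[OF vecF.vs]
  note [simp] = plus_hvec.rep_eq scaleR_hvec.rep_eq himul.rep_eq vec_at_mem c(1-4)
  show "himul (x + y) = himul x + himul y" by (rule vec_eqI) (simp add: c(9))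
  show "himul (r *\<^sub>R x) = r *\<^sub>R himul x"
    by (rule vec_eqI) (simp add: c(11) mult.commute)
  have "norm (himul x) = norm x"
    unfolding norm_hvec.rep_eq by (rule vecF.nF_cong) (simp add: vecF.nm_smul)
  then show "norm (himul x) \<le> norm x * 1" by simp
qed

interpretation hv: hilb "hip :: ('a, 'v) hvec \<Rightarrow> ('a, 'v) hvec \<Rightarrow> _" "endo_of himul" hact
proof
  fix x y z :: "('a, 'v) hvec" and r :: real and a :: "('a, ('v, 'a) hmod) el"
  note [simp] = plus_hvec.rep_eq scaleR_hvec.rep_eq himul.rep_eq vec_at_mem hact.rep_eq
    plus_el.rep_eq scaleR_el.rep_eq mulI_el.rep_eq star_el.rep_eq times_el.rep_eq el_at_mem
    hm_inner_closed hip.rep_eq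
  show "hip x (y + z) = hip x y + hip x z"
    by (rule hip_eqI) (simp_all add: hm_inner_add cs_vs(7) cs_closed)
  show "hip x (r *\<^sub>R y) = r *\<^sub>R hip x y"
    by (rule hip_eqI) (simp_all add: hm_inner_smul cvs_smul_zero[OF cs_cvs])
  show sx: "star (hip x y) = hip y x" for x y :: "('a, 'v) hvec"
    by (rule hip_eqI[symmetric])
      (simp_all add: hm_inner_star[of _ _ "vec_at x _" "vec_at y _"] cs_star_zero)
  show "hip x (app (endo_of himul) y) = mulI (hip x y)"
    unfolding app_endo_of[OF himul_linear]
    by (rule hip_eqI) (simp_all add: hm_inner_smul cvs_smul_zero[OF cs_cvs])
  show "hip x (hact y a) = hip x y * a"
    by (rule hip_eqI) (simp_all add: hm_inner_act cs_zero_mult)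
  show "norm (hip x x) = (norm x)\<^sup>2"
  proof (rule antisym)
    show "norm (hip x x) \<le> (norm x)\<^sup>2"
    proof (rule norm_el_le)
      fix p :: "'a cs_alg \<times> ('v, 'a) hmod" assume A: "cstar_algebra (fst p)"
      show "cs_norm (fst p) (el_at (hip x x) p) \<le> (norm x)\<^sup>2"
      proof (cases "pre_hilb (fst p) (snd p)")
        case True
        then have p: "hgood p" using A by simp
        have "cs_norm (fst p) (el_at (hip x x) p) \<le> hm_norm (fst p) (snd p) (vec_at x p) * hm_norm (fst p) (snd p) (vec_at x p)"
          using hm_inner_norm[OF p refl refl vec_at_mem[OF p] vec_at_mem[OF p]] p by simp
        also have "\<dots> \<le> norm x * norm x"
          by (intro mult_mono norm_hvec_at p norm_ge_zero hm_norm_nonneg[OF p refl refl] vec_at_mem)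
        finally show ?thesis by (simp add: power2_eq_square)
      next
        case False
        then show ?thesis using A cs_norm_eq_0[OF A cs_closed(1)[OF A]] by simp
      qed
    qed simp
    have "norm x \<le> sqrt (norm (hip x x))"
    proof (rule norm_hvec_le)
      fix p :: "'a cs_alg \<times> ('v, 'a) hmod" assume p: "hgood p"
      then have A: "cstar_algebra (fst p)" by simp
      show "hm_norm (fst p) (snd p) (vec_at x p) \<le> sqrt (norm (hip x x))"
        using norm_el_at[OF A, of "hip x x"] hip_at[OF p, of x x] by (simp add: hm_norm_def)
    qed simp
    from power_mono[OF this norm_ge_zero, of 2] show "(norm x)\<^sup>2 \<le> norm (hip x x)" by simp
  qed
  show "norm (hip x y) \<le> norm x * norm y"
  proof (rule norm_el_le)
    fix p :: "'a cs_alg \<times> ('v, 'a) hmod" assume A: "cstar_algebra (fst p)"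
    show "cs_norm (fst p) (el_at (hip x y) p) \<le> norm x * norm y"
    proof (cases "pre_hilb (fst p) (snd p)")
      case True
      then have p: "hgood p" using A by simp
      have "cs_norm (fst p) (el_at (hip x y) p) \<le> hm_norm (fst p) (snd p) (vec_at x p) * hm_norm (fst p) (snd p) (vec_at y p)"
        using hm_inner_norm[OF p refl refl vec_at_mem[OF p] vec_at_mem[OF p]] p by simp
      also have "\<dots> \<le> norm x * norm y"
        by (intro mult_mono norm_hvec_at p norm_ge_zero hm_norm_nonneg[OF p refl refl] vec_at_mem)
      finally show ?thesis .
    next
      case False
      then show ?thesis using A cs_norm_eq_0[OF A cs_closed(1)[OF A]] by simp
    qed
  qed simp
  show "pos (hip x x)"
  \<comment> \<open>Positivity is known in each coordinate separately. The criterion with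
    \<open>t = norm (hip x x)\<close>, which dominates the norm in every coordinate, passes to the
    whole family.\<close>
  proof (rule pos_criterion)
    show "star (hip x x) = hip x x" by (rule sx)
    show "0 \<le> norm (hip x x)" by simp
    fix b :: "('a, ('v, 'a) hmod) el"
    show "norm (norm (hip x x) *\<^sub>R b - hip x x * b) \<le> norm (hip x x) * norm b"
    proof (rule norm_el_le)
      fix p :: "'a cs_alg \<times> ('v, 'a) hmod" assume A: "cstar_algebra (fst p)"
      let ?h = "el_at (hip x x) p" and ?b = "el_at b p" and ?n = "norm (hip x x)"
      have h: "?h \<in> cs_carrier (fst p)" and b: "?b \<in> cs_carrier (fst p)"
        using A by (simp_all only: el_at_mem)
      have ph: "pos (emb p ?h)"
      proof (cases "hgood p")
        case True
        then show ?thesis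
          using inn_pos[OF True refl refl vec_at_mem[OF True, of x]]
          by (simp add: inn_def[OF True refl refl])
      next
        case False
        then have "emb p ?h = 0" using A emb_eq_0[OF A h] by simp
        then show ?thesis by simp
      qed
      have "norm (emb p ?h) \<le> ?n" by (simp only: norm_emb[OF A h] norm_el_at[OF A])
      then have "norm (?n *\<^sub>R emb p ?b - emb p ?h * emb p ?b) \<le> ?n * norm (emb p ?b)"
        by (rule pos_norm_diff[OF ph])
      also have "\<dots> \<le> ?n * norm b"
        using norm_emb[OF A b] norm_el_at[OF A, of b] by (intro mult_left_mono) auto
      also have "?n *\<^sub>R emb p ?b - emb p ?h * emb p ?b = emb p (el_at (?n *\<^sub>R b - hip x x * b) p)"
      proof -
        have "el_at (?n *\<^sub>R b - hip x x * b) p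
            = cs_add (fst p) (cs_smul (fst p) (of_real ?n) ?b) (cs_neg (fst p) (cs_mult (fst p) ?h ?b))"
          using A by (simp add: minus_el_def uminus_el.rep_eq del: add_uminus_conv_diff hip.rep_eq)
        then show ?thesis using A h b
          by (simp add: emb_add emb_neg emb_mult emb_smul_real cs_closed del: hip.rep_eq)
      qed
      finally show "cs_norm (fst p) (el_at (?n *\<^sub>R b - hip x x * b) p) \<le> ?n * norm b"
        by (simp only: norm_emb[OF A el_at_mem[OF A]])
    qed simp
  qed
qed

lift_definition hemb :: "'a cs_alg \<times> ('v, 'a) hmod \<Rightarrow> 'v \<Rightarrow> ('a, 'v) hvec" is
  "\<lambda>p x. if hgood p \<and> x \<in> hm_carrier (snd p) then vecF.single p x
     else vecF.fam (\<lambda>p. hm_zero (snd p))"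
  by (auto intro: vecF.single_mem vecF.fam_zero)

context
  fixes p :: "'a cs_alg \<times> ('v, 'a) hmod"
  assumes p: "hgood p"
begin

lemma vec_at_hemb:
  assumes "x \<in> hm_carrier (snd p)" "hgood q"
  shows "vec_at (hemb p x) q = (if q = p then x else hm_zero (snd q))"
  using assms p by (simp add: hemb.rep_eq vecF.single_def)

lemma hemb_at: "x \<in> hm_carrier (snd p) \<Longrightarrow> vec_at (hemb p x) p = x"
  using p by (simp add: vec_at_hemb)

context
  fixes x :: 'v
  assumes x: "x \<in> hm_carrier (snd p)"
begin

lemma hemb_inject:
  assumes y: "y \<in> hm_carrier (snd p)" shows "hemb p x = hemb p y \<longleftrightarrow> x = y"
proof
  assume "hemb p x = hemb p y"
  then have "vec_at (hemb p x) p = vec_at (hemb p y) p" by (rule arg_cong)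
  then show "x = y" by (simp only: hemb_at x y)
qed simp

lemma hemb_add:
  assumes y: "y \<in> hm_carrier (snd p)" shows "hemb p (hm_add (snd p) x y) = hemb p x + hemb p y"
proof (rule vec_eqI)
  note c = cvs_facts[OF vecF.vs]
  fix q :: "'a cs_alg \<times> ('v, 'a) hmod" assume q: "hgood q"
  then show "vec_at (hemb p (hm_add (snd p) x y)) q = vec_at (hemb p x + hemb p y) q"
    using p x y by (simp add: vec_at_hemb c(1,2,7) plus_hvec.rep_eq)
qed

lemma hemb_smul_real: "hemb p (hm_smul (snd p) (of_real r) x) = r *\<^sub>R hemb p x"
proof (rule vec_eqI)
  note c = cvs_facts[OF vecF.vs]
  fix q :: "'a cs_alg \<times> ('v, 'a) hmod" assume q: "hgood q"
  then show "vec_at (hemb p (hm_smul (snd p) (of_real r) x)) q = vec_at (r *\<^sub>R hemb p x) q"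
    using p x by (simp add: vec_at_hemb c(4) scaleR_hvec.rep_eq cvs_smul_zero[OF vecF.vs])
qed

lemma hemb_smul_I: "hemb p (hm_smul (snd p) \<i> x) = app (endo_of himul) (hemb p x)"
  unfolding app_endo_of[OF himul_linear]
proof (rule vec_eqI)
  note c = cvs_facts[OF vecF.vs]
  fix q :: "'a cs_alg \<times> ('v, 'a) hmod" assume q: "hgood q"
  then show "vec_at (hemb p (hm_smul (snd p) \<i> x)) q = vec_at (himul (hemb p x)) q"
    using p x by (simp add: vec_at_hemb c(4) himul.rep_eq cvs_smul_zero[OF vecF.vs])
qed

lemma hip_hemb:
  assumes y: "y \<in> hm_carrier (snd p)" shows "hip (hemb p x) (hemb p y) = emb p (hm_inner (snd p) x y)"
proof (rule hip_eqI)
  have i: "hm_inner (snd p) x y \<in> cs_carrier (fst p)"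
    using p x y by (simp add: hm_inner_closed)
  show "el_at (hip (hemb p x) (hemb p y)) q = el_at (emb p (hm_inner (snd p) x y)) q" if q: "hgood q" for q
    using p q x y i by (simp add: hip_at vec_at_hemb el_at_emb hm_inner_zero[of "fst q"] hm_vs(1)[of "fst q"])
  show "el_at (emb p (hm_inner (snd p) x y)) q = cs_zero (fst q)"
    if "cstar_algebra (fst q)" "\<not> hgood q" for q
    using p that i by (auto simp: el_at_emb)
qed

end

end

lemma closed_limit: "closed S \<Longrightarrow> (\<And>n::nat. f n \<in> S) \<Longrightarrow> f \<longlonglongrightarrow> l \<Longrightarrow> l \<in> S"
  using closed_sequentially by blast

context hilb
begin

subsection \<open>Finite rank and compact operators\<close>

lemma ip_act_left: "ip (act x a) y = star a * ip x y"
  using ip_star[of y "act x a"] by (simp add: ip_act star_mult ip_star)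

lemma norm_act: "norm (act x a) \<le> norm x * norm a"
proof (rule power2_le_imp_le)
  have "(norm (act x a))\<^sup>2 = norm (star a * ip x x * a)"
    by (simp only: ip_norm[symmetric] ip_act ip_act_left)
  also have "\<dots> \<le> norm (star a) * norm (ip x x) * norm a"
    by (rule order_trans[OF norm_mult_ineq mult_right_mono[OF norm_mult_ineq norm_ge_zero]])
  also have "\<dots> = (norm x * norm a)\<^sup>2" by (simp add: ip_norm power2_eq_square)
  finally show "(norm (act x a))\<^sup>2 \<le> (norm x * norm a)\<^sup>2" .
qed simp

lemma bounded_bilinear_act: "bounded_bilinear act"
proof
  show "\<exists>K. \<forall>a b. norm (act a b) \<le> norm a * norm b * K"
    using norm_act by (intro exI[of _ 1]) simp
qed (rule ip_eqI, simp add: ip_act ip.add_right ip.scaleR_right algebra_simps)+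

sublocale act: bounded_bilinear act
  by (rule bounded_bilinear_act)

lemma adj_act: "adj S T \<Longrightarrow> app S (act x a) = act (app S x) a"
  by (rule ip_eqI) (simp add: adjD[OF adj_sym, symmetric] ip_act)

definition theta :: "'h \<Rightarrow> 'h \<Rightarrow> 'h endo" where
  "theta u v = endo_of (\<lambda>x. act v (ip u x))"

lemma app_theta [simp]: "app (theta u v) x = act v (ip u x)"
proof -
  have "bounded_linear (\<lambda>x. act v (ip u x))"
    by (rule bounded_linear_compose[OF act.bounded_linear_right ip.bounded_linear_right])
  then show ?thesis unfolding theta_def by (rule app_endo_of)
qed

lemma adj_theta: "adj (theta u v) (theta v u)"
  by (simp add: adj_def ip_act ip_act_left ip_star)

lemma theta_conj:
  "adj S S' \<Longrightarrow> adj R R' \<Longrightarrow> S * theta u v * R = theta (app R' u) (app S v)"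
  by (rule endo_eqI) (simp add: adj_act adjD[OF adj_sym])

definition fr :: "('h \<times> 'h) list \<Rightarrow> 'h endo" where
  "fr ps = sum_list (map (\<lambda>p. theta (fst p) (snd p)) ps)"

definition FR :: "'h set \<Rightarrow> 'h endo set" where
  "FR U = fr ` {ps. set ps \<subseteq> U \<times> U}"

text \<open>Operators on the whole ambient space whose defining vectors are confined to
  \<open>U\<close>. For a closed submodule \<open>U\<close> this is a copy of the compact operators
  of \<open>U\<close>: by \<open>FR_norm_le\<close> the norm is already visible on \<open>U\<close>,
  whether or not \<open>U\<close> has an orthogonal complement. Compact operators of different
  submodules can thus be multiplied and compared.\<close>

definition Kop :: "'h set \<Rightarrow> 'h endo set" where
  "Kop U = closure (FR U)"

lemma fr_simps [simp]: "fr [] = 0" "fr (p # ps) = theta (fst p) (snd p) + fr ps"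
  by (simp_all add: fr_def)

lemma fr_append: "fr (ps @ qs) = fr ps + fr qs"
  by (simp add: fr_def)

lemma adj_fr: "adj (fr ps) (fr (map prod.swap ps))"
  by (induction ps) (simp_all add: adj_add adj_theta)

lemma fr_conj:
  assumes S: "adj S S'" and R: "adj R R'"
  shows "S * fr ps * R = fr (map (\<lambda>p. (app R' (fst p), app S (snd p))) ps)"
  by (induction ps) (simp_all add: distrib_left distrib_right theta_conj[OF S R])

lemma FR_I: "set ps \<subseteq> U \<times> U \<Longrightarrow> fr ps \<in> FR U"
  by (simp add: FR_def)

lemma FR_E: "T \<in> FR U \<Longrightarrow> (\<And>ps. set ps \<subseteq> U \<times> U \<Longrightarrow> T = fr ps \<Longrightarrow> thesis) \<Longrightarrow> thesis"
  by (auto simp: FR_def)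

lemma FR_0: "0 \<in> FR U"
  using FR_I[of "[]"] by simp

lemma FR_add: "S \<in> FR U \<Longrightarrow> T \<in> FR U \<Longrightarrow> S + T \<in> FR U"
  by (elim FR_E) (simp add: fr_append[symmetric] FR_I)

lemma FR_adj: "T \<in> FR U \<Longrightarrow> \<exists>T'\<in>FR U. adj T T'"
  by (elim FR_E) (force intro!: bexI[OF _ FR_I] adj_fr)

lemma FR_conj:
  assumes "T \<in> FR U" and S: "adj S S'" and R: "adj R R'"
    and "\<And>u. u \<in> U \<Longrightarrow> app S u \<in> U'" "\<And>u. u \<in> U \<Longrightarrow> app R' u \<in> U'"
  shows "S * T * R \<in> FR U'"
  using assms(1)
proof (rule FR_E)
  fix ps assume ps: "set ps \<subseteq> U \<times> U" and T: "T = fr ps"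
  show ?thesis unfolding T fr_conj[OF S R] using ps assms(4,5) by (intro FR_I) force
qed

lemma FR_subset_Kop: "T \<in> FR U \<Longrightarrow> T \<in> Kop U"
  unfolding Kop_def by (rule subsetD[OF closure_subset])

lemma closed_Kop: "closed (Kop U)"
  by (simp add: Kop_def)

lemma Kop_approx: "T \<in> Kop U \<Longrightarrow> 0 < e \<Longrightarrow> \<exists>D\<in>FR U. norm (T - D) < e"
  unfolding Kop_def closure_approachable by (metis dist_norm norm_minus_commute)

lemma Kop_seq: "T \<in> Kop U \<Longrightarrow> \<exists>D. (\<forall>n. D n \<in> FR U) \<and> D \<longlonglongrightarrow> T"
  unfolding Kop_def closure_sequential .

lemma Kop_lim: "(\<And>n. D n \<in> Kop U) \<Longrightarrow> D \<longlonglongrightarrow> T \<Longrightarrow> T \<in> Kop U"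
  by (rule closed_limit[OF closed_Kop])

lemma Kop_add:
  assumes "S \<in> Kop U" "T \<in> Kop U" shows "S + T \<in> Kop U"
proof -
  obtain D E where *: "\<And>n. D n \<in> FR U" "D \<longlonglongrightarrow> S" "\<And>n. E n \<in> FR U" "E \<longlonglongrightarrow> T"
    using Kop_seq[OF assms(1)] Kop_seq[OF assms(2)] by blast
  show ?thesis
    by (rule Kop_lim[OF _ tendsto_add[OF *(2,4)]]) (intro FR_subset_Kop FR_add *)
qed

lemma Kop_conj:
  assumes T: "T \<in> Kop U" and S: "adj S S'" and R: "adj R R'"
    and "\<And>u. u \<in> U \<Longrightarrow> app S u \<in> U'" "\<And>u. u \<in> U \<Longrightarrow> app R' u \<in> U'"
  shows "S * T * R \<in> Kop U'"
proof -
  obtain D where D: "\<And>n. D n \<in> FR U" "D \<longlonglongrightarrow> T" using Kop_seq[OF T] by blast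
  have "(\<lambda>n. S * D n * R) \<longlonglongrightarrow> S * T * R" by (intro tendsto_intros D)
  then show ?thesis
    by (rule Kop_lim[rotated]) (intro FR_subset_Kop FR_conj[OF D(1) S R] assms(4,5))
qed

lemma Kop_mult_left:
  assumes "T \<in> Kop U" "adj S S'" "\<And>u. u \<in> U \<Longrightarrow> app S u \<in> U"
  shows "S * T \<in> Kop U"
  using Kop_conj[OF assms(1,2) adj_1] assms(3) by simp

lemma Kop_mult_right:
  assumes "T \<in> Kop U" "adj R R'" "\<And>u. u \<in> U \<Longrightarrow> app R' u \<in> U"
  shows "T * R \<in> Kop U"
  using Kop_conj[OF assms(1) adj_1 assms(2)] assms(3) by simp

lemma Kop_mono: "U \<subseteq> U' \<Longrightarrow> Kop U \<subseteq> Kop U'"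
  unfolding Kop_def FR_def by (intro closure_mono image_mono) auto

text \<open>Adjoint operators have equal norms, so the adjoints of finite rank approximants form a
  Cauchy sequence again.\<close>

lemma Kop_adj:
  assumes "T \<in> Kop U" obtains T' where "T' \<in> Kop U" "adj T T'"
proof -
  obtain D where D: "\<And>n. D n \<in> FR U" "D \<longlonglongrightarrow> T" using Kop_seq[OF assms] by blast
  obtain D' where D': "\<And>n. D' n \<in> FR U" "\<And>n. adj (D n) (D' n)" using FR_adj[OF D(1)] by metis
  have "Cauchy D'"
  proof (rule metric_CauchyI)
    fix e :: real assume "e > 0"
    then obtain M where M: "\<And>m n. m \<ge> M \<Longrightarrow> n \<ge> M \<Longrightarrow> dist (D m) (D n) < e"
      using metric_CauchyD[OF LIMSEQ_imp_Cauchy[OF D(2)]] by blast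
    have "dist (D' m) (D' n) = dist (D m) (D n)" for m n
      using adj_norm[OF adj_diff[OF D'(2) D'(2)], of m n] by (simp add: dist_norm)
    then show "\<exists>M. \<forall>m\<ge>M. \<forall>n\<ge>M. dist (D' m) (D' n) < e" using M by (intro exI[of _ M]) simp
  qed
  then obtain T' where T': "D' \<longlonglongrightarrow> T'" using convergent_eq_Cauchy by blast
  show ?thesis
  proof (rule that)
    show "T' \<in> Kop U" by (rule Kop_lim[OF FR_subset_Kop[OF D'(1)] T'])
    show "adj T T'" by (rule adj_lim[OF D(2) T' D'(2)])
  qed
qed

definition submod :: "'h set \<Rightarrow> bool" where
  "submod U \<longleftrightarrow> subspace U \<and> closed U \<and> (\<forall>x\<in>U. \<forall>a. act x a \<in> U)"

lemma submod_simps: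
  assumes "submod U"
  shows "0 \<in> U" "x \<in> U \<Longrightarrow> y \<in> U \<Longrightarrow> x + y \<in> U" "x \<in> U \<Longrightarrow> y \<in> U \<Longrightarrow> x - y \<in> U"
    "x \<in> U \<Longrightarrow> r *\<^sub>R x \<in> U" "x \<in> U \<Longrightarrow> act x a \<in> U" "closed U"
  using assms by (simp_all add: submod_def subspace_def subspace_diff)

lemma Kop_scaleR:
  assumes "T \<in> Kop U" "submod U" shows "r *\<^sub>R T \<in> Kop U"
  using Kop_mult_left[OF assms(1) adj_scaleR[OF adj_1]] submod_simps(4)[OF assms(2)]
  by (simp add: app_lin)

lemma Kop_minus: "T \<in> Kop U \<Longrightarrow> submod U \<Longrightarrow> - T \<in> Kop U"
  using Kop_scaleR[of T U "-1"] by simp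

lemma Kop_diff: "S \<in> Kop U \<Longrightarrow> T \<in> Kop U \<Longrightarrow> submod U \<Longrightarrow> S - T \<in> Kop U"
  using Kop_add[of S U "- T"] Kop_minus by simp

lemma Kop_0: "0 \<in> Kop U"
  by (rule FR_subset_Kop[OF FR_0])

lemma Kop_subspace: "submod U \<Longrightarrow> subspace (Kop U)"
  by (simp add: subspace_def Kop_0 Kop_add Kop_scaleR)

lemma FR_range:
  assumes "T \<in> FR U" "submod U" shows "app T x \<in> U"
  using assms(1)
proof (rule FR_E)
  fix ps assume ps: "set ps \<subseteq> U \<times> U" and T: "T = fr ps"
  from ps have "app (fr ps) x \<in> U"
    by (induction ps) (auto simp: app_lin submod_simps[OF assms(2)])
  then show ?thesis using T by simp
qed

lemma Kop_range:
  assumes "T \<in> Kop U" "submod U" shows "app T x \<in> U"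
proof -
  obtain D where D: "\<And>n. D n \<in> FR U" "D \<longlonglongrightarrow> T" using Kop_seq[OF assms(1)] by blast
  show ?thesis
    by (rule closed_limit[OF submod_simps(6)[OF assms(2)] FR_range[OF D(1) assms(2)]
        app.tendsto[OF D(2) tendsto_const]])
qed

lemma Kop_mult:
  assumes "S \<in> Kop U" "T \<in> Kop U" "submod U" shows "S * T \<in> Kop U"
  using assms(1) by (rule Kop_adj) (rule Kop_mult_left[OF assms(2) _ Kop_range[OF assms(1,3)]])

text \<open>\<open>D\<close> and its adjoint both have their range in \<open>U\<close>. The bound
  for \<open>D\<close> on \<open>U\<close> therefore gives the same bound for the adjoint on
  \<open>U\<close>, and this one gives the bound for \<open>D\<close> on the whole space.\<close>

lemma FR_norm_le:
  assumes D: "D \<in> FR U" and U: "submod U" and "0 \<le> d"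
    and bd: "\<And>x. x \<in> U \<Longrightarrow> norm (app D x) \<le> d * norm x"
  shows "norm D \<le> d"
proof -
  obtain D' where D': "D' \<in> FR U" "adj D D'" using FR_adj[OF D] by blast
  have bd': "norm (app D' y) \<le> d * norm y" if y: "y \<in> U" for y
  proof (rule le_of_square_le_mult)
    have "(norm (app D' y))\<^sup>2 = norm (ip y (app D (app D' y)))"
      by (simp only: ip_norm[symmetric] adjD[OF adj_sym[OF D'(2)]])
    also have "\<dots> \<le> norm y * norm (app D (app D' y))" by (rule ip_CS)
    also have "\<dots> \<le> norm y * (d * norm (app D' y))"
      by (intro mult_left_mono bd FR_range[OF D'(1) U] norm_ge_zero)
    finally show "(norm (app D' y))\<^sup>2 \<le> d * norm y * norm (app D' y)" by (simp add: mult_ac)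
  qed (use assms(3) in simp_all)
  show ?thesis
  proof (rule norm_endo_bound[OF assms(3)], rule le_of_square_le_mult)
    fix x
    have "(norm (app D x))\<^sup>2 = norm (ip x (app D' (app D x)))"
      by (simp only: ip_norm[symmetric] adjD[OF D'(2)])
    also have "\<dots> \<le> norm x * norm (app D' (app D x))" by (rule ip_CS)
    also have "\<dots> \<le> norm x * (d * norm (app D x))"
      by (intro mult_left_mono bd' FR_range[OF D U] norm_ge_zero)
    finally show "(norm (app D x))\<^sup>2 \<le> d * norm x * norm (app D x)" by (simp add: mult_ac)
  qed (use assms(3) in simp_all)
qed

lemma FR_diff: "S \<in> FR U \<Longrightarrow> T \<in> FR U \<Longrightarrow> submod U \<Longrightarrow> S - T \<in> FR U"
  using FR_add[of S U "(- 1) *\<^sub>R 1 * T * 1"]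
    FR_conj[of T U "(- 1) *\<^sub>R 1" "(- 1) *\<^sub>R 1" 1 1 U] submod_simps(4)[of U _ "-1"]
  by (simp add: adj_minus app_lin)

text \<open>A compact operator of a module is given only as a map on \<open>U\<close>. Its finite
  rank approximants are close to each other on \<open>U\<close>, hence by \<open>FR_norm_le\<close>
  everywhere, and their limit on the ambient space extends the given map.\<close>

lemma Kop_extend:
  assumes U: "submod U"
    and ap: "\<And>e. e > 0 \<Longrightarrow> \<exists>D\<in>FR U. \<forall>x\<in>U. norm (app D x - \<tau> x) \<le> e * norm x"
  obtains T where "T \<in> Kop U" "\<And>x. x \<in> U \<Longrightarrow> app T x = \<tau> x"
proof -
  have "\<exists>D\<in>FR U. \<forall>x\<in>U. norm (app D x - \<tau> x) \<le> (1 / real (Suc n)) * norm x" for n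
    by (rule ap) simp
  then obtain D where D: "\<And>n. D n \<in> FR U"
    "\<And>n x. x \<in> U \<Longrightarrow> norm (app (D n) x - \<tau> x) \<le> (1 / real (Suc n)) * norm x"
    by metis
  have le: "norm (D m - D n) \<le> 1 / real (Suc m) + 1 / real (Suc n)" for m n
  proof (rule FR_norm_le[OF FR_diff[OF D(1) D(1) U] U])
    fix x assume x: "x \<in> U"
    have "norm (app (D m - D n) x) = norm ((app (D m) x - \<tau> x) - (app (D n) x - \<tau> x))"
      by (simp add: app_lin)
    also have "\<dots> \<le> norm (app (D m) x - \<tau> x) + norm (app (D n) x - \<tau> x)"
      by (rule norm_triangle_ineq4)
    finally show "norm (app (D m - D n) x) \<le> (1 / real (Suc m) + 1 / real (Suc n)) * norm x"
      using D(2)[OF x, of m] D(2)[OF x, of n] by (simp add: distrib_right)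
  qed simp
  have "Cauchy D"
  proof (rule metric_CauchyI)
    fix e :: real assume "e > 0"
    then obtain M where M: "1 / real (Suc M) < e / 2"
      using nat_approx_posE[of "e / 2"] by auto
    have small: "1 / real (Suc n) < e / 2" if "n \<ge> M" for n
    proof -
      have "1 / real (Suc n) \<le> 1 / real (Suc M)" using that by (intro divide_left_mono) auto
      then show ?thesis using M by simp
    qed
    have "dist (D m) (D n) < e" if "m \<ge> M" "n \<ge> M" for m n
      using le[of m n] small[OF that(1)] small[OF that(2)] by (simp add: dist_norm)
    then show "\<exists>M. \<forall>m\<ge>M. \<forall>n\<ge>M. dist (D m) (D n) < e" by blast
  qed
  then obtain T where T: "D \<longlonglongrightarrow> T" using convergent_eq_Cauchy by blast
  show ?thesis
  proof (rule that)
    show "T \<in> Kop U" by (rule Kop_lim[OF FR_subset_Kop[OF D(1)] T])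
    fix x assume x: "x \<in> U"
    have "(\<lambda>n. app (D n) x - \<tau> x) \<longlonglongrightarrow> 0"
    proof (rule Lim_null_comparison)
      show "\<forall>\<^sub>F n in sequentially. norm (app (D n) x - \<tau> x) \<le> (1 / real (Suc n)) * norm x"
        using D(2)[OF x] by simp
      show "(\<lambda>n. (1 / real (Suc n)) * norm x) \<longlonglongrightarrow> 0"
        using tendsto_mult_left_zero[OF LIMSEQ_inverse_real_of_nat, of "norm x"]
        by (simp add: inverse_eq_divide)
    qed
    moreover have "(\<lambda>n. app (D n) x - \<tau> x) \<longlonglongrightarrow> app T x - \<tau> x"
      by (intro tendsto_diff app.tendsto T tendsto_const)
    ultimately show "app T x = \<tau> x" using LIMSEQ_unique by fastforce
  qed
qed

subsection \<open>Bump functions of a self-adjoint operator\<close>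

text \<open>With \<open>r = \<bar>b\<bar>\<close> for \<open>b = c(T - 1/2)\<close>, the functions \<open>k = (r + b)/c\<close> and \<open>1 - g = (r - b)/c\<close> have
  product zero; \<open>k\<close> takes the value 1 at \<open>T = 1\<close>, and both \<open>g\<close> and \<open>k\<close> vanish at \<open>T = 0\<close>.\<close>

lemma bump:
  assumes T: "adj T T" "T \<in> S" and S: "subspace S" "closed S" "\<And>a b. a \<in> S \<Longrightarrow> b \<in> S \<Longrightarrow> a * b \<in> S"
  obtains g k where "adj g g" "adj k k" "g \<in> S" "k \<in> S" "g * k = k"
    "\<forall>Z. subspace Z \<and> closed Z \<and> app T ` Z \<subseteq> Z \<longrightarrow> (\<forall>x. app T x - x \<in> Z \<longrightarrow> app k x - x \<in> Z)"
proof -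
  \<comment> \<open>Chosen to give \<open>norm b \<le> 1\<close>, which
    \<open>norm_one_minus_square\<close> requires.\<close>
  define c where "c = 1 / (norm T + 1)"
  have nT: "norm T + 1 > 0" by (rule add_nonneg_pos) simp_all
  then have c: "0 < c" "c \<le> 1" by (simp_all add: c_def divide_le_eq_1)
  define b where "b = c *\<^sub>R (T - (1/2) *\<^sub>R 1)"
  have b: "adj b b" unfolding b_def by (intro adj_scaleR adj_diff T adj_1)
  have "norm (T - (1/2) *\<^sub>R 1) \<le> norm T + (1/2) * 1"
    using norm_triangle_ineq4[of T "(1/2) *\<^sub>R 1"] norm_one_endo[where 'a='h] by simp
  then have "norm (T - (1/2) *\<^sub>R 1) \<le> norm T + 1" by simp
  then have "norm b \<le> c * (norm T + 1)"
    using c(1) unfolding b_def norm_scaleR by (intro mult_mono) auto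
  also have "\<dots> = 1" using nT by (simp add: c_def)
  finally have nb: "norm b \<le> 1" .
  define y where "y = 1 - b * b"
  have ny: "norm y \<le> 1" unfolding y_def by (rule norm_one_minus_square[OF b nb])
  have ay: "adj y y" unfolding y_def by (intro adj_diff adj_1 adj_mult b)
  define r where "r = 1 - sqo y"
  have ar: "adj r r" unfolding r_def by (intro adj_diff adj_1 adj_sqo ay ny)
  have rr: "r * r = b * b" using sqo_square[OF ny] by (simp add: r_def y_def)
  have "b * sqo y = sqo y * b"
    by (rule sqo_commute[OF ny]) (simp add: y_def algebra_simps)
  then have br: "b * r = r * b" by (simp add: r_def algebra_simps)
  \<comment> \<open>The common value of \<open>y = 1 - b * b\<close> at T = 0 and T = 1, where
    \<open>b\<close> is -c/2 and c/2. Accordingly \<open>r\<close> takes the value c/2 at both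
    points.\<close>
  define \<eta> where "\<eta> = 1 - c\<^sup>2 / 4"
  have c2: "c\<^sup>2 \<le> 1" using c by (simp add: power_le_one)
  have \<eta>: "0 \<le> \<eta>" "\<eta> \<le> 1" "norm \<eta> \<le> 1" using c2 by (simp_all add: \<eta>_def)
  have "sqo \<eta> = 1 - sqrt ((c / 2)\<^sup>2)"
    unfolding sqo_real[OF \<eta>(1,2)] by (simp add: \<eta>_def power_divide)
  then have s\<eta>: "sqo \<eta> = 1 - c / 2" using c(1) by simp
  define k where "k = (1/c) *\<^sub>R (r + b)"
  define g where "g = 1 - (1/c) *\<^sub>R (r - b)"
  note sub = subspace_add[OF S(1)] subspace_diff[OF S(1)] subspace_scale[OF S(1)] subspace_0[OF S(1)]
  \<comment> \<open>\<open>S\<close> need not contain the unit. Each function of \<open>T\<close> is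
    split into its scalar value at 0 and a remainder in \<open>S\<close>; the splitting is carried
    through the iteration and its limit.\<close>
  have y\<eta>: "y - \<eta> *\<^sub>R 1 \<in> S"
  proof -
    have "y - \<eta> *\<^sub>R 1 = c\<^sup>2 *\<^sub>R (T - T * T)"
      by (simp add: y_def \<eta>_def b_def algebra_simps power2_eq_square)
        (simp add: scaleR_left.diff[symmetric] scaleR_left.add[symmetric] field_simps)
    then show ?thesis using T(2) by (simp add: sub S(3))
  qed
  have sS: "sqi y n - sqi \<eta> n *\<^sub>R 1 \<in> S" for n
  proof (induction n)
    case (Suc n)
    let ?A = "sqi y n - sqi \<eta> n *\<^sub>R 1"
    have "sqi y (Suc n) - sqi \<eta> (Suc n) *\<^sub>R 1
        = (1/2) *\<^sub>R ((y - \<eta> *\<^sub>R 1) + (?A * ?A + (2 * sqi \<eta> n) *\<^sub>R ?A))"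
      by (simp add: algebra_simps scaleR_2[symmetric])
    then show ?case using Suc y\<eta> by (simp add: sub S(3))
  qed (simp add: sub)
  have "sqo y - sqo \<eta> *\<^sub>R 1 \<in> S"
    by (rule closed_limit[OF S(2), of "\<lambda>n. sqi y n - sqi \<eta> n *\<^sub>R 1", OF sS])
      (intro tendsto_diff tendsto_scaleR tendsto_const sqo_lim[OF ny] sqo_lim[OF \<eta>(3)])
  then have "(1 - c / 2) *\<^sub>R 1 - sqo y \<in> S" using sub(3)[of _ "-1"] s\<eta> by fastforce
  then have rS: "r - (c / 2) *\<^sub>R 1 \<in> S" by (simp add: r_def algebra_simps)
  show ?thesis
  proof (rule that[of g k])
    show "adj g g" unfolding g_def by (intro adj_diff adj_1 adj_scaleR ar b)
    show "adj k k" unfolding k_def by (intro adj_scaleR adj_add ar b)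
    have "k = (1/c) *\<^sub>R ((r - (c / 2) *\<^sub>R 1) + c *\<^sub>R T)"
      by (simp add: k_def b_def algebra_simps)
    then show "k \<in> S" using rS T(2) by (simp add: sub)
    have "g = (1/c) *\<^sub>R (c *\<^sub>R T - (r - (c / 2) *\<^sub>R 1))"
      using c by (simp add: g_def b_def algebra_simps scaleR_left.add[symmetric])
    then show "g \<in> S" using rS T(2) by (simp add: sub)
    have "(r - b) * (r + b) = 0" by (simp add: algebra_simps rr br)
    then show "g * k = k" by (simp add: g_def k_def left_diff_distrib)
  next
    \<comment> \<open>Calculus modulo an invariant closed subspace: if \<open>x\<close> is an
      eigenvector of \<open>T\<close> for the value 1 modulo \<open>Z\<close>, then each iterate
      acts on \<open>x\<close> as its scalar counterpart at \<eta>, modulo \<open>Z\<close>. With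
      \<open>Z = {0}\<close> this says that \<open>k\<close> fixes what \<open>T\<close> fixes; with
      the kernel of a quotient map it says so modulo an ideal.\<close>
    show "\<forall>Z. subspace Z \<and> closed Z \<and> app T ` Z \<subseteq> Z \<longrightarrow> (\<forall>x. app T x - x \<in> Z \<longrightarrow> app k x - x \<in> Z)"
    proof (intro allI impI, elim conjE)
      fix Z x
      assume Z: "subspace Z" "closed Z" and TZ': "app T ` Z \<subseteq> Z" and x: "app T x - x \<in> Z"
      have TZ: "app T z \<in> Z" if "z \<in> Z" for z using TZ' that by blast
      note subZ = subspace_add[OF Z(1)] subspace_diff[OF Z(1)] subspace_scale[OF Z(1)] subspace_0[OF Z(1)]
      have bZ: "app b z \<in> Z" if "z \<in> Z" for z
        using that TZ by (simp add: b_def app_lin subZ)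
      have yZ: "app y z \<in> Z" if "z \<in> Z" for z
        using that bZ by (simp add: y_def app_lin subZ)
      have bx: "app b x - (c / 2) *\<^sub>R x \<in> Z"
      proof -
        have "app b x - (c / 2) *\<^sub>R x = c *\<^sub>R (app T x - x)"
          by (simp add: b_def app_lin algebra_simps scaleR_left.add[symmetric])
        then show ?thesis using x by (simp add: subZ)
      qed
      have yx: "app y x - \<eta> *\<^sub>R x \<in> Z"
      proof -
        have "app y x - \<eta> *\<^sub>R x = (- 1) *\<^sub>R (app b (app b x - (c / 2) *\<^sub>R x) + (c / 2) *\<^sub>R (app b x - (c / 2) *\<^sub>R x))"
          by (simp add: y_def \<eta>_def app_lin algebra_simps power2_eq_square)
        then show ?thesis using bx bZ by (simp only: subZ)
      qed
      have "(\<forall>z\<in>Z. app (sqi y n) z \<in> Z) \<and> app (sqi y n) x - sqi \<eta> n *\<^sub>R x \<in> Z" for n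
      proof (induction n)
        case 0
        show ?case by (simp add: app_lin subZ)
      next
        case (Suc n)
        let ?s = "sqi y n"
        let ?v = "app ?s x - sqi \<eta> n *\<^sub>R x"
        have "app (sqi y (Suc n)) x - sqi \<eta> (Suc n) *\<^sub>R x
            = (1/2) *\<^sub>R ((app y x - \<eta> *\<^sub>R x) + (app ?s ?v + sqi \<eta> n *\<^sub>R ?v))"
          by (simp add: app_lin algebra_simps)
        moreover have "(1/2) *\<^sub>R ((app y x - \<eta> *\<^sub>R x) + (app ?s ?v + sqi \<eta> n *\<^sub>R ?v)) \<in> Z"
          by (intro subZ(1,3)) (use Suc yx in auto)
        moreover have "\<forall>z\<in>Z. app (sqi y (Suc n)) z \<in> Z"
          using Suc yZ by (simp add: app_lin subZ)
        ultimately show ?case by simp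
      qed
      then have *: "app (sqi y n) x - sqi \<eta> n *\<^sub>R x \<in> Z" for n by blast
      have "app (sqo y) x - sqo \<eta> *\<^sub>R x \<in> Z"
        by (rule closed_limit[OF Z(2), of "\<lambda>n. app (sqi y n) x - sqi \<eta> n *\<^sub>R x", OF *])
          (intro tendsto_diff tendsto_scaleR tendsto_const app.tendsto sqo_lim[OF ny] sqo_lim[OF \<eta>(3)])
      then have "(1/c) *\<^sub>R ((app b x - (c / 2) *\<^sub>R x) - (app (sqo y) x - sqo \<eta> *\<^sub>R x)) \<in> Z"
        by (rule subZ(3)[OF subZ(2)[OF bx]])
      also have "(1/c) *\<^sub>R ((app b x - (c / 2) *\<^sub>R x) - (app (sqo y) x - sqo \<eta> *\<^sub>R x)) = app k x - x"
        using c by (simp add: k_def r_def s\<eta> app_lin algebra_simps scaleR_left.add[symmetric])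
      finally show "app k x - x \<in> Z" .
    qed
  qed
qed

subsection \<open>The operator \<open>(1 + D\<^sup>*D)\<close>\<close>

text \<open>As a = D'D is positive, 1 + a is (1 + t)(1 - y) with the norm of y at most t/(1 + t) <
  1, and the Neumann series inverts it. For the two bounds put x = w + a w: then the inner square of
  x is that of w, plus twice that of D w, plus that of a w, and each summand is dominated in norm by
  the sum.\<close>

lemma one_plus_inverse:
  assumes D: "adj D D'"
  obtains B where "B * (1 + D' * D) = 1" "(1 + D' * D) * B = 1" "adj B B" "norm B \<le> 1" "norm (D * B) \<le> 1"
proof -
  define a where "a = D' * D"
  have a: "adj a a" unfolding a_def by (rule adj_mult[OF adj_sym[OF D] D])
  have "psd a" unfolding a_def by (rule psd_adj_mult[OF D])
  then obtain t where t: "t \<ge> 0" "norm (t *\<^sub>R 1 - a) \<le> t" by (auto simp: psd_def)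
  define y where "y = (1 / (1 + t)) *\<^sub>R (t *\<^sub>R 1 - a)"
  have "norm y = norm (t *\<^sub>R 1 - a) / (1 + t)" using t(1) by (simp add: y_def)
  also have "\<dots> \<le> t / (1 + t)" using t by (intro divide_right_mono) auto
  also have "\<dots> < 1" using t(1) by simp
  finally obtain z where z: "z * (1 - y) = 1" "(1 - y) * z = 1" by (rule neumann)
  define B where "B = (1 / (1 + t)) *\<^sub>R z"
  have "(1 + t) *\<^sub>R y = t *\<^sub>R 1 - a" using t(1) by (simp add: y_def)
  then have ya: "(1 + t) *\<^sub>R (1 - y) = 1 + a" by (simp add: scaleR_diff_right scaleR_left.add)
  have B: "B * (1 + a) = 1" "(1 + a) * B = 1"
    unfolding B_def ya[symmetric] using t(1) z by simp_all
  have adjB: "adj B B"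
    unfolding adj_def
  proof (intro allI)
    fix x w
    have "ip (app B x) w = ip (app B x) (app ((1 + a) * B) w)" by (simp add: B(2))
    also have "\<dots> = ip (app (1 + a) (app B x)) (app B w)"
      using adjD[OF adj_add[OF adj_1 a]] by simp
    also have "app (1 + a) (app B x) = x"
      using B(2) by (metis app_simps)
    finally show "ip (app B x) w = ip x (app B w)" .
  qed
  have est: "norm (app B x) \<le> norm x \<and> norm (app D (app B x)) \<le> norm x" for x
  proof -
    define w where "w = app B x"
    have x: "x = w + app a w"
      using B(2) unfolding w_def by (metis app_simps app.add_left)
    have aw: "ip w (app a w) = ip (app D w) (app D w)" "ip (app a w) w = ip (app D w) (app D w)"
      using adjD[OF D, of w "app D w"] adjD[OF a, of w w] by (simp_all add: a_def)
    have e: "ip x x = ip w w + (2 *\<^sub>R ip (app D w) (app D w) + ip (app a w) (app a w))"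
      unfolding x by (simp add: ip.add_left ip.add_right aw scaleR_2)
    have "norm (ip w w) \<le> norm (ip x x)"
      unfolding e by (intro pos_norm_mono pos_add pos_scaleR ip_pos) simp
    then have 1: "(norm w)\<^sup>2 \<le> (norm x)\<^sup>2" by (simp only: ip_norm)
    have "norm (2 *\<^sub>R ip (app D w) (app D w)) \<le> norm (ip x x)"
    proof -
      have "ip x x = 2 *\<^sub>R ip (app D w) (app D w) + (ip w w + ip (app a w) (app a w))"
        unfolding e by (simp add: algebra_simps)
      then show ?thesis by (simp only:) (intro pos_norm_mono pos_add pos_scaleR ip_pos, simp)
    qed
    then have "2 * (norm (app D w))\<^sup>2 \<le> (norm x)\<^sup>2" by (simp add: ip_norm)
    moreover have "0 \<le> (norm (app D w))\<^sup>2" by simp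
    ultimately have 2: "(norm (app D w))\<^sup>2 \<le> (norm x)\<^sup>2" by linarith
    show ?thesis using power2_le_imp_le[OF 1] power2_le_imp_le[OF 2] by (simp add: w_def)
  qed
  show ?thesis
  proof (rule that[of B])
    show "norm B \<le> 1" "norm (D * B) \<le> 1"
      using est by (auto intro!: norm_endo_bound)
  qed (use B adjB in \<open>simp_all add: a_def\<close>)
qed

text \<open>\<open>W\<close> is (1 + K)(1 - K)^(-1), expanded by 1 + K so that the only inverse
  needed is that of 1 - K^2. Since the adjoint of \<open>K\<close> is \<open>- K\<close>, this is
  one plus the adjoint of \<open>K\<close> times \<open>K\<close>, which
  \<open>one_plus_inverse\<close> covers.\<close>

lemma cayley:
  assumes K: "adj K (- K)"
  obtains W W' B where "adj W W'" "W * W' = 1" "W' * W = 1" "W = (1 + K) * (1 + K) * B"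
    "B * (1 - K * K) = 1" "adj B B"
proof -
  obtain B where B: "B * (1 + - K * K) = 1" "(1 + - K * K) * B = 1" "adj B B"
    using one_plus_inverse[OF K] by metis
  have BK2: "B * (1 - K * K) = 1" "(1 - K * K) * B = 1" using B(1,2) by simp_all
  have BK: "B * K = K * B"
  proof -
    have "B * K = B * (K * ((1 - K * K) * B))" by (simp add: BK2)
    also have "\<dots> = B * (1 - K * K) * (K * B)" by (simp add: algebra_simps)
    also have "\<dots> = K * B" by (simp add: BK2)
    finally show ?thesis .
  qed
  let ?W = "(1 + K) * (1 + K) * B" and ?W' = "(1 - K) * (1 - K) * B"
  have c1: "B * (1 - K) = (1 - K) * B" "B * (1 + K) = (1 + K) * B"
    by (simp_all add: algebra_simps BK)
  have c2: "(1 + K) * (1 - K) = 1 - K * K" "(1 - K) * (1 + K) = 1 - K * K"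
    by (simp_all add: algebra_simps)
  show ?thesis
  proof (rule that[of ?W ?W' B])
    have p: "adj (1 + K) (1 - K)" using adj_add[OF adj_1 K] by simp
    have "adj ?W (B * ((1 - K) * (1 - K)))" by (rule adj_mult[OF adj_mult[OF p p] B(3)])
    also have "B * ((1 - K) * (1 - K)) = ?W'" by (metis c1(1) mult.assoc)
    finally show "adj ?W ?W'" .
    have "?W * ?W' = (1 + K) * (1 + K) * ((B * (1 - K)) * (1 - K)) * B" by (simp only: mult.assoc)
    also have "\<dots> = (1 + K) * ((1 + K) * (1 - K)) * (B * (1 - K)) * B" by (simp only: c1 mult.assoc)
    also have "\<dots> = (1 + K) * ((1 - K * K) * ((1 - K) * (B * B)))" by (simp only: c1 c2 mult.assoc)
    also have "(1 - K * K) * ((1 - K) * (B * B)) = (1 - K) * ((1 - K * K) * (B * B))"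
      by (simp add: algebra_simps)
    also have "(1 - K * K) * (B * B) = B" by (simp only: mult.assoc[symmetric] BK2) simp
    also have "(1 + K) * ((1 - K) * B) = 1" by (simp only: mult.assoc[symmetric] c2 BK2)
    finally show "?W * ?W' = 1" .
    have "?W' * ?W = (1 - K) * (1 - K) * ((B * (1 + K)) * (1 + K)) * B" by (simp only: mult.assoc)
    also have "\<dots> = (1 - K) * ((1 - K) * (1 + K)) * (B * (1 + K)) * B" by (simp only: c1 mult.assoc)
    also have "\<dots> = (1 - K) * ((1 - K * K) * ((1 + K) * (B * B)))" by (simp only: c1 c2 mult.assoc)
    also have "(1 - K * K) * ((1 + K) * (B * B)) = (1 + K) * ((1 - K * K) * (B * B))"
      by (simp add: algebra_simps)
    also have "(1 - K * K) * (B * B) = B" by (simp only: mult.assoc[symmetric] BK2) simp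
    also have "(1 - K) * ((1 + K) * B) = 1" by (simp only: mult.assoc[symmetric] c2 BK2)
    finally show "?W' * ?W = 1" .
  qed (use BK2 B(3) in simp_all)
qed

end

subsection \<open>The distance to a subspace\<close>

lemma infdist_less: "S \<noteq> {} \<Longrightarrow> infdist x S < d \<Longrightarrow> \<exists>s\<in>S. dist x s < d"
  unfolding infdist_def by (auto simp: cINF_less_iff[OF _ bdd_below_image_dist] split: if_splits)

context
  fixes S :: "'a::real_normed_vector set"
  assumes S: "subspace S"
begin

lemma infdist_sub_less: "infdist x S < d \<Longrightarrow> \<exists>s\<in>S. norm (x - s) < d"
  using infdist_less[of S x d] subspace_0[OF S] by (auto simp: dist_norm)

lemma infdist_sub_le: "s \<in> S \<Longrightarrow> infdist x S \<le> norm (x - s)"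
  using infdist_le[of s S x] by (simp add: dist_norm)

lemma infdist_sub_norm: "infdist x S \<le> norm x"
  using infdist_sub_le[of 0 x] subspace_0[OF S] by simp

lemma infdist_sub_leI:
  assumes "\<And>e. e > 0 \<Longrightarrow> infdist x S \<le> b + e" shows "infdist x S \<le> b"
  using assms by (rule field_le_epsilon)

lemma infdist_sub_add: "infdist (x + y) S \<le> infdist x S + infdist y S"
proof (rule infdist_sub_leI)
  fix e :: real assume "e > 0"
  then have "infdist x S < infdist x S + e / 2" "infdist y S < infdist y S + e / 2" by auto
  then obtain s t where s: "s \<in> S" "norm (x - s) < infdist x S + e / 2"
    and t: "t \<in> S" "norm (y - t) < infdist y S + e / 2"
    using infdist_sub_less by metis
  have "infdist (x + y) S \<le> norm ((x + y) - (s + t))"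
    by (rule infdist_sub_le[OF subspace_add[OF S s(1) t(1)]])
  also have "\<dots> = norm ((x - s) + (y - t))" by (simp add: algebra_simps)
  also have "\<dots> \<le> norm (x - s) + norm (y - t)" by (rule norm_triangle_ineq)
  finally show "infdist (x + y) S \<le> infdist x S + infdist y S + e" using s t by simp
qed

lemma infdist_sub_0: "s \<in> S \<Longrightarrow> infdist s S = 0"
  using infdist_sub_le[of s s] infdist_nonneg[of s S] by simp

lemma infdist_sub_map:
  assumes f: "\<And>x y. f (x - y) = f x - f y" "\<And>s. s \<in> S \<Longrightarrow> f s \<in> S"
    and bd: "\<And>x. norm (f x) \<le> b * norm x" and b: "0 \<le> b"
  shows "infdist (f x) S \<le> b * infdist x S"
proof (rule infdist_sub_leI)
  fix e :: real assume e: "e > 0"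
  define d where "d = e / (b + 1)"
  have d: "d > 0" "b * d \<le> e" using e b by (simp_all add: d_def field_simps)
  then obtain s where s: "s \<in> S" "norm (x - s) < infdist x S + d"
    using infdist_sub_less[of x "infdist x S + d"] by auto
  have "infdist (f x) S \<le> norm (f x - f s)" by (rule infdist_sub_le[OF f(2)[OF s(1)]])
  also have "\<dots> \<le> b * norm (x - s)" using bd[of "x - s"] f(1) by simp
  also have "\<dots> \<le> b * (infdist x S + d)" using s b by (intro mult_left_mono) auto
  finally show "infdist (f x) S \<le> b * infdist x S + e" using d(2) by (simp add: distrib_left)
qed

lemma infdist_sub_scaleR: "infdist (r *\<^sub>R x) S \<le> \<bar>r\<bar> * infdist x S"
  by (rule infdist_sub_map) (auto simp: scaleR_diff_right subspace_scale[OF S])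

lemma infdist_sub_minus: "infdist (- x) S = infdist x S"
  using infdist_sub_scaleR[of "-1" x] infdist_sub_scaleR[of "-1" "- x"] by simp

lemma infdist_sub_diff: "infdist (x - y) S \<le> infdist x S + infdist y S"
  using infdist_sub_add[of x "- y"] by (simp add: infdist_sub_minus)

lemma infdist_sub_shift: "s \<in> S \<Longrightarrow> infdist (x + s) S = infdist x S"
  using infdist_sub_add[of x s] infdist_sub_add[of "x + s" "- s"]
  by (simp add: infdist_sub_0 subspace_neg[OF S])

lemma infdist_sub_cong: "x - y \<in> S \<Longrightarrow> infdist x S = infdist y S"
  using infdist_sub_shift[of "x - y" y] by simp

lemma infdist_sub_eq_0: "closed S \<Longrightarrow> infdist x S = 0 \<longleftrightarrow> x \<in> S"
  using in_closed_iff_infdist_zero[of S x] subspace_0[OF S] by auto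

end

text \<open>Completeness of the quotient by \<open>S\<close>, stated with representatives. Along a
  fast subsequence each increment is corrected by an element of \<open>S\<close> to have small norm;
  the corrected series converges absolutely, and its sum differs from the subsequence only by
  elements of \<open>S\<close>.\<close>

lemma infdist_complete:
  fixes X :: "nat \<Rightarrow> 'a::banach"
  assumes S: "subspace S"
    and C: "\<And>e. e > 0 \<Longrightarrow> \<exists>K. \<forall>m\<ge>K. \<forall>n\<ge>K. infdist (X m - X n) S < e"
  obtains x where "(\<lambda>n. infdist (X n - x) S) \<longlonglongrightarrow> 0"
proof -
  have "\<exists>K. \<forall>m\<ge>K. \<forall>n\<ge>K. infdist (X m - X n) S < (1/2) ^ k" for k
    by (rule C) simp
  then obtain K where K: "\<And>k m n. m \<ge> K k \<Longrightarrow> n \<ge> K k \<Longrightarrow> infdist (X m - X n) S < (1/2) ^ k"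
    by metis
  \<comment> \<open>Summing the thresholds puts both \<open>r k\<close> and \<open>r (Suc k)\<close>
    beyond \<open>K k\<close>, which is what the estimate of the k-th increment needs.\<close>
  define r where "r k = (\<Sum>i\<le>k. K i)" for k
  have rK: "K k \<le> r k" "K k \<le> r (Suc k)" for k
    unfolding r_def by (auto intro: member_le_sum trans_le_add1)
  have "\<exists>s\<in>S. norm ((X (r (Suc k)) - X (r k)) - s) < (1/2) ^ k" for k
    by (rule infdist_sub_less[OF S K[OF rK(2) rK(1)]])
  then obtain s where s: "\<And>k. s k \<in> S" "\<And>k. norm ((X (r (Suc k)) - X (r k)) - s k) < (1/2) ^ k"
    by metis
  define Y where "Y k = (X (r (Suc k)) - X (r k)) - s k" for k
  have sm: "summable Y"
    by (rule summable_comparison_test'[of "\<lambda>k. (1/2) ^ k" 0])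
      (use s(2) in \<open>auto simp: Y_def summable_geometric less_imp_le\<close>)
  define x where "x = X (r 0) + suminf Y"
  have sub: "(\<Sum>i<k. Y i) = X (r k) - X (r 0) - (\<Sum>i<k. s i)" for k
    by (induction k) (simp_all add: Y_def)
  have near: "infdist (X (r k) - x) S \<le> norm ((\<Sum>i<k. Y i) - suminf Y)" for k
  proof -
    have "(X (r k) - x) - ((\<Sum>i<k. Y i) - suminf Y) = (\<Sum>i<k. s i)"
      by (simp add: sub x_def)
    moreover have "(\<Sum>i<k. s i) \<in> S" by (intro subspace_sum[OF S] s)
    ultimately have "infdist (X (r k) - x) S = infdist ((\<Sum>i<k. Y i) - suminf Y) S"
      by (intro infdist_sub_cong[OF S]) simp
    then show ?thesis using infdist_sub_norm[OF S] by simp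
  qed
  have "(\<lambda>k. (\<Sum>i<k. Y i) - suminf Y) \<longlonglongrightarrow> 0"
    using summable_LIMSEQ[OF sm] by (rule LIM_zero)
  then have lim: "(\<lambda>k. norm ((\<Sum>i<k. Y i) - suminf Y)) \<longlonglongrightarrow> 0"
    by (rule tendsto_norm_zero)
  show ?thesis
  proof (rule that[of x], rule LIMSEQ_I)
    fix e :: real assume e: "e > 0"
    obtain k1 where k1: "\<And>k. k \<ge> k1 \<Longrightarrow> norm ((\<Sum>i<k. Y i) - suminf Y) < e / 2"
      using LIMSEQ_D[OF lim, of "e / 2"] e by auto
    obtain k2 where k2: "(1/2::real) ^ k2 < e / 2"
      using real_arch_pow_inv[of "e / 2" "1/2"] e by auto
    define k where "k = max k1 k2"
    have "(1/2::real) ^ k \<le> (1/2) ^ k2"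
      unfolding k_def by (rule power_decreasing) auto
    then have pk: "(1/2::real) ^ k < e / 2" using k2 by linarith
    have "norm (infdist (X n - x) S - 0) < e" if n: "n \<ge> K k" for n
    proof -
      have "infdist (X n - x) S \<le> infdist (X n - X (r k)) S + infdist (X (r k) - x) S"
        using infdist_sub_add[OF S, of "X n - X (r k)" "X (r k) - x"] by simp
      also have "\<dots> < e / 2 + e / 2"
        using K[OF n rK(1)] pk near[of k] k1[of k] by (simp add: k_def)
      finally show ?thesis using infdist_nonneg[of "X n - x" S] by simp
    qed
    then show "\<exists>n0. \<forall>n\<ge>n0. norm (infdist (X n - x) S - 0) < e" by blast
  qed
qed

subsection \<open>Hilbert modules and ideals\<close>

text \<open>An ideal with an approximate unit. The contraction bounds record what positivity and
  norm at most 1 of \<open>e n\<close> give, phrased without the operator 1 - e n, since the algebra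
  may have no unit.\<close>

locale hilbI = hilb ip J act
  for ip :: "'h::banach \<Rightarrow> 'h \<Rightarrow> 'e::cstar" and J act +
  fixes Id :: "'e set" and e :: "nat \<Rightarrow> 'e"
  assumes Id: "subspace Id" "closed Id"
    and Id_mult: "i \<in> Id \<Longrightarrow> a * i \<in> Id" "i \<in> Id \<Longrightarrow> i * a \<in> Id"
    and e_Id: "e n \<in> Id" and e_star: "star (e n) = e n"
    and e_le: "norm (b - b * e n) \<le> norm b" "norm (b - e n * b) \<le> norm b"
    and e_lim: "i \<in> Id \<Longrightarrow> (\<lambda>n. i * e n) \<longlonglongrightarrow> i"
begin

lemmas Id_sub = subspace_add[OF Id(1)] subspace_diff[OF Id(1)] subspace_scale[OF Id(1)]
  subspace_0[OF Id(1)] subspace_neg[OF Id(1)]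

lemma Id_star: "i \<in> Id \<Longrightarrow> star i \<in> Id"
proof -
  assume i: "i \<in> Id"
  have "(\<lambda>n. star (i * e n)) \<longlonglongrightarrow> star i" by (rule tendsto_star[OF e_lim[OF i]])
  then show ?thesis
    by (rule closed_limit[OF Id(2), rotated]) (simp add: star_mult e_star Id_mult e_Id)
qed

text \<open>The kernel of the passage to the quotient by the ideal, as a submodule of the ambient
  space. For an embedded module it cuts out exactly \<open>MI\<close>
  (\<open>module_ideal_eq\<close>), so everything about \<open>M/MI\<close> becomes a congruence
  modulo \<open>Z\<close>.\<close>

definition Z :: "'h set" where
  "Z = {x. ip x x \<in> Id}"

lemma cut_down: "ip (x - act x (e n)) (x - act x (e n)) = (ip x x - ip x x * e n) - e n * (ip x x - ip x x * e n)"
  by (simp add: ip.diff_left ip.diff_right ip_act ip_act_left e_star right_diff_distrib left_diff_distrib mult.assoc)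

text \<open>The squared norm of the difference is that of the inner square of \<open>x\<close>
  multiplied by 1 - e n from both sides, and this tends to 0 because the inner square lies in the
  ideal.\<close>

lemma Z_lim:
  assumes "x \<in> Z" shows "(\<lambda>n. act x (e n)) \<longlonglongrightarrow> x"
proof -
  let ?h = "ip x x"
  have h: "?h \<in> Id" using assms by (simp add: Z_def)
  have le: "(norm (x - act x (e n)))\<^sup>2 \<le> norm (?h - ?h * e n)" for n
    unfolding ip_norm[symmetric] cut_down by (rule e_le(2))
  have "(\<lambda>n. ?h - ?h * e n) \<longlonglongrightarrow> ?h - ?h" by (intro tendsto_diff tendsto_const e_lim h)
  then have "(\<lambda>n. norm (?h - ?h * e n)) \<longlonglongrightarrow> 0" by (simp add: tendsto_norm_zero)
  then have "(\<lambda>n. sqrt (norm (?h - ?h * e n))) \<longlonglongrightarrow> sqrt 0" by (rule tendsto_real_sqrt)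
  then have lim: "(\<lambda>n. sqrt (norm (?h - ?h * e n))) \<longlonglongrightarrow> 0" by simp
  have "(\<lambda>n. x - act x (e n)) \<longlonglongrightarrow> 0"
    by (rule Lim_null_comparison[OF _ lim]) (simp add: le real_le_rsqrt)
  then have "(\<lambda>n. x - (x - act x (e n))) \<longlonglongrightarrow> x - 0" by (intro tendsto_diff tendsto_const)
  then show ?thesis by simp
qed

lemma Z_iff: "x \<in> Z \<longleftrightarrow> (\<forall>y. ip y x \<in> Id)"
proof
  assume x: "x \<in> Z"
  show "\<forall>y. ip y x \<in> Id"
  proof
    fix y
    have "(\<lambda>n. ip y (act x (e n))) \<longlonglongrightarrow> ip y x" by (intro ip.tendsto tendsto_const Z_lim x)
    then show "ip y x \<in> Id"
      by (rule closed_limit[OF Id(2), rotated]) (simp add: ip_act Id_mult e_Id)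
  qed
qed (simp add: Z_def)

lemma ZD: "x \<in> Z \<Longrightarrow> ip y x \<in> Id"
  by (simp add: Z_iff)

lemma ZI: "(\<And>y. ip y x \<in> Id) \<Longrightarrow> x \<in> Z"
  by (simp add: Z_iff)

lemma Z_left: "x \<in> Z \<Longrightarrow> ip x y \<in> Id"
  using Id_star[OF ZD[of x y]] by (simp add: ip_star)

lemma act_Z: "i \<in> Id \<Longrightarrow> act x i \<in> Z"
  by (rule ZI) (simp add: ip_act Id_mult)

lemma submod_Z: "submod Z"
  unfolding submod_def subspace_def
proof (intro conjI ballI allI)
  show "closed Z"
    unfolding closed_sequential_limits
  proof (intro allI impI, elim conjE)
    fix f l assume f: "\<forall>n::nat. f n \<in> Z" "f \<longlonglongrightarrow> l"
    show "l \<in> Z"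
    proof (rule ZI)
      fix y
      have "(\<lambda>n. ip y (f n)) \<longlonglongrightarrow> ip y l" by (intro ip.tendsto tendsto_const f)
      then show "ip y l \<in> Id" by (rule closed_limit[OF Id(2), rotated]) (use f ZD in blast)
    qed
  qed
qed (simp_all add: Z_iff ip.add_right ip.scaleR_right ip.zero_right ip_act Id_sub Id_mult)

lemmas Z_sub = submod_simps[OF submod_Z]

lemma Z_subspace: "subspace Z" and Z_closed: "closed Z"
  using submod_Z by (simp_all add: submod_def)

lemma adj_Z: "adj S T \<Longrightarrow> x \<in> Z \<Longrightarrow> app S x \<in> Z"
  by (rule ZI) (simp add: adjD[OF adj_sym, symmetric] ZD)

definition N :: "'h \<Rightarrow> real" where
  "N x = infdist x Z"

lemma N_nonneg: "0 \<le> N x"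
  by (simp add: N_def infdist_nonneg)

lemma N_norm: "N x \<le> norm x"
  unfolding N_def by (rule infdist_sub_norm[OF Z_subspace])

lemma N_add: "N (x + y) \<le> N x + N y"
  unfolding N_def by (rule infdist_sub_add[OF Z_subspace])

lemma N_diff: "N (x - y) \<le> N x + N y"
  unfolding N_def by (rule infdist_sub_diff[OF Z_subspace])

lemma N_cong: "x - y \<in> Z \<Longrightarrow> N x = N y"
  unfolding N_def by (rule infdist_sub_cong[OF Z_subspace])

lemma N_eq_0: "N x = 0 \<longleftrightarrow> x \<in> Z"
  unfolding N_def by (rule infdist_sub_eq_0[OF Z_subspace Z_closed])

lemma N_scaleR: "N (r *\<^sub>R x) \<le> \<bar>r\<bar> * N x"
  unfolding N_def by (rule infdist_sub_scaleR[OF Z_subspace])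

lemma N_adj: "adj S T \<Longrightarrow> N (app S x) \<le> norm S * N x"
  unfolding N_def by (rule infdist_sub_map[OF Z_subspace]) (auto simp: app_lin norm_app adj_Z)

lemma NA_ip: "infdist (ip x y) Id \<le> N x * N y"
proof (rule field_le_epsilon)
  fix \<epsilon> :: real assume \<epsilon>: "\<epsilon> > 0"
  \<comment> \<open>With d at most 1 the excess d (N x + N y + d) of the product (N x + d)(N y + d)
    is at most \<epsilon>.\<close>
  define d where "d = min 1 (\<epsilon> / (N x + N y + 1))"
  have p: "N x + N y + 1 > 0" using N_nonneg[of x] N_nonneg[of y] by linarith
  have d: "d > 0" "d \<le> 1" "d \<le> \<epsilon> / (N x + N y + 1)" using \<epsilon> p by (simp_all add: d_def)
  obtain s t where s: "s \<in> Z" "norm (x - s) < N x + d" and t: "t \<in> Z" "norm (y - t) < N y + d"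
    using infdist_sub_less[OF Z_subspace, of x "N x + d"] infdist_sub_less[OF Z_subspace, of y "N y + d"] d(1)
    by (auto simp: N_def)
  have "ip x y - ip (x - s) (y - t) \<in> Id"
    using s t by (simp add: ip.diff_left ip.diff_right Id_sub ZD Z_left)
  then have "infdist (ip x y) Id = infdist (ip (x - s) (y - t)) Id"
    by (rule infdist_sub_cong[OF Id(1)])
  also have "\<dots> \<le> norm (ip (x - s) (y - t))" by (rule infdist_sub_norm[OF Id(1)])
  also have "\<dots> \<le> norm (x - s) * norm (y - t)" by (rule ip_CS)
  also have "\<dots> \<le> (N x + d) * (N y + d)"
    using s t N_nonneg[of x] d by (intro mult_mono) auto
  also have "\<dots> = N x * N y + d * (N x + N y + d)" by (simp add: algebra_simps)
  also have "d * (N x + N y + d) \<le> d * (N x + N y + 1)" using d by (intro mult_left_mono) auto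
  also have "\<dots> \<le> \<epsilon>" using d(3) p by (simp add: pos_le_divide_eq)
  finally show "infdist (ip x y) Id \<le> N x * N y + \<epsilon>" by simp
qed

text \<open>Subtracting \<open>act x (e n)\<close> changes \<open>x\<close> within \<open>Z\<close>
  and multiplies its inner square by 1 - e n on both sides. The same multiplication does not
  increase the norm of \<open>ip x x + i\<close> and makes \<open>i\<close> disappear in the limit.
  Taken over all \<open>i\<close> this is the harder half of the equality between the squared
  quotient norm of \<open>x\<close> and the distance of \<open>ip x x\<close> from the
  ideal.\<close>

lemma N_le_norm: 
  assumes i: "i \<in> Id" shows "(N x)\<^sup>2 \<le> norm (ip x x + i)"
proof (rule LIMSEQ_le_const)
  let ?c = "ip x x + i"
  show "(\<lambda>n. norm ?c + norm (i - i * e n)) \<longlonglongrightarrow> norm ?c"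
  proof -
    have "(\<lambda>n. norm ?c + norm (i - i * e n)) \<longlonglongrightarrow> norm ?c + norm (i - i)"
      by (intro tendsto_add tendsto_norm tendsto_diff tendsto_const e_lim i)
    then show ?thesis by simp
  qed
  have "(N x)\<^sup>2 \<le> norm ?c + norm (i - i * e n)" for n
  proof -
    have "N x \<le> norm (x - act x (e n))"
      unfolding N_def by (rule infdist_sub_le[OF Z_subspace act_Z[OF e_Id]])
    then have "(N x)\<^sup>2 \<le> norm (ip (x - act x (e n)) (x - act x (e n)))"
      unfolding ip_norm by (intro power_mono N_nonneg)
    also have "ip (x - act x (e n)) (x - act x (e n))
        = ((?c - ?c * e n) - e n * (?c - ?c * e n)) - ((i - i * e n) - e n * (i - i * e n))"
      unfolding cut_down by (simp add: algebra_simps)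
    also have "norm \<dots> \<le> norm ((?c - ?c * e n) - e n * (?c - ?c * e n)) + norm ((i - i * e n) - e n * (i - i * e n))"
      by (rule norm_triangle_ineq4)
    also have "\<dots> \<le> norm ?c + norm (i - i * e n)"
      by (intro add_mono order_trans[OF e_le(2) e_le(1)] e_le(2))
    finally show ?thesis .
  qed
  then show "\<exists>M. \<forall>n\<ge>M. (N x)\<^sup>2 \<le> norm ?c + norm (i - i * e n)" by blast
qed

lemma N_sq_le: "(N x)\<^sup>2 \<le> infdist (ip x x) Id"
proof (rule field_le_epsilon)
  fix \<epsilon> :: real assume "\<epsilon> > 0"
  then obtain i where i: "i \<in> Id" "norm (ip x x - i) < infdist (ip x x) Id + \<epsilon>"
    using infdist_sub_less[OF Id(1), of "ip x x" "infdist (ip x x) Id + \<epsilon>"] by auto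
  then show "(N x)\<^sup>2 \<le> infdist (ip x x) Id + \<epsilon>"
    using N_le_norm[of "- i" x] by (simp add: Id_sub)
qed

subsection \<open>Lifting compact operators from the quotient\<close>

text \<open>States that the map induced by \<psi> on the quotient is a limit, in the quotient
  operator norm, of maps induced by \<open>Kop U\<close>. \<psi> itself is a choice of
  representatives and is linear only modulo \<open>Z\<close>.\<close>

definition approx :: "'h set \<Rightarrow> ('h \<Rightarrow> 'h) \<Rightarrow> bool" where
  "approx U \<psi> \<longleftrightarrow> (\<forall>\<epsilon>>0. \<exists>D\<in>Kop U. \<forall>x. N (app D x - \<psi> x) \<le> \<epsilon> * N x)"

text \<open>If \<open>D\<close> has quotient norm at most 1/2, then \<open>D(1 + D\<^sup>*D)\<^sup>-\<^sup>1\<close> is a contraction which is close to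
  \<open>D\<close> in the quotient norm, so the norm of a lift can be controlled.\<close>

lemma lift_step:
  assumes U: "submod U" and ap: "approx U \<psi>" and c: "c > 0" and bd: "\<And>x. N (\<psi> x) \<le> c * N x"
  obtains D where "D \<in> Kop U" "norm D \<le> 5/2 * c" "\<And>x. N (app D x - \<psi> x) \<le> 3/4 * c * N x"
proof -
  obtain D0 where D0: "D0 \<in> Kop U" "\<And>x. N (app D0 x - \<psi> x) \<le> c / 4 * N x"
    using ap c unfolding approx_def by (metis divide_pos_pos zero_less_numeral)
  \<comment> \<open>The quotient norm of \<open>D0\<close> is at most c + c/4, so dividing by this
    \<open>s\<close> brings it down to 1/2.\<close>
  define s where "s = 5/2 * c"
  have s: "s > 0" using c by (simp add: s_def)
  define D where "D = (1 / s) *\<^sub>R D0"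
  have DK: "D \<in> Kop U" unfolding D_def by (rule Kop_scaleR[OF D0(1) U])
  obtain D' where D': "D' \<in> Kop U" "adj D D'" using Kop_adj[OF DK] by blast
  have half: "N (app D x) \<le> 1/2 * N x" for x
  proof -
    have "N (app D0 x) \<le> N (app D0 x - \<psi> x) + N (\<psi> x)"
      using N_add[of "app D0 x - \<psi> x" "\<psi> x"] by simp
    also have "\<dots> \<le> c / 4 * N x + c * N x" by (intro add_mono D0 bd)
    also have "\<dots> = s * (1/2 * N x)" by (simp add: s_def algebra_simps)
    finally have "N (app D0 x) \<le> s * (1/2 * N x)" .
    then have le: "(1 / s) * N (app D0 x) \<le> (1 / s) * (s * (1/2 * N x))"
      using s by (intro mult_left_mono) auto
    have "N (app D x) \<le> (1 / s) * N (app D0 x)"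
      using N_scaleR[of "1/s" "app D0 x"] s by (simp add: D_def app_lin)
    also note le
    also have "(1 / s) * (s * (1/2 * N x)) = 1/2 * N x" using s by simp
    finally show ?thesis .
  qed
  have half': "N (app D' x) \<le> 1/2 * N x" for x
  proof (rule le_of_square_le_mult)
    have "(N (app D' x))\<^sup>2 \<le> infdist (ip (app D' x) (app D' x)) Id"
      by (rule N_sq_le)
    also have "ip (app D' x) (app D' x) = ip x (app D (app D' x))"
      by (rule adjD[OF adj_sym[OF D'(2)]])
    also have "infdist \<dots> Id \<le> N x * N (app D (app D' x))" by (rule NA_ip)
    also have "\<dots> \<le> N x * (1/2 * N (app D' x))" by (intro mult_left_mono half N_nonneg)
    finally show "(N (app D' x))\<^sup>2 \<le> 1/2 * N x * N (app D' x)" by simp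
  qed (simp_all add: N_nonneg)
  obtain B where B: "(1 + D' * D) * B = 1" "adj B B" "norm B \<le> 1" "norm (D * B) \<le> 1"
    using one_plus_inverse[OF D'(2)] by metis
  \<comment> \<open>\<open>B\<close> need not preserve \<open>U\<close>, hence it is rewritten as 1
    - D'DB. The operator D'DB is self-adjoint, because \<open>B\<close> commutes with D'D, and it
    has its range in \<open>U\<close>.\<close>
  have DB: "D * B \<in> Kop U"
  proof -
    have "B = 1 - D' * D * B" using B(1) by (simp add: algebra_simps)
    then have "D * B = D - D * (D' * D * B)" by (metis mult.right_neutral right_diff_distrib)
    moreover have "D * (D' * D * B) \<in> Kop U"
    proof (rule Kop_mult_right[OF DK])
      have a: "adj (D' * D) (D' * D)" by (rule adj_mult[OF adj_sym[OF D'(2)] D'(2)])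
      have "adj 1 (B * (1 + D' * D))"
        using adj_mult[OF adj_add[OF adj_1 a] B(2)] by (simp only: B(1))
      then have "B * (1 + D' * D) = 1" by (rule adj_unique) simp
      then have "B * (D' * D) = 1 - B" by (simp add: distrib_left eq_diff_eq add.commute)
      moreover have "D' * D * B = 1 - B" using B(1) by (simp add: distrib_right eq_diff_eq add.commute)
      ultimately have BD: "B * (D' * D) = D' * D * B" by simp
      show "adj (D' * D * B) (D' * D * B)"
        using adj_mult[OF a B(2)] by (simp only: BD)
      show "app (D' * D * B) u \<in> U" if "u \<in> U" for u
        by (simp add: Kop_range[OF D'(1) U])
    qed
    ultimately show ?thesis using Kop_diff[OF DK _ U] by simp
  qed
  show ?thesis
  proof (rule that[of "s *\<^sub>R (D * B)"])
    show "s *\<^sub>R (D * B) \<in> Kop U" by (rule Kop_scaleR[OF DB U])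
    show "norm (s *\<^sub>R (D * B)) \<le> 5/2 * c"
      using B(4) s mult_left_mono[OF B(4), of s] by (simp add: s_def)
    fix x
    define y where "y = app B x"
    have xy: "x - y = app D' (app D y)"
    proof -
      have "app ((1 + D' * D) * B) x = y + app D' (app D y)" by (simp add: y_def app_lin)
      then have "x = y + app D' (app D y)" by (simp add: B(1))
      then show ?thesis by simp
    qed
    have "N (app (D * B) x - app D x) = N (app D y - app D x)" by (simp add: y_def)
    also have "\<dots> = N (app D (x - y))"
      using N_scaleR[of "-1" "app D y - app D x"] N_scaleR[of "-1" "app D (x - y)"] by (simp add: app_lin)
    \<comment> \<open>The error of replacing \<open>D\<close> by \<open>D * B\<close> passes through
      D, D' and D once each. After scaling by \<open>s\<close> it contributes 5/16 c, and together
      with c/4 this is below 3/4 c.\<close>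
    also have "\<dots> \<le> 1/2 * (1/2 * (1/2 * N y))"
      unfolding xy by (intro order_trans[OF half mult_left_mono] order_trans[OF half' mult_left_mono] half) auto
    also have "N y \<le> norm B * N x" unfolding y_def by (rule N_adj[OF B(2)])
    also have "\<dots> \<le> 1 * N x" by (intro mult_right_mono B N_nonneg)
    finally have 1: "N (app (D * B) x - app D x) \<le> 1/8 * N x" by simp
    have "N (app (s *\<^sub>R (D * B)) x - app D0 x) = N (s *\<^sub>R (app (D * B) x - app D x))"
      using s by (simp add: D_def app_lin scaleR_diff_right)
    also have "\<dots> \<le> s * N (app (D * B) x - app D x)" using N_scaleR[of s] s by simp
    also have "\<dots> \<le> s * (1/8 * N x)" using s 1 by (intro mult_left_mono) auto
    finally have 2: "N (app (s *\<^sub>R (D * B)) x - app D0 x) \<le> s * (1/8 * N x)" .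
    have "N (app (s *\<^sub>R (D * B)) x - \<psi> x) \<le> N (app (s *\<^sub>R (D * B)) x - app D0 x) + N (app D0 x - \<psi> x)"
      using N_add[of "app (s *\<^sub>R (D * B)) x - app D0 x" "app D0 x - \<psi> x"] by simp
    also have "\<dots> \<le> s * (1/8 * N x) + c / 4 * N x" by (intro add_mono 2 D0)
    also have "\<dots> \<le> 3/4 * c * N x"
      using c N_nonneg[of x] by (simp add: s_def algebra_simps mult_nonneg_nonneg)
    finally show "N (app (s *\<^sub>R (D * B)) x - \<psi> x) \<le> 3/4 * c * N x" .
  qed
qed

text \<open>Applied to the successive remainders, \<open>lift_step\<close> reduces the quotient
  error by the factor 3/4 and adds a correction whose norm is of the same order. The corrections are
  summable in operator norm, so the error can be removed completely, not only approximately.\<close>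

lemma lift:
  assumes U: "submod U" and ap: "approx U \<psi>"
  obtains X where "X \<in> Kop U" "\<And>x. app X x - \<psi> x \<in> Z"
proof -
  obtain D where D: "D \<in> Kop U" "\<And>x. N (app D x - \<psi> x) \<le> 1 * N x"
    using ap unfolding approx_def by (metis zero_less_one)
  obtain D' where D': "adj D D'" using Kop_adj[OF D(1)] by blast
  define c where "c = norm D + 1"
  have c: "c > 0" unfolding c_def by (rule add_nonneg_pos) simp_all
  have bd: "N (\<psi> x) \<le> c * N x" for x
  proof -
    have "N (\<psi> x) \<le> N (app D x) + N (app D x - \<psi> x)"
      using N_diff[of "app D x" "app D x - \<psi> x"] by simp
    also have "\<dots> \<le> norm D * N x + 1 * N x" by (intro add_mono N_adj[OF D'] D)
    finally show ?thesis by (simp add: c_def distrib_right)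
  qed
  define P where "P n S \<longleftrightarrow> S \<in> Kop U \<and> (\<forall>x. N (\<psi> x - app S x) \<le> c * (3/4) ^ n * N x)" for n S
  have P0: "P 0 0" using bd by (simp add: P_def Kop_0 app_lin)
  have step: "\<exists>S'. P (Suc n) S' \<and> norm (S' - S) \<le> 5/2 * c * (3/4) ^ n" if S: "P n S" for n S
  proof -
    have ap': "approx U (\<lambda>x. \<psi> x - app S x)"
      unfolding approx_def
    proof (intro allI impI)
      fix \<epsilon> :: real assume "\<epsilon> > 0"
      then obtain E where E: "E \<in> Kop U" "\<forall>x. N (app E x - \<psi> x) \<le> \<epsilon> * N x"
        using ap unfolding approx_def by blast
      have "E - S \<in> Kop U" using S by (intro Kop_diff E U) (simp add: P_def)
      moreover have eq: "app (E - S) x - (\<psi> x - app S x) = app E x - \<psi> x" for x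
        by (simp add: app_lin)
      have "\<forall>x. N (app (E - S) x - (\<psi> x - app S x)) \<le> \<epsilon> * N x"
        unfolding eq by (rule E(2))
      ultimately show "\<exists>D\<in>Kop U. \<forall>x. N (app D x - (\<psi> x - app S x)) \<le> \<epsilon> * N x"
        by (intro bexI[of _ "E - S"])
    qed
    have c': "c * (3/4) ^ n > 0" using c by simp
    have bd': "N (\<psi> x - app S x) \<le> c * (3/4) ^ n * N x" for x using S by (simp add: P_def)
    obtain E where E: "E \<in> Kop U" "norm E \<le> 5/2 * (c * (3/4) ^ n)"
      "\<And>x. N (app E x - (\<psi> x - app S x)) \<le> 3/4 * (c * (3/4) ^ n) * N x"
      using lift_step[OF U ap' c' bd'] by blast
    have "N (\<psi> x - app (S + E) x) \<le> c * (3/4) ^ Suc n * N x" for x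
    proof -
      have eq: "\<psi> x - app (S + E) x = (- 1) *\<^sub>R (app E x - (\<psi> x - app S x))"
        by (simp add: app_lin algebra_simps)
      have "N (\<psi> x - app (S + E) x) \<le> N (app E x - (\<psi> x - app S x))"
        unfolding eq using N_scaleR[of "-1" "app E x - (\<psi> x - app S x)"] by simp
      then show ?thesis using E(3)[of x] by simp
    qed
    then have "P (Suc n) (S + E)" using S E(1) by (simp add: P_def Kop_add)
    then show ?thesis using E(2) by (intro exI[of _ "S + E"]) simp
  qed
  obtain S where S: "\<And>n. P n (S n)" "\<And>n. norm (S (Suc n) - S n) \<le> 5/2 * c * (3/4) ^ n"
    using dependent_nat_choice[of P "\<lambda>n S S'. norm (S' - S) \<le> 5/2 * c * (3/4) ^ n"] P0 step by metis
  have "summable (\<lambda>n. S (Suc n) - S n)"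
    by (rule summable_comparison_test'[of "\<lambda>n. 5/2 * c * (3/4) ^ n" 0])
      (use S(2) in \<open>auto intro!: summable_mult summable_geometric\<close>)
  then have "(\<lambda>n. S n - S 0) \<longlonglongrightarrow> (\<Sum>n. S (Suc n) - S n)"
    using summable_LIMSEQ by (simp add: sum_lessThan_telescope[symmetric])
  then have "(\<lambda>n. (S n - S 0) + S 0) \<longlonglongrightarrow> (\<Sum>n. S (Suc n) - S n) + S 0"
    by (intro tendsto_add tendsto_const)
  then obtain X where X: "S \<longlonglongrightarrow> X" by auto
  show ?thesis
  proof (rule that)
    show "X \<in> Kop U" by (rule Kop_lim[OF _ X]) (use S(1) in \<open>simp add: P_def\<close>)
    fix x
    have "N (app X x - \<psi> x) \<le> 0"
    proof (rule LIMSEQ_le_const)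
      show "(\<lambda>n. norm (app X x - app (S n) x) + c * (3/4) ^ n * N x) \<longlonglongrightarrow> 0"
      proof -
        have "(\<lambda>n. norm (app X x - app (S n) x) + c * (3/4) ^ n * N x)
            \<longlonglongrightarrow> norm (app X x - app X x) + c * 0 * N x"
          by (intro tendsto_add tendsto_norm tendsto_diff tendsto_const app.tendsto X tendsto_mult
              LIMSEQ_power_zero) simp
        then show ?thesis by simp
      qed
      have "N (app X x - \<psi> x) \<le> norm (app X x - app (S n) x) + c * (3/4) ^ n * N x" for n
      proof -
        have "N (app X x - \<psi> x) \<le> N (app X x - app (S n) x) + N (\<psi> x - app (S n) x)"
          using N_diff[of "app X x - app (S n) x" "\<psi> x - app (S n) x"] by simp
        also have "\<dots> \<le> norm (app X x - app (S n) x) + c * (3/4) ^ n * N x"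
          using S(1)[of n] by (intro add_mono N_norm) (simp add: P_def)
        finally show ?thesis .
      qed
      then show "\<exists>M. \<forall>n\<ge>M. N (app X x - \<psi> x) \<le> norm (app X x - app (S n) x) + c * (3/4) ^ n * N x"
        by blast
    qed
    then have "N (app X x - \<psi> x) = 0" using N_nonneg by (simp add: order_antisym)
    then show "app X x - \<psi> x \<in> Z" by (simp add: N_eq_0)
  qed
qed

text \<open>If K^2 x is -x modulo \<open>Z\<close>, then 1 - K^2 acts on \<open>x\<close> as 2 and
  (1 + K)^2 acts as 2K. So \<open>B\<close> halves \<open>x\<close> and the two factors 2 cancel,
  all modulo \<open>Z\<close>, which \<open>B\<close> and \<open>1 + K\<close> preserve as
  adjointable operators.\<close>

lemma cayley_Z:
  assumes K: "adj K (- K)" and W: "W = (1 + K) * (1 + K) * B" "B * (1 - K * K) = 1" "adj B B"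
    and x: "app K (app K x) + x \<in> Z"
  shows "app W x - app K x \<in> Z"
proof -
  define z where "z = app K (app K x) + x"
  have K1: "adj (1 + K) (1 - K)" using adj_add[OF adj_1 K] by simp
  have "app (B * (1 - K * K)) x = x" unfolding W(2) by simp
  moreover have "app (1 - K * K) x = 2 *\<^sub>R x - z" by (simp add: z_def app_lin scaleR_2)
  ultimately have "app B (2 *\<^sub>R x - z) = x" by simp
  then have "2 *\<^sub>R app B x = x + app B z" by (simp add: app_lin algebra_simps)
  then have Bx: "app B x = (1/2) *\<^sub>R (x + app B z)"
    by (metis scaleR_half_double scaleR_2 scaleR_add_right)
  have "app ((1 + K) * (1 + K)) x = 2 *\<^sub>R app K x + z"
    by (simp add: z_def app_lin scaleR_2)
  then have "app W x - app K x = (1/2) *\<^sub>R (z + app ((1 + K) * (1 + K)) (app B z))"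
    unfolding W(1) app_simps(2)[of "(1 + K) * (1 + K)" B] Bx app.scaleR_right app.add_right
    by (simp add: algebra_simps)
  moreover have "app ((1 + K) * (1 + K)) (app B z) \<in> Z"
    by (intro adj_Z[OF adj_mult[OF K1 K1]] adj_Z[OF W(3)]) (use x in \<open>simp add: z_def\<close>)
  ultimately show ?thesis using x by (simp add: Z_sub z_def)
qed

end

subsection \<open>Modules embedded in the type of bounded families\<close>

definition csm :: "complex \<Rightarrow> ('a, 'v) hvec \<Rightarrow> ('a, 'v) hvec" where
  "csm c x = Re c *\<^sub>R x + Im c *\<^sub>R app (endo_of himul) x"

lemma csm_adj: "hv.adj S T \<Longrightarrow> app S (csm c x) = csm c (app S x)"
  using arg_cong[OF hv.adj_J_commute, of S T "\<lambda>R. app R x"] by (simp add: csm_def app_lin)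

lemma csm_diff: "csm c (x - y) = csm c x - csm c y"
  by (simp add: csm_def app_lin algebra_simps)

lemma csm_in: "subspace S \<Longrightarrow> (\<And>x. x \<in> S \<Longrightarrow> app (endo_of himul) x \<in> S) \<Longrightarrow> x \<in> S \<Longrightarrow> csm c x \<in> S"
  unfolding csm_def by (intro subspace_add subspace_scale) auto

text \<open>One algebra and one Hilbert module, located at the coordinate \<open>(A, H)\<close> of
  the two large types. Only the embedded copies of \<open>A\<close>, \<open>H\<close> and
  \<open>I\<close> are used afterwards, with \<open>u\<close> as approximate unit of
  \<open>I\<close>.\<close>

locale idl =
  fixes A :: "'a cs_alg" and H :: "('v, 'a) hmod" and I :: "'a set" and u :: "nat \<Rightarrow> 'a"
  assumes good: "hgood (A, H)" and ideal: "closed_ideal A I"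
    and u: "\<And>n. u n \<in> I" "\<And>n. cs_pos A (u n)" "\<And>n. cs_norm A (u n) \<le> 1"
    and u_lim: "\<And>i. i \<in> I \<Longrightarrow> (\<lambda>n. cs_dist A (cs_mult A i (u n)) i) \<longlonglongrightarrow> 0"
begin

abbreviation em :: "'a \<Rightarrow> ('a, ('v, 'a) hmod) el" where
  "em \<equiv> emb (A, H)"

abbreviation JJ :: "('a, 'v) hvec endo" where
  "JJ \<equiv> endo_of himul"

lemma A: "cstar_algebra A"
  using good by simp

lemma fA: "cstar_algebra (fst (A, H))"
  using A by simp

lemma I_sub: "i \<in> I \<Longrightarrow> i \<in> cs_carrier A"
  using ideal unfolding closed_ideal_def by (elim conjE) (rule subsetD)

lemma ideal_axioms:
  shows "cs_zero A \<in> I" "\<forall>x\<in>I. \<forall>y\<in>I. cs_add A x y \<in> I" "\<forall>x\<in>I. cs_neg A x \<in> I"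
    "\<forall>z. \<forall>x\<in>I. cs_smul A z x \<in> I"
    "\<forall>a\<in>cs_carrier A. \<forall>x\<in>I. cs_mult A a x \<in> I \<and> cs_mult A x a \<in> I"
    "\<forall>s l. (\<forall>n. s n \<in> I) \<longrightarrow> l \<in> cs_carrier A \<longrightarrow>
        (\<lambda>n. cs_dist A (s n) l) \<longlonglongrightarrow> 0 \<longrightarrow> l \<in> I"
  using ideal unfolding closed_ideal_def by - (elim conjE, assumption)+

lemmas I_zero = ideal_axioms(1)
  and I_add = ideal_axioms(2)[rule_format]
  and I_neg = ideal_axioms(3)[rule_format]
  and I_smul = ideal_axioms(4)[rule_format]
  and I_mult_left = ideal_axioms(5)[rule_format, THEN conjunct1]
  and I_mult_right = ideal_axioms(5)[rule_format, THEN conjunct2]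
  and I_closed = ideal_axioms(6)[rule_format]

lemma em_add: "a \<in> cs_carrier A \<Longrightarrow> b \<in> cs_carrier A \<Longrightarrow> em (cs_add A a b) = em a + em b"
  and em_neg: "a \<in> cs_carrier A \<Longrightarrow> em (cs_neg A a) = - em a"
  and em_mult: "a \<in> cs_carrier A \<Longrightarrow> b \<in> cs_carrier A \<Longrightarrow> em (cs_mult A a b) = em a * em b"
  and em_star: "a \<in> cs_carrier A \<Longrightarrow> em (cs_star A a) = star (em a)"
  and em_smul: "a \<in> cs_carrier A \<Longrightarrow> em (cs_smul A (of_real r) a) = r *\<^sub>R em a"
  and em_norm: "a \<in> cs_carrier A \<Longrightarrow> norm (em a) = cs_norm A a"
  and em_eq_0: "a \<in> cs_carrier A \<Longrightarrow> em a = 0 \<longleftrightarrow> a = cs_zero A"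
  and em_inject: "a \<in> cs_carrier A \<Longrightarrow> b \<in> cs_carrier A \<Longrightarrow> em a = em b \<longleftrightarrow> a = b"
  and em_at: "a \<in> cs_carrier A \<Longrightarrow> el_at (em a) (A, H) = a"
  using emb_add[OF fA] emb_neg[OF fA] emb_mult[OF fA] emb_star[OF fA] emb_smul_real[OF fA]
    norm_emb[OF fA] emb_eq_0[OF fA] emb_inject[OF fA] emb_at[OF fA] by simp_all

lemma el_at_A: "el_at b (A, H) \<in> cs_carrier A"
  using el_at_mem[OF fA, of b] by simp

text \<open>An arbitrary element of the product meets an embedded one only in the coordinate
  \<open>(A, H)\<close>. Therefore the copy of \<open>I\<close> is an ideal of the whole product, as
  \<open>hilbI\<close> demands.\<close>

lemma em_mult_any:
  assumes "a \<in> cs_carrier A"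
  shows "b * em a = em (cs_mult A (el_at b (A, H)) a)" "em a * b = em (cs_mult A a (el_at b (A, H)))"
proof -
  have z: "cs_mult B x (cs_zero B) = cs_zero B" if B: "cstar_algebra B" and x: "x \<in> cs_carrier B" for B :: "'a cs_alg" and x
    using cs_smul_mult_right[OF B x cs_closed(1)[OF B], of 0]
      cvs_smul_0[OF cs_cvs[OF B] cs_closed(5)[OF B x cs_closed(1)[OF B]]]
      cvs_smul_0[OF cs_cvs[OF B] cs_closed(1)[OF B]] by simp
  note m = cs_closed(5)[OF A]
  show "b * em a = em (cs_mult A (el_at b (A, H)) a)"
    using assms A el_at_A m
    by (intro el_eqI) (simp add: times_el.rep_eq el_at_emb z el_at_mem)
  show "em a * b = em (cs_mult A a (el_at b (A, H)))"
    using assms A el_at_A m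
    by (intro el_eqI) (simp add: times_el.rep_eq el_at_emb cs_zero_mult el_at_mem)
qed

lemma cs_dist_em: "a \<in> cs_carrier A \<Longrightarrow> b \<in> cs_carrier A \<Longrightarrow> cs_dist A a b = norm (em a - em b)"
  unfolding cs_dist_def by (simp add: em_norm[symmetric] em_add em_neg cs_closed[OF A])

lemma closed_em_I: "closed (em ` I)"
  unfolding closed_sequential_limits
proof (intro allI impI, elim conjE)
  fix f l assume f: "\<forall>n::nat. f n \<in> em ` I" "f \<longlonglongrightarrow> l"
  then have "\<forall>n. \<exists>i. i \<in> I \<and> f n = em i" by blast
  then obtain s where "\<forall>n. s n \<in> I \<and> f n = em (s n)" by (rule choice[THEN exE])
  then have s: "\<And>n. s n \<in> I" "f = (\<lambda>n. em (s n))" by auto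
  define a where "a = el_at l (A, H)"
  have a: "a \<in> cs_carrier A" unfolding a_def by (rule el_at_A)
  have lim: "(\<lambda>n. norm (f n - l)) \<longlonglongrightarrow> 0"
    by (intro tendsto_norm_zero LIM_zero f)
  have lim': "(\<lambda>n. cs_dist A (s n) a) \<longlonglongrightarrow> 0"
  proof (rule Lim_null_comparison[OF _ lim], rule always_eventually, rule allI)
    fix n
    have "el_at (f n + - l) (A, H) = cs_add A (s n) (cs_neg A a)"
      using A by (simp add: plus_el.rep_eq uminus_el.rep_eq a_def s(2) em_at I_sub[OF s(1)]
          del: add_uminus_conv_diff)
    moreover have "cs_norm A (el_at (f n + - l) (A, H)) \<le> norm (f n + - l)"
      using norm_el_at[OF fA, of "f n + - l"] by (simp only: fst_conv)
    ultimately have "cs_dist A (s n) a \<le> norm (f n - l)" by (simp add: cs_dist_def)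
    then show "norm (cs_dist A (s n) a) \<le> norm (f n - l)"
      by (simp add: cs_dist_em[OF I_sub[OF s(1)] a])
  qed
  then have "a \<in> I" using I_closed[of s a] s(1) a by blast
  have "(\<lambda>n. norm (em (s n) - em a)) \<longlonglongrightarrow> 0"
    using lim' by (simp add: cs_dist_em I_sub s(1) a)
  then have "f \<longlonglongrightarrow> em a"
    unfolding s(2) by (rule LIM_zero_cancel[OF tendsto_norm_zero_cancel])
  then have "l = em a" using f(2) LIMSEQ_unique by blast
  then show "l \<in> em ` I" using \<open>a \<in> I\<close> by simp
qed

sublocale hI: hilbI "hip :: ('a, 'v) hvec \<Rightarrow> ('a, 'v) hvec \<Rightarrow> _" "endo_of himul" hact "em ` I" "\<lambda>n. em (u n)"
proof
  fix i a :: "('a, ('v, 'a) hmod) el" and n :: nat and b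
  have uC: "u n \<in> cs_carrier A" for n by (rule I_sub[OF u(1)])
  have pu: "pos (em (u n))"
  proof -
    obtain c where "c \<in> cs_carrier A" "u n = cs_mult A (cs_star A c) c"
      using u(2)[of n] unfolding cs_pos_def by blast
    then have "em (u n) = star (em c) * em c" by (simp add: em_mult em_star cs_closed[OF A])
    then show ?thesis by (simp add: pos_star_mult)
  qed
  have nu: "norm (em (u n)) \<le> 1" using u(3)[of n] by (simp add: em_norm uC)
  show "subspace (em ` I)"
    unfolding subspace_def
  proof (intro conjI ballI allI)
    show "0 \<in> em ` I" using I_zero em_eq_0[OF I_sub[OF I_zero]] by force
    show "x + y \<in> em ` I" if "x \<in> em ` I" "y \<in> em ` I" for x y
      using that I_add by (force simp: em_add[OF I_sub I_sub, symmetric])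
    show "r *\<^sub>R x \<in> em ` I" if "x \<in> em ` I" for r x
      using that I_smul by (force simp: em_smul[OF I_sub, symmetric])
  qed
  show "closed (em ` I)" by (rule closed_em_I)
  show "a * i \<in> em ` I" "i * a \<in> em ` I" if "i \<in> em ` I"
    using that I_mult_left I_mult_right by (auto simp: em_mult_any I_sub el_at_A)
  show "em (u n) \<in> em ` I" by (simp add: u(1))
  show "star (em (u n)) = em (u n)" by (rule pos_star[OF pu])
  show "norm (b - b * em (u n)) \<le> norm b" "norm (b - em (u n) * b) \<le> norm b"
    by (rule pos_one_minus[OF pu nu])+
  show "(\<lambda>n. i * em (u n)) \<longlonglongrightarrow> i" if i: "i \<in> em ` I"
  proof -
    obtain j where j: "j \<in> I" "i = em j" using i by blast
    have "(\<lambda>n. norm (i * em (u n) - i)) \<longlonglongrightarrow> 0"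
      using u_lim[OF j(1)] by (simp add: cs_dist_em cs_closed[OF A] I_sub[OF j(1)] uC em_mult j(2))
    then show ?thesis by (simp add: tendsto_norm_zero_iff LIM_zero_iff)
  qed
qed

lemma coset_mem: "x \<in> coset A I a \<longleftrightarrow> (\<exists>i\<in>I. x = cs_add A a i)"
  by (auto simp: coset_def)

lemma coset_mem_em:
  assumes a: "a \<in> cs_carrier A"
  shows "x \<in> coset A I a \<longleftrightarrow> x \<in> cs_carrier A \<and> em x - em a \<in> em ` I"
proof
  assume "x \<in> coset A I a"
  then obtain i where "i \<in> I" "x = cs_add A a i" by (auto simp: coset_mem)
  then show "x \<in> cs_carrier A \<and> em x - em a \<in> em ` I"
    using a by (simp add: em_add I_sub cs_closed[OF A])
next
  assume *: "x \<in> cs_carrier A \<and> em x - em a \<in> em ` I"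
  then obtain i where i: "i \<in> I" "em x - em a = em i" by blast
  then have "em x = em (cs_add A a i)" using a by (simp add: em_add I_sub diff_eq_eq add.commute)
  then have "x = cs_add A a i" using * a i by (simp add: em_inject cs_closed[OF A] I_sub)
  then show "x \<in> coset A I a" using i by (auto simp: coset_mem)
qed

lemma coset_eq:
  assumes a: "a \<in> cs_carrier A" and b: "b \<in> cs_carrier A"
  shows "coset A I a = coset A I b \<longleftrightarrow> em a - em b \<in> em ` I"
proof
  assume "coset A I a = coset A I b"
  moreover have "a \<in> coset A I a" using a by (simp add: coset_mem_em hI.Id_sub)
  ultimately show "em a - em b \<in> em ` I" using coset_mem_em[OF b] by blast
next
  assume *: "em a - em b \<in> em ` I"
  have "em x - em a \<in> em ` I \<longleftrightarrow> em x - em b \<in> em ` I" for x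
    using hI.Id_sub(1)[OF _ *, of "em x - em a"] hI.Id_sub(2)[OF _ *, of "em x - em b"] by auto
  then show "coset A I a = coset A I b"
    by (intro set_eqI) (simp add: coset_mem_em[OF a] coset_mem_em[OF b])
qed

lemma rep_coset:
  assumes a: "a \<in> cs_carrier A"
  shows "rep (coset A I a) \<in> cs_carrier A" "em (rep (coset A I a)) - em a \<in> em ` I"
proof -
  have "a \<in> coset A I a" using a by (simp add: coset_mem_em hI.Id_sub)
  then have "rep (coset A I a) \<in> coset A I a" unfolding rep_def by (rule someI)
  then show "rep (coset A I a) \<in> cs_carrier A" "em (rep (coset A I a)) - em a \<in> em ` I"
    using coset_mem_em[OF a] by blast+
qed

lemma quot_norm:
  assumes a: "a \<in> cs_carrier A"
  shows "cs_norm (quot_alg A I) (coset A I a) = infdist (em a) (em ` I)"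
proof -
  have "cs_norm A ` coset A I a = (\<lambda>s. dist (em a) s) ` (em ` I)"
  proof (intro set_eqI iffI)
    fix r assume "r \<in> cs_norm A ` coset A I a"
    then obtain i where i: "i \<in> I" "r = cs_norm A (cs_add A a i)" by (auto simp: coset_mem)
    then have "r = dist (em a) (em (cs_neg A i))"
      using a by (simp add: dist_norm em_norm[symmetric] cs_closed[OF A] I_sub em_add em_neg)
    then show "r \<in> (\<lambda>s. dist (em a) s) ` (em ` I)" using I_neg[OF i(1)] by blast
  next
    fix r assume "r \<in> (\<lambda>s. dist (em a) s) ` (em ` I)"
    then obtain i where i: "i \<in> I" "r = dist (em a) (em i)" by blast
    then have "r = cs_norm A (cs_add A a (cs_neg A i))"
      using a by (simp add: dist_norm em_norm[symmetric] cs_closed[OF A] I_sub em_add em_neg)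
    moreover have "cs_add A a (cs_neg A i) \<in> coset A I a" using I_neg[OF i(1)] by (auto simp: coset_mem)
    ultimately show "r \<in> cs_norm A ` coset A I a" by blast
  qed
  then show ?thesis
    using I_zero unfolding infdist_def quot_alg_def by (auto simp: image_image)
qed

end

text \<open>A module, possibly with a carrier type of its own, realized isometrically and with
  closed image inside the ambient vectors. The four modules of the theorem are instances over one
  common ambient space.\<close>

locale emod = idl A H I u
  for A :: "'a cs_alg" and H :: "('v, 'a) hmod" and I :: "'a set" and u :: "nat \<Rightarrow> 'a" +
  fixes Y :: "('y, 'a) hmod" and e :: "'y \<Rightarrow> ('a, 'v) hvec"
  assumes zero: "hm_zero Y \<in> hm_carrier Y" "e (hm_zero Y) = 0"
    and add: "x \<in> hm_carrier Y \<Longrightarrow> y \<in> hm_carrier Y \<Longrightarrow> hm_add Y x y \<in> hm_carrier Y"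
      "x \<in> hm_carrier Y \<Longrightarrow> y \<in> hm_carrier Y \<Longrightarrow> e (hm_add Y x y) = e x + e y"
    and neg: "x \<in> hm_carrier Y \<Longrightarrow> hm_neg Y x \<in> hm_carrier Y"
      "x \<in> hm_carrier Y \<Longrightarrow> e (hm_neg Y x) = - e x"
    and smul: "x \<in> hm_carrier Y \<Longrightarrow> hm_smul Y c x \<in> hm_carrier Y"
      "x \<in> hm_carrier Y \<Longrightarrow> e (hm_smul Y c x) = csm c (e x)"
    and act: "x \<in> hm_carrier Y \<Longrightarrow> a \<in> cs_carrier A \<Longrightarrow> hm_act Y x a \<in> hm_carrier Y"
      "x \<in> hm_carrier Y \<Longrightarrow> hact (e x) b = e (hm_act Y x (el_at b (A, H)))"
    and inner: "x \<in> hm_carrier Y \<Longrightarrow> y \<in> hm_carrier Y \<Longrightarrow> hm_inner Y x y \<in> cs_carrier A"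
      "x \<in> hm_carrier Y \<Longrightarrow> y \<in> hm_carrier Y \<Longrightarrow> hip (e x) (e y) = em (hm_inner Y x y)"
    and inj: "inj_on e (hm_carrier Y)"
    and closed_im: "closed (e ` hm_carrier Y)"
begin

lemma e_act: "x \<in> hm_carrier Y \<Longrightarrow> a \<in> cs_carrier A \<Longrightarrow> e (hm_act Y x a) = hact (e x) (em a)"
  by (simp add: act(2) em_at)

lemma e_eq: "x \<in> hm_carrier Y \<Longrightarrow> y \<in> hm_carrier Y \<Longrightarrow> e x = e y \<longleftrightarrow> x = y"
  using inj by (simp add: inj_on_eq_iff)

definition ei :: "('a, 'v) hvec \<Rightarrow> 'y" where
  "ei = inv_into (hm_carrier Y) e"

lemma ei_e [simp]: "x \<in> hm_carrier Y \<Longrightarrow> ei (e x) = x"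
  unfolding ei_def by (rule inv_into_f_f[OF inj])

lemma e_ei [simp]: "v \<in> e ` hm_carrier Y \<Longrightarrow> e (ei v) = v"
  unfolding ei_def by (rule f_inv_into_f)

lemma ei_mem [simp]: "v \<in> e ` hm_carrier Y \<Longrightarrow> ei v \<in> hm_carrier Y"
  unfolding ei_def by (rule inv_into_into)

lemma norm_e: "x \<in> hm_carrier Y \<Longrightarrow> hm_norm A Y x = norm (e x)"
  using hv.ip_norm[of "e x"] by (simp add: hm_norm_def inner em_norm)

lemma dist_e: "x \<in> hm_carrier Y \<Longrightarrow> y \<in> hm_carrier Y \<Longrightarrow> hm_dist A Y x y = norm (e x - e y)"
  by (simp add: hm_dist_def norm_e add neg)

lemma submod_im: "hI.submod (e ` hm_carrier Y)"
  unfolding hI.submod_def subspace_def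
proof (intro conjI ballI allI)
  show "0 \<in> e ` hm_carrier Y" using zero by force
  show "v + w \<in> e ` hm_carrier Y" if "v \<in> e ` hm_carrier Y" "w \<in> e ` hm_carrier Y" for v w
    using that add by (force simp: add(2)[symmetric])
  show "r *\<^sub>R v \<in> e ` hm_carrier Y" if v: "v \<in> e ` hm_carrier Y" for r v
  proof -
    obtain x where x: "x \<in> hm_carrier Y" "v = e x" using v by blast
    then have "r *\<^sub>R v = e (hm_smul Y (of_real r) x)" by (simp add: smul csm_def)
    then show ?thesis using smul(1)[OF x(1)] by blast
  qed
  show "hact v a \<in> e ` hm_carrier Y" if "v \<in> e ` hm_carrier Y" for v a
    using that act el_at_A by force
qed (rule closed_im)

lemma J_im: "v \<in> e ` hm_carrier Y \<Longrightarrow> app JJ v \<in> e ` hm_carrier Y"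
proof -
  assume "v \<in> e ` hm_carrier Y"
  then obtain x where x: "x \<in> hm_carrier Y" "v = e x" by blast
  then have "app JJ v = e (hm_smul Y \<i> x)" by (simp add: smul csm_def)
  then show ?thesis using smul(1)[OF x(1)] by blast
qed

lemma submodule_im:
  assumes F: "hm_submodule A Y F"
  shows "hI.submod (e ` F)" "\<And>v. v \<in> e ` F \<Longrightarrow> app JJ v \<in> e ` F"
proof -
  have ax: "F \<subseteq> hm_carrier Y" "hm_zero Y \<in> F" "\<forall>x\<in>F. \<forall>y\<in>F. hm_add Y x y \<in> F"
    "\<forall>z. \<forall>x\<in>F. hm_smul Y z x \<in> F" "\<forall>x\<in>F. \<forall>a\<in>cs_carrier A. hm_act Y x a \<in> F"
    "\<forall>s l. (\<forall>n. s n \<in> F) \<longrightarrow> l \<in> hm_carrier Y \<longrightarrow> (\<lambda>n. hm_dist A Y (s n) l) \<longlonglongrightarrow> 0 \<longrightarrow> l \<in> F"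
    using F unfolding hm_submodule_def by - (elim conjE, assumption)+
  note F_sub = subsetD[OF ax(1)]
  note ops = ax(3,4,5)[rule_format]
  show J: "app JJ v \<in> e ` F" if v: "v \<in> e ` F" for v
  proof -
    obtain x where x: "x \<in> F" "v = e x" using v by blast
    then have "app JJ v = e (hm_smul Y \<i> x)" by (simp add: smul csm_def F_sub)
    then show ?thesis using ops(2)[OF x(1)] by simp
  qed
  show "hI.submod (e ` F)"
    unfolding hI.submod_def subspace_def
  proof (intro conjI ballI allI)
    show "0 \<in> e ` F" using ax(2) zero by force
    show "v + w \<in> e ` F" if vw: "v \<in> e ` F" "w \<in> e ` F" for v w
    proof -
      obtain x y where xy: "x \<in> F" "v = e x" "y \<in> F" "w = e y" using vw by blast
      then have "v + w = e (hm_add Y x y)" by (simp add: add F_sub)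
      then show ?thesis using ops(1)[OF xy(1,3)] by simp
    qed
    show "r *\<^sub>R v \<in> e ` F" if v: "v \<in> e ` F" for r v
    proof -
      obtain x where x: "x \<in> F" "v = e x" using v by blast
      then have "r *\<^sub>R v = e (hm_smul Y (of_real r) x)" by (simp add: smul csm_def F_sub)
      then show ?thesis using ops(2)[OF x(1)] by simp
    qed
    show "hact v a \<in> e ` F" if v: "v \<in> e ` F" for v a
    proof -
      obtain x where x: "x \<in> F" "v = e x" using v by blast
      then have "hact v a = e (hm_act Y x (el_at a (A, H)))" by (simp add: act F_sub)
      then show ?thesis using ops(3)[OF x(1) el_at_A] by simp
    qed
    show "closed (e ` F)"
      unfolding closed_sequential_limits
    proof (intro allI impI, elim conjE)
      fix f l assume f: "\<forall>n::nat. f n \<in> e ` F" "f \<longlonglongrightarrow> l"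
      then have "\<forall>n. \<exists>x. x \<in> F \<and> f n = e x" by blast
      then obtain s where "\<forall>n. s n \<in> F \<and> f n = e (s n)" by (rule choice[THEN exE])
      then have s: "\<And>n. s n \<in> F" "\<And>n. f n = e (s n)" by auto
      have "l \<in> e ` hm_carrier Y"
        by (rule closed_limit[OF closed_im _ f(2)]) (simp add: s F_sub)
      then obtain x where x: "x \<in> hm_carrier Y" "l = e x" by blast
      have "(\<lambda>n. norm (f n - l)) \<longlonglongrightarrow> 0" by (intro tendsto_norm_zero LIM_zero f)
      then have "(\<lambda>n. hm_dist A Y (s n) x) \<longlonglongrightarrow> 0" by (simp add: dist_e F_sub s x)
      then have "x \<in> F" using ax(6)[rule_format, of s x] s(1) x(1) by blast
      then show "l \<in> e ` F" using x by simp
    qed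
  qed
qed

lemma submoduleI:
  assumes F: "F \<subseteq> hm_carrier Y" and sm: "hI.submod (e ` F)" and J: "\<And>v. v \<in> e ` F \<Longrightarrow> app JJ v \<in> e ` F"
  shows "hm_submodule A Y F"
proof -
  note F_sub = subsetD[OF F]
  note S = hI.submod_simps[OF sm]
  have in_F: "x \<in> F" if "x \<in> hm_carrier Y" "e x \<in> e ` F" for x
    using that F_sub e_eq by blast
  have sub: "subspace (e ` F)" using sm by (simp add: hI.submod_def)
  show ?thesis
    unfolding hm_submodule_def
  proof (intro conjI ballI allI impI F)
    show "hm_zero Y \<in> F" by (rule in_F) (use zero S(1) in auto)
    show "hm_add Y x y \<in> F" if "x \<in> F" "y \<in> F" for x y
      using that by (intro in_F) (simp_all add: add F_sub S)
    show "hm_neg Y x \<in> F" if "x \<in> F" for x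
      using that S(3)[OF S(1), of "e x"] by (intro in_F) (simp_all add: neg F_sub)
    show "hm_smul Y z x \<in> F" if "x \<in> F" for z x
      using that by (intro in_F) (simp_all add: smul F_sub csm_in[OF sub J])
    show "hm_act Y x a \<in> F" if "x \<in> F" "a \<in> cs_carrier A" for x a
      using that by (intro in_F) (simp_all add: act(1) e_act F_sub S)
    show "l \<in> F" if "\<forall>n. s n \<in> F" "l \<in> hm_carrier Y" "(\<lambda>n. hm_dist A Y (s n) l) \<longlonglongrightarrow> 0" for s :: "nat \<Rightarrow> 'y" and l
    proof (rule in_F[OF that(2)])
      have sF: "s n \<in> F" for n using that(1) by blast
      have "(\<lambda>n. norm (e (s n) - e l)) \<longlonglongrightarrow> 0"
        using that(3) by (simp add: dist_e F_sub[OF sF] that(2))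
      then have "(\<lambda>n. e (s n)) \<longlonglongrightarrow> e l" by (simp add: tendsto_norm_zero_iff LIM_zero_iff)
      then show "e l \<in> e ` F" by (rule closed_limit[OF S(6), rotated]) (simp add: sF)
    qed
  qed
qed

end

context hilb
begin

lemma submod_Int: "submod U \<Longrightarrow> submod V \<Longrightarrow> submod (U \<inter> V)"
  by (simp add: submod_def closed_Int subspace_inter)

end

context emod
begin

lemma e_theta:
  assumes "a \<in> hm_carrier Y" "b \<in> hm_carrier Y" "x \<in> hm_carrier Y"
  shows "e (theta Y a b x) = app (hI.theta (e a) (e b)) (e x)"
  using assms by (simp add: theta_def e_act inner)

lemma theta_mem:
  "a \<in> hm_carrier Y \<Longrightarrow> b \<in> hm_carrier Y \<Longrightarrow> x \<in> hm_carrier Y \<Longrightarrow> theta Y a b x \<in> hm_carrier Y"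
  by (simp add: theta_def act inner)

lemma fr_apply_simps:
  "fr_apply Z [] x = hm_zero Z"
  "fr_apply Z (p # ps) x = hm_add Z (theta Z (fst p) (snd p) x) (fr_apply Z ps x)"
  by (simp_all add: fr_apply_def)

lemma e_fr:
  assumes "set ps \<subseteq> hm_carrier Y \<times> hm_carrier Y" and x: "x \<in> hm_carrier Y"
  shows "fr_apply Y ps x \<in> hm_carrier Y \<and>
    e (fr_apply Y ps x) = app (hI.fr (map (map_prod e e) ps)) (e x)"
  using assms(1)
proof (induction ps)
  case Nil
  then show ?case by (simp add: fr_apply_simps zero app_lin)
next
  case (Cons p ps)
  then have p: "fst p \<in> hm_carrier Y" "snd p \<in> hm_carrier Y" by auto
  have IH: "fr_apply Y ps x \<in> hm_carrier Y"
    "e (fr_apply Y ps x) = app (hI.fr (map (map_prod e e) ps)) (e x)"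
    using Cons by auto
  show ?case
    using IH theta_mem[OF p x] by (simp add: fr_apply_simps add e_theta[OF p x] app_lin del: hI.app_theta)
qed

lemma map_prod_e_ei:
  assumes "set qs \<subseteq> e ` hm_carrier Y \<times> e ` hm_carrier Y"
  shows "map (map_prod e e) (map (map_prod ei ei) qs) = qs"
    and "set (map (map_prod ei ei) qs) \<subseteq> hm_carrier Y \<times> hm_carrier Y"
proof -
  show "map (map_prod e e) (map (map_prod ei ei) qs) = qs"
    unfolding map_map by (rule map_idI) (use assms in force)
  show "set (map (map_prod ei ei) qs) \<subseteq> hm_carrier Y \<times> hm_carrier Y"
    using assms by force
qed

text \<open>The definition of a compact operator speaks about the carrier only;
  \<open>Kop_extend\<close> turns it into an element of \<open>Kop\<close> acting on the ambient
  space.\<close>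

lemma compact_dest:
  assumes T: "hm_compact A Y T"
  obtains T' where "T' \<in> hI.Kop (e ` hm_carrier Y)" "\<And>x. x \<in> hm_carrier Y \<Longrightarrow> app T' (e x) = e (T x)"
proof -
  have T1: "\<And>x. x \<in> hm_carrier Y \<Longrightarrow> T x \<in> hm_carrier Y"
    and T2: "\<And>\<epsilon>. \<epsilon> > 0 \<Longrightarrow> \<exists>ps. set ps \<subseteq> hm_carrier Y \<times> hm_carrier Y \<and>
        (\<forall>x\<in>hm_carrier Y. hm_dist A Y (T x) (fr_apply Y ps x) \<le> \<epsilon> * hm_norm A Y x)"
    using T unfolding hm_compact_def by blast+
  have "\<exists>D\<in>hI.FR (e ` hm_carrier Y). \<forall>v\<in>e ` hm_carrier Y. norm (app D v - e (T (ei v))) \<le> \<epsilon> * norm v"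
    if eps: "\<epsilon> > 0" for \<epsilon>
  proof -
    obtain ps where ps: "set ps \<subseteq> hm_carrier Y \<times> hm_carrier Y"
      "\<And>x. x \<in> hm_carrier Y \<Longrightarrow> hm_dist A Y (T x) (fr_apply Y ps x) \<le> \<epsilon> * hm_norm A Y x"
      using T2[OF eps] by blast
    have "norm (app (hI.fr (map (map_prod e e) ps)) v - e (T (ei v))) \<le> \<epsilon> * norm v"
      if v: "v \<in> e ` hm_carrier Y" for v
    proof -
      obtain x where x: "x \<in> hm_carrier Y" "v = e x" using v by blast
      show ?thesis
        using ps(2)[OF x(1)] e_fr[OF ps(1) x(1)] T1[OF x(1)] x
        by (simp add: dist_e norm_e norm_minus_commute)
    qed
    moreover have "hI.fr (map (map_prod e e) ps) \<in> hI.FR (e ` hm_carrier Y)"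
      by (rule hI.FR_I) (use ps(1) in force)
    ultimately show ?thesis by blast
  qed
  then obtain T' where T': "T' \<in> hI.Kop (e ` hm_carrier Y)"
    "\<And>v. v \<in> e ` hm_carrier Y \<Longrightarrow> app T' v = e (T (ei v))"
    using hI.Kop_extend[OF submod_im, of "\<lambda>v. e (T (ei v))"] by blast
  show ?thesis by (rule that[OF T'(1)]) (simp add: T'(2))
qed

lemma compact_intro:
  assumes T: "T \<in> hI.Kop (e ` hm_carrier Y)"
  shows "hm_compact A Y (\<lambda>x. ei (app T (e x)))"
  unfolding hm_compact_def
proof (intro conjI ballI allI impI)
  have range: "app T v \<in> e ` hm_carrier Y" for v by (rule hI.Kop_range[OF T submod_im])
  then show "ei (app T (e x)) \<in> hm_carrier Y" for x by simp
  fix \<epsilon> :: real assume "\<epsilon> > 0"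
  then obtain D where D: "D \<in> hI.FR (e ` hm_carrier Y)" "norm (T - D) < \<epsilon>"
    using hI.Kop_approx[OF T] by blast
  obtain qs where qs: "set qs \<subseteq> e ` hm_carrier Y \<times> e ` hm_carrier Y" "D = hI.fr qs"
    using hI.FR_E[OF D(1)] by blast
  let ?ps = "map (map_prod ei ei) qs"
  have "hm_dist A Y (ei (app T (e x))) (fr_apply Y ?ps x) \<le> \<epsilon> * hm_norm A Y x"
    if x: "x \<in> hm_carrier Y" for x
  proof -
    have fx: "fr_apply Y ?ps x \<in> hm_carrier Y" "e (fr_apply Y ?ps x) = app D (e x)"
      using e_fr[OF map_prod_e_ei(2)[OF qs(1)] x] unfolding map_prod_e_ei(1)[OF qs(1)] qs(2) by blast+
    have "hm_dist A Y (ei (app T (e x))) (fr_apply Y ?ps x) = norm (app (T - D) (e x))"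
      using fx range by (simp add: dist_e app_lin)
    also have "\<dots> \<le> norm (T - D) * norm (e x)" by (rule norm_app)
    also have "\<dots> \<le> \<epsilon> * norm (e x)" using D(2) by (intro mult_right_mono) auto
    finally show ?thesis by (simp add: norm_e x)
  qed
  then show "\<exists>ps. set ps \<subseteq> hm_carrier Y \<times> hm_carrier Y \<and>
      (\<forall>x\<in>hm_carrier Y. hm_dist A Y (ei (app T (e x))) (fr_apply Y ps x) \<le> \<epsilon> * hm_norm A Y x)"
    using map_prod_e_ei(2)[OF qs(1)] by blast
qed

text \<open>The operator in the definition is \<open>S'\<close> after \<open>S\<close>. The
  extension \<open>R\<close> of \<open>S\<close> has an adjoint \<open>R'\<close>, being compact,
  and \<open>R'\<close> agrees with \<open>S'\<close> on \<open>Y\<close> since both have the same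
  inner products with all of \<open>Y\<close>. So \<open>R' * R\<close> is a self-adjoint compact
  operator that fixes \<open>F\<close>.\<close>

lemma contained_dest:
  assumes "compactly_contained A Y F"
  obtains T where "hm_submodule A Y F" "T \<in> hI.Kop (e ` hm_carrier Y)" "hI.adj T T"
    "\<And>x. x \<in> F \<Longrightarrow> app T (e x) = e x"
proof -
  obtain T0 S S' where F: "hm_submodule A Y F" and S: "hm_compact A Y S"
    and S': "\<And>x. x \<in> hm_carrier Y \<Longrightarrow> S' x \<in> hm_carrier Y" "hm_adjoint Y S S'"
    and T0: "\<And>x. x \<in> hm_carrier Y \<Longrightarrow> T0 x = S' (S x)" "\<And>x. x \<in> F \<Longrightarrow> T0 x = x"
    using assms unfolding compactly_contained_def hm_pos_compact_def by blast
  obtain R where R: "R \<in> hI.Kop (e ` hm_carrier Y)" "\<And>x. x \<in> hm_carrier Y \<Longrightarrow> app R (e x) = e (S x)"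
    using compact_dest[OF S] by blast
  obtain R' where R': "R' \<in> hI.Kop (e ` hm_carrier Y)" "hI.adj R R'" using hI.Kop_adj[OF R(1)] by blast
  have Sx: "\<And>x. x \<in> hm_carrier Y \<Longrightarrow> S x \<in> hm_carrier Y" using S by (simp add: hm_compact_def)
  have R'e: "app R' (e y) = e (S' y)" if y: "y \<in> hm_carrier Y" for y
  proof -
    obtain z where z: "z \<in> hm_carrier Y" "app R' (e y) = e z"
      using hI.Kop_range[OF R'(1) submod_im, of "e y"] by blast
    have eq: "hip (e x) (e z) = hip (e x) (e (S' y))" if x: "x \<in> hm_carrier Y" for x
    proof -
      have "hip (e x) (e z) = hip (e (S x)) (e y)"
        using hv.adjD[OF R'(2), of "e x" "e y"] by (simp add: z(2) R(2)[OF x])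
      also have "\<dots> = em (hm_inner Y x (S' y))"
        using S'(2) x y Sx by (simp add: inner hm_adjoint_def)
      finally show ?thesis using x y S' by (simp add: inner)
    qed
    let ?d = "hm_add Y z (hm_neg Y (S' y))"
    have d: "?d \<in> hm_carrier Y" "e ?d = e z - e (S' y)" using z y S' by (simp_all add: add neg)
    have "hip (e z - e (S' y)) (e z - e (S' y)) = 0"
      using eq[OF d(1)] by (simp add: d(2) hv.ip.diff_right)
    then have "e z - e (S' y) = 0" by (rule hv.ip_eq_0D)
    then show ?thesis using z by simp
  qed
  have F_sub: "\<And>x. x \<in> F \<Longrightarrow> x \<in> hm_carrier Y" using F unfolding hm_submodule_def by blast
  show ?thesis
  proof (rule that[OF F, of "R' * R"])
    show "R' * R \<in> hI.Kop (e ` hm_carrier Y)" by (rule hI.Kop_mult[OF R'(1) R(1) submod_im])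
    show "hI.adj (R' * R) (R' * R)" by (rule hv.adj_mult[OF hv.adj_sym[OF R'(2)] R'(2)])
    show "app (R' * R) (e x) = e x" if "x \<in> F" for x
      using T0(2)[OF that] T0(1)[OF F_sub[OF that]] by (simp add: R(2) R'e F_sub[OF that] Sx)
  qed
qed

text \<open>A self-adjoint \<open>T\<close> fixing \<open>F\<close> is enough: its square also fixes
  \<open>F\<close> and is visibly of the positive form, with \<open>T\<close> as its own
  adjoint.\<close>

lemma contained_intro:
  assumes F: "hm_submodule A Y F" and T: "T \<in> hI.Kop (e ` hm_carrier Y)" "hI.adj T T"
    and fixed: "\<And>x. x \<in> F \<Longrightarrow> app T (e x) = e x"
  shows "compactly_contained A Y F"
proof -
  let ?S = "\<lambda>x. ei (app T (e x))"
  have range: "app T v \<in> e ` hm_carrier Y" for v by (rule hI.Kop_range[OF T(1) submod_im])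
  have "hm_compact A Y (\<lambda>x. ei (app (T * T) (e x)))"
    by (rule compact_intro[OF hI.Kop_mult[OF T(1) T(1) submod_im]])
  moreover have "(\<lambda>x. ei (app (T * T) (e x))) = (\<lambda>x. ?S (?S x))"
    using range by (intro ext) simp
  moreover have "hm_adjoint Y ?S ?S"
    unfolding hm_adjoint_def
  proof (intro ballI)
    fix x y assume xy: "x \<in> hm_carrier Y" "y \<in> hm_carrier Y"
    have "em (hm_inner Y (?S x) y) = hip (app T (e x)) (e y)"
      using inner(2)[of "?S x" y] range xy by simp
    also have "\<dots> = hip (e x) (app T (e y))" by (rule hv.adjD[OF T(2)])
    also have "\<dots> = em (hm_inner Y x (?S y))"
      using inner(2)[of x "?S y"] range xy by simp
    finally show "hm_inner Y (?S x) y = hm_inner Y x (?S y)"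
      using xy range by (simp add: em_inject inner)
  qed
  ultimately have "hm_pos_compact A Y (\<lambda>x. ?S (?S x))"
    unfolding hm_pos_compact_def using compact_intro[OF T(1)] range
    by (intro conjI exI[of _ ?S]) simp_all
  moreover have "\<forall>x\<in>F. ?S (?S x) = x"
    using F fixed unfolding hm_submodule_def by (auto simp: subset_iff)
  ultimately show ?thesis using F unfolding compactly_contained_def by blast
qed

subsection \<open>The quotient module\<close>

text \<open>For the inclusion from right to left, \<open>z\<close> is the limit of its products with
  the approximate unit by \<open>Z_lim\<close>, and these lie in every submodule containing the
  generators.\<close>

lemma module_ideal_eq: "module_ideal A I Y = {z \<in> hm_carrier Y. e z \<in> hI.Z}"
proof (intro equalityI subsetI)
  let ?F = "{z \<in> hm_carrier Y. e z \<in> hI.Z}"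
  have im: "e ` ?F = e ` hm_carrier Y \<inter> hI.Z" by auto
  have "hm_submodule A Y ?F"
  proof (rule submoduleI)
    show "hI.submod (e ` ?F)" unfolding im by (rule hI.submod_Int[OF submod_im hI.submod_Z])
    show "app JJ v \<in> e ` ?F" if "v \<in> e ` ?F" for v
      using that unfolding im by (intro IntI J_im hI.adj_Z[OF hv.adj_J]) blast+
  qed auto
  moreover have "{hm_act Y m i |m i. m \<in> hm_carrier Y \<and> i \<in> I} \<subseteq> ?F"
    by (auto simp: act(1) e_act I_sub intro!: hI.act_Z)
  ultimately show "z \<in> ?F" if "z \<in> module_ideal A I Y" for z
    using that unfolding module_ideal_def gen_submodule_def by blast
next
  fix z assume "z \<in> {z \<in> hm_carrier Y. e z \<in> hI.Z}"
  then have z: "z \<in> hm_carrier Y" "e z \<in> hI.Z" by auto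
  show "z \<in> module_ideal A I Y"
    unfolding module_ideal_def gen_submodule_def
  proof (intro InterI, elim CollectE conjE)
    fix F assume F: "hm_submodule A Y F" "{hm_act Y m i |m i. m \<in> hm_carrier Y \<and> i \<in> I} \<subseteq> F"
    have "hm_act Y z (u n) \<in> F" for n using F(2) z(1) u(1) by blast
    then have "hact (e z) (em (u n)) \<in> e ` F" for n
      using e_act[OF z(1) I_sub[OF u(1)[of n]]] by (metis imageI)
    then have "e z \<in> e ` F"
      by (rule closed_limit[OF hI.submod_simps(6)[OF submodule_im(1)[OF F(1)]] _ hI.Z_lim[OF z(2)]])
    moreover have "F \<subseteq> hm_carrier Y" using F(1) unfolding hm_submodule_def by blast
    ultimately show "z \<in> F" using z(1) e_eq by blast
  qed
qed

definition c :: "'y \<Rightarrow> 'y set" where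
  "c y = mcoset Y (module_ideal A I Y) y"

abbreviation QY :: "('y set, 'a set) hmod" where
  "QY \<equiv> quot_mod A I Y"

abbreviation AI :: "'a set cs_alg" where
  "AI \<equiv> quot_alg A I"

lemma c_mem:
  assumes y: "y \<in> hm_carrier Y"
  shows "x \<in> c y \<longleftrightarrow> x \<in> hm_carrier Y \<and> e x - e y \<in> hI.Z"
proof
  assume "x \<in> c y"
  then obtain z where "z \<in> hm_carrier Y" "e z \<in> hI.Z" "x = hm_add Y y z"
    by (auto simp: c_def mcoset_def module_ideal_eq)
  then show "x \<in> hm_carrier Y \<and> e x - e y \<in> hI.Z" using y by (simp add: add)
next
  assume x: "x \<in> hm_carrier Y \<and> e x - e y \<in> hI.Z"
  let ?z = "hm_add Y x (hm_neg Y y)"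
  have z: "?z \<in> hm_carrier Y" "e ?z = e x - e y" using x y by (simp_all add: add neg)
  have yz: "hm_add Y y ?z \<in> hm_carrier Y" by (rule add(1)[OF y z(1)])
  have "e x = e (hm_add Y y ?z)" using z y by (simp add: add)
  then have "x = hm_add Y y ?z" using e_eq[OF conjunct1[OF x] yz] by blast
  then show "x \<in> c y" using x z by (auto simp: c_def mcoset_def module_ideal_eq)
qed

lemma c_eq:
  assumes x: "x \<in> hm_carrier Y" and y: "y \<in> hm_carrier Y"
  shows "c x = c y \<longleftrightarrow> e x - e y \<in> hI.Z"
proof
  assume "c x = c y"
  moreover have "x \<in> c x" using x by (simp add: c_mem hI.Z_sub)
  ultimately show "e x - e y \<in> hI.Z" using c_mem[OF y] by blast
next
  assume *: "e x - e y \<in> hI.Z"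
  have "e w - e x \<in> hI.Z \<longleftrightarrow> e w - e y \<in> hI.Z" for w
    using hI.Z_sub(2)[OF _ *, of "e w - e x"] hI.Z_sub(3)[OF _ *, of "e w - e y"] by auto
  then show "c x = c y"
    by (intro set_eqI) (simp add: c_mem[OF x] c_mem[OF y])
qed

lemma rep_c:
  assumes y: "y \<in> hm_carrier Y"
  shows "rep (c y) \<in> hm_carrier Y" "e (rep (c y)) - e y \<in> hI.Z" "c (rep (c y)) = c y"
proof -
  have "y \<in> c y" using y by (simp add: c_mem hI.Z_sub)
  then have "rep (c y) \<in> c y" unfolding rep_def by (rule someI)
  then show *: "rep (c y) \<in> hm_carrier Y" "e (rep (c y)) - e y \<in> hI.Z"
    using c_mem[OF y] by blast+
  then show "c (rep (c y)) = c y" using y by (simp add: c_eq)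
qed

lemma QY_carrier: "hm_carrier QY = c ` hm_carrier Y"
  by (simp add: quot_mod_def Let_def c_def[abs_def])

lemma QY_zero: "hm_zero QY = c (hm_zero Y)"
  by (simp add: quot_mod_def Let_def c_def)

lemma QY_add:
  assumes x: "x \<in> hm_carrier Y" and y: "y \<in> hm_carrier Y"
  shows "hm_add QY (c x) (c y) = c (hm_add Y x y)"
proof -
  have "hm_add QY (c x) (c y) = c (hm_add Y (rep (c x)) (rep (c y)))"
    by (simp add: quot_mod_def Let_def c_def)
  moreover have "e (hm_add Y (rep (c x)) (rep (c y))) - e (hm_add Y x y) \<in> hI.Z"
    using hI.Z_sub(2)[OF rep_c(2)[OF x] rep_c(2)[OF y]] rep_c(1)[OF x] rep_c(1)[OF y] x y
    by (simp add: add algebra_simps)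
  ultimately show ?thesis using rep_c(1)[OF x] rep_c(1)[OF y] x y by (simp add: c_eq add)
qed

lemma QY_neg:
  assumes x: "x \<in> hm_carrier Y"
  shows "hm_neg QY (c x) = c (hm_neg Y x)"
proof -
  have "hm_neg QY (c x) = c (hm_neg Y (rep (c x)))"
    by (simp add: quot_mod_def Let_def c_def)
  moreover have "e (hm_neg Y (rep (c x))) - e (hm_neg Y x) \<in> hI.Z"
    using hI.Z_sub(3)[OF hI.Z_sub(1) rep_c(2)[OF x]] rep_c(1)[OF x] x
    by (simp add: neg algebra_simps)
  ultimately show ?thesis using rep_c(1)[OF x] x by (simp add: c_eq neg)
qed

lemma csm_Z: "v \<in> hI.Z \<Longrightarrow> csm z v \<in> hI.Z"
  by (rule csm_in[OF hI.Z_subspace]) (auto intro: hI.adj_Z[OF hv.adj_J])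

lemma QY_smul:
  assumes x: "x \<in> hm_carrier Y"
  shows "hm_smul QY z (c x) = c (hm_smul Y z x)"
proof -
  have "hm_smul QY z (c x) = c (hm_smul Y z (rep (c x)))"
    by (simp add: quot_mod_def Let_def c_def)
  moreover have "e (hm_smul Y z (rep (c x))) - e (hm_smul Y z x) \<in> hI.Z"
    using csm_Z[OF rep_c(2)[OF x], of z] rep_c(1)[OF x] x by (simp add: smul csm_diff)
  ultimately show ?thesis using rep_c(1)[OF x] x by (simp add: c_eq smul)
qed

lemma QY_act:
  assumes x: "x \<in> hm_carrier Y" and a: "a \<in> cs_carrier A"
  shows "hm_act QY (c x) (coset A I a) = c (hm_act Y x a)"
proof -
  let ?x = "rep (c x)" and ?a = "rep (coset A I a)"
  note rx = rep_c[OF x] and ra = rep_coset[OF a]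
  have "hm_act QY (c x) (coset A I a) = c (hm_act Y ?x ?a)"
    by (simp add: quot_mod_def Let_def c_def)
  moreover have "e (hm_act Y ?x ?a) - e (hm_act Y x a) = hact (e ?x - e x) (em ?a) + hact (e x) (em ?a - em a)"
    using rx ra x a by (simp add: e_act hv.act.diff_left hv.act.diff_right)
  moreover have "\<dots> \<in> hI.Z"
    by (intro hI.Z_sub(2) hI.Z_sub(5) hI.act_Z rx ra)
  ultimately show ?thesis using rx ra x a by (simp add: c_eq act(1))
qed

lemma QY_inner:
  assumes x: "x \<in> hm_carrier Y" and y: "y \<in> hm_carrier Y"
  shows "hm_inner QY (c x) (c y) = coset A I (hm_inner Y x y)"
proof -
  let ?x = "rep (c x)" and ?y = "rep (c y)"
  note rx = rep_c[OF x] and ry = rep_c[OF y]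
  have "hm_inner QY (c x) (c y) = coset A I (hm_inner Y ?x ?y)"
    by (simp add: quot_mod_def Let_def c_def)
  moreover have "em (hm_inner Y ?x ?y) - em (hm_inner Y x y) = hip (e ?x - e x) (e ?y) + hip (e x) (e ?y - e y)"
    using rx ry x y by (simp add: inner(2)[symmetric] hv.ip.diff_left hv.ip.diff_right)
  moreover have "\<dots> \<in> em ` I"
    by (intro hI.Id_sub(1) hI.Z_left hI.ZD rx ry)
  ultimately show ?thesis using rx ry x y by (simp add: coset_eq inner)
qed

lemma QY_norm:
  assumes x: "x \<in> hm_carrier Y"
  shows "hm_norm AI QY (c x) = hI.N (e x)"
proof -
  have "cs_norm AI (hm_inner QY (c x) (c x)) = infdist (hip (e x) (e x)) (em ` I)"
    using x by (simp add: QY_inner quot_norm inner)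
  also have "\<dots> = (hI.N (e x))\<^sup>2"
    using hI.N_sq_le[of "e x"] hI.NA_ip[of "e x" "e x"] by (simp add: power2_eq_square)
  finally show ?thesis by (simp add: hm_norm_def hI.N_nonneg)
qed

lemma QY_dist:
  assumes x: "x \<in> hm_carrier Y" and y: "y \<in> hm_carrier Y"
  shows "hm_dist AI QY (c x) (c y) = hI.N (e x - e y)"
  using x y by (simp add: hm_dist_def QY_neg QY_add QY_norm add neg)

lemma QY_fr:
  assumes "set ps \<subseteq> hm_carrier Y \<times> hm_carrier Y" and x: "x \<in> hm_carrier Y"
  shows "fr_apply QY (map (map_prod c c) ps) (c x) = c (fr_apply Y ps x)"
  using assms(1)
proof (induction ps)
  case Nil
  then show ?case by (simp add: fr_apply_simps QY_zero)
next
  case (Cons p ps)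
  then have p: "fst p \<in> hm_carrier Y" "snd p \<in> hm_carrier Y" and ps: "set ps \<subseteq> hm_carrier Y \<times> hm_carrier Y" by auto
  have "theta QY (c (fst p)) (c (snd p)) (c x) = c (theta Y (fst p) (snd p) x)"
    using p x by (simp add: theta_def QY_inner QY_act inner)
  then show ?case
    using Cons.IH[OF ps] e_fr[OF ps x] theta_mem[OF p x] by (simp add: fr_apply_simps QY_add)
qed

lemma lift_list:
  assumes "set qs \<subseteq> hm_carrier QY \<times> hm_carrier QY"
  obtains ps where "set ps \<subseteq> hm_carrier Y \<times> hm_carrier Y" "qs = map (map_prod c c) ps"
proof (rule that[of "map (map_prod rep rep) qs"])
  have r: "rep X \<in> hm_carrier Y \<and> c (rep X) = X" if "X \<in> hm_carrier QY" for X
    using that rep_c unfolding QY_carrier by blast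
  show "set (map (map_prod rep rep) qs) \<subseteq> hm_carrier Y \<times> hm_carrier Y"
    using assms r by force
  have "map_prod c c (map_prod rep rep z) = z" if "z \<in> set qs" for z
    using that assms r by (cases z) auto
  then show "qs = map (map_prod c c) (map (map_prod rep rep) qs)"
    unfolding map_map by (intro map_idI[symmetric]) simp
qed

text \<open>An orthogonal projection onto the image of \<open>Y\<close>. It extends maps given on
  \<open>Y\<close> to all ambient vectors, as \<open>approx\<close> requires, and it does not
  increase the quotient norm.\<close>

definition proj :: "('a, 'v) hvec endo \<Rightarrow> bool" where
  "proj q \<longleftrightarrow> hI.adj q q \<and> (\<forall>v. app q v \<in> e ` hm_carrier Y) \<and> (\<forall>x\<in>hm_carrier Y. app q (e x) = e x)"

lemma proj_facts:
  assumes "proj q"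
  shows "hI.adj q q" "app q v \<in> e ` hm_carrier Y" "v \<in> e ` hm_carrier Y \<Longrightarrow> app q v = v" "hI.N (app q v) \<le> hI.N v"
proof -
  show a: "hI.adj q q" and r: "\<And>v. app q v \<in> e ` hm_carrier Y"
    and id: "\<And>v. v \<in> e ` hm_carrier Y \<Longrightarrow> app q v = v"
    using assms by (auto simp: proj_def)
  have "q * q = q" by (rule endo_eqI) (simp add: r id)
  then have "norm q = (norm q)\<^sup>2" using hv.norm_adj_mult[OF a] by simp
  then have "norm q \<le> 1" by (cases "norm q = 0") (auto simp: power2_eq_square)
  then have "norm q * hI.N v \<le> 1 * hI.N v" by (intro mult_right_mono hI.N_nonneg)
  then show "hI.N (app q v) \<le> hI.N v" using hI.N_adj[OF a, of v] by simp
qed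

lemma Id_swap: "hip x y - hip z w \<in> em ` I \<Longrightarrow> hip y x - hip w z \<in> em ` I"
  using hI.Id_star[of "hip x y - hip z w"] by (simp add: star_diff hv.ip_star)

text \<open>Precomposed with \<open>q\<close>, the compact operator \<open>T0\<close> of the
  quotient satisfies \<open>approx\<close> and lifts to \<open>X\<close>. The factorization of
  \<open>T0\<close> as \<open>S'\<close> after \<open>S\<close> makes it symmetric modulo the ideal,
  so the adjoint \<open>X'\<close> agrees with \<open>X\<close> modulo \<open>Z\<close>, and the
  mean of \<open>X\<close> and \<open>X'\<close> is a self-adjoint lift.\<close>

lemma quot_contained_dest:
  assumes F: "compactly_contained AI QY F" and q: "proj q"
  obtains T where "T \<in> hI.Kop (e ` hm_carrier Y)" "hI.adj T T"
    "\<And>y. y \<in> hm_carrier Y \<Longrightarrow> c y \<in> F \<Longrightarrow> app T (e y) - e y \<in> hI.Z"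
proof -
  let ?Y = "e ` hm_carrier Y"
  note q = proj_facts[OF q]
  obtain T0 where pc: "hm_pos_compact AI QY T0" and fixF: "\<forall>X\<in>F. T0 X = X"
    using F unfolding compactly_contained_def by blast
  obtain S S' where SS: "hm_compact AI QY S \<and> (\<forall>x\<in>hm_carrier QY. S' x \<in> hm_carrier QY) \<and>
      hm_adjoint QY S S' \<and> (\<forall>x\<in>hm_carrier QY. T0 x = S' (S x))"
    using pc unfolding hm_pos_compact_def by (elim conjE exE) (rule that, intro conjI)
  have T0: "hm_compact AI QY T0" "\<And>X. X \<in> F \<Longrightarrow> T0 X = X"
    using pc fixF unfolding hm_pos_compact_def by simp_all
  have S: "hm_compact AI QY S" and S': "hm_adjoint QY S S'"
    "\<And>X. X \<in> hm_carrier QY \<Longrightarrow> T0 X = S' (S X)"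
    using SS by simp_all
  have mem: "\<exists>z\<in>hm_carrier Y. R (c y) = c z" if "hm_compact AI QY R" "y \<in> hm_carrier Y" for R y
    using that unfolding hm_compact_def QY_carrier by blast
  obtain t where t: "\<And>y. y \<in> hm_carrier Y \<Longrightarrow> t y \<in> hm_carrier Y" "\<And>y. y \<in> hm_carrier Y \<Longrightarrow> T0 (c y) = c (t y)"
    using mem[OF T0(1)] by metis
  obtain s where s: "\<And>y. y \<in> hm_carrier Y \<Longrightarrow> s y \<in> hm_carrier Y" "\<And>y. y \<in> hm_carrier Y \<Longrightarrow> S (c y) = c (s y)"
    using mem[OF S] by metis
  define \<psi> where "\<psi> v = e (t (ei (app q v)))" for v
  have ei_q: "ei (app q v) \<in> hm_carrier Y" "e (ei (app q v)) = app q v" for v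
    using q(2) by simp_all
  have "hI.approx ?Y \<psi>"
    unfolding hI.approx_def
  proof (intro allI impI)
    fix \<epsilon> :: real assume "\<epsilon> > 0"
    then obtain qs where qs: "set qs \<subseteq> hm_carrier QY \<times> hm_carrier QY"
      "\<And>X. X \<in> hm_carrier QY \<Longrightarrow> hm_dist AI QY (T0 X) (fr_apply QY qs X) \<le> \<epsilon> * hm_norm AI QY X"
      using T0(1) unfolding hm_compact_def by blast
    obtain ps where ps: "set ps \<subseteq> hm_carrier Y \<times> hm_carrier Y" "qs = map (map_prod c c) ps"
      using lift_list[OF qs(1)] by blast
    let ?D = "hI.fr (map (map_prod e e) ps)"
    have D: "?D \<in> hI.FR ?Y" by (rule hI.FR_I) (use ps(1) in force)
    \<comment> \<open>The vectors of \<open>?D\<close> lie in the image of \<open>Y\<close>, so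
      \<open>?D\<close> does not see what \<open>q\<close> removes.\<close>
    have Dq: "app ?D v = app ?D (app q v)" for v
    proof -
      have "hip (e y) v = hip (e y) (app q v)" if "y \<in> hm_carrier Y" for y
        using hv.adjD[OF q(1), of "e y" v] q(3)[of "e y"] that by simp
      then show ?thesis using ps(1) by (induction ps) (auto simp: app_lin)
    qed
    have "hI.N (app ?D v - \<psi> v) \<le> \<epsilon> * hI.N v" for v
    proof -
      let ?y = "ei (app q v)"
      have y: "?y \<in> hm_carrier Y" by (rule ei_q)
      note f = e_fr[OF ps(1) y]
      have cy: "c ?y \<in> hm_carrier QY" using y by (simp add: QY_carrier)
      have "hm_dist AI QY (T0 (c ?y)) (fr_apply QY qs (c ?y)) = hI.N (e (t ?y) - e (fr_apply Y ps ?y))"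
        using f y by (simp add: ps(2) QY_fr[OF ps(1)] t QY_dist)
      then have "hI.N (e (t ?y) - e (fr_apply Y ps ?y)) \<le> \<epsilon> * hI.N (app q v)"
        using qs(2)[OF cy] y by (simp add: QY_norm ei_q)
      also have "\<dots> \<le> \<epsilon> * hI.N v" using \<open>\<epsilon> > 0\<close> q(4) by (intro mult_left_mono) auto
      finally have le: "hI.N (\<psi> v - app ?D v) \<le> \<epsilon> * hI.N v"
        using f Dq[of v] by (simp add: \<psi>_def ei_q)
      have "app ?D v - \<psi> v = (- 1) *\<^sub>R (\<psi> v - app ?D v)" by simp
      then show ?thesis using le hI.N_scaleR[of "-1" "\<psi> v - app ?D v"] by simp
    qed
    then show "\<exists>D\<in>hI.Kop ?Y. \<forall>v. hI.N (app D v - \<psi> v) \<le> \<epsilon> * hI.N v"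
      using hI.FR_subset_Kop[OF D] by blast
  qed
  then obtain X where X: "X \<in> hI.Kop ?Y" "\<And>v. app X v - \<psi> v \<in> hI.Z"
    using hI.lift[OF submod_im] by blast
  obtain X' where X': "X' \<in> hI.Kop ?Y" "hI.adj X X'" using hI.Kop_adj[OF X(1)] by blast
  have t_sym: "hip (e (t y)) (e z) - hip (e y) (e (t z)) \<in> em ` I"
    if y: "y \<in> hm_carrier Y" and z: "z \<in> hm_carrier Y" for y z
  proof -
    have *: "hip (e (s y)) (e (s z)) - hip (e y) (e (t z)) \<in> em ` I"
      if y: "y \<in> hm_carrier Y" and z: "z \<in> hm_carrier Y" for y z
    proof -
      have cyz: "c y \<in> hm_carrier QY" "c z \<in> hm_carrier QY" "S (c z) \<in> hm_carrier QY"
        using y z s by (simp_all add: QY_carrier)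
      have "hm_inner QY (S (c y)) (S (c z)) = hm_inner QY (c y) (T0 (c z))"
        using S' cyz unfolding hm_adjoint_def by simp
      then show ?thesis
        using y z s t by (simp add: QY_inner coset_eq inner)
    qed
    have "hip (e (s y)) (e (s z)) - hip (e (t y)) (e z) \<in> em ` I"
      by (rule Id_swap[OF *[OF z y]])
    from hI.Id_sub(2)[OF *[OF y z] this] show ?thesis by simp
  qed
  have X'X: "app X' v - app X v \<in> hI.Z" for v
  proof (rule hI.ZI)
    fix w
    let ?w = "app q w" and ?v = "app q v"
    have Xq: "app q (app X v) = app X v" for v
      by (rule q(3)[OF hI.Kop_range[OF X(1) submod_im]])
    have 1: "hip w (app X' v) = hip (app X w) ?v"
      using hv.adjD[OF X'(2), of w v] hv.adjD[OF q(1), of "app X w" v] by (simp add: Xq)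
    have 2: "hip w (app X v) = hip ?w (app X v)"
      using hv.adjD[OF q(1), of w "app X v"] by (simp add: Xq)
    have 3: "hip (\<psi> w) ?v - hip ?w (\<psi> v) \<in> em ` I"
      using t_sym[OF ei_q(1) ei_q(1), of w v] by (simp add: \<psi>_def ei_q)
    have "hip w (app X' v - app X v)
        = hip (app X w - \<psi> w) ?v + (hip (\<psi> w) ?v - hip ?w (\<psi> v)) - hip ?w (app X v - \<psi> v)"
      by (simp add: hv.ip.diff_right hv.ip.diff_left 1 2)
    then show "hip w (app X' v - app X v) \<in> em ` I"
      using 3 by (simp only: hI.Id_sub(1,2) hI.Z_left[OF X(2)] hI.ZD[OF X(2)])
  qed
  show ?thesis
  proof (rule that[of "(1/2) *\<^sub>R (X + X')"])
    show "(1/2) *\<^sub>R (X + X') \<in> hI.Kop ?Y"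
      by (intro hI.Kop_scaleR hI.Kop_add X X' submod_im)
    show "hI.adj ((1/2) *\<^sub>R (X + X')) ((1/2) *\<^sub>R (X + X'))"
      using hv.adj_scaleR[OF hv.adj_add[OF X'(2) hv.adj_sym[OF X'(2)]], of "1/2"] by (simp add: add.commute)
    fix y assume y: "y \<in> hm_carrier Y" "c y \<in> F"
    have "c (t y) = c y" using T0(2)[OF y(2)] t(2)[OF y(1)] by simp
    then have ty: "e (t y) - e y \<in> hI.Z" using y t by (simp add: c_eq)
    have "\<psi> (e y) = e (t y)" using y q(3) by (simp add: \<psi>_def)
    then have "app X (e y) - e y = (app X (e y) - \<psi> (e y)) + (e (t y) - e y)" by simp
    then have Xy: "app X (e y) - e y \<in> hI.Z" by (simp only: hI.Z_sub(2)[OF X(2) ty])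
    have "app ((1/2) *\<^sub>R (X + X')) (e y) - e y
        = (1/2) *\<^sub>R ((app X' (e y) - app X (e y)) + 2 *\<^sub>R (app X (e y) - e y))"
      by (simp add: app_lin algebra_simps scaleR_2) (simp add: scaleR_left.add[symmetric])
    then show "app ((1/2) *\<^sub>R (X + X')) (e y) - e y \<in> hI.Z"
      using X'X Xy by (simp only: hI.Z_sub)
  qed
qed

text \<open>The operator induced on cosets by the compression of \<open>T\<close> with
  \<open>q\<close>. Its independence of the representative is \<open>qop_c\<close>: adjointable
  operators preserve \<open>Z\<close>.\<close>

definition qop :: "('a, 'v) hvec endo \<Rightarrow> ('a, 'v) hvec endo \<Rightarrow> 'y set \<Rightarrow> 'y set" where
  "qop q T X = c (ei (app q (app T (e (rep X)))))"

lemma qop_c: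
  assumes q: "proj q" and T: "hI.adj T T'" and y: "y \<in> hm_carrier Y"
  shows "qop q T (c y) = c (ei (app q (app T (e y))))"
proof -
  note q = proj_facts[OF q]
  have "app q (app T (e (rep (c y)) - e y)) \<in> hI.Z"
    by (intro hI.adj_Z[OF q(1)] hI.adj_Z[OF T] rep_c y)
  then show ?thesis
    unfolding qop_def using q(2) by (subst c_eq) (simp_all add: app_lin)
qed

lemma qop_compact:
  assumes q: "proj q" and T: "T \<in> hI.Kop U"
  shows "hm_compact AI QY (qop q T)"
  unfolding hm_compact_def
proof (intro conjI ballI allI impI)
  note qf = proj_facts[OF q]
  have ei_q: "ei (app q v) \<in> hm_carrier Y" "e (ei (app q v)) = app q v" for v
    using qf(2) by simp_all
  obtain T' where T': "hI.adj T T'" using hI.Kop_adj[OF T] by blast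
  show "qop q T X \<in> hm_carrier QY" if "X \<in> hm_carrier QY" for X
    by (simp add: qop_def QY_carrier ei_q)
  fix \<epsilon> :: real assume "\<epsilon> > 0"
  then obtain D where D: "D \<in> hI.FR U" "norm (T - D) < \<epsilon>"
    using hI.Kop_approx[OF T] by blast
  obtain qs where qs: "D = hI.fr qs" using hI.FR_E[OF D(1)] by blast
  obtain D' where D': "hI.adj D D'" using hI.FR_adj[OF D(1)] by blast
  let ?ps = "map (map_prod (\<lambda>v. ei (app q v)) (\<lambda>v. ei (app q v))) qs"
  have ps: "set ?ps \<subseteq> hm_carrier Y \<times> hm_carrier Y" using ei_q(1) by force
  have fr: "app (hI.fr (map (map_prod e e) ?ps)) (e y) = app q (app D (e y))" if y: "y \<in> hm_carrier Y" for y
  proof -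
    have "map (map_prod e e) ?ps = map (\<lambda>p. (app q (fst p), app q (snd p))) qs"
      by (simp add: map_prod_def case_prod_unfold ei_q)
    then have "hI.fr (map (map_prod e e) ?ps) = q * D * q"
      by (simp only: qs hI.fr_conj[OF qf(1) qf(1)])
    then show ?thesis using qf(3)[of "e y"] y by simp
  qed
  have "hm_dist AI QY (qop q T X) (fr_apply QY (map (map_prod c c) ?ps) X) \<le> \<epsilon> * hm_norm AI QY X"
    if X: "X \<in> hm_carrier QY" for X
  proof -
    obtain y where y: "y \<in> hm_carrier Y" "X = c y" using X by (auto simp: QY_carrier)
    note f = e_fr[OF ps y(1)]
    have "hm_dist AI QY (qop q T X) (fr_apply QY (map (map_prod c c) ?ps) X)
        = hI.N (app q (app T (e y)) - app q (app D (e y)))"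
      using f by (simp add: y qop_c[OF q T'] QY_fr[OF ps] QY_dist ei_q fr del: map_map)
    also have "\<dots> = hI.N (app q (app (T - D) (e y)))" by (simp add: app_lin)
    also have "\<dots> \<le> hI.N (app (T - D) (e y))" by (rule qf(4))
    also have "\<dots> \<le> norm (T - D) * hI.N (e y)" by (rule hI.N_adj[OF hv.adj_diff[OF T' D']])
    also have "\<dots> \<le> \<epsilon> * hI.N (e y)" using D(2) by (intro mult_right_mono hI.N_nonneg) auto
    finally show ?thesis by (simp add: y QY_norm)
  qed
  moreover have "set (map (map_prod c c) ?ps) \<subseteq> hm_carrier QY \<times> hm_carrier QY"
    using ps unfolding QY_carrier by force
  ultimately show "\<exists>ps. set ps \<subseteq> hm_carrier QY \<times> hm_carrier QY \<and>
      (\<forall>X\<in>hm_carrier QY. hm_dist AI QY (qop q T X) (fr_apply QY ps X) \<le> \<epsilon> * hm_norm AI QY X)"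
    by blast
qed

text \<open>\<open>U\<close> may be larger than the image of \<open>Y\<close>, as the images of
  \<open>M \<oplus> NI\<close> and \<open>N \<oplus> MI\<close> are, provided \<open>q\<close> moves
  its vectors only within \<open>Z\<close>. Compression by \<open>q\<close> is then multiplicative
  modulo \<open>Z\<close>, and the square of the induced operator serves as in
  \<open>contained_intro\<close>.\<close>

lemma quot_contained_intro:
  assumes F: "hm_submodule AI QY F" and q: "proj q" and U: "hI.submod U"
    and qU: "\<And>v. v \<in> U \<Longrightarrow> app q v - v \<in> hI.Z"
    and T: "T \<in> hI.Kop U" "hI.adj T T"
    and fixed: "\<And>y. y \<in> hm_carrier Y \<Longrightarrow> c y \<in> F \<Longrightarrow> app T (e y) - e y \<in> hI.Z"
  shows "compactly_contained AI QY F"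
proof -
  note qf = proj_facts[OF q]
  have ei_q: "ei (app q v) \<in> hm_carrier Y" "e (ei (app q v)) = app q v" for v
    using qf(2) by simp_all
  have TT: "hI.adj (T * T) (T * T)" by (rule hv.adj_mult[OF T(2) T(2)])
  have sq: "qop q (T * T) X = qop q T (qop q T X)" if X: "X \<in> hm_carrier QY" for X
  proof -
    obtain y where y: "y \<in> hm_carrier Y" "X = c y" using X by (auto simp: QY_carrier)
    have "app q (app T (app T (e y) - app q (app T (e y)))) \<in> hI.Z"
      using hI.Z_sub(3)[OF hI.Z_sub(1) qU[OF hI.Kop_range[OF T(1) U], of "e y"]]
      by (intro hI.adj_Z[OF qf(1)] hI.adj_Z[OF T(2)]) simp
    then show ?thesis
      by (simp add: y qop_c[OF q TT] qop_c[OF q T(2)] ei_q c_eq app_lin)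
  qed
  have "hm_compact AI QY (\<lambda>X. qop q T (qop q T X))"
    using qop_compact[OF q hI.Kop_mult[OF T(1) T(1) U]] unfolding hm_compact_def by (simp add: sq)
  moreover have "hm_adjoint QY (qop q T) (qop q T)"
    unfolding hm_adjoint_def QY_carrier
  proof (intro ballI, elim imageE)
    fix X Y' x y assume xy: "X = c x" "x \<in> hm_carrier Y" "Y' = c y" "y \<in> hm_carrier Y"
    have "hip (app q (app T (e x))) (e y) = hip (e x) (app q (app T (e y)))"
      using hv.adjD[OF qf(1), of "app T (e x)" "e y"] hv.adjD[OF T(2), of "e x" "e y"]
        hv.adjD[OF qf(1), of "e x" "app T (e y)"] qf(3) xy by simp
    then have "hm_inner Y (ei (app q (app T (e x)))) y = hm_inner Y x (ei (app q (app T (e y))))"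
      using inner(2)[of "ei (app q (app T (e x)))" y] inner(2)[of x "ei (app q (app T (e y)))"] xy
      by (simp add: ei_q em_inject inner(1))
    then show "hm_inner QY (qop q T X) Y' = hm_inner QY X (qop q T Y')"
      by (simp add: xy qop_c[OF q T(2)] QY_inner ei_q)
  qed
  ultimately have "hm_pos_compact AI QY (\<lambda>X. qop q T (qop q T X))"
    unfolding hm_pos_compact_def using qop_compact[OF q T(1)]
    by (intro conjI exI[of _ "qop q T"]) (simp_all add: hm_compact_def)
  moreover have "qop q T (qop q T X) = X" if X: "X \<in> F" for X
  proof -
    have fx: "qop q T X = X" if X: "X \<in> F"
    proof -
      have "X \<in> hm_carrier QY" using X F unfolding hm_submodule_def by blast
      then obtain y where y: "y \<in> hm_carrier Y" "X = c y" by (auto simp: QY_carrier)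
      have "app q (app T (e y) - e y) \<in> hI.Z"
        using X y by (intro hI.adj_Z[OF qf(1)] fixed) auto
      then show ?thesis using y qf(3)[of "e y"] by (simp add: qop_c[OF q T(2)] c_eq ei_q app_lin)
    qed
    show ?thesis using fx[OF X] by simp
  qed
  ultimately show ?thesis using F unfolding compactly_contained_def by blast
qed

end

section \<open>Isometric assignments modulo the ideal\<close>

context hilbI
begin

text \<open>An assignment which preserves inner products modulo the ideal is automatically linear modulo \<open>Z\<close>.\<close>

inductive_set span_pairs :: "('h \<times> 'h) set \<Rightarrow> ('h \<times> 'h) set" for \<Phi> where
  base: "(x, x') \<in> \<Phi> \<Longrightarrow> (x, x') \<in> span_pairs \<Phi>"
| zero: "(0, 0) \<in> span_pairs \<Phi>"
| add: "(x, x') \<in> span_pairs \<Phi> \<Longrightarrow> (y, y') \<in> span_pairs \<Phi> \<Longrightarrow> (x + y, x' + y') \<in> span_pairs \<Phi>"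
| scaleR: "(x, x') \<in> span_pairs \<Phi> \<Longrightarrow> (r *\<^sub>R x, r *\<^sub>R x') \<in> span_pairs \<Phi>"
| act: "(x, x') \<in> span_pairs \<Phi> \<Longrightarrow> (act x a, act x' a) \<in> span_pairs \<Phi>"
| imag: "(x, x') \<in> span_pairs \<Phi> \<Longrightarrow> (app J x, app J x') \<in> span_pairs \<Phi>"

lemma span_pairs_diff:
  "(x, x') \<in> span_pairs \<Phi> \<Longrightarrow> (y, y') \<in> span_pairs \<Phi> \<Longrightarrow> (x - y, x' - y') \<in> span_pairs \<Phi>"
  using span_pairs.add[of x x' \<Phi> "(-1) *\<^sub>R y" "(-1) *\<^sub>R y'"] span_pairs.scaleR[of y y' \<Phi> "-1"] by simp

lemma mulI_Id:
  assumes "i \<in> Id" shows "mulI i \<in> Id"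
proof -
  have "(\<lambda>n. mulI (i * e n)) \<longlonglongrightarrow> mulI i"
    by (rule bounded_linear.tendsto[OF bounded_linear_mulI e_lim[OF assms]])
  then show ?thesis
    by (rule closed_limit[OF Id(2), rotated]) (simp only: mulI_left[symmetric] Id_mult e_Id)
qed

lemma span_pairs_left:
  assumes "(x, x') \<in> span_pairs \<Phi>" "\<And>x x'. (x, x') \<in> \<Phi> \<Longrightarrow> ip y x - ip y' x' \<in> Id"
  shows "ip y x - ip y' x' \<in> Id"
  using assms(1)
proof induction
  case (base x x') then show ?case by (rule assms(2))
next
  case zero then show ?case by (simp add: ip.zero_right Id_sub)
next
  case (add x x' w w')
  then show ?case using Id_sub(1)[OF add.IH] by (simp add: ip.add_right algebra_simps)
next
  case (scaleR x x' r)
  then show ?case using Id_sub(3)[OF scaleR.IH, of r] by (simp add: ip.scaleR_right scaleR_diff_right)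
next
  case (act x x' a)
  then show ?case using Id_mult(2)[OF act.IH, of a] by (simp add: ip_act left_diff_distrib)
next
  case (imag x x')
  have "mulI (ip y x - ip y' x') = ip y (app J x) - ip y' (app J x')"
    using mulI_add[of "ip y x" "- ip y' x'"] by (simp add: ip_J mulI_minus)
  then show ?case using mulI_Id[OF imag.IH] by simp
qed

lemma span_pairs_ip:
  assumes \<Phi>: "\<And>x x' y y'. (x, x') \<in> \<Phi> \<Longrightarrow> (y, y') \<in> \<Phi> \<Longrightarrow> ip x y - ip x' y' \<in> Id"
    and x: "(x, x') \<in> span_pairs \<Phi>" and y: "(y, y') \<in> span_pairs \<Phi>"
  shows "ip x y - ip x' y' \<in> Id"
proof (rule span_pairs_left[OF y])
  fix w w' assume w: "(w, w') \<in> \<Phi>"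
  have "ip w x - ip w' x' \<in> Id" by (rule span_pairs_left[OF x]) (rule \<Phi>[OF w])
  then show "ip x w - ip x' w' \<in> Id"
    using Id_star[of "ip w x - ip w' x'"] by (simp add: star_diff ip_star)
qed

lemma N_sq: "(N x)\<^sup>2 = infdist (ip x x) Id"
  using N_sq_le[of x] NA_ip[of x x] by (simp add: power2_eq_square)

text \<open>Applied to a difference of two pairs, this carries every relation that holds modulo
  \<open>Z\<close> among the second components over to the first components, and conversely. It is
  how linearity, module linearity and injectivity are obtained from inner products alone.\<close>

lemma span_pairs_N:
  assumes \<Phi>: "\<And>x x' y y'. (x, x') \<in> \<Phi> \<Longrightarrow> (y, y') \<in> \<Phi> \<Longrightarrow> ip x y - ip x' y' \<in> Id"
    and x: "(x, x') \<in> span_pairs \<Phi>"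
  shows "N x = N x'"
proof -
  have "(N x)\<^sup>2 = (N x')\<^sup>2"
    unfolding N_sq by (rule infdist_sub_cong[OF Id(1) span_pairs_ip[OF \<Phi> x x]])
  then show ?thesis by (simp add: N_nonneg)
qed

end

subsection \<open>Direct sums\<close>

lemma cs_pos_norm_mono:
  assumes A: "cstar_algebra A" and p: "cs_pos A p" and q: "cs_pos A q"
  shows "cs_norm A p \<le> cs_norm A (cs_add A p q)"
proof -
  let ?e = "emb (A, ())"
  have fA: "cstar_algebra (fst (A, ()))" using A by simp
  have pe: "a \<in> cs_carrier A \<and> pos (?e a)" if a: "cs_pos A a" for a
  proof -
    obtain b where "b \<in> cs_carrier A" "a = cs_mult A (cs_star A b) b"
      using a unfolding cs_pos_def by blast
    then show ?thesis
      using emb_mult[OF fA, of "cs_star A b" b] emb_star[OF fA, of b]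
      by (simp add: cs_closed[OF A] pos_star_mult)
  qed
  have "norm (?e p) \<le> norm (?e p + ?e q)" using pe[OF p] pe[OF q] by (intro pos_norm_mono) auto
  also have "?e p + ?e q = ?e (cs_add A p q)"
    using emb_add[OF fA, of p q] pe[OF p] pe[OF q] by simp
  finally show ?thesis
    using norm_emb[OF fA] pe[OF p] pe[OF q] by (simp add: cs_closed[OF A])
qed

lemma cvs_swap:
  assumes V: "cvs V z ad ng sm" and "a \<in> V" "b \<in> V" "c \<in> V" "d \<in> V"
  shows "ad (ad a b) (ad c d) = ad (ad a c) (ad b d)"
proof -
  note cl = cvs_add[OF V]
  have "ad (ad a b) (ad c d) = ad a (ad b (ad c d))" by (rule cvs_assoc[OF V]) (use assms cl in auto)
  also have "ad b (ad c d) = ad (ad b c) d" by (rule cvs_assoc[OF V, symmetric]) (use assms in auto)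
  also have "ad b c = ad c b" by (rule cvs_commute[OF V]) (use assms in auto)
  also have "ad (ad c b) d = ad c (ad b d)" by (rule cvs_assoc[OF V]) (use assms in auto)
  also have "ad a (ad c (ad b d)) = ad (ad a c) (ad b d)"
    by (rule cvs_assoc[OF V, symmetric]) (use assms cl in auto)
  finally show ?thesis .
qed

lemma hm_dsum_simps [simp]:
  "hm_carrier (hm_dsum A M N) = hm_carrier M \<times> hm_carrier N"
  "hm_zero (hm_dsum A M N) = (hm_zero M, hm_zero N)"
  "hm_add (hm_dsum A M N) (a, b) (c, d) = (hm_add M a c, hm_add N b d)"
  "hm_neg (hm_dsum A M N) (a, b) = (hm_neg M a, hm_neg N b)"
  "hm_smul (hm_dsum A M N) z (a, b) = (hm_smul M z a, hm_smul N z b)"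
  "hm_act (hm_dsum A M N) (a, b) i = (hm_act M a i, hm_act N b i)"
  "hm_inner (hm_dsum A M N) (a, b) (c, d) = cs_add A (hm_inner M a c) (hm_inner N b d)"
  by (simp_all add: hm_dsum_def)

lemma restrict_simps [simp]:
  "hm_carrier (restrict_mod M F) = F" "hm_zero (restrict_mod M F) = hm_zero M"
  "hm_add (restrict_mod M F) = hm_add M" "hm_neg (restrict_mod M F) = hm_neg M"
  "hm_smul (restrict_mod M F) = hm_smul M" "hm_act (restrict_mod M F) = hm_act M"
  "hm_inner (restrict_mod M F) = hm_inner M"
  by (simp_all add: restrict_mod_def)

lemma sqrt_add_le: "0 \<le> a \<Longrightarrow> 0 \<le> b \<Longrightarrow> sqrt (a + b) \<le> sqrt a + sqrt b"
  by (rule real_le_lsqrt) (auto simp: power2_sum)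

context
  fixes A :: "'a cs_alg" and M :: "('m, 'a) hmod" and N :: "('n, 'a) hmod"
  assumes A: "cstar_algebra A" and M: "hilbert_module A M" and N: "hilbert_module A N"
begin

text \<open>The norm of a direct sum lies between the maximum and the sum of the two norms, so
  definiteness and completeness can be checked in each summand.\<close>

lemma dsum_norm:
  assumes x: "x \<in> hm_carrier M" and y: "y \<in> hm_carrier N"
  shows "hm_norm A M x \<le> hm_norm A (hm_dsum A M N) (x, y)"
    "hm_norm A N y \<le> hm_norm A (hm_dsum A M N) (x, y)"
    "hm_norm A (hm_dsum A M N) (x, y) \<le> hm_norm A M x + hm_norm A N y"
proof -
  have p: "cs_pos A (hm_inner M x x)" "cs_pos A (hm_inner N y y)"
    using hilbert_axioms(8)[OF M] hilbert_axioms(8)[OF N] x y by blast+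
  have c: "hm_inner M x x \<in> cs_carrier A" "hm_inner N y y \<in> cs_carrier A"
    using p by (simp_all add: cs_pos_def)
  show "hm_norm A M x \<le> hm_norm A (hm_dsum A M N) (x, y)"
    unfolding hm_norm_def by (simp add: cs_pos_norm_mono[OF A p])
  show "hm_norm A N y \<le> hm_norm A (hm_dsum A M N) (x, y)"
    using cs_pos_norm_mono[OF A p(2,1)] cs_vs(6)[OF A c] unfolding hm_norm_def by simp
  have "sqrt (cs_norm A (cs_add A (hm_inner M x x) (hm_inner N y y)))
      \<le> sqrt (cs_norm A (hm_inner M x x) + cs_norm A (hm_inner N y y))"
    by (rule real_sqrt_le_mono) (rule cs_norm_tri[OF A c])
  also have "\<dots> \<le> hm_norm A M x + hm_norm A N y"
    unfolding hm_norm_def by (intro sqrt_add_le cs_norm_nonneg[OF A] c)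
  finally show "hm_norm A (hm_dsum A M N) (x, y) \<le> hm_norm A M x + hm_norm A N y"
    by (simp add: hm_norm_def)
qed

lemma pre_hilb_dsum: "pre_hilb A (hm_dsum A M N)"
proof -
  note pM = hilbert_pre_hilb[OF A M] and pN = hilbert_pre_hilb[OF A N]
  note vM = hm_cvs[OF pM] and vN = hm_cvs[OF pN]
  note cM = hm_vs(1-4)[OF pM] hm_act_closed[OF pM] hm_inner_closed[OF pM]
  note cN = hm_vs(1-4)[OF pN] hm_act_closed[OF pN] hm_inner_closed[OF pN]
  let ?H = "hm_dsum A M N"
  have cvs: "cvs (hm_carrier ?H) (hm_zero ?H) (hm_add ?H) (hm_neg ?H) (hm_smul ?H)"
    unfolding cvs_def
  proof (intro conjI ballI allI)
    show "hm_add ?H x y = hm_add ?H y x" if "x \<in> hm_carrier ?H" "y \<in> hm_carrier ?H" for x y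
      using that by (cases x; cases y) (auto intro: cvs_commute[OF vM] cvs_commute[OF vN])
  qed (auto simp: cM cN hm_vs(5,7-12)[OF pM] hm_vs(5,7-12)[OF pN])
  have complete: "complete_wrt (hm_carrier ?H) (hm_dist A ?H)"
    unfolding complete_wrt_def
  proof (intro allI impI)
    fix s :: "nat \<Rightarrow> 'm \<times> 'n" assume s: "\<forall>n. s n \<in> hm_carrier ?H"
      and C: "\<forall>e>0. \<exists>K. \<forall>m\<ge>K. \<forall>n\<ge>K. hm_dist A ?H (s m) (s n) < e"
    have s1: "fst (s n) \<in> hm_carrier M" and s2: "snd (s n) \<in> hm_carrier N" for n
      using s by (simp_all add: mem_Times_iff)
    have d: "hm_dist A ?H (s m) x = hm_norm A ?H (hm_add M (fst (s m)) (hm_neg M (fst x)),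
        hm_add N (snd (s m)) (hm_neg N (snd x)))" for m x
      by (cases "s m"; cases x) (simp add: hm_dist_def)
    have le: "hm_dist A M (fst (s m)) x \<le> hm_dist A ?H (s m) (x, y)"
      "hm_dist A N (snd (s m)) y \<le> hm_dist A ?H (s m) (x, y)"
      "hm_dist A ?H (s m) (x, y) \<le> hm_dist A M (fst (s m)) x + hm_dist A N (snd (s m)) y"
      if "x \<in> hm_carrier M" "y \<in> hm_carrier N" for m x y
      unfolding d unfolding hm_dist_def fst_conv snd_conv
      by (intro dsum_norm cM(2,3) cN(2,3) s1 s2 that)+
    have le': "hm_dist A M (fst (s m)) (fst (s n)) \<le> hm_dist A ?H (s m) (s n)"
      "hm_dist A N (snd (s m)) (snd (s n)) \<le> hm_dist A ?H (s m) (s n)" for m n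
      using le(1,2)[OF s1 s2, of m n n] by simp_all
    have "\<exists>l\<in>hm_carrier M. (\<lambda>n. hm_dist A M (fst (s n)) l) \<longlonglongrightarrow> 0"
      using hm_complete[OF pM, unfolded complete_wrt_def, rule_format, of "\<lambda>n. fst (s n)"] s1 C le'(1)
      by (meson le_less_trans)
    then obtain l1 where l1: "l1 \<in> hm_carrier M" "(\<lambda>n. hm_dist A M (fst (s n)) l1) \<longlonglongrightarrow> 0" by blast
    have "\<exists>l\<in>hm_carrier N. (\<lambda>n. hm_dist A N (snd (s n)) l) \<longlonglongrightarrow> 0"
      using hm_complete[OF pN, unfolded complete_wrt_def, rule_format, of "\<lambda>n. snd (s n)"] s2 C le'(2)
      by (meson le_less_trans)
    then obtain l2 where l2: "l2 \<in> hm_carrier N" "(\<lambda>n. hm_dist A N (snd (s n)) l2) \<longlonglongrightarrow> 0" by blast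
    have lim: "(\<lambda>n. hm_dist A M (fst (s n)) l1 + hm_dist A N (snd (s n)) l2) \<longlonglongrightarrow> 0"
      using tendsto_add[OF l1(2) l2(2)] by simp
    have nn: "0 \<le> hm_dist A M (fst (s n)) l1" for n
      unfolding hm_dist_def hm_norm_def
      by (intro real_sqrt_ge_zero cs_norm_nonneg[OF A] cM s1 l1)
    have "(\<lambda>n. hm_dist A ?H (s n) (l1, l2)) \<longlonglongrightarrow> 0"
    proof (rule Lim_null_comparison[OF _ lim], rule always_eventually, rule allI)
      fix n
      have "0 \<le> hm_dist A ?H (s n) (l1, l2)" using nn[of n] le(1)[OF l1(1) l2(1), of n] by linarith
      then show "norm (hm_dist A ?H (s n) (l1, l2)) \<le> hm_dist A M (fst (s n)) l1 + hm_dist A N (snd (s n)) l2"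
        using le(3)[OF l1(1) l2(1), of n] by simp
    qed
    then show "\<exists>l\<in>hm_carrier ?H. (\<lambda>n. hm_dist A ?H (s n) l) \<longlonglongrightarrow> 0"
      using l1(1) l2(1) by (intro bexI[of _ "(l1, l2)"]) simp_all
  qed
  show ?thesis
    unfolding pre_hilb_def
  proof (intro conjI cvs complete ballI allI impI)
    show "\<exists>b\<in>cs_carrier A. \<exists>c\<in>cs_carrier A.
        hm_inner ?H x x = cs_add A (cs_mult A (cs_star A b) b) (cs_mult A (cs_star A c) c)"
      if "x \<in> hm_carrier ?H" for x
    proof (cases x)
      case (Pair a b)
      then have "cs_pos A (hm_inner M a a)" "cs_pos A (hm_inner N b b)"
        using hilbert_axioms(8)[OF M] hilbert_axioms(8)[OF N] that by auto
      then show ?thesis unfolding Pair hm_dsum_simps cs_pos_def by metis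
    qed
    show "x = hm_zero ?H" if x: "x \<in> hm_carrier ?H" and 0: "hm_inner ?H x x = cs_zero A" for x
    proof (cases x)
      case (Pair a b)
      then have ab: "a \<in> hm_carrier M" "b \<in> hm_carrier N" using x by auto
      have "hm_norm A ?H (a, b) = 0"
        using 0 cs_norm_eq_0[OF A cs_closed(1)[OF A]] by (simp add: Pair hm_norm_def)
      then have "hm_norm A M a \<le> 0" "hm_norm A N b \<le> 0" using dsum_norm(1,2)[OF ab] by simp_all
      then have "cs_norm A (hm_inner M a a) = 0" "cs_norm A (hm_inner N b b) = 0"
        using cs_norm_nonneg[OF A] ab cM cN by (simp_all add: hm_norm_def order_antisym)
      then show ?thesis
        using ab cM cN by (simp add: Pair cs_norm_eq_0[OF A] hm_definite[OF pM] hm_definite[OF pN])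
    qed
    show "hm_inner ?H x (hm_add ?H y w) = cs_add A (hm_inner ?H x y) (hm_inner ?H x w)"
      if "x \<in> hm_carrier ?H" "y \<in> hm_carrier ?H" "w \<in> hm_carrier ?H" for x y w
      using that cM cN
      by (cases x; cases y; cases w)
        (simp add: hm_inner_add[OF pM] hm_inner_add[OF pN] cvs_swap[OF cs_cvs[OF A]])
    show "hm_inner ?H y x = cs_star A (hm_inner ?H x y)"
      if "x \<in> hm_carrier ?H" "y \<in> hm_carrier ?H" for x y
    proof (cases x; cases y)
      fix a b c d assume xy: "x = (a, b)" "y = (c, d)"
      then show ?thesis
        using that cM cN hm_inner_star[OF pM, of a c] hm_inner_star[OF pN, of b d]
        by (simp add: cs_star_add[OF A])
    qed
  qed (auto simp: cM cN cs_closed[OF A] hm_inner_smul[OF pM] hm_inner_smul[OF pN] cs_vs(9)[OF A]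
      hm_inner_act[OF pM] hm_inner_act[OF pN] cs_distrib_right[OF A])
qed

end

text \<open>The ambient module is \<open>M \<oplus> N\<close>. Having both direct sums of the
  theorem inside it makes it possible to move one into the other by a unitary of the common
  space.\<close>

locale dsum_pair =
  fixes A :: "'a cs_alg" and M :: "('m, 'a) hmod" and N :: "('n, 'a) hmod" and I :: "'a set" and u :: "nat \<Rightarrow> 'a"
  assumes cA: "cstar_algebra A" and M: "hilbert_module A M" and N: "hilbert_module A N"
    and ideal': "closed_ideal A I"
    and u': "\<And>n. u n \<in> I" "\<And>n. cs_pos A (u n)" "\<And>n. cs_norm A (u n) \<le> 1"
    and u_lim': "\<And>i. i \<in> I \<Longrightarrow> (\<lambda>n. cs_dist A (cs_mult A i (u n)) i) \<longlonglongrightarrow> 0"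
begin

abbreviation HH :: "('m \<times> 'n, 'a) hmod" where
  "HH \<equiv> hm_dsum A M N"

sublocale idl A HH I u
  by standard (simp_all add: cA pre_hilb_dsum[OF cA M N] ideal' u' u_lim')

lemma pH: "hgood (A, HH)"
  by (rule good)

lemma pH': "pre_hilb A HH"
  using good by simp

lemma preM: "pre_hilb A M" and preN: "pre_hilb A N"
  by (rule hilbert_pre_hilb[OF cA M], rule hilbert_pre_hilb[OF cA N])

lemmas clM = hm_vs(1-4)[OF preM] hm_act_closed[OF preM] hm_inner_closed[OF preM]
lemmas clN = hm_vs(1-4)[OF preN] hm_act_closed[OF preN] hm_inner_closed[OF preN]
lemmas clH = hm_vs(1-4)[OF pH'] hm_act_closed[OF pH'] hm_inner_closed[OF pH']

abbreviation h :: "'m \<times> 'n \<Rightarrow> ('a, 'm \<times> 'n) hvec" where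
  "h \<equiv> hemb (A, HH)"

abbreviation vat :: "('a, 'm \<times> 'n) hvec \<Rightarrow> 'm \<times> 'n" where
  "vat v \<equiv> vec_at v (A, HH)"

lemma at_mem: "vat v \<in> hm_carrier HH" "fst (vat v) \<in> hm_carrier M" "snd (vat v) \<in> hm_carrier N"
  using vec_at_mem[OF pH, of v] by (simp_all add: mem_Times_iff)

lemma h_add: "x \<in> hm_carrier HH \<Longrightarrow> y \<in> hm_carrier HH \<Longrightarrow> h (hm_add HH x y) = h x + h y"
  using hemb_add[OF pH, of x y] by simp

lemma h_real: "x \<in> hm_carrier HH \<Longrightarrow> h (hm_smul HH (of_real r) x) = r *\<^sub>R h x"
  using hemb_smul_real[OF pH, of x r] by simp

lemma h_smul:
  assumes x: "x \<in> hm_carrier HH" shows "h (hm_smul HH z x) = csm z (h x)"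
proof -
  have "z = of_real (Re z) + \<i> * of_real (Im z)" by (rule complex_eq)
  then have "hm_smul HH z x = hm_add HH (hm_smul HH (of_real (Re z)) x) (hm_smul HH \<i> (hm_smul HH (of_real (Im z)) x))"
    using hm_vs(10)[OF pH' x, of "of_real (Re z)" "\<i> * of_real (Im z)"]
      hm_vs(11)[OF pH' x, of \<i> "of_real (Im z)"] by simp
  then have "h (hm_smul HH z x) = Re z *\<^sub>R h x + app JJ (Im z *\<^sub>R h x)"
    using x hemb_smul_I[OF pH, of "hm_smul HH (of_real (Im z)) x"]
    by (simp only: h_add h_real clH(4) snd_conv)
  then show ?thesis by (simp add: csm_def app_lin)
qed

lemma h_zero: "h (hm_zero HH) = 0"
  using h_real[OF clH(1), of 0] cvs_smul_0[OF hm_cvs[OF pH'] clH(1)] by (simp del: hm_dsum_simps)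

lemma h_neg: "x \<in> hm_carrier HH \<Longrightarrow> h (hm_neg HH x) = - h x"
  using h_real[of x "-1"] cvs_neg_smul[OF hm_cvs[OF pH'], of x] by (simp del: hm_dsum_simps)

lemma h_inner: "x \<in> hm_carrier HH \<Longrightarrow> y \<in> hm_carrier HH \<Longrightarrow> hip (h x) (h y) = em (hm_inner HH x y)"
  using hip_hemb[OF pH, of x y] by simp

text \<open>Here \<open>v\<close> is any ambient vector; an embedded \<open>x\<close> sees only its
  coordinate \<open>(A, HH)\<close>. Adjointness of \<open>pM\<close> and \<open>pN\<close> has to
  be tested against such \<open>v\<close>.\<close>

lemma h_inner_at:
  assumes x: "x \<in> hm_carrier HH" shows "hip (h x) v = em (hm_inner HH x (vat v))"
proof (rule hip_eqI)
  have i: "hm_inner HH x (vat v) \<in> cs_carrier A" by (rule clH(6)[OF x at_mem(1)])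
  fix q :: "'a cs_alg \<times> ('m \<times> 'n, 'a) hmod"
  { assume q: "hgood q"
    show "el_at (hip (h x) v) q = el_at (em (hm_inner HH x (vat v))) q"
    proof (cases "q = (A, HH)")
      case True
      then show ?thesis using x hip_at[OF pH, of "h x" v] em_at[OF i]
        by (simp add: hemb_at[OF pH] del: hm_dsum_simps)
    next
      case False
      have "hm_inner (snd q) (vec_at v q) (hm_zero (snd q)) = cs_zero (fst q)"
        using q by (intro hm_inner_zero vec_at_mem) auto
      then have "hm_inner (snd q) (hm_zero (snd q)) (vec_at v q) = cs_zero (fst q)"
        using q hm_inner_star[of "fst q" "snd q" "vec_at v q" "hm_zero (snd q)"] vec_at_mem[OF q, of v]
        by (simp add: cs_star_zero hm_vs(1)[of "fst q"])
      then show ?thesis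
        using q x False i A by (simp add: hip_at vec_at_hemb[OF pH] el_at_emb del: hm_dsum_simps)
    qed }
  { assume "cstar_algebra (fst q)" "\<not> hgood q"
    then show "el_at (em (hm_inner HH x (vat v))) q = cs_zero (fst q)"
      using pH i A by (auto simp: el_at_emb) }
qed

lemma h_act:
  assumes x: "x \<in> hm_carrier HH" shows "hact (h x) b = h (hm_act HH x (el_at b (A, HH)))"
proof (rule vec_eqI)
  have ax: "hm_act HH x (el_at b (A, HH)) \<in> hm_carrier HH" by (rule clH(5)[OF x el_at_A])
  fix q :: "'a cs_alg \<times> ('m \<times> 'n, 'a) hmod" assume q: "hgood q"
  then show "vec_at (hact (h x) b) q = vec_at (h (hm_act HH x (el_at b (A, HH)))) q"
    using x ax by (simp add: hact.rep_eq vec_at_hemb[OF pH] hm_act_zero[of "fst q"] el_at_mem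
        del: hm_dsum_simps)
qed

lemma h_norm: "x \<in> hm_carrier HH \<Longrightarrow> norm (h x) = hm_norm A HH x"
  using hv.ip_norm[of "h x"] by (simp add: hm_norm_def h_inner em_norm clH del: hm_dsum_simps)

lemma at_h: "x \<in> hm_carrier HH \<Longrightarrow> vat (h x) = x"
  using hemb_at[OF pH, of x] by simp

lemma at_add: "vat (v + w) = hm_add HH (vat v) (vat w)"
  using pH by (simp add: plus_hvec.rep_eq)

lemma at_scaleR: "vat (r *\<^sub>R v) = hm_smul HH (of_real r) (vat v)"
  using pH by (simp add: scaleR_hvec.rep_eq)

definition pM :: "('a, 'm \<times> 'n) hvec endo" where
  "pM = endo_of (\<lambda>v. h (fst (vat v), hm_zero N))"

definition pN :: "('a, 'm \<times> 'n) hvec endo" where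
  "pN = endo_of (\<lambda>v. h (hm_zero M, snd (vat v)))"

lemma coords:
  "(fst (vat v), hm_zero N) \<in> hm_carrier HH" "(hm_zero M, snd (vat v)) \<in> hm_carrier HH"
  by (simp_all add: at_mem clM clN)

lemma zeros: "hm_add M (hm_zero M) (hm_zero M) = hm_zero M" "hm_add N (hm_zero N) (hm_zero N) = hm_zero N"
  "hm_smul M z (hm_zero M) = hm_zero M" "hm_smul N z (hm_zero N) = hm_zero N"
  using cvs_zero_left[OF hm_cvs[OF preM] clM(1)] cvs_zero_left[OF hm_cvs[OF preN] clN(1)]
    cvs_smul_zero[OF hm_cvs[OF preM]] cvs_smul_zero[OF hm_cvs[OF preN]] by simp_all

lemma coord_norm: "hm_norm A HH (fst x, hm_zero N) \<le> hm_norm A HH x" "hm_norm A HH (hm_zero M, snd x) \<le> hm_norm A HH x"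
  if x: "x \<in> hm_carrier HH" for x
proof -
  obtain a b where ab: "x = (a, b)" "a \<in> hm_carrier M" "b \<in> hm_carrier N" using x by auto
  have z: "hm_norm A M (hm_zero M) = 0" "hm_norm A N (hm_zero N) = 0"
    using hm_inner_zero[OF cA preM clM(1)] hm_inner_zero[OF cA preN clN(1)]
      cs_norm_eq_0[OF cA cs_closed(1)[OF cA]] by (simp_all add: hm_norm_def)
  show "hm_norm A HH (fst x, hm_zero N) \<le> hm_norm A HH x"
    using dsum_norm(3)[OF cA M N ab(2) clN(1)] dsum_norm(1)[OF cA M N ab(2,3)] z ab(1) by simp
  show "hm_norm A HH (hm_zero M, snd x) \<le> hm_norm A HH x"
    using dsum_norm(3)[OF cA M N clM(1) ab(3)] dsum_norm(2)[OF cA M N ab(2,3)] z ab(1) by simp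
qed

lemma norm_at: "hm_norm A HH (vat v) \<le> norm v"
  using norm_hvec_at[OF pH, of v] by simp

lemma app_pM: "app pM v = h (fst (vat v), hm_zero N)"
  unfolding pM_def
proof (rule app_endo_of, rule bounded_linear_intro[where K=1])
  fix v w r
  have "(fst (vat (v + w)), hm_zero N) = hm_add HH (fst (vat v), hm_zero N) (fst (vat w), hm_zero N)"
    unfolding at_add by (cases "vat v"; cases "vat w") (simp add: zeros)
  then show "h (fst (vat (v + w)), hm_zero N) = h (fst (vat v), hm_zero N) + h (fst (vat w), hm_zero N)"
    by (simp only: h_add coords)
  have "(fst (vat (r *\<^sub>R v)), hm_zero N) = hm_smul HH (of_real r) (fst (vat v), hm_zero N)"
    unfolding at_scaleR by (cases "vat v") (simp add: zeros)
  then show "h (fst (vat (r *\<^sub>R v)), hm_zero N) = r *\<^sub>R h (fst (vat v), hm_zero N)"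
    by (simp only: h_real coords)
  show "norm (h (fst (vat v), hm_zero N)) \<le> norm v * 1"
    unfolding h_norm[OF coords(1)] using order_trans[OF coord_norm(1)[OF at_mem(1)] norm_at, of v] by simp
qed

lemma app_pN: "app pN v = h (hm_zero M, snd (vat v))"
  unfolding pN_def
proof (rule app_endo_of, rule bounded_linear_intro[where K=1])
  fix v w r
  have "(hm_zero M, snd (vat (v + w))) = hm_add HH (hm_zero M, snd (vat v)) (hm_zero M, snd (vat w))"
    unfolding at_add by (cases "vat v"; cases "vat w") (simp add: zeros)
  then show "h (hm_zero M, snd (vat (v + w))) = h (hm_zero M, snd (vat v)) + h (hm_zero M, snd (vat w))"
    by (simp only: h_add coords)
  have "(hm_zero M, snd (vat (r *\<^sub>R v))) = hm_smul HH (of_real r) (hm_zero M, snd (vat v))"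
    unfolding at_scaleR by (cases "vat v") (simp add: zeros)
  then show "h (hm_zero M, snd (vat (r *\<^sub>R v))) = r *\<^sub>R h (hm_zero M, snd (vat v))"
    by (simp only: h_real coords)
  show "norm (h (hm_zero M, snd (vat v))) \<le> norm v * 1"
    unfolding h_norm[OF coords(2)] using order_trans[OF coord_norm(2)[OF at_mem(1)] norm_at, of v] by simp
qed

lemma inner_zero:
  "x \<in> hm_carrier M \<Longrightarrow> hm_inner M x (hm_zero M) = cs_zero A" "x \<in> hm_carrier M \<Longrightarrow> hm_inner M (hm_zero M) x = cs_zero A"
  "y \<in> hm_carrier N \<Longrightarrow> hm_inner N y (hm_zero N) = cs_zero A" "y \<in> hm_carrier N \<Longrightarrow> hm_inner N (hm_zero N) y = cs_zero A"
  using hm_inner_zero[OF cA preM, of x] hm_inner_star[OF preM, of x "hm_zero M"]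
    hm_inner_zero[OF cA preN, of y] hm_inner_star[OF preN, of y "hm_zero N"]
  by (simp_all add: clM clN cs_star_zero[OF cA])

lemmas cs_add_zero = cvs_zero_right[OF cs_cvs[OF cA]] cvs_zero_left[OF cs_cvs[OF cA]]

lemma adj_pM: "hv.adj pM pM"
  unfolding hv.adj_def
proof (intro allI)
  have 1: "hip (app pM v) w = em (hm_inner M (fst (vat v)) (fst (vat w)))" for v w
    unfolding app_pM h_inner_at[OF coords(1)]
    using at_mem[of v] at_mem[of w] by (cases "vat v"; cases "vat w") (simp add: inner_zero cs_add_zero clM)
  fix v w
  have "hip v (app pM w) = star (em (hm_inner M (fst (vat w)) (fst (vat v))))"
    using hv.ip_star[of "app pM w" v] by (simp add: 1)
  also have "\<dots> = em (hm_inner M (fst (vat v)) (fst (vat w)))"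
    using hm_inner_star[OF preM at_mem(2) at_mem(2), of v w] by (simp add: em_star clM at_mem)
  finally show "hip (app pM v) w = hip v (app pM w)" by (simp add: 1)
qed

lemma adj_pN: "hv.adj pN pN"
  unfolding hv.adj_def
proof (intro allI)
  have 1: "hip (app pN v) w = em (hm_inner N (snd (vat v)) (snd (vat w)))" for v w
    unfolding app_pN h_inner_at[OF coords(2)]
    using at_mem[of v] at_mem[of w] by (cases "vat v"; cases "vat w") (simp add: inner_zero cs_add_zero clN)
  fix v w
  have "hip v (app pN w) = star (em (hm_inner N (snd (vat w)) (snd (vat v))))"
    using hv.ip_star[of "app pN w" v] by (simp add: 1)
  also have "\<dots> = em (hm_inner N (snd (vat v)) (snd (vat w)))"
    using hm_inner_star[OF preN at_mem(3) at_mem(3), of v w] by (simp add: em_star clN at_mem)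
  finally show "hip (app pN v) w = hip v (app pN w)" by (simp add: 1)
qed

lemma pMN: "pM * pM = pM" "pN * pN = pN" "pM * pN = 0" "pN * pM = 0"
  by (rule endo_eqI; simp add: app_pM app_pN at_h[OF coords(1)] at_h[OF coords(2)] h_zero[simplified] app_lin)+

lemma h_split:
  assumes "a \<in> hm_carrier M" "b \<in> hm_carrier N"
  shows "app pM (h (a, b)) = h (a, hm_zero N)" "app pN (h (a, b)) = h (hm_zero M, b)"
    "h (a, b) = h (a, hm_zero N) + h (hm_zero M, b)"
proof -
  have ab: "(a, b) \<in> hm_carrier HH" using assms by simp
  show "app pM (h (a, b)) = h (a, hm_zero N)" "app pN (h (a, b)) = h (hm_zero M, b)"
    by (simp_all only: app_pM app_pN at_h[OF ab] fst_conv snd_conv)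
  have "(a, b) = hm_add HH (a, hm_zero N) (hm_zero M, b)"
    using assms cvs_zero_right[OF hm_cvs[OF preM]] cvs_zero_left[OF hm_cvs[OF preN]] by simp
  then show "h (a, b) = h (a, hm_zero N) + h (hm_zero M, b)"
    using h_add[of "(a, hm_zero N)" "(hm_zero M, b)"] assms by (simp add: clM clN)
qed

lemma h_at: "app pM v + app pN v = h (vat v)"
  using h_split(3)[OF at_mem(2,3), of v v] by (simp add: app_pM app_pN)

lemma closed_eq: "closed {v. app S v = app T v}"
  by (rule closed_Collect_eq) (intro linear_continuous_on app.bounded_linear_right)+

text \<open>Every module below sits in \<open>M \<oplus> N\<close> through an isometry \<open>f\<close>.\<close>

lemma emod_via:
  fixes Y :: "('y, 'a) hmod"
  assumes f: "\<And>x. x \<in> hm_carrier Y \<Longrightarrow> f x \<in> hm_carrier HH" and inj: "inj_on f (hm_carrier Y)"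
    and zero: "hm_zero Y \<in> hm_carrier Y" "f (hm_zero Y) = hm_zero HH"
    and add: "\<And>x y. x \<in> hm_carrier Y \<Longrightarrow> y \<in> hm_carrier Y \<Longrightarrow> hm_add Y x y \<in> hm_carrier Y \<and> f (hm_add Y x y) = hm_add HH (f x) (f y)"
    and neg: "\<And>x. x \<in> hm_carrier Y \<Longrightarrow> hm_neg Y x \<in> hm_carrier Y \<and> f (hm_neg Y x) = hm_neg HH (f x)"
    and smul: "\<And>x z. x \<in> hm_carrier Y \<Longrightarrow> hm_smul Y z x \<in> hm_carrier Y \<and> f (hm_smul Y z x) = hm_smul HH z (f x)"
    and act: "\<And>x a. x \<in> hm_carrier Y \<Longrightarrow> a \<in> cs_carrier A \<Longrightarrow> hm_act Y x a \<in> hm_carrier Y \<and> f (hm_act Y x a) = hm_act HH (f x) a"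
    and inner: "\<And>x y. x \<in> hm_carrier Y \<Longrightarrow> y \<in> hm_carrier Y \<Longrightarrow> hm_inner Y x y = hm_inner HH (f x) (f y)"
    and closed: "closed ((\<lambda>x. h (f x)) ` hm_carrier Y)"
  shows "emod A HH I u Y (\<lambda>x. h (f x))"
proof
  fix x y b and a :: 'a and c
  show "hm_zero Y \<in> hm_carrier Y" "h (f (hm_zero Y)) = 0" using zero h_zero by simp_all
  show "closed ((\<lambda>x. h (f x)) ` hm_carrier Y)" by (rule closed)
  show "inj_on (\<lambda>x. h (f x)) (hm_carrier Y)"
    using inj f hemb_inject[OF pH] by (auto simp: inj_on_def simp del: hm_dsum_simps)
  assume x: "x \<in> hm_carrier Y"
  show "hm_neg Y x \<in> hm_carrier Y" "h (f (hm_neg Y x)) = - h (f x)"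
    using neg[OF x] h_neg[OF f[OF x]] by simp_all
  show "hm_smul Y c x \<in> hm_carrier Y" "h (f (hm_smul Y c x)) = csm c (h (f x))"
    using smul[OF x] h_smul[OF f[OF x]] by simp_all
  show "hact (h (f x)) b = h (f (hm_act Y x (el_at b (A, HH))))"
    using act[OF x el_at_A] h_act[OF f[OF x]] by simp
  { assume "a \<in> cs_carrier A"
    then show "hm_act Y x a \<in> hm_carrier Y" using act[OF x] by blast }
  assume y: "y \<in> hm_carrier Y"
  show "hm_add Y x y \<in> hm_carrier Y" "h (f (hm_add Y x y)) = h (f x) + h (f y)"
    using add[OF x y] h_add[OF f[OF x] f[OF y]] by simp_all
  show "hm_inner Y x y \<in> cs_carrier A" "hip (h (f x)) (h (f y)) = em (hm_inner Y x y)"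
    using inner[OF x y] clH(6)[OF f[OF x] f[OF y]] h_inner[OF f[OF x] f[OF y]] by simp_all
qed

lemma neg_zeros: "hm_neg M (hm_zero M) = hm_zero M" "hm_neg N (hm_zero N) = hm_zero N"
  by (rule cvs_neg_zero[OF hm_cvs[OF preM]], rule cvs_neg_zero[OF hm_cvs[OF preN]])

lemma act_zeros: "a \<in> cs_carrier A \<Longrightarrow> hm_act M (hm_zero M) a = hm_zero M" "a \<in> cs_carrier A \<Longrightarrow> hm_act N (hm_zero N) a = hm_zero N"
  by (rule hm_act_zero[OF cA preM], assumption, rule hm_act_zero[OF cA preN], assumption)

definition eM :: "'m \<Rightarrow> ('a, 'm \<times> 'n) hvec" where
  "eM m = h (m, hm_zero N)"

definition eN :: "'n \<Rightarrow> ('a, 'm \<times> 'n) hvec" where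
  "eN n = h (hm_zero M, n)"

lemma eM_im: "eM ` hm_carrier M = {v. app pM v = v}"
proof (intro equalityI subsetI)
  show "v \<in> {v. app pM v = v}" if "v \<in> eM ` hm_carrier M" for v
    using that h_split(1) by (auto simp: eM_def clN)
  show "v \<in> eM ` hm_carrier M" if "v \<in> {v. app pM v = v}" for v
    using that at_mem(2)[of v] by (auto simp: app_pM eM_def intro!: image_eqI[of _ _ "fst (vat v)"])
qed

lemma eN_im: "eN ` hm_carrier N = {v. app pN v = v}"
proof (intro equalityI subsetI)
  show "v \<in> {v. app pN v = v}" if "v \<in> eN ` hm_carrier N" for v
    using that h_split(2) by (auto simp: eN_def clM)
  show "v \<in> eN ` hm_carrier N" if "v \<in> {v. app pN v = v}" for v
    using that at_mem(3)[of v] by (auto simp: app_pN eN_def intro!: image_eqI[of _ _ "snd (vat v)"])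
qed

sublocale EM: emod A HH I u M eM
  unfolding eM_def[abs_def]
proof (rule emod_via)
  show "closed ((\<lambda>m. h (m, hm_zero N)) ` hm_carrier M)"
    using eM_im closed_eq[of pM 1] by (simp add: eM_def[abs_def])
qed (auto simp: clM clN zeros neg_zeros act_zeros inner_zero cs_add_zero inj_on_def)

sublocale EN: emod A HH I u N eN
  unfolding eN_def[abs_def]
proof (rule emod_via)
  show "closed ((\<lambda>n. h (hm_zero M, n)) ` hm_carrier N)"
    using eN_im closed_eq[of pN 1] by (simp add: eN_def[abs_def])
qed (auto simp: clM clN zeros neg_zeros act_zeros inner_zero cs_add_zero inj_on_def)

lemma EM_proj: "EM.proj pM"
  unfolding EM.proj_def eM_im
  using adj_pM h_split(1) by (auto simp: eM_def clN app_simps(2)[symmetric] pMN simp del: app_simps(2))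

lemma EN_proj: "EN.proj pN"
  unfolding EN.proj_def eN_im
  using adj_pN h_split(2) by (auto simp: eN_def clM app_simps(2)[symmetric] pMN simp del: app_simps(2))

abbreviation PP :: "('m \<times> 'n, 'a) hmod" where
  "PP \<equiv> hm_dsum A M (MI_mod A I N)"

abbreviation QQ :: "('n \<times> 'm, 'a) hmod" where
  "QQ \<equiv> hm_dsum A N (MI_mod A I M)"

definition eQ :: "'n \<times> 'm \<Rightarrow> ('a, 'm \<times> 'n) hvec" where
  "eQ x = h (snd x, fst x)"

text \<open>The first condition says that \<open>v\<close> is supported at the single coordinate
  \<open>(A, HH)\<close> of the ambient type, the second that its \<open>N\<close>-part lies in
  \<open>NI\<close>. This is the image of \<open>M \<oplus> NI\<close>; \<open>Qset\<close> is that
  of \<open>N \<oplus> MI\<close>.\<close>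

definition Pset :: "('a, 'm \<times> 'n) hvec set" where
  "Pset = {v. app pM v + app pN v = v \<and> app pN v \<in> hI.Z}"

definition Qset :: "('a, 'm \<times> 'n) hvec set" where
  "Qset = {v. app pM v + app pN v = v \<and> app pM v \<in> hI.Z}"

lemma MI_simps [simp]:
  "hm_carrier (MI_mod A I M) = {z \<in> hm_carrier M. eM z \<in> hI.Z}"
  "hm_carrier (MI_mod A I N) = {z \<in> hm_carrier N. eN z \<in> hI.Z}"
  "hm_zero (MI_mod A I Y) = hm_zero Y" "hm_add (MI_mod A I Y) = hm_add Y" "hm_neg (MI_mod A I Y) = hm_neg Y"
  "hm_smul (MI_mod A I Y) = hm_smul Y" "hm_act (MI_mod A I Y) = hm_act Y" "hm_inner (MI_mod A I Y) = hm_inner Y"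
  by (simp_all add: MI_mod_def EM.module_ideal_eq EN.module_ideal_eq)

lemma eP_im: "h ` hm_carrier PP = Pset"
proof (intro equalityI subsetI)
  show "v \<in> Pset" if "v \<in> h ` hm_carrier PP" for v
    using that h_split by (auto simp: Pset_def eN_def)
  fix v assume v: "v \<in> Pset"
  then have "v = h (vat v)" by (simp add: Pset_def h_at)
  moreover have "vat v \<in> hm_carrier PP"
    using v at_mem[of v] by (cases "vat v") (simp add: Pset_def app_pN eN_def)
  ultimately show "v \<in> h ` hm_carrier PP" by (rule image_eqI)
qed

lemma eQ_im: "eQ ` hm_carrier QQ = Qset"
proof (intro equalityI subsetI)
  show "v \<in> Qset" if "v \<in> eQ ` hm_carrier QQ" for v
    using that h_split by (auto simp: Qset_def eM_def eQ_def)
  fix v assume v: "v \<in> Qset"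
  then have "v = eQ (snd (vat v), fst (vat v))" by (simp add: Qset_def h_at eQ_def)
  moreover have "(snd (vat v), fst (vat v)) \<in> hm_carrier QQ"
    using v at_mem[of v] by (simp add: Qset_def app_pM eM_def)
  ultimately show "v \<in> eQ ` hm_carrier QQ" by (rule image_eqI)
qed

lemma closed_PQ: "closed Pset" "closed Qset"
proof -
  have *: "closed {v. app p v \<in> hI.Z}" for p :: "('a, 'm \<times> 'n) hvec endo"
    using continuous_closed_preimage[of UNIV "app p" hI.Z] hI.Z_closed
      linear_continuous_on[OF app.bounded_linear_right, of UNIV p] by (simp add: vimage_def)
  have "Pset = {v. app (pM + pN) v = app 1 v} \<inter> {v. app pN v \<in> hI.Z}"
    "Qset = {v. app (pM + pN) v = app 1 v} \<inter> {v. app pM v \<in> hI.Z}"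
    by (auto simp: Pset_def Qset_def app_lin)
  then show "closed Pset" "closed Qset" by (simp_all only: closed_Int closed_eq *)
qed

lemma Z_ops:
  "eN (hm_zero N) \<in> hI.Z" "eM (hm_zero M) \<in> hI.Z"
  "x \<in> hm_carrier N \<Longrightarrow> y \<in> hm_carrier N \<Longrightarrow> eN x \<in> hI.Z \<Longrightarrow> eN y \<in> hI.Z \<Longrightarrow> eN (hm_add N x y) \<in> hI.Z"
  "x \<in> hm_carrier N \<Longrightarrow> eN x \<in> hI.Z \<Longrightarrow> eN (hm_neg N x) \<in> hI.Z"
  "x \<in> hm_carrier N \<Longrightarrow> eN x \<in> hI.Z \<Longrightarrow> eN (hm_smul N z x) \<in> hI.Z"
  "x \<in> hm_carrier N \<Longrightarrow> eN x \<in> hI.Z \<Longrightarrow> a \<in> cs_carrier A \<Longrightarrow> eN (hm_act N x a) \<in> hI.Z"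
  "v \<in> hm_carrier M \<Longrightarrow> w \<in> hm_carrier M \<Longrightarrow> eM v \<in> hI.Z \<Longrightarrow> eM w \<in> hI.Z \<Longrightarrow> eM (hm_add M v w) \<in> hI.Z"
  "v \<in> hm_carrier M \<Longrightarrow> eM v \<in> hI.Z \<Longrightarrow> eM (hm_neg M v) \<in> hI.Z"
  "v \<in> hm_carrier M \<Longrightarrow> eM v \<in> hI.Z \<Longrightarrow> eM (hm_smul M z v) \<in> hI.Z"
  "v \<in> hm_carrier M \<Longrightarrow> eM v \<in> hI.Z \<Longrightarrow> a \<in> cs_carrier A \<Longrightarrow> eM (hm_act M v a) \<in> hI.Z"
  using hI.Z_sub(3)[OF hI.Z_sub(1), of "eN x"] hI.Z_sub(3)[OF hI.Z_sub(1), of "eM v"]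
  by (simp_all add: EN.zero EN.add EN.neg EN.smul EN.e_act EM.zero EM.add EM.neg EM.smul EM.e_act
      hI.Z_sub EM.csm_Z)

sublocale EP: emod A HH I u PP h
proof -
  have "emod A HH I u PP (\<lambda>x. h (id x))"
  proof (rule emod_via)
    show "closed ((\<lambda>x. h (id x)) ` hm_carrier PP)"
      using eP_im closed_PQ(1) by (simp del: hm_dsum_simps MI_simps)
  qed (auto simp: clM clN Z_ops)
  then show "emod A HH I u PP h" by simp
qed

sublocale EQ: emod A HH I u QQ eQ
  unfolding eQ_def[abs_def]
proof (rule emod_via)
  show "closed ((\<lambda>x. h (snd x, fst x)) ` hm_carrier QQ)"
    using eQ_im closed_PQ(2) by (simp add: eQ_def[abs_def] del: hm_dsum_simps MI_simps)
  show "hm_inner QQ x y = hm_inner HH (snd x, fst x) (snd y, fst y)"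
    if "x \<in> hm_carrier QQ" "y \<in> hm_carrier QQ" for x y
    using that by (cases x; cases y) (simp add: cs_vs(6)[OF cA] clM clN)
qed (auto simp: clM clN Z_ops inj_on_def)

end

context hilb
begin

lemma submod_fixed: "adj T T' \<Longrightarrow> submod {v. app T v = v}"
  unfolding submod_def subspace_def
  by (auto simp: app_lin adj_act intro!: closed_Collect_eq linear_continuous_on app.bounded_linear_right continuous_on_id)

end

context emod
begin

lemma rep_QY:
  assumes "X \<in> hm_carrier QY" shows "rep X \<in> hm_carrier Y" "c (rep X) = X"
  using assms rep_c unfolding QY_carrier by blast+

end

section \<open>Isomorphisms between submodules of the quotients\<close>

context dsum_pair
begin

text \<open>A choice of vectors in \<open>N\<close> with the right inner products modulo the ideal
  is all that is asked for; no linearity of \<open>y\<close> is assumed. By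
  \<open>span_pairs_N\<close> the induced map on cosets is linear, module linear and isometric. That
  its image is closed comes from completeness of the quotient together with closedness of
  \<open>F\<close>.\<close>

lemma quot_iso:
  assumes F: "hm_submodule (quot_alg A I) EM.QY F"
    and y: "\<And>X. X \<in> F \<Longrightarrow> y X \<in> hm_carrier N"
    and ip: "\<And>X Y. X \<in> F \<Longrightarrow> Y \<in> F \<Longrightarrow> hip (eN (y X)) (eN (y Y)) - hip (eM (rep X)) (eM (rep Y)) \<in> em ` I"
  defines "\<phi> \<equiv> \<lambda>X. EN.c (y X)"
  shows "hm_submodule (quot_alg A I) EN.QY (\<phi> ` F)"
    "hm_iso (quot_alg A I) (restrict_mod EM.QY F) (restrict_mod EN.QY (\<phi> ` F)) \<phi>"
proof -
  have ax: "F \<subseteq> hm_carrier EM.QY" "hm_zero EM.QY \<in> F" "\<forall>x\<in>F. \<forall>y\<in>F. hm_add EM.QY x y \<in> F"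
    "\<forall>x\<in>F. hm_neg EM.QY x \<in> F"
    "\<forall>z. \<forall>x\<in>F. hm_smul EM.QY z x \<in> F" "\<forall>x\<in>F. \<forall>a\<in>cs_carrier (quot_alg A I). hm_act EM.QY x a \<in> F"
    "\<forall>s l. (\<forall>n. s n \<in> F) \<longrightarrow> l \<in> hm_carrier EM.QY \<longrightarrow> (\<lambda>n. hm_dist (quot_alg A I) EM.QY (s n) l) \<longlonglongrightarrow> 0 \<longrightarrow> l \<in> F"
    using F unfolding hm_submodule_def by - (elim conjE, assumption)+
  note ops = ax(3,4,5,6)[rule_format]
  define w where "w X = eM (rep X)" for X
  define t where "t X = eN (y X)" for X
  have r: "rep X \<in> hm_carrier M" "EM.c (rep X) = X" if "X \<in> F" for X
    using EM.rep_QY[of X] ax(1) that by blast+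
  \<comment> \<open>The image component comes first and the source component second: the relations
    are known for \<open>w\<close> and are wanted for \<open>t\<close>.\<close>
  define \<Phi> where "\<Phi> = (\<lambda>X. (t X, w X)) ` F"
  have base: "(t X, w X) \<in> hI.span_pairs \<Phi>" if "X \<in> F" for X
    using that by (intro hI.span_pairs.base) (simp add: \<Phi>_def)
  have ip\<Phi>: "hip a b - hip a' b' \<in> em ` I" if "(a, a') \<in> \<Phi>" "(b, b') \<in> \<Phi>" for a a' b b'
    using that ip by (auto simp: \<Phi>_def t_def w_def)
  have zN: "hI.N a = hI.N a'" if "(a, a') \<in> hI.span_pairs \<Phi>" for a a'
    by (rule hI.span_pairs_N[OF _ that]) (rule ip\<Phi>)
  then have zZ: "a \<in> hI.Z \<longleftrightarrow> a' \<in> hI.Z" if "(a, a') \<in> hI.span_pairs \<Phi>" for a a'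
    using that hI.N_eq_0 by metis
  have wZ: "w (EM.c m) - eM m \<in> hI.Z" if "m \<in> hm_carrier M" for m
    unfolding w_def by (rule EM.rep_c(2)[OF that])
  have t_add: "t (hm_add EM.QY X Y) - (t X + t Y) \<in> hI.Z" if X: "X \<in> F" and Y: "Y \<in> F" for X Y
  proof -
    have "hm_add EM.QY X Y = EM.c (hm_add M (rep X) (rep Y))"
      using EM.QY_add[OF r(1)[OF X] r(1)[OF Y]] by (simp add: r(2) X Y)
    then have "w (hm_add EM.QY X Y) - (w X + w Y) \<in> hI.Z"
      using wZ[of "hm_add M (rep X) (rep Y)"] r(1)[OF X] r(1)[OF Y] by (simp add: EM.add w_def)
    then show ?thesis
      using zZ[OF hI.span_pairs_diff[OF base[OF ops(1)[OF X Y]] hI.span_pairs.add[OF base[OF X] base[OF Y]]]]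
      by blast
  qed
  have t_neg: "t (hm_neg EM.QY X) - - t X \<in> hI.Z" if X: "X \<in> F" for X
  proof -
    have "hm_neg EM.QY X = EM.c (hm_neg M (rep X))"
      using EM.QY_neg[OF r(1)[OF X]] by (simp add: r(2) X)
    then have "w (hm_neg EM.QY X) + w X \<in> hI.Z"
      using wZ[of "hm_neg M (rep X)"] r(1)[OF X] by (simp add: EM.neg w_def)
    then show ?thesis
      using zZ[OF hI.span_pairs.add[OF base[OF ops(2)[OF X]] base[OF X]]] by simp
  qed
  have t_smul: "t (hm_smul EM.QY z X) - csm z (t X) \<in> hI.Z" if X: "X \<in> F" for z X
  proof -
    have "hm_smul EM.QY z X = EM.c (hm_smul M z (rep X))"
      using EM.QY_smul[OF r(1)[OF X], of z] by (simp add: r(2) X)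
    then have "w (hm_smul EM.QY z X) - csm z (w X) \<in> hI.Z"
      using wZ[of "hm_smul M z (rep X)"] r(1)[OF X] by (simp add: EM.smul w_def)
    moreover have "(csm z (t X), csm z (w X)) \<in> hI.span_pairs \<Phi>"
      unfolding csm_def
      by (intro hI.span_pairs.add hI.span_pairs.scaleR hI.span_pairs.imag base X)
    ultimately show ?thesis
      using zZ[OF hI.span_pairs_diff[OF base[OF ops(3)[OF X, of z]]]] by blast
  qed
  have t_act: "t (hm_act EM.QY X (coset A I a)) - hact (t X) (em a) \<in> hI.Z" if X: "X \<in> F" and a: "a \<in> cs_carrier A" for X a
  proof -
    have ca: "coset A I a \<in> cs_carrier (quot_alg A I)" using a by (simp add: quot_alg_def)
    have "hm_act EM.QY X (coset A I a) = EM.c (hm_act M (rep X) a)"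
      using EM.QY_act[OF r(1)[OF X] a] by (simp add: r(2) X)
    then have "w (hm_act EM.QY X (coset A I a)) - hact (w X) (em a) \<in> hI.Z"
      using wZ[of "hm_act M (rep X) a"] r(1)[OF X] a by (simp add: EM.act(1) EM.e_act w_def)
    then show ?thesis
      using zZ[OF hI.span_pairs_diff[OF base[OF ops(4)[OF X ca]] hI.span_pairs.act[OF base[OF X], of "em a"]]]
      by blast
  qed
  have \<phi>_add: "\<phi> (hm_add EM.QY X Y) = hm_add EN.QY (\<phi> X) (\<phi> Y)" if X: "X \<in> F" and Y: "Y \<in> F" for X Y
    using t_add[OF X Y] y[OF X] y[OF Y] y[OF ops(1)[OF X Y]]
    by (simp add: \<phi>_def EN.QY_add EN.c_eq EN.add t_def)
  have \<phi>_neg: "\<phi> (hm_neg EM.QY X) = hm_neg EN.QY (\<phi> X)" if X: "X \<in> F" for X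
    using t_neg[OF X] y[OF X] y[OF ops(2)[OF X]]
    by (simp add: \<phi>_def EN.QY_neg EN.c_eq EN.neg t_def)
  have \<phi>_smul: "\<phi> (hm_smul EM.QY z X) = hm_smul EN.QY z (\<phi> X)" if X: "X \<in> F" for z X
    using t_smul[OF X, of z] y[OF X] y[OF ops(3)[OF X]]
    by (simp add: \<phi>_def EN.QY_smul EN.c_eq EN.smul t_def)
  have \<phi>_act: "\<phi> (hm_act EM.QY X a) = hm_act EN.QY (\<phi> X) a" if X: "X \<in> F" and a: "a \<in> cs_carrier (quot_alg A I)" for X a
  proof -
    obtain b where b: "b \<in> cs_carrier A" "a = coset A I b" using a by (auto simp: quot_alg_def)
    show ?thesis
      using t_act[OF X b(1)] y[OF X] y[OF ops(4)[OF X a]] b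
      by (simp add: \<phi>_def EN.QY_act EN.c_eq EN.act(1) EN.e_act t_def)
  qed
  have dist: "hm_dist (quot_alg A I) EM.QY X Y = hI.N (w X - w Y)" if "X \<in> F" "Y \<in> F" for X Y
    using EM.QY_dist[OF r(1)[OF that(1)] r(1)[OF that(2)]] by (simp add: r(2) that w_def)
  have Nt: "hI.N (t X - t Y) = hI.N (w X - w Y)" if "X \<in> F" "Y \<in> F" for X Y
    by (rule zN[OF hI.span_pairs_diff[OF base base]]) (rule that)+
  have inner: "hm_inner EN.QY (\<phi> X) (\<phi> Y) = hm_inner EM.QY X Y" if X: "X \<in> F" and Y: "Y \<in> F" for X Y
  proof -
    have "hm_inner EM.QY X Y = coset A I (hm_inner M (rep X) (rep Y))"
      using EM.QY_inner[OF r(1)[OF X] r(1)[OF Y]] by (simp add: r(2) X Y)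
    then show ?thesis
      using ip[OF X Y] y[OF X] y[OF Y] r(1)[OF X] r(1)[OF Y]
      by (simp add: \<phi>_def EN.QY_inner coset_eq EN.inner EM.inner)
  qed
  have inj: "inj_on \<phi> F"
  proof (rule inj_onI)
    fix X Y assume X: "X \<in> F" and Y: "Y \<in> F" and eq: "\<phi> X = \<phi> Y"
    then have "t X - t Y \<in> hI.Z" using y by (simp add: \<phi>_def EN.c_eq t_def)
    then have "w X - w Y \<in> hI.Z" using zZ[OF hI.span_pairs_diff[OF base[OF X] base[OF Y]]] by simp
    then have "EM.c (rep X) = EM.c (rep Y)" by (simp add: EM.c_eq[OF r(1)[OF X] r(1)[OF Y]] w_def)
    then show "X = Y" by (simp add: r(2) X Y)
  qed
  show "hm_iso (quot_alg A I) (restrict_mod EM.QY F) (restrict_mod EN.QY (\<phi> ` F)) \<phi>"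
    unfolding hm_iso_def restrict_simps
    by (intro conjI ballI allI inj_on_imp_bij_betw inj \<phi>_add inner \<phi>_smul \<phi>_act)
  show "hm_submodule (quot_alg A I) EN.QY (\<phi> ` F)"
    unfolding hm_submodule_def
  proof (intro conjI ballI allI impI)
    show "\<phi> ` F \<subseteq> hm_carrier EN.QY" using y by (auto simp: \<phi>_def EN.QY_carrier)
    show "hm_add EN.QY X Y \<in> \<phi> ` F" if "X \<in> \<phi> ` F" "Y \<in> \<phi> ` F" for X Y
      using that ops(1) by (auto simp: \<phi>_add[symmetric])
    show "hm_neg EN.QY X \<in> \<phi> ` F" if "X \<in> \<phi> ` F" for X
      using that ops(2) by (auto simp: \<phi>_neg[symmetric])
    show "hm_smul EN.QY z X \<in> \<phi> ` F" if "X \<in> \<phi> ` F" for z X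
      using that ops(3) by (auto simp: \<phi>_smul[symmetric])
    show "hm_act EN.QY X a \<in> \<phi> ` F" if "X \<in> \<phi> ` F" "a \<in> cs_carrier (quot_alg A I)" for X a
      using that ops(4) by (auto simp: \<phi>_act[symmetric])
    have "w (hm_zero EM.QY) \<in> hI.Z"
      using wZ[OF EM.zero(1)] by (simp add: EM.QY_zero EM.zero)
    then have "t (hm_zero EM.QY) \<in> hI.Z" using zZ[OF base[OF ax(2)]] by simp
    then have "\<phi> (hm_zero EM.QY) = hm_zero EN.QY"
      using y[OF ax(2)] by (simp add: \<phi>_def EN.QY_zero EN.c_eq EN.zero t_def)
    then show "hm_zero EN.QY \<in> \<phi> ` F" using ax(2) by (metis imageI)
  next
    fix s l assume s: "\<forall>n. s n \<in> \<phi> ` F" and l: "l \<in> hm_carrier EN.QY"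
      and lim: "(\<lambda>n. hm_dist (quot_alg A I) EN.QY (s n) l) \<longlonglongrightarrow> 0"
    have "\<forall>n. \<exists>X. X \<in> F \<and> s n = \<phi> X" using s by blast
    then obtain X where "\<forall>n. X n \<in> F \<and> s n = \<phi> (X n)" by (rule choice[THEN exE])
    then have X: "\<And>n. X n \<in> F" "\<And>n. s n = \<phi> (X n)" by auto
    obtain q where q: "q \<in> hm_carrier N" "l = EN.c q" using l by (auto simp: EN.QY_carrier)
    have lim1: "(\<lambda>n. hI.N (t (X n) - eN q)) \<longlonglongrightarrow> 0"
      using lim by (simp add: X(2) q \<phi>_def EN.QY_dist y[OF X(1)] t_def)
    have "\<exists>K. \<forall>m\<ge>K. \<forall>n\<ge>K. infdist (w (X m) - w (X n)) hI.Z < \<epsilon>" if eps: "\<epsilon> > 0" for \<epsilon>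
    proof -
      obtain K where K: "\<And>n. n \<ge> K \<Longrightarrow> norm (hI.N (t (X n) - eN q) - 0) < \<epsilon> / 2"
        using LIMSEQ_D[OF lim1, of "\<epsilon> / 2"] eps by auto
      have "infdist (w (X m) - w (X n)) hI.Z < \<epsilon>" if "m \<ge> K" "n \<ge> K" for m n
      proof -
        have "hI.N (t (X m) - t (X n)) \<le> hI.N (t (X m) - eN q) + hI.N (t (X n) - eN q)"
          using hI.N_diff[of "t (X m) - eN q" "t (X n) - eN q"] by simp
        then show ?thesis
          using K[OF that(1)] K[OF that(2)] Nt[OF X(1) X(1), of m n] by (simp add: hI.N_def[symmetric])
      qed
      then show ?thesis by blast
    qed
    then obtain x where x: "(\<lambda>n. infdist (w (X n) - x) hI.Z) \<longlonglongrightarrow> 0"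
      using infdist_complete[OF hI.Z_subspace, of "\<lambda>n. w (X n)"] by blast
    note pf = EM.proj_facts[OF EM_proj]
    define m where "m = EM.ei (app pM x)"
    have m: "m \<in> hm_carrier M" "eM m = app pM x"
      unfolding m_def by (intro EM.ei_mem EM.e_ei pf(2))+
    have wm: "hI.N (w (X n) - eM m) \<le> infdist (w (X n) - x) hI.Z" for n
    proof -
      have "app pM (w (X n)) = w (X n)"
        using r(1)[OF X(1)] by (intro pf(3)) (simp add: w_def)
      then have "w (X n) - eM m = app pM (w (X n) - x)" by (simp add: m app_lin)
      then show ?thesis using pf(4)[of "w (X n) - x"] by (simp add: hI.N_def)
    qed
    have lim2: "(\<lambda>n. hI.N (w (X n) - eM m)) \<longlonglongrightarrow> 0"
      by (rule Lim_null_comparison[OF always_eventually x]) (simp add: wm hI.N_nonneg)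
    have "hm_dist (quot_alg A I) EM.QY (X n) (EM.c m) = hI.N (w (X n) - eM m)" for n
      using EM.QY_dist[OF r(1)[OF X(1)] m(1), of n] by (simp add: r(2) X(1) w_def)
    then have mF: "EM.c m \<in> F"
      using ax(7)[rule_format, of X "EM.c m"] X(1) m(1) lim2 by (simp add: EM.QY_carrier)
    have tm: "hI.N (t (X n) - t (EM.c m)) = hI.N (w (X n) - eM m)" for n
    proof -
      have "(w (X n) - w (EM.c m)) - (w (X n) - eM m) = (-1) *\<^sub>R (w (EM.c m) - eM m)" by simp
      then have "(w (X n) - w (EM.c m)) - (w (X n) - eM m) \<in> hI.Z"
        using wZ[OF m(1)] by (simp only: hI.Z_sub)
      then show ?thesis using hI.N_cong Nt[OF X(1) mF] by simp
    qed
    have "hI.N (t (EM.c m) - eN q) \<le> 0"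
    proof (rule LIMSEQ_le_const)
      show "(\<lambda>n. hI.N (t (X n) - eN q) + hI.N (w (X n) - eM m)) \<longlonglongrightarrow> 0"
        using tendsto_add[OF lim1 lim2] by simp
      have "hI.N (t (EM.c m) - eN q) \<le> hI.N (t (X n) - eN q) + hI.N (w (X n) - eM m)" for n
        using hI.N_diff[of "t (X n) - eN q" "t (X n) - t (EM.c m)"] by (simp add: tm)
      then show "\<exists>K. \<forall>n\<ge>K. hI.N (t (EM.c m) - eN q) \<le> hI.N (t (X n) - eN q) + hI.N (w (X n) - eM m)"
        by blast
    qed
    then have "t (EM.c m) - eN q \<in> hI.Z" using hI.N_nonneg hI.N_eq_0 by (metis order_antisym)
    then have "l = \<phi> (EM.c m)"
      using y[OF mF] q by (simp add: \<phi>_def t_def EN.c_eq)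
        (use hI.Z_sub(3)[OF hI.Z_sub(1)] in fastforce)
    then show "l \<in> \<phi> ` F" using mF by blast
  qed
qed

end

section \<open>From the direct sums to the quotients\<close>

context dsum_pair
begin

lemma UM_Pset: "eM ` hm_carrier M \<subseteq> Pset"
proof
  fix v assume "v \<in> eM ` hm_carrier M"
  then have v: "app pM v = v" by (simp add: eM_im)
  then have "app pN v = app (pN * pM) v" by simp
  then have "app pN v = 0" by (simp only: pMN app_lin)
  then show "v \<in> Pset" using v by (simp add: Pset_def hI.Z_sub)
qed

lemma fixed_contained:
  fixes g :: "('a, 'm \<times> 'n) hvec endo"
  assumes g: "g \<in> hv.Kop (h ` hm_carrier PP)" "hv.adj g g"
  shows "compactly_contained A PP {x \<in> hm_carrier PP. app g (h x) = h x}" (is "compactly_contained A PP ?F")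
proof (rule EP.contained_intro[OF _ g])
  have im: "h ` ?F = h ` hm_carrier PP \<inter> {v. app g v = v}" by auto
  show "hm_submodule A PP ?F"
  proof (rule EP.submoduleI)
    show "hv.submod (h ` ?F)"
      unfolding im by (rule hv.submod_Int[OF EP.submod_im hv.submod_fixed[OF g(2)]])
    show "app JJ v \<in> h ` ?F" if v: "v \<in> h ` ?F" for v
    proof -
      have "app g (app JJ v) = app JJ (app g v)"
        using arg_cong[OF hv.adj_J_commute[OF g(2)], of "\<lambda>R. app R v"] by simp
      then show ?thesis using v EP.J_im[of v] unfolding im by simp
    qed
  qed auto
qed simp

lemma Id_cong: "a - a' \<in> hI.Z \<Longrightarrow> b - b' \<in> hI.Z \<Longrightarrow> hip a b - hip a' b' \<in> em ` I"
proof -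
  assume *: "a - a' \<in> hI.Z" "b - b' \<in> hI.Z"
  have "hip a b - hip a' b' = hip (a - a') b + hip a' (b - b')"
    by (simp add: hv.ip.diff_left hv.ip.diff_right)
  then show ?thesis using * by (simp only: hI.Id_sub(1) hI.Z_left hI.ZD)
qed

lemma quot_le:
  assumes cu: "cu_le A PP QQ"
  shows "cu_le (quot_alg A I) EM.QY EN.QY"
  unfolding cu_le_def
proof (intro allI impI)
  fix F assume F: "compactly_contained (quot_alg A I) EM.QY F"
  have Fs: "hm_submodule (quot_alg A I) EM.QY F" using F by (simp add: compactly_contained_def)
  then have r: "rep X \<in> hm_carrier M" "EM.c (rep X) = X" if "X \<in> F" for X
    using EM.rep_QY[of X] that unfolding hm_submodule_def by blast+
  obtain T where T: "T \<in> hv.Kop (eM ` hm_carrier M)" "hv.adj T T"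
    "\<And>y. y \<in> hm_carrier M \<Longrightarrow> EM.c y \<in> F \<Longrightarrow> app T (eM y) - eM y \<in> hI.Z"
    by (rule EM.quot_contained_dest[OF F EM_proj]) (rule that, (assumption | blast)+)
  \<comment> \<open>The functions are taken inside the compact operators of \<open>M\<close>, so
    that the submodule fixed by \<open>g\<close> is compactly contained in
    \<open>M \<oplus> NI\<close>.\<close>
  obtain g k where gk: "hv.adj g g" "hv.adj k k" "g \<in> hv.Kop (eM ` hm_carrier M)" "k \<in> hv.Kop (eM ` hm_carrier M)"
    "g * k = k" "\<forall>Z. subspace Z \<and> closed Z \<and> app T ` Z \<subseteq> Z \<longrightarrow> (\<forall>x. app T x - x \<in> Z \<longrightarrow> app k x - x \<in> Z)"
    by (rule hv.bump[OF T(2,1) hv.Kop_subspace[OF EM.submod_im] hv.closed_Kop])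
      (erule (1) hv.Kop_mult[OF _ _ EM.submod_im], rule that)
  have kr: "app k (eM (rep X)) - eM (rep X) \<in> hI.Z" if "X \<in> F" for X
    using gk(6)[rule_format, of hI.Z "eM (rep X)"] T(3)[OF r(1)[OF that]] r(2)[OF that]
    by (simp add: hI.Z_subspace hI.Z_closed image_subset_iff hI.adj_Z[OF T(2)] that)
  have gP: "g \<in> hv.Kop (h ` hm_carrier PP)"
    using hv.Kop_mono[OF UM_Pset] gk(3) unfolding eP_im by (rule subsetD)
  let ?F1 = "{x \<in> hm_carrier PP. app g (h x) = h x}"
  obtain F1 U where F1: "compactly_contained A QQ F1" and U: "hm_iso A (restrict_mod PP ?F1) (restrict_mod QQ F1) U"
    using cu[unfolded cu_le_def, rule_format, OF fixed_contained[OF gP gk(1)]] by (elim exE conjE) (rule that)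
  obtain T1 where T1: "hm_submodule A QQ F1" "T1 \<in> hv.Kop (eQ ` hm_carrier QQ)" "hv.adj T1 T1"
    "\<And>x. x \<in> F1 \<Longrightarrow> app T1 (eQ x) = eQ x"
    by (rule EQ.contained_dest[OF F1]) (rule that, (assumption | blast)+)
  have F1_sub: "x \<in> hm_carrier QQ" if "x \<in> F1" for x
    using T1(1) that unfolding hm_submodule_def by blast
  have U1: "U x \<in> F1" if "x \<in> ?F1" for x
    using U that unfolding hm_iso_def restrict_simps bij_betw_def by blast
  have U2: "hm_inner QQ (U x) (U x') = hm_inner PP x x'" if "x \<in> ?F1" "x' \<in> ?F1" for x x'
    using U that unfolding hm_iso_def restrict_simps by blast
  define z where "z X = EP.ei (app k (eM (rep X)))" for X
  have kP: "app k v \<in> h ` hm_carrier PP" for v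
    unfolding eP_im by (rule subsetD[OF UM_Pset hv.Kop_range[OF gk(4) EM.submod_im]])
  have z1: "z X \<in> hm_carrier PP" "h (z X) = app k (eM (rep X))" for X
    unfolding z_def by (rule EP.ei_mem[OF kP], rule EP.e_ei[OF kP])
  have z: "z X \<in> ?F1" for X
  proof -
    have "app g (app k (eM (rep X))) = app k (eM (rep X))" by (simp only: app_simps(2)[symmetric] gk(5))
    then have "app g (h (z X)) = h (z X)" by (simp only: z1(2))
    with z1(1) show ?thesis by (intro CollectI conjI)
  qed
  define \<tau> where "\<tau> X = eQ (U (z X))" for X
  have Q: "U (z X) \<in> hm_carrier QQ" "\<tau> X \<in> Qset" for X
    using F1_sub[OF U1[OF z]] unfolding \<tau>_def eQ_im[symmetric] by simp_all
  note pf = EN.proj_facts[OF EN_proj]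
  \<comment> \<open>The \<open>N\<close>-part of the image under \<open>U\<close>. The discarded
    \<open>M\<close>-part lies in \<open>MI\<close>, hence in \<open>Z\<close>, so inner products
    are unchanged modulo the ideal.\<close>
  define y where "y X = EN.ei (app pN (\<tau> X))" for X
  have y: "y X \<in> hm_carrier N" "eN (y X) = app pN (\<tau> X)" for X
    unfolding y_def by (intro EN.ei_mem EN.e_ei pf(2))+
  have QZ: "app pN v - v \<in> hI.Z" if "v \<in> Qset" for v
  proof -
    have "app pM v + app pN v = v" "app pM v \<in> hI.Z" using that by (simp_all add: Qset_def)
    then have "app pN v - v = (-1) *\<^sub>R app pM v" by (simp add: eq_diff_eq[symmetric])
    then show ?thesis using hI.Z_sub(4)[OF \<open>app pM v \<in> hI.Z\<close>] by (simp only:)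
  qed
  have ip: "hip (eN (y X)) (eN (y Y)) - hip (eM (rep X)) (eM (rep Y)) \<in> em ` I" if "X \<in> F" "Y \<in> F" for X Y
  proof -
    have 1: "hip (eN (y X)) (eN (y Y)) - hip (\<tau> X) (\<tau> Y) \<in> em ` I"
      unfolding y(2) by (intro Id_cong QZ Q)
    have 2: "hip (\<tau> X) (\<tau> Y) = hip (h (z X)) (h (z Y))"
      unfolding \<tau>_def EQ.inner(2)[OF Q(1) Q(1)] EP.inner(2)[OF z1(1) z1(1)] by (simp only: U2[OF z z])
    have 3: "hip (h (z X)) (h (z Y)) - hip (eM (rep X)) (eM (rep Y)) \<in> em ` I"
      unfolding z1(2) by (intro Id_cong kr that)
    show ?thesis using hI.Id_sub(1)[OF 1[unfolded 2] 3] by simp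
  qed
  note iso = quot_iso[OF Fs y(1) ip]
  let ?F2 = "(\<lambda>X. EN.c (y X)) ` F"
  have "compactly_contained (quot_alg A I) EN.QY ?F2"
  \<comment> \<open>The operator \<open>T1\<close> which fixes \<open>F1\<close> belongs to
    \<open>N \<oplus> MI\<close>. Modulo \<open>Z\<close> this module reduces to \<open>N\<close>,
    so \<open>T1\<close> also witnesses that the image in \<open>N/NI\<close> is compactly
    contained.\<close>
  proof (rule EN.quot_contained_intro[OF iso(1) EN_proj EQ.submod_im _ T1(2,3)])
    show "app pN v - v \<in> hI.Z" if "v \<in> eQ ` hm_carrier QQ" for v
      using that unfolding eQ_im by (rule QZ)
    fix n assume n: "n \<in> hm_carrier N" "EN.c n \<in> ?F2"
    then obtain X where X: "X \<in> F" "EN.c n = EN.c (y X)" by blast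
    then have "eN n - eN (y X) \<in> hI.Z" using EN.c_eq[OF n(1) y(1)] by blast
    then have "(eN n - eN (y X)) + (app pN (\<tau> X) - \<tau> X) \<in> hI.Z" by (rule hI.Z_sub(2)[OF _ QZ[OF Q(2)]])
    then have d: "eN n - \<tau> X \<in> hI.Z" by (simp add: y)
    have "app T1 (eN n) - eN n = app T1 (eN n - \<tau> X) - (eN n - \<tau> X)"
      using T1(4)[OF U1[OF z]] by (simp add: \<tau>_def app_lin)
    then show "app T1 (eN n) - eN n \<in> hI.Z" using d by (simp only: hI.Z_sub hI.adj_Z[OF T1(3)])
  qed
  then show "\<exists>F'. compactly_contained (quot_alg A I) EN.QY F' \<and>
      (\<exists>U. hm_iso (quot_alg A I) (restrict_mod EM.QY F) (restrict_mod EN.QY F') U)"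
    using iso(2) by blast
qed

end

section \<open>Unitary transport and fixed submodules of a quotient\<close>

context hilb
begin

text \<open>The image under \<open>W\<close> is the preimage under the continuous \<open>W'\<close>;
  this is why it is closed.\<close>

lemma submod_unitary:
  assumes W: "adj W W'" "W * W' = 1" "W' * W = 1" and V: "submod V"
  shows "submod (app W ` V)"
proof -
  have inv: "app W (app W' v) = v" "app W' (app W v) = v" for v
    using W(2,3) by (simp_all only: app_simps[symmetric] app_simps(1))
  have eq: "app W ` V = {v. app W' v \<in> V}"
  proof (intro equalityI subsetI)
    show "v \<in> app W ` V" if "v \<in> {v. app W' v \<in> V}" for v
      using that inv(1)[of v] by (intro image_eqI[of _ _ "app W' v"]) simp_all
  qed (auto simp: inv)
  have "closed {v. app W' v \<in> V}"
    using continuous_closed_preimage[of UNIV "app W'" V] submod_simps(6)[OF V]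
      linear_continuous_on[OF app.bounded_linear_right, of UNIV W'] by (simp add: vimage_def)
  then show ?thesis
    unfolding eq submod_def subspace_def
    by (simp add: app_lin adj_act[OF adj_sym[OF W(1)]] submod_simps[OF V])
qed

end

context emod
begin

text \<open>The kernel of the operator induced by \<open>g - 1\<close> on the quotient. The
  membership criterion holds for every representative because \<open>g - 1\<close> preserves
  \<open>Z\<close>.\<close>

lemma quot_fixed_submodule:
  fixes g :: "('a, 'v) hvec endo"
  assumes g: "hI.adj g g'"
  defines "E \<equiv> c ` {y \<in> hm_carrier Y. app g (e y) - e y \<in> hI.Z}"
  shows "hm_submodule AI QY E"
    and "\<And>y. y \<in> hm_carrier Y \<Longrightarrow> c y \<in> E \<longleftrightarrow> app g (e y) - e y \<in> hI.Z"
proof -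
  define G where "G = g - 1"
  have G: "hI.adj G (g' - 1)" unfolding G_def by (rule hv.adj_diff[OF g hv.adj_1])
  have GZ: "app g v - v = app G v" for v by (simp add: G_def app_lin)
  have iff: "c y \<in> E \<longleftrightarrow> app G (e y) \<in> hI.Z" if y: "y \<in> hm_carrier Y" for y
  proof
    assume "c y \<in> E"
    then obtain x where x: "x \<in> hm_carrier Y" "app G (e x) \<in> hI.Z" "c y = c x" by (auto simp: E_def GZ)
    then have "app G (e y - e x) \<in> hI.Z" using c_eq[OF y x(1)] by (intro hI.adj_Z[OF G]) blast
    then have "app G (e y - e x) + app G (e x) \<in> hI.Z" using x(2) by (rule hI.Z_sub(2))
    then show "app G (e y) \<in> hI.Z" by (simp add: app_lin)
  qed (use y in \<open>auto simp: E_def GZ\<close>)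
  then show "c y \<in> E \<longleftrightarrow> app g (e y) - e y \<in> hI.Z" if "y \<in> hm_carrier Y" for y
    using that by (simp add: GZ)
  have E_sub: "E \<subseteq> hm_carrier QY" by (auto simp: E_def QY_carrier)
  have ex: "\<exists>y\<in>hm_carrier Y. X = c y \<and> app G (e y) \<in> hI.Z" if "X \<in> E" for X
    using that by (auto simp: E_def GZ)
  show "hm_submodule AI QY E"
    unfolding hm_submodule_def
  proof (intro conjI ballI allI impI E_sub)
    show "hm_zero QY \<in> E" by (simp add: QY_zero iff zero app_lin hI.Z_sub)
    show "hm_add QY X X' \<in> E" if X: "X \<in> E" and X': "X' \<in> E" for X X'
    proof -
      obtain y y' where "y \<in> hm_carrier Y" "X = c y" "app G (e y) \<in> hI.Z"
        "y' \<in> hm_carrier Y" "X' = c y'" "app G (e y') \<in> hI.Z"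
        using ex[OF X] ex[OF X'] by blast
      then show ?thesis by (simp add: QY_add iff add app_lin hI.Z_sub)
    qed
    show "hm_neg QY X \<in> E" if X: "X \<in> E" for X
    proof -
      obtain y where "y \<in> hm_carrier Y" "X = c y" "app G (e y) \<in> hI.Z" using ex[OF X] by blast
      then show ?thesis
        using hI.Z_sub(4)[of "app G (e y)" "-1"] by (simp add: QY_neg iff neg app_lin)
    qed
    show "hm_smul QY z X \<in> E" if X: "X \<in> E" for z X
    proof -
      obtain y where "y \<in> hm_carrier Y" "X = c y" "app G (e y) \<in> hI.Z" using ex[OF X] by blast
      then show ?thesis by (simp add: QY_smul iff smul csm_adj[OF G] csm_Z)
    qed
    show "hm_act QY X a \<in> E" if X: "X \<in> E" and a: "a \<in> cs_carrier AI" for X a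
    proof -
      obtain y where y: "y \<in> hm_carrier Y" "X = c y" "app G (e y) \<in> hI.Z" using ex[OF X] by blast
      obtain b where b: "b \<in> cs_carrier A" "a = coset A I b" using a by (auto simp: quot_alg_def)
      show ?thesis using y b by (simp add: QY_act iff act(1) e_act hv.adj_act[OF G] hI.Z_sub)
    qed
    fix s l assume s: "\<forall>n. s n \<in> E" and l: "l \<in> hm_carrier QY" and lim: "(\<lambda>n. hm_dist AI QY (s n) l) \<longlonglongrightarrow> 0"
    obtain x where x: "x \<in> hm_carrier Y" "l = c x" using l by (auto simp: QY_carrier)
    have "\<forall>n. \<exists>y. y \<in> hm_carrier Y \<and> s n = c y \<and> app G (e y) \<in> hI.Z" using s ex by blast
    then obtain y where "\<forall>n. y n \<in> hm_carrier Y \<and> s n = c (y n) \<and> app G (e (y n)) \<in> hI.Z"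
      by (rule choice[THEN exE])
    then have y: "\<And>n. y n \<in> hm_carrier Y" "\<And>n. s n = c (y n)" "\<And>n. app G (e (y n)) \<in> hI.Z" by auto
    have "hI.N (app G (e x)) \<le> norm G * 0"
    proof (rule LIMSEQ_le_const)
      show "(\<lambda>n. norm G * hm_dist AI QY (s n) l) \<longlonglongrightarrow> norm G * 0"
        by (intro tendsto_mult tendsto_const lim)
      have "hI.N (app G (e x)) \<le> norm G * hm_dist AI QY (s n) l" for n
      proof -
        have "app G (e x) - app G (e x - e (y n)) = app G (e (y n))" by (simp add: app_lin)
        then have "hI.N (app G (e x)) = hI.N (app G (e x - e (y n)))" using y(3)[of n] by (intro hI.N_cong) simp
        also have "e x - e (y n) = (-1) *\<^sub>R (e (y n) - e x)" by simp
        also have "hI.N (app G ((-1) *\<^sub>R (e (y n) - e x))) \<le> norm G * hI.N ((-1) *\<^sub>R (e (y n) - e x))"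
          by (rule hI.N_adj[OF G])
        also have "\<dots> \<le> norm G * hI.N (e (y n) - e x)"
          using hI.N_scaleR[of "-1" "e (y n) - e x"] by (intro mult_left_mono) simp_all
        finally show ?thesis by (simp add: y(2) x(2) QY_dist[OF y(1) x(1)])
      qed
      then show "\<exists>K. \<forall>n\<ge>K. hI.N (app G (e x)) \<le> norm G * hm_dist AI QY (s n) l" by blast
    qed
    then have "hI.N (app G (e x)) = 0" using hI.N_nonneg[of "app G (e x)"] by simp
    then show "l \<in> E" using x by (simp add: iff hI.N_eq_0)
  qed
qed

end

context dsum_pair
begin

lemma unitary_transport:
  assumes F: "hm_submodule A PP F" and W: "hv.adj W W'" "W * W' = 1" "W' * W = 1"
    and ran: "\<And>x. x \<in> F \<Longrightarrow> app W (h x) \<in> eQ ` hm_carrier QQ"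
  defines "U \<equiv> \<lambda>x. EQ.ei (app W (h x))"
  shows "hm_submodule A QQ (U ` F)" "hm_iso A (restrict_mod PP F) (restrict_mod QQ (U ` F)) U"
proof -
  have ax: "F \<subseteq> hm_carrier PP" "\<forall>x\<in>F. \<forall>y\<in>F. hm_add PP x y \<in> F"
    "\<forall>z. \<forall>x\<in>F. hm_smul PP z x \<in> F" "\<forall>x\<in>F. \<forall>a\<in>cs_carrier A. hm_act PP x a \<in> F"
    using F unfolding hm_submodule_def by - (elim conjE, assumption)+
  note F_sub = subsetD[OF ax(1)] and ops = ax(2-4)[rule_format]
  have U: "U x \<in> hm_carrier QQ" "eQ (U x) = app W (h x)" if "x \<in> F" for x
    using EQ.ei_mem[OF ran[OF that]] EQ.e_ei[OF ran[OF that]] by (simp_all only: U_def)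
  have im: "eQ ` U ` F = app W ` (h ` F)"
    unfolding image_image by (rule image_cong[OF refl U(2)])
  have WW: "hip (app W v) (app W w) = hip v w" for v w
    using hv.adjD[OF W(1), of v "app W w"] by (simp only: app_simps(2)[symmetric] W(3) app_simps(1))
  have inj: "inj_on U F"
  proof (rule inj_onI)
    fix x y assume xy: "x \<in> F" "y \<in> F" "U x = U y"
    then have "app W' (app W (h x)) = app W' (app W (h y))" using U(2) by metis
    then have "h x = h y" by (simp only: app_simps(2)[symmetric] W(3) app_simps(1))
    then show "x = y" using EP.e_eq[OF F_sub F_sub] xy by blast
  qed
  show "hm_submodule A QQ (U ` F)"
  proof (rule EQ.submoduleI)
    show "U ` F \<subseteq> hm_carrier QQ" using U(1) by blast
    show "hv.submod (eQ ` U ` F)"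
      unfolding im by (rule hv.submod_unitary[OF W EP.submodule_im(1)[OF F]])
    show "app JJ v \<in> eQ ` U ` F" if v: "v \<in> eQ ` U ` F" for v
    proof -
      obtain w where w: "w \<in> h ` F" "v = app W w" using v unfolding im by blast
      have "app JJ (app W w) = app W (app JJ w)"
        using arg_cong[OF hv.adj_J_commute[OF W(1)], of "\<lambda>R. app R w"] by simp
      then show ?thesis using EP.submodule_im(2)[OF F w(1)] unfolding im w(2) by simp
    qed
  qed
  show "hm_iso A (restrict_mod PP F) (restrict_mod QQ (U ` F)) U"
    unfolding hm_iso_def restrict_simps
  proof (intro conjI ballI allI inj_on_imp_bij_betw inj)
    fix x assume x: "x \<in> F"
    note Ux = U(1)[OF x]
    show "U (hm_smul PP z x) = hm_smul QQ z (U x)" for z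
    proof -
      have m: "hm_smul PP z x \<in> F" by (rule ops(2)[OF x])
      have "eQ (U (hm_smul PP z x)) = eQ (hm_smul QQ z (U x))"
        unfolding EQ.smul(2)[OF Ux] U(2)[OF m] U(2)[OF x] EP.smul(2)[OF F_sub[OF x]] by (rule csm_adj[OF W(1)])
      then show ?thesis using EQ.e_eq[OF U(1)[OF m] EQ.smul(1)[OF Ux]] by blast
    qed
    show "U (hm_act PP x a) = hm_act QQ (U x) a" if a: "a \<in> cs_carrier A" for a
    proof -
      have m: "hm_act PP x a \<in> F" by (rule ops(3)[OF x a])
      have "eQ (U (hm_act PP x a)) = eQ (hm_act QQ (U x) a)"
        unfolding EQ.e_act[OF Ux a] U(2)[OF m] U(2)[OF x] EP.e_act[OF F_sub[OF x] a] by (rule hv.adj_act[OF W(1)])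
      then show ?thesis using EQ.e_eq[OF U(1)[OF m] EQ.act(1)[OF Ux a]] by blast
    qed
    fix y assume y: "y \<in> F"
    note Uy = U(1)[OF y]
    show "U (hm_add PP x y) = hm_add QQ (U x) (U y)"
    proof -
      have m: "hm_add PP x y \<in> F" by (rule ops(1)[OF x y])
      have "eQ (U (hm_add PP x y)) = eQ (hm_add QQ (U x) (U y))"
        unfolding EQ.add(2)[OF Ux Uy] U(2)[OF m] U(2)[OF x] U(2)[OF y] EP.add(2)[OF F_sub[OF x] F_sub[OF y]]
        by (rule app.add_right)
      then show ?thesis using EQ.e_eq[OF U(1)[OF m] EQ.add(1)[OF Ux Uy]] by blast
    qed
    have "em (hm_inner QQ (U x) (U y)) = em (hm_inner PP x y)"
      unfolding EQ.inner(2)[OF Ux Uy, symmetric] EP.inner(2)[OF F_sub[OF x] F_sub[OF y], symmetric]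
        U(2)[OF x] U(2)[OF y] by (rule WW)
    then show "hm_inner QQ (U x) (U y) = hm_inner PP x y"
      using em_inject[OF EQ.inner(1)[OF Ux Uy] EP.inner(1)[OF F_sub[OF x] F_sub[OF y]]] by blast
  qed
qed

end

section \<open>From the quotients to the direct sums\<close>

context dsum_pair
begin

lemma Pset_proj: "v \<in> Pset \<Longrightarrow> app pM v - v \<in> hI.Z"
proof -
  assume v: "v \<in> Pset"
  then have "app pM v + app pN v = v" by (simp add: Pset_def)
  then have "app pM v - v = (-1) *\<^sub>R app pN v" by (simp add: eq_diff_eq[symmetric])
  moreover have "app pN v \<in> hI.Z" using v by (simp add: Pset_def)
  ultimately show ?thesis by (simp only: hI.Z_sub(4))
qed

lemma submod_P: "hv.submod Pset"
  using EP.submod_im by (simp only: eP_im)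

text \<open>The classes fixed by \<open>g'\<close> form a submodule \<open>E\<close> compactly
  contained in \<open>M/MI\<close>, so the hypothesis embeds it into \<open>N/NI\<close> by some
  \<phi>. A vector of \<open>M \<oplus> NI\<close> fixed by \<open>g'\<close> has its
  \<open>M\<close>-part in a class of \<open>E\<close>, and \<sigma> chooses a representative of the
  image of that class. Only the inner products are kept; linearity modulo \<open>Z\<close> follows
  from them.\<close>

lemma iso_vectors:
  assumes cu: "cu_le (quot_alg A I) EM.QY EN.QY"
    and g: "g' \<in> hv.Kop Pset" "hv.adj g' g'"
  obtains \<sigma> where "\<And>v. v \<in> Pset \<Longrightarrow> app g' v = v \<Longrightarrow> app pN (\<sigma> v) = \<sigma> v"
    "\<And>v w. v \<in> Pset \<Longrightarrow> app g' v = v \<Longrightarrow> w \<in> Pset \<Longrightarrow> app g' w = w \<Longrightarrow> hip (\<sigma> v) (\<sigma> w) - hip v w \<in> em ` I"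
proof -
  define E where "E = EM.c ` {y \<in> hm_carrier M. app g' (eM y) - eM y \<in> hI.Z}"
  note E = EM.quot_fixed_submodule[OF g(2), folded E_def]
  have "compactly_contained (quot_alg A I) EM.QY E"
    by (rule EM.quot_contained_intro[OF E(1) EM_proj submod_P Pset_proj g]) (simp_all only: E(2))
  from cu[unfolded cu_le_def, rule_format, OF this]
  obtain E' \<phi> where E': "compactly_contained (quot_alg A I) EN.QY E'"
    and \<phi>: "hm_iso (quot_alg A I) (restrict_mod EM.QY E) (restrict_mod EN.QY E') \<phi>"
    by (elim exE conjE) (rule that)
  have E'_sub: "X \<in> hm_carrier EN.QY" if "X \<in> E'" for X
    using E' unfolding compactly_contained_def hm_submodule_def by (elim conjE) (rule subsetD[OF _ that])
  have bij: "bij_betw \<phi> E E'" and inner: "\<forall>X\<in>E. \<forall>X'\<in>E. \<phi> (hm_add EM.QY X X') = hm_add EN.QY (\<phi> X) (\<phi> X') \<and>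
      hm_inner EN.QY (\<phi> X) (\<phi> X') = hm_inner EM.QY X X'"
    using \<phi> unfolding hm_iso_def restrict_simps by - (elim conjE, assumption)+
  have \<phi>1: "\<phi> X \<in> E'" if "X \<in> E" for X
    using bij_betw_apply[OF bij that] .
  have \<phi>2: "hm_inner EN.QY (\<phi> X) (\<phi> X') = hm_inner EM.QY X X'" if "X \<in> E" "X' \<in> E" for X X'
    using inner[rule_format, OF that] by (rule conjunct2)
  define m where "m v = EM.ei (app pM v)" for v
  have m: "m v \<in> hm_carrier M" "eM (m v) = app pM v" for v
    unfolding m_def by (intro EM.ei_mem EM.e_ei EM.proj_facts(2)[OF EM_proj])+
  have mE: "EM.c (m v) \<in> E" if v: "v \<in> Pset" "app g' v = v" for v
  proof -
    have "app g' (app pM v - v) - (app pM v - v) \<in> hI.Z"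
      by (rule hI.Z_sub(3)[OF hI.adj_Z[OF g(2) Pset_proj[OF v(1)]] Pset_proj[OF v(1)]])
    then have "app g' (eM (m v)) - eM (m v) \<in> hI.Z" using v(2) by (simp add: m(2) app_lin)
    then show ?thesis by (rule iffD2[OF E(2)[OF m(1)]])
  qed
  define n where "n v = rep (\<phi> (EM.c (m v)))" for v
  have n: "n v \<in> hm_carrier N" "EN.c (n v) = \<phi> (EM.c (m v))" if "v \<in> Pset" "app g' v = v" for v
    unfolding n_def using EN.rep_QY[OF E'_sub[OF \<phi>1[OF mE[OF that]]]] by blast+
  show ?thesis
  proof (rule that[of "\<lambda>v. eN (n v)"])
    show "app pN (eN (n v)) = eN (n v)" if "v \<in> Pset" "app g' v = v" for v
      by (rule EN.proj_facts(3)[OF EN_proj imageI[OF n(1)[OF that]]])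
    fix v w assume v: "v \<in> Pset" "app g' v = v" and w: "w \<in> Pset" "app g' w = w"
    note nv = n[OF v] and nw = n[OF w]
    have "coset A I (hm_inner N (n v) (n w)) = coset A I (hm_inner M (m v) (m w))"
      using \<phi>2[OF mE[OF v] mE[OF w]]
      by (simp only: nv(2)[symmetric] nw(2)[symmetric] EN.QY_inner[OF nv(1) nw(1)] EM.QY_inner[OF m(1) m(1)])
    then have 1: "hip (eN (n v)) (eN (n w)) - hip (app pM v) (app pM w) \<in> em ` I"
      using coset_eq[OF EN.inner(1)[OF nv(1) nw(1)] EM.inner(1)[OF m(1) m(1)]]
      by (simp only: EN.inner(2)[OF nv(1) nw(1)] EM.inner(2)[OF m(1) m(1), symmetric] m(2))
    have 2: "hip (app pM v) (app pM w) - hip v w \<in> em ` I"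
      by (intro Id_cong Pset_proj v w)
    show "hip (eN (n v)) (eN (n w)) - hip v w \<in> em ` I"
      using hI.Id_sub(1)[OF 1 2] by simp
  qed
qed

text \<open>Of the three factors \<open>l\<close>, the middle one is approximated by a finite rank
  operator \<open>R\<close>, and the left one brings the vectors of \<open>R\<close> into the domain
  where \<sigma> is isometric. Applying \<sigma> to the output vectors of \<open>l * R * l\<close>
  gives finite rank operators, and by \<open>span_pairs_N\<close> their distance to \<psi> in the
  quotient norm is that of \<open>l * R * l\<close> to the cube of \<open>l\<close>.\<close>

lemma lift_vectors:
  assumes l: "l \<in> hv.Kop Pset" "hv.adj l l"
    and \<sigma>: "\<And>v w. v \<in> Pset \<Longrightarrow> w \<in> Pset \<Longrightarrow> hip (\<sigma> (app l v)) (\<sigma> (app l w)) - hip (app l v) (app l w) \<in> em ` I"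
  obtains X where "X \<in> hv.Kop UNIV" "\<And>x. app X x - \<sigma> (app l (app l (app l x))) \<in> hI.Z"
proof -
  define \<Phi> where "\<Phi> = (\<lambda>v. (\<sigma> (app l v), app l v)) ` Pset"
  have \<Phi>: "hip x y - hip x' y' \<in> em ` I" if "(x, x') \<in> \<Phi>" "(y, y') \<in> \<Phi>" for x x' y y'
    using that \<sigma> by (auto simp: \<Phi>_def)
  have base: "(\<sigma> (app l v), app l v) \<in> hI.span_pairs \<Phi>" if "v \<in> Pset" for v
    using that by (intro hI.span_pairs.base) (simp add: \<Phi>_def)
  have lP: "app l v \<in> Pset" for v by (rule hv.Kop_range[OF l(1) submod_P])
  have fr: "(app (hv.fr (map (\<lambda>p. (app l (fst p), \<sigma> (app l (snd p)))) ps)) x,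
      app (hv.fr (map (\<lambda>p. (app l (fst p), app l (snd p))) ps)) x) \<in> hI.span_pairs \<Phi>"
    if "set ps \<subseteq> Pset \<times> Pset" for ps x
    using that
  proof (induction ps)
    case Nil
    show ?case using hI.span_pairs.zero by (simp add: app_lin)
  next
    case (Cons p ps)
    then have p: "snd p \<in> Pset" and ps: "set ps \<subseteq> Pset \<times> Pset" by auto
    show ?case
      using hI.span_pairs.add[OF hI.span_pairs.act[OF base[OF p]] Cons.IH[OF ps]] by (simp add: app_lin)
  qed
  have sub: "hv.submod UNIV" by (simp add: hv.submod_def)
  define \<psi> where "\<psi> x = \<sigma> (app l (app l (app l x)))" for x
  have "hI.approx UNIV \<psi>"
    unfolding hI.approx_def
  proof (intro allI impI)
    fix \<epsilon> :: real assume eps: "\<epsilon> > 0"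
    define d where "d = \<epsilon> / (norm l * norm l + 1)"
    have p: "norm l * norm l + 1 > 0" by (rule add_nonneg_pos) simp_all
    have d: "d > 0" using eps p by (simp add: d_def)
    obtain R where R: "R \<in> hv.FR Pset" "norm (l - R) < d" using hv.Kop_approx[OF l(1) d] by blast
    obtain ps where ps: "set ps \<subseteq> Pset \<times> Pset" "R = hv.fr ps" using hv.FR_E[OF R(1)] by blast
    obtain R' where R': "hv.adj R R'" using hv.FR_adj[OF R(1)] by blast
    let ?D = "hv.fr (map (\<lambda>p. (app l (fst p), \<sigma> (app l (snd p)))) ps)"
    have lRl: "hv.fr (map (\<lambda>p. (app l (fst p), app l (snd p))) ps) = l * R * l"
      unfolding ps(2) by (rule hv.fr_conj[OF l(2) l(2), symmetric])
    have "?D \<in> hv.Kop UNIV" by (rule hv.FR_subset_Kop[OF hv.FR_I]) simp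
    moreover have "hI.N (app ?D x - \<psi> x) \<le> \<epsilon> * hI.N x" for x
    proof -
      have "(app ?D x - \<psi> x, app (l * R * l) x - app l (app l (app l x))) \<in> hI.span_pairs \<Phi>"
        unfolding \<psi>_def lRl[symmetric] by (intro hI.span_pairs_diff fr ps(1) base lP)
      then have "hI.N (app ?D x - \<psi> x) = hI.N (app (l * R * l) x - app l (app l (app l x)))"
        by (rule hI.span_pairs_N[rotated]) (rule \<Phi>)
      also have "app (l * R * l) x - app l (app l (app l x)) = app (l * (R - l) * l) x"
        by (simp add: app_lin)
      also have "hI.N \<dots> \<le> norm (l * (R - l) * l) * hI.N x"
        by (rule hI.N_adj[OF hv.adj_mult[OF hv.adj_mult[OF l(2) hv.adj_diff[OF R' l(2)]] l(2)]])
      also have "\<dots> \<le> \<epsilon> * hI.N x"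
      proof (rule mult_right_mono[OF _ hI.N_nonneg])
        have "norm (l * (R - l) * l) \<le> norm l * norm (R - l) * norm l"
          by (rule order_trans[OF norm_mult_ineq mult_right_mono[OF norm_mult_ineq norm_ge_zero]])
        also have "\<dots> = norm l * norm l * norm (l - R)" by (simp add: norm_minus_commute)
        also have "\<dots> \<le> (norm l * norm l + 1) * d"
          using R(2) by (intro mult_mono) auto
        also have "\<dots> = \<epsilon>" using p by (simp add: d_def)
        finally show "norm (l * (R - l) * l) \<le> \<epsilon>" .
      qed
      finally show ?thesis .
    qed
    ultimately show "\<exists>D\<in>hv.Kop UNIV. \<forall>x. hI.N (app D x - \<psi> x) \<le> \<epsilon> * hI.N x" by blast
  qed
  from sub this obtain X where X: "X \<in> hv.Kop UNIV" "\<And>x. app X x - \<psi> x \<in> hI.Z"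
    by (rule hI.lift) (rule that, (assumption | blast)+)
  show ?thesis by (rule that[OF X(1)]) (rule X(2)[unfolded \<psi>_def])
qed

text \<open>The partial isometry modulo the ideal lifts to an operator \<open>X\<close> from \<open>M\<close> to \<open>N\<close>; the Cayley transform of
  \<open>X - X\<^sup>*\<close> is a unitary which agrees with \<open>X\<close> modulo \<open>Z\<close> wherever \<open>X\<close> is isometric modulo \<open>Z\<close>.\<close>

lemma unitary_lift:
  assumes l: "hv.adj l l" "\<And>x. app l x \<in> Pset"
    and X: "hv.adj X X'" "\<And>x. app X x - \<sigma> (app l (app l (app l x))) \<in> hI.Z"
    and \<sigma>: "\<And>x. app pN (\<sigma> (app l x)) = \<sigma> (app l x)"
      "\<And>x y. hip (\<sigma> (app l x)) (\<sigma> (app l y)) - hip (app l x) (app l y) \<in> em ` I"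
  obtains W W' where "hv.adj W W'" "W * W' = 1" "W' * W = 1"
    "\<And>z. app l z = z \<Longrightarrow> app W z \<in> Qset"
proof -
  \<comment> \<open>Cutting down to an operator from \<open>M\<close> to \<open>N\<close> makes
    \<open>Y * Y\<close> and \<open>Y' * Y'\<close> vanish, so that the square of \<open>K\<close>
    reduces to minus the sum of \<open>Y * Y'\<close> and \<open>Y' * Y\<close>.\<close>
  define Y where "Y = pN * X * pM"
  define Y' where "Y' = pM * X' * pN"
  have Y: "hv.adj Y Y'" unfolding Y_def Y'_def
    using hv.adj_mult[OF hv.adj_mult[OF adj_pN X(1)] adj_pM] by (simp only: mult.assoc)
  define K where "K = Y - Y'"
  have "hv.adj K (Y' - Y)" unfolding K_def by (intro hv.adj_diff Y hv.adj_sym[OF Y])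
  then have K: "hv.adj K (- K)" by (simp add: K_def)
  obtain W W' B where W: "hv.adj W W'" "W * W' = 1" "W' * W = 1" "W = (1 + K) * (1 + K) * B"
    "B * (1 - K * K) = 1" "hv.adj B B"
    by (rule hv.cayley[OF K]) (rule that)
  have Yx: "app Y x - \<sigma> (app l (app l (app l (app pM x)))) \<in> hI.Z" for x
  proof -
    have "app pN (app X (app pM x) - \<sigma> (app l (app l (app l (app pM x))))) \<in> hI.Z"
      by (intro hI.adj_Z[OF adj_pN] X(2))
    then show ?thesis by (simp add: Y_def app_lin \<sigma>(1))
  qed
  have Wz: "app W z \<in> Qset" if lz: "app l z = z" for z
  proof -
    have z: "z \<in> Pset" using l(2)[of z] lz by simp
    have pMz: "app pM z - z \<in> hI.Z" by (rule Pset_proj[OF z])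
    have \<sigma>z: "app pN (\<sigma> z) = \<sigma> z" using \<sigma>(1)[of z] lz by simp
    then have pM\<sigma>: "app pM (\<sigma> z) = 0"
      using arg_cong[OF pMN(3), of "\<lambda>R. app R (\<sigma> z)"] by (simp add: app_lin)
    have Yz: "app Y z - \<sigma> z \<in> hI.Z"
    proof -
      have "app pN (app X (app pM z - z) + (app X z - \<sigma> (app l (app l (app l z))))) \<in> hI.Z"
        by (intro hI.adj_Z[OF adj_pN] hI.Z_sub(2) hI.adj_Z[OF X(1)] pMz X(2))
      then show ?thesis by (simp add: Y_def lz \<sigma>z app_lin)
    qed
    have Y'z: "app Y' z \<in> hI.Z"
    proof -
      have "app pN z \<in> hI.Z" using z by (simp add: Pset_def)
      then show ?thesis
        unfolding Y'_def app_simps(2) by (intro hI.adj_Z[OF adj_pM] hI.adj_Z[OF hv.adj_sym[OF X(1)]])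
    qed
    have YY: "app Y (app Y v) = 0" "app Y' (app Y' v) = 0" for v
    proof -
      have "Y * Y = pN * X * (pM * pN) * X * pM" "Y' * Y' = pM * X' * (pN * pM) * X' * pN"
        by (simp_all only: Y_def Y'_def mult.assoc)
      then have "app (Y * Y) v = 0" "app (Y' * Y') v = 0" by (simp_all add: pMN app_lin)
      then show "app Y (app Y v) = 0" "app Y' (app Y' v) = 0" by simp_all
    qed
    \<comment> \<open>Modulo the ideal, the inner product of \<open>Y w\<close> with
      \<open>Y z\<close> equals that of \<sigma>(l^3 w) with \<sigma>(z), then that of l^3 w with z
      since \<sigma> is isometric, and the factors \<open>l\<close> move over to \<open>z\<close>,
      which they fix.\<close>
    have Y'Y: "app Y' (app Y z) - z \<in> hI.Z"
    proof (rule hI.ZI)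
      fix w
      let ?w = "app pM w"
      let ?v = "app l (app l (app l ?w))"
      have "hip (app Y w) (app Y z) - hip (\<sigma> ?v) (\<sigma> z) \<in> em ` I" by (rule Id_cong[OF Yx Yz])
      moreover have "hip (\<sigma> ?v) (\<sigma> z) - hip ?v z \<in> em ` I"
        using \<sigma>(2)[of "app l (app l ?w)" z] by (simp add: lz)
      ultimately have "(hip (app Y w) (app Y z) - hip (\<sigma> ?v) (\<sigma> z)) + (hip (\<sigma> ?v) (\<sigma> z) - hip ?v z) \<in> em ` I"
        by (rule hI.Id_sub(1))
      then have 1: "hip (app Y w) (app Y z) - hip ?v z \<in> em ` I" by simp
      have "hip ?v z = hip ?w z"
        by (simp only: hv.adjD[OF l(1)] lz)
      also have "\<dots> = hip w (app pM z)" by (rule hv.adjD[OF adj_pM])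
      finally have 2: "hip w (app Y' (app Y z) - z) = (hip (app Y w) (app Y z) - hip ?v z) + hip w (app pM z - z)"
        by (simp add: hv.adjD[OF Y] hv.ip.diff_right)
      show "hip w (app Y' (app Y z) - z) \<in> em ` I"
        unfolding 2 by (intro hI.Id_sub(1) 1 hI.ZD[OF pMz])
    qed
    have "app K (app K z) + z = (-1) *\<^sub>R (app Y' (app Y z) - z) + (-1) *\<^sub>R app Y (app Y' z)"
      by (simp add: K_def app_lin YY)
    moreover have "\<dots> \<in> hI.Z"
      by (intro hI.Z_sub Y'Y hI.adj_Z[OF Y] Y'z)
    ultimately have "app K (app K z) + z \<in> hI.Z" by (simp only:)
    then have WK: "app W z - app K z \<in> hI.Z" by (rule hI.cayley_Z[OF K W(4,5,6)])
    have "app pM ((app W z - app K z) + ((app Y z - \<sigma> z) - app Y' z)) \<in> hI.Z"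
      by (intro hI.adj_Z[OF adj_pM] hI.Z_sub(2,3) WK Yz Y'z)
    then have 1: "app pM (app W z) \<in> hI.Z" by (simp add: K_def app_lin pM\<sigma>)
    \<comment> \<open>The projection onto the ambient coordinate \<open>(A, HH)\<close>. The Cayley
      transform contains the unit of all coordinates, so it must be checked that \<open>W\<close>
      commutes with \<open>?p\<close> and keeps the vector in that coordinate.\<close>
    let ?p = "pM + pN"
    have pY: "?p * Y = Y" "Y * ?p = Y" "?p * Y' = Y'" "Y' * ?p = Y'"
    proof -
      have "pM * Y = 0" "pN * Y = Y" "pM * Y' = Y'" "pN * Y' = 0"
        by (simp_all only: Y_def Y'_def mult.assoc[symmetric] pMN mult_zero_left)
      moreover have "Y * pM = Y" "Y * pN = 0" "Y' * pM = 0" "Y' * pN = Y'"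
        by (simp_all only: Y_def Y'_def mult.assoc pMN mult_zero_right)
      ultimately show "?p * Y = Y" "Y * ?p = Y" "?p * Y' = Y'" "Y' * ?p = Y'"
        by (simp_all only: distrib_left distrib_right add_0 add_0_right)
    qed
    have pK: "?p * K = K * ?p" unfolding K_def left_diff_distrib right_diff_distrib by (simp only: pY)
    have "hv.adj (K * K) (- K * - K)" by (rule hv.adj_mult[OF K K])
    then have "hv.adj (1 - K * K) (1 - K * K)" using hv.adj_diff[OF hv.adj_1] by simp
    from hv.adj_mult[OF W(6) this] have "hv.adj 1 ((1 - K * K) * B)" unfolding W(5) .
    then have B2: "(1 - K * K) * B = 1" using hv.adj_1 by (rule hv.adj_unique)
    have "?p * (K * K) = (?p * K) * K" by (simp only: mult.assoc)
    also have "\<dots> = K * (?p * K)" by (simp only: pK mult.assoc)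
    finally have pKK: "?p * (1 - K * K) = (1 - K * K) * ?p"
      by (simp only: right_diff_distrib left_diff_distrib mult_1 mult_1_right pK mult.assoc)
    have "?p * B = B * (1 - K * K) * ?p * B" by (simp only: W(5) mult_1)
    also have "\<dots> = B * ?p * ((1 - K * K) * B)" by (simp only: mult.assoc pKK[symmetric])
    finally have pB: "?p * B = B * ?p" by (simp only: B2 mult_1_right)
    have pK1: "?p * (1 + K) = (1 + K) * ?p" by (simp only: distrib_left[of ?p] distrib_right[of 1 K] pK mult_1 mult_1_right)
    have "?p * W = (?p * (1 + K)) * (1 + K) * B" by (simp only: W(4) mult.assoc)
    also have "\<dots> = (1 + K) * (?p * (1 + K)) * B" by (simp only: pK1 mult.assoc)
    also have "\<dots> = (1 + K) * (1 + K) * (?p * B)" by (simp only: pK1 mult.assoc)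
    also have "\<dots> = W * ?p" by (simp only: pB W(4) mult.assoc)
    finally have "app ?p (app W z) = app W (app ?p z)" by (simp only: app_simps(2)[symmetric])
    moreover have "app ?p z = z" using z by (simp add: Pset_def app_lin)
    ultimately have "app ?p (app W z) = app W z" by (simp only:)
    then have "app pM (app W z) + app pN (app W z) = app W z" by (simp add: app_lin)
    then show ?thesis using 1 by (simp add: Qset_def)
  qed
  show ?thesis by (rule that[OF W(1,2,3) Wz])
qed

text \<open>Each stage of the construction is under control only on vectors fixed by the preceding
  operator, hence two nested pairs of bump functions with \<open>g * l = l\<close> and
  \<open>l * j = j\<close>. The assignment \<sigma> is available on vectors fixed by
  \<open>g\<close>, and \<open>l\<close> maps into these; \<open>W\<close> maps vectors fixed by
  \<open>l\<close> into \<open>Qset\<close>, and \<open>j\<close> maps into those. All of them fix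
  \<open>F\<close>.\<close>

lemma dsum_le:
  assumes cu: "cu_le (quot_alg A I) EM.QY EN.QY"
  shows "cu_le A PP QQ"
  unfolding cu_le_def
proof (intro allI impI)
  fix F assume F: "compactly_contained A PP F"
  obtain T where T: "hm_submodule A PP F" "T \<in> hv.Kop (h ` hm_carrier PP)" "hv.adj T T"
    "\<And>x. x \<in> F \<Longrightarrow> app T (h x) = h x"
    by (rule EP.contained_dest[OF F]) (rule that, (assumption | blast)+)
  note TP = T(2)[unfolded eP_im]
  have Z0: "app k (h x) = h x"
    if "\<forall>Z. subspace Z \<and> closed Z \<and> app T ` Z \<subseteq> Z \<longrightarrow> (\<forall>x. app T x - x \<in> Z \<longrightarrow> app k x - x \<in> Z)" "app T (h x) = h x"
    for k T :: "('a, 'm \<times> 'n) hvec endo" and x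
    using that(1)[rule_format, of "{0}" "h x"] that(2) by (simp add: app_lin subspace_single_0)
  obtain g k where gk: "hv.adj g g" "hv.adj k k" "g \<in> hv.Kop Pset" "k \<in> hv.Kop Pset"
    "g * k = k" "\<forall>Z. subspace Z \<and> closed Z \<and> app T ` Z \<subseteq> Z \<longrightarrow> (\<forall>x. app T x - x \<in> Z \<longrightarrow> app k x - x \<in> Z)"
    by (rule hv.bump[OF T(3) TP hv.Kop_subspace[OF submod_P] hv.closed_Kop])
      (erule (1) hv.Kop_mult[OF _ _ submod_P], rule that)
  \<comment> \<open>A closed subalgebra of the compact operators, to which \<open>k\<close> belongs.
    Running the second construction inside it makes \<open>l\<close> inherit
    \<open>g * l = l\<close>.\<close>
  let ?S = "hv.Kop Pset \<inter> {a. g * a = a}"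
  have S: "subspace ?S" "closed ?S" "\<And>a b. a \<in> ?S \<Longrightarrow> b \<in> ?S \<Longrightarrow> a * b \<in> ?S"
  proof -
    have "subspace {a. g * a = a}" unfolding subspace_def by (simp add: distrib_left)
    then show "subspace ?S" by (rule subspace_inter[OF hv.Kop_subspace[OF submod_P]])
    have "closed {a. g * a = a}" by (intro closed_Collect_eq continuous_intros)
    then show "closed ?S" by (rule closed_Int[OF hv.closed_Kop])
    show "a * b \<in> ?S" if "a \<in> ?S" "b \<in> ?S" for a b
      using that hv.Kop_mult[OF _ _ submod_P, of a b] by (simp add: mult.assoc[symmetric])
  qed
  have kS: "k \<in> ?S" using gk(4,5) by simp
  obtain l j where lj: "hv.adj l l" "hv.adj j j" "l \<in> ?S" "j \<in> ?S" "l * j = j"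
    "\<forall>Z. subspace Z \<and> closed Z \<and> app k ` Z \<subseteq> Z \<longrightarrow> (\<forall>x. app k x - x \<in> Z \<longrightarrow> app j x - x \<in> Z)"
    by (rule hv.bump[OF gk(2) kS S(1,2)]) (erule (1) S(3), rule that)
  have lK: "l \<in> hv.Kop Pset" "g * l = l" and jK: "j \<in> hv.Kop Pset" using lj(3,4) by simp_all
  have lP: "app l x \<in> Pset" for x by (rule hv.Kop_range[OF lK(1) submod_P])
  have gl: "app g (app l x) = app l x" for x using arg_cong[OF lK(2), of "\<lambda>R. app R x"] by simp
  have jF: "app j (h x) = h x" if "x \<in> F" for x
    by (rule Z0[OF lj(6) Z0[OF gk(6) T(4)[OF that]]])
  have lF: "app l (h x) = h x" if "x \<in> F" for x
    using arg_cong[OF lj(5), of "\<lambda>R. app R (h x)"] by (simp add: jF[OF that])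
  obtain \<sigma> where \<sigma>: "\<And>v. v \<in> Pset \<Longrightarrow> app g v = v \<Longrightarrow> app pN (\<sigma> v) = \<sigma> v"
    "\<And>v w. v \<in> Pset \<Longrightarrow> app g v = v \<Longrightarrow> w \<in> Pset \<Longrightarrow> app g w = w \<Longrightarrow> hip (\<sigma> v) (\<sigma> w) - hip v w \<in> em ` I"
    by (rule iso_vectors[OF cu gk(3,1)]) (rule that, (assumption | blast)+)
  note \<sigma>l = \<sigma>(1)[OF lP gl] \<sigma>(2)[OF lP gl lP gl]
  obtain X where X: "X \<in> hv.Kop UNIV" "\<And>x. app X x - \<sigma> (app l (app l (app l x))) \<in> hI.Z"
    by (rule lift_vectors[OF lK(1) lj(1) \<sigma>l(2)]) (rule that, (assumption | blast)+)
  obtain X' where X': "hv.adj X X'" using hv.Kop_adj[OF X(1)] by blast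
  obtain W W' where W: "hv.adj W W'" "W * W' = 1" "W' * W = 1" "\<And>z. app l z = z \<Longrightarrow> app W z \<in> Qset"
    by (rule unitary_lift[OF lj(1) lP X' X(2) \<sigma>l]) (rule that, (assumption | blast)+)
  have WF: "app W (h x) \<in> eQ ` hm_carrier QQ" if "x \<in> F" for x
    unfolding eQ_im by (rule W(4)[OF lF[OF that]])
  note U = unitary_transport(1,2)[OF T(1) W(1-3) WF]
  let ?U = "\<lambda>x. EQ.ei (app W (h x))"
  have eU: "eQ (?U x) = app W (h x)" if "x \<in> F" for x by (rule EQ.e_ei[OF WF[OF that]])
  have W'W: "app W' (app W v) = v" for v
    by (simp only: app_simps(2)[symmetric] W(3) app_simps(1))
  have Wj: "hv.adj (W * j) (j * W')" by (rule hv.adj_mult[OF W(1) lj(2)])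
  have "compactly_contained A QQ (?U ` F)"
  \<comment> \<open>The range of \<open>j\<close> consists of vectors fixed by \<open>l\<close>, so
    \<open>W * j\<close> maps into \<open>Qset\<close> and the conjugate of the compact
    \<open>j\<close> by \<open>W * j\<close> is compact for \<open>N \<oplus> MI\<close>. On the
    transported vectors it cancels \<open>W'\<close> against \<open>W\<close>, applies
    \<open>j\<close> three times to an element fixed by \<open>j\<close>, and returns
    \<open>W\<close> of it.\<close>
  proof (rule EQ.contained_intro[OF U(1), of "(W * j) * j * (j * W')"])
    show "(W * j) * j * (j * W') \<in> hv.Kop (eQ ` hm_carrier QQ)"
    proof (rule hv.Kop_conj[OF jK Wj hv.adj_sym[OF Wj]])
      show 1: "app (W * j) v \<in> eQ ` hm_carrier QQ" for v
        unfolding eQ_im app_simps(2)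
        by (rule W(4)) (simp only: app_simps(2)[symmetric] lj(5))
      show "app (W * j) v \<in> eQ ` hm_carrier QQ" for v by (rule 1)
    qed
    show "hv.adj ((W * j) * j * (j * W')) ((W * j) * j * (j * W'))"
      using hv.adj_mult[OF hv.adj_mult[OF Wj lj(2)] hv.adj_sym[OF Wj]] by (simp only: mult.assoc)
    fix x assume "x \<in> ?U ` F"
    then obtain y where y: "y \<in> F" "x = ?U y" by blast
    show "app ((W * j) * j * (j * W')) (eQ x) = eQ x"
      unfolding y(2) eU[OF y(1)] app_simps(2) W'W by (simp only: jF[OF y(1)])
  qed
  then show "\<exists>F'. compactly_contained A QQ F' \<and> (\<exists>U. hm_iso A (restrict_mod PP F) (restrict_mod QQ F') U)"
    using U(2) by blast
qed

end

theorem theorem1p1: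
  fixes A :: "'a cs_alg" and I :: "'a set"
    and M :: "('m, 'a) hmod" and N :: "('n, 'a) hmod"
  assumes "cstar_algebra A"
    and "closed_ideal A I"
    and "sigma_unital A I"
    and "hilbert_module A M" and "countably_generated A M"
    and "hilbert_module A N" and "countably_generated A N"
  shows "cu_le (quot_alg A I) (quot_mod A I M) (quot_mod A I N) \<longleftrightarrow>
         cu_le A (hm_dsum A M (MI_mod A I N)) (hm_dsum A N (MI_mod A I M))"
proof -
  obtain u where u: "\<forall>n. u n \<in> I \<and> cs_pos A (u n) \<and> cs_norm A (u n) \<le> 1 \<and> cs_le A (u n) (u (Suc n))"
    "\<forall>x\<in>I. (\<lambda>n. cs_dist A (cs_mult A (u n) x) x) \<longlonglongrightarrow> 0 \<and>
        (\<lambda>n. cs_dist A (cs_mult A x (u n)) x) \<longlonglongrightarrow> 0"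
    using assms(3) unfolding sigma_unital_def by (elim exE conjE) (rule that)
  interpret dsum_pair A M N I u
  proof
    show "u n \<in> I" "cs_pos A (u n)" "cs_norm A (u n) \<le> 1" for n
      using u(1)[rule_format, of n] by - (elim conjE, assumption)+
    show "(\<lambda>n. cs_dist A (cs_mult A i (u n)) i) \<longlonglongrightarrow> 0" if "i \<in> I" for i
      using u(2)[rule_format, OF that] by (rule conjunct2)
  qed (rule assms)+
  show ?thesis by (rule iffI[OF dsum_le quot_le])
qed

end
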